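(* Let $u>0$, $c>0$, and let $\{\xi_\mu(x)\}_{x,\mu\in\mathbf{N}}$ be real jointly Gaussian random variables with zero mean and covariance $\mathbf{E}\{\xi_\mu(x)\xi_\nu(y)\}=u^2\delta_{xy}\delta_{\mu\nu}$. Let $H_{m,N}$ be the $N\times N$ random matrix with entries $$H_{m,N}(x,y)=\frac1N\sum_{\mu=1}^m \xi_\mu(x)\xi_\mu(y),\qquad x,y=1,\dots,N,$$ let $G_{m,N}(z)=(H_{m,N}-z)^{-1}$, and set $$R_{m,N}^{(\alpha)}(\lambda)=\frac1N\,\mathrm{Im}\,\mathrm{Tr}\,G_{m,N}(\lambda+\mathrm{i}N^{-\alpha}).$$ Let $0<\alpha<1$, let $\lambda\in\Lambda_{c,u}=(u^2(1-\sqrt c)^2,\;u^2(1+\sqrt c)^2)$, let $k\ge1$, let $\tau_1,\dots,\tau_k\in\mathbf{R}$ be given, and put $\lambda_i=\lambda+\tau_iN^{-\alpha}$. Consider the $k$ random variables $$\gamma_{m,N}^{(\alpha)}(i)=N^{1-\alpha}\left[R_{m,N}^{(\alpha)}(\lambda_i)-\mathbf{E}R_{m,N}^{(\alpha)}(\lambda_i)\right],\qquad i=1,\dots,k.$$ Then, as $N,m\to\infty$ with $m/N\to c$, the joint distribution of the vector $(\gamma_{m,N}^{(\alpha)}(1),\dots,\gamma_{m,N}^{(\alpha)}(k))$ converges to the $k$-dimensional Gaussian distribution with zero mean and covariance $$C(\tau_i,\tau_j)=\frac{4-(\tau_i-\tau_j)^2}{[4+(\tau_i-\tau_j)^2]^2},\qquad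 i,j=1,\dots,k.$$
   Context: $\delta_{xy}$ denotes the Kronecker delta. $\mathrm{Tr}$ is the (unnormalized) trace, $\mathrm{i}$ is the imaginary unit, and $\mathbf{E}$ is mathematical expectation. The limit is taken along $m=m(N)$ with $m/N\to c$ as $N\to\infty$. Convergence of joint distributions means weak convergence (convergence in distribution) of random vectors in $\mathbf{R}^k$. *)

theory Defs
  imports
    "HOL-Probability.Probability"
    "Jordan_Normal_Form.Gauss_Jordan_Elimination"
begin

text \<open>
  \<open>$\<close> is kept for the components of vectors in \<open>real ^ 'k\<close>. Random matrices have a size that
  varies with \<open>N\<close>, hence the carrier-based type \<open>mat\<close>, whose entries are indexed from 0.
\<close>
no_notation vec_index (infixl "$" 100)

text \<open>Degenerate (almost surely constant) variables count as Gaussian.\<close>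
definition gaussian_rv :: "'a measure \<Rightarrow> ('a \<Rightarrow> real) \<Rightarrow> bool" where
  "gaussian_rv M X \<longleftrightarrow>
     X \<in> borel_measurable M \<and>
     ((\<exists>a. AE \<omega> in M. X \<omega> = a) \<or>
      (\<exists>a \<sigma>. \<sigma> > 0 \<and> distributed M lborel X (\<lambda>x. ennreal (normal_density a \<sigma> x))))"

definition jointly_gaussian ::
    "'a measure \<Rightarrow> 'i set \<Rightarrow> ('i \<Rightarrow> 'a \<Rightarrow> real) \<Rightarrow> bool" where
  "jointly_gaussian M I X \<longleftrightarrow>
     (\<forall>J a. finite J \<and> J \<subseteq> I \<longrightarrow> gaussian_rv M (\<lambda>\<omega>. \<Sum>i\<in>J. a i * X i \<omega>))"

text \<open>
  \<open>\<nu>\<close> is the (possibly degenerate) Gaussian distribution with zero mean and covariance \<open>K\<close>.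
\<close>
definition centered_gaussian_distribution ::
    "(real ^ 'k) measure \<Rightarrow> ('k::finite \<Rightarrow> 'k \<Rightarrow> real) \<Rightarrow> bool" where
  "centered_gaussian_distribution \<nu> K \<longleftrightarrow>
     prob_space \<nu> \<and> sets \<nu> = sets borel \<and>
     jointly_gaussian \<nu> UNIV (\<lambda>i x. x $ i) \<and>
     (\<forall>i. (\<integral>x. x $ i \<partial>\<nu>) = 0) \<and>
     (\<forall>i j. (\<integral>x. x $ i * x $ j \<partial>\<nu>) = K i j)"

definition weakly_converges ::
    "(nat \<Rightarrow> 'b::topological_space measure) \<Rightarrow> 'b measure \<Rightarrow> bool" where
  "weakly_converges \<mu> \<nu> \<longleftrightarrow>
     (\<forall>f :: 'b \<Rightarrow> real. continuous_on UNIV f \<and> bounded (range f) \<longrightarrow>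
        (\<lambda>n. \<integral>x. f x \<partial>\<mu> n) \<longlonglongrightarrow> (\<integral>x. f x \<partial>\<nu>))"

definition mat_trace :: "'a::comm_monoid_add mat \<Rightarrow> 'a" where
  "mat_trace A = (\<Sum>i<dim_row A. A $$ (i, i))"

text \<open>
  The variables \<open>\<xi> \<mu> x\<close> are used for \<open>\<mu>, x \<ge> 1\<close> only, so row and column \<open>i\<close> of the matrix
  correspond to the index \<open>Suc i\<close>.
\<close>
definition H_mat ::
    "(nat \<Rightarrow> nat \<Rightarrow> 'a \<Rightarrow> real) \<Rightarrow> nat \<Rightarrow> nat \<Rightarrow> 'a \<Rightarrow> complex mat" where
  "H_mat \<xi> m N \<omega> = mat N N (\<lambda>(i, j).
     complex_of_real ((1 / real N) * (\<Sum>\<mu>=1..m. \<xi> \<mu> (Suc i) \<omega> * \<xi> \<mu> (Suc j) \<omega>)))"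

text \<open>Meaningful when \<open>H - z\<close> is invertible, in particular for real symmetric \<open>H\<close> and
  non-real \<open>z\<close>.\<close>
definition resolvent :: "complex mat \<Rightarrow> complex \<Rightarrow> complex mat" where
  "resolvent H z = the (mat_inverse (H - z \<cdot>\<^sub>m 1\<^sub>m (dim_row H)))"

definition R_fun ::
    "(nat \<Rightarrow> nat \<Rightarrow> 'a \<Rightarrow> real) \<Rightarrow> real \<Rightarrow> nat \<Rightarrow> nat \<Rightarrow> real \<Rightarrow> 'a \<Rightarrow> real" where
  "R_fun \<xi> \<alpha> m N l \<omega> =
     (1 / real N) * Im (mat_trace (resolvent (H_mat \<xi> m N \<omega>) (Complex l (real N powr (- \<alpha>)))))"

definition gamma_var ::
    "'a measure \<Rightarrow> (nat \<Rightarrow> nat \<Rightarrow> 'a \<Rightarrow> real) \<Rightarrow> real \<Rightarrow> nat \<Rightarrow> nat \<Rightarrow> real \<Rightarrow> 'a \<Rightarrow> real" where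
  "gamma_var M \<xi> \<alpha> m N l \<omega> =
     real N powr (1 - \<alpha>) * (R_fun \<xi> \<alpha> m N l \<omega> - (\<integral>\<omega>'. R_fun \<xi> \<alpha> m N l \<omega>' \<partial>M))"

definition C_cov :: "real \<Rightarrow> real \<Rightarrow> real" where
  "C_cov s t = (4 - (s - t)\<^sup>2) / (4 + (s - t)\<^sup>2)\<^sup>2"

end

theory Submission
  imports Defs "Jordan_Normal_Form.Schur_Decomposition"
begin

text \<open>Gaussian integration by parts along the vector field \<open>G \<xi>\<close> gives a loop equation expressing
  \<open>E (P(g) \<Phi>)\<close> by terms of relative size \<open>1 / N\<^sup>2\<close>, where \<open>g = Tr G / N\<close>, \<open>P\<close> is the
  Marchenko-Pastur quadratic and \<open>\<Phi>\<close> is any smooth test function. Taking \<open>\<Phi> = cnj (P(g))\<close> yields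
  \<open>E |P(g)|\<^sup>2 \<le> C / (N \<eta>)\<^sup>2\<close> at every scale \<open>\<eta> = N powr (- \<alpha>)\<close> at once, since \<open>|g|\<^sup>2\<close> is itself
  controlled by \<open>1 + |P(g)|\<close>. In the bulk the second root of \<open>P\<close> stays at a fixed distance below
  the real axis while \<open>Im g \<ge> 0\<close>, so \<open>g\<close> is within \<open>O(1 / (N \<eta>))\<close> of the first root in
  \<open>L\<^sup>2\<close>. Taking \<open>\<Phi> = exp (\<i> \<theta> T) - E exp (\<i> \<theta> T)\<close> for a linear combination \<open>T\<close> of the variables
  \<open>\<gamma>(i)\<close> and linearising \<open>P\<close> at that root shows that \<open>\<psi>(\<theta>) = E exp (\<i> \<theta> T)\<close> satisfies
  \<open>\<psi>' = - \<theta> \<sigma>\<^sup>2 \<psi> + o(1)\<close>, hence is asymptotically Gaussian; \<open>|\<psi>| \<le> 1\<close> forces \<open>\<sigma>\<^sup>2 \<ge> 0\<close>, that is,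
  the limiting covariance is positive semidefinite. Tightness and the Stone-Weierstrass theorem for
  trigonometric polynomials turn this into weak convergence.\<close>

section \<open>Weak convergence and characteristic functions\<close>

text \<open>None of \<open>u\<close>, \<open>c\<close>, \<open>l\<close> survives in the limit. The
  reason is the shape of one kernel: times the square of the scale \<eta>, the trace of G(z) H
  G(w)^2 over N tends to \<open>l\<close> times a difference of boundary values of the Stieltjes
  transform, divided by the squared rescaled distance. Points on the same side of the real axis have
  equal boundary values and drop out. Points on opposite sides produce the jump
  \<open>s0 - cnj s0\<close>, which cancels against the derivative of P at its root. What remains is
  - Re (1 / (x + 2 i)^2) with x the difference of two \<tau>, and this is \<open>C_cov\<close>. Two
  obstacles shape the proof. The loop equation brings in the derivative of g at distance \<eta> from
  the axis, which the bound on g does not control directly; it is replaced by difference quotients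
  over distances \<epsilon> \<eta>, and \<epsilon> tends to 0 only after N has grown. Moreover the
  field G \<xi> is linear in unbounded variables; G H = 1 + z G shows that the field and its
  divergence are bounded all the same, so that integration by parts is applied to bounded functions
  throughout.\<close>

lemma integral_clamp_tendsto:
  fixes p :: "'b::topological_space \<Rightarrow> real"
  assumes pr: "\<And>n. prob_space (\<mu> n)" "\<And>n. sets (\<mu> n) = sets borel"
    and pr': "prob_space \<nu>" "sets \<nu> = sets borel"
    and p: "continuous_on UNIV p" "\<And>x. \<bar>p x\<bar> \<le> B"
    and pow: "\<And>k::nat. (\<lambda>n. \<integral>x. p x ^ k \<partial>\<mu> n) \<longlonglongrightarrow> (\<integral>x. p x ^ k \<partial>\<nu>)"
    and h: "continuous_on UNIV (h :: real \<Rightarrow> real)"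
  shows "(\<lambda>n. \<integral>x. h (p x) \<partial>\<mu> n) \<longlonglongrightarrow> (\<integral>x. h (p x) \<partial>\<nu>)"
proof (rule LIMSEQ_I)
  fix r :: real assume r: "0 < r"
  \<comment> \<open>\<open>p\<close> takes values in [-B, B], so a polynomial approximation of
    \<open>h\<close> on this interval reduces the claim to the moments of \<open>p\<close>.\<close>
  obtain q where q: "real_polynomial_function q" "\<And>x. x \<in> {-B..B} \<Longrightarrow> \<bar>h x - q x\<bar> < r/4"
    by (rule Stone_Weierstrass_real_polynomial_function[of "{-B..B}" h "r/4"])
      (use r continuous_on_subset[OF h] in auto)
  obtain a n where a: "q = (\<lambda>x. \<Sum>i\<le>n. a i * x ^ i)"
    using q(1) real_polynomial_function_iff_sum by metis
  have pB: "p x \<in> {-B..B}" for x using p(2)[of x] by auto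
  have B0: "0 \<le> B" using p(2) abs_ge_zero order_trans by blast
  have pm: "p \<in> borel_measurable borel" using p(1) by (rule borel_measurable_continuous_onI)
  have hc: "continuous_on {-B..B} h" using h continuous_on_subset by blast
  then have "bounded (h ` {-B..B})" using compact_continuous_image compact_imp_bounded by blast
  then obtain C where C: "\<And>y. y \<in> {-B..B} \<Longrightarrow> \<bar>h y\<bar> \<le> C" unfolding bounded_iff by fastforce
  have hpm: "(\<lambda>x. h (p x)) \<in> borel_measurable borel"
    using borel_measurable_continuous_onI[OF h] pm by measurable
  have int_pow: "integrable M (\<lambda>x. p x ^ k)" if "prob_space M" "sets M = sets borel" for M and k :: nat
  proof -
    interpret prob_space M by fact
    have "\<bar>p x ^ k\<bar> \<le> B ^ k" for x using p(2)[of x] by (simp add: power_abs power_mono)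
    moreover have "(\<lambda>x. p x ^ k) \<in> borel_measurable M"
      using pm that(2) by (simp cong: measurable_cong_sets)
    ultimately show ?thesis by (intro integrable_const_bound[where B="B^k"]) auto
  qed
  have int_h: "integrable M (\<lambda>x. h (p x))" if "prob_space M" "sets M = sets borel" for M
  proof -
    interpret prob_space M by fact
    have "(\<lambda>x. h (p x)) \<in> borel_measurable M"
      using hpm that(2) by (simp cong: measurable_cong_sets)
    then show ?thesis using C[OF pB] by (intro integrable_const_bound[where B=C]) auto
  qed
  have int_q: "integrable M (\<lambda>x. q (p x))" if "prob_space M" "sets M = sets borel" for M
    unfolding a using int_pow[OF that] by auto
  have eq: "(\<integral>x. q (p x) \<partial>M) = (\<Sum>i\<le>n. a i * (\<integral>x. p x ^ i \<partial>M))"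
    if "prob_space M" "sets M = sets borel" for M
    unfolding a using int_pow[OF that] by (subst Bochner_Integration.integral_sum) auto
  have close: "\<bar>(\<integral>x. h (p x) \<partial>M) - (\<integral>x. q (p x) \<partial>M)\<bar> \<le> r/4"
    if "prob_space M" "sets M = sets borel" for M
  proof -
    interpret prob_space M by fact
    have "\<bar>(\<integral>x. h (p x) \<partial>M) - (\<integral>x. q (p x) \<partial>M)\<bar> = \<bar>\<integral>x. h (p x) - q (p x) \<partial>M\<bar>"
      using int_h[OF that] int_q[OF that] by simp
    also have "\<dots> \<le> (\<integral>x. \<bar>h (p x) - q (p x)\<bar> \<partial>M)" by (rule integral_abs_bound)
    also have "\<dots> \<le> (\<integral>x. r/4 \<partial>M)"
      by (rule integral_mono) (use int_h[OF that] int_q[OF that] q(2)[OF pB] less_imp_le in auto)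
    finally show ?thesis by (simp add: prob_space)
  qed
  have "(\<lambda>k. \<Sum>i\<le>n. a i * (\<integral>x. p x ^ i \<partial>\<mu> k)) \<longlonglongrightarrow> (\<Sum>i\<le>n. a i * (\<integral>x. p x ^ i \<partial>\<nu>))"
    by (intro tendsto_intros pow)
  then have "(\<lambda>k. \<integral>x. q (p x) \<partial>\<mu> k) \<longlonglongrightarrow> (\<integral>x. q (p x) \<partial>\<nu>)"
    using eq[OF pr] eq[OF pr'] by simp
  then obtain k0 where k0: "\<And>k. k \<ge> k0 \<Longrightarrow> \<bar>(\<integral>x. q (p x) \<partial>\<mu> k) - (\<integral>x. q (p x) \<partial>\<nu>)\<bar> < r/4"
    using LIMSEQ_D[of _ _ "r/4"] r by (metis real_norm_def zero_less_divide_iff zero_less_numeral)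
  show "\<exists>no. \<forall>k\<ge>no. norm ((\<integral>x. h (p x) \<partial>\<mu> k) - (\<integral>x. h (p x) \<partial>\<nu>)) < r"
  proof (intro exI allI impI)
    fix k assume "k \<ge> k0"
    with k0[of k] close[OF pr, of k] close[OF pr'] r
    show "norm ((\<integral>x. h (p x) \<partial>\<mu> k) - (\<integral>x. h (p x) \<partial>\<nu>)) < r" by (simp add: abs_if split: if_splits)
  qed
qed

text \<open>The approximant of \<open>f\<close> on a large compact set is uncontrolled outside it; clamping it
  to the range of \<open>f\<close> stays within the uniform closure of the algebra.\<close>

proposition weakly_converges_algebra:
  fixes \<mu> :: "nat \<Rightarrow> 'b::t2_space measure" and R :: "('b \<Rightarrow> real) set"
  assumes pr: "\<And>n. prob_space (\<mu> n)" "\<And>n. sets (\<mu> n) = sets borel"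
    and pr': "prob_space \<nu>" "sets \<nu> = sets borel"
    and R: "\<And>f. f \<in> R \<Longrightarrow> continuous_on UNIV f" "\<And>f. f \<in> R \<Longrightarrow> bounded (range f)"
      "\<And>f g. f \<in> R \<Longrightarrow> g \<in> R \<Longrightarrow> (\<lambda>x. f x + g x) \<in> R"
      "\<And>f g. f \<in> R \<Longrightarrow> g \<in> R \<Longrightarrow> (\<lambda>x. f x * g x) \<in> R"
      "\<And>c. (\<lambda>_. c) \<in> R"
    and sep: "\<And>x y. x \<in> T \<Longrightarrow> y \<in> T \<Longrightarrow> x \<noteq> y \<Longrightarrow> \<exists>f\<in>R. f x \<noteq> f y"
    and tight: "\<And>\<epsilon>. \<epsilon> > 0 \<Longrightarrow> \<exists>K. compact K \<and> K \<in> sets borel \<and> K \<subseteq> T \<and> measure \<nu> K \<ge> 1 - \<epsilon> \<and>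
        (\<forall>\<^sub>F n in sequentially. measure (\<mu> n) K \<ge> 1 - \<epsilon>)"
    and conv: "\<And>p. p \<in> R \<Longrightarrow> (\<lambda>n. \<integral>x. p x \<partial>\<mu> n) \<longlonglongrightarrow> (\<integral>x. p x \<partial>\<nu>)"
  shows "weakly_converges \<mu> \<nu>"
  unfolding weakly_converges_def
proof (intro allI impI LIMSEQ_I, elim conjE)
  fix f :: "'b \<Rightarrow> real" and r :: real
  assume f: "continuous_on UNIV f" "bounded (range f)" and r: "0 < r"
  obtain B0 where B0: "\<And>x. \<bar>f x\<bar> \<le> B0" using f(2) unfolding bounded_iff by auto
  define B where "B = max B0 1"
  have B: "\<bar>f x\<bar> \<le> B" for x using B0[of x] unfolding B_def by simp
  have B1: "B \<ge> 1" unfolding B_def by simp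
  \<comment> \<open>Outside \<open>K\<close> both functions compared are bounded by
    \<open>B\<close>, so the exceptional mass costs at most 2 B \<epsilon> = r/8.\<close>
  define \<epsilon> where "\<epsilon> = r / (16 * B)"
  have \<epsilon>: "\<epsilon> > 0" using r B1 unfolding \<epsilon>_def by simp
  obtain K where K: "compact K" "K \<in> sets borel" "K \<subseteq> T" "measure \<nu> K \<ge> 1 - \<epsilon>"
    "\<forall>\<^sub>F n in sequentially. measure (\<mu> n) K \<ge> 1 - \<epsilon>" using tight[OF \<epsilon>] by blast
  interpret FR: function_ring_on R K
  proof
    show "continuous_on K g" if "g \<in> R" for g using R(1)[OF that] continuous_on_subset by blast
    show "\<exists>f\<in>R. f x \<noteq> f y" if "x \<in> K" "y \<in> K" "x \<noteq> y" for x y using sep K(3) that by blast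
  qed (use R K in auto)
  have "continuous_on K f" using f(1) continuous_on_subset by blast
  from FR.Stone_Weierstrass_basic[OF this, of "r/8"] r
  obtain p where p: "p \<in> R" "\<And>x. x \<in> K \<Longrightarrow> \<bar>f x - p x\<bar> < r/8" by auto
  obtain Bp where Bp: "\<And>x. \<bar>p x\<bar> \<le> Bp" using R(2)[OF p(1)] unfolding bounded_iff by auto
  define h :: "real \<Rightarrow> real" where "h y = max (-B) (min B y)" for y
  have hc: "continuous_on UNIV h" unfolding h_def by (intro continuous_intros)
  have pc: "continuous_on UNIV p" by (rule R(1)[OF p(1)])
  have lim: "(\<lambda>n. \<integral>x. h (p x) \<partial>\<mu> n) \<longlonglongrightarrow> (\<integral>x. h (p x) \<partial>\<nu>)"
    by (rule integral_clamp_tendsto[OF pr pr' pc Bp _ hc]) (rule conv[OF FR.power[OF p(1)]])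
  have hB: "\<bar>h y\<bar> \<le> B" for y using B1 unfolding h_def by auto
  \<comment> \<open>Clamping is 1-Lipschitz and fixes the values of \<open>f\<close>, so on
    \<open>K\<close> it does not move \<open>p\<close> away from \<open>f\<close>.\<close>
  have hK: "\<bar>f x - h (p x)\<bar> \<le> r/8" if "x \<in> K" for x
    using p(2)[OF that] B[of x] unfolding h_def abs_le_iff abs_less_iff max_def min_def by (auto split: if_splits)
  have close: "\<bar>(\<integral>x. f x \<partial>M) - (\<integral>x. h (p x) \<partial>M)\<bar> \<le> r/4"
    if M: "prob_space M" "sets M = sets borel" and KM: "measure M K \<ge> 1 - \<epsilon>" for M
  proof -
    interpret prob_space M by fact
    have fm: "f \<in> borel_measurable M"
      using borel_measurable_continuous_onI[OF f(1)] M(2) by (simp cong: measurable_cong_sets)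
    have hm: "(\<lambda>x. h (p x)) \<in> borel_measurable M"
      using borel_measurable_continuous_onI[OF hc] borel_measurable_continuous_onI[OF pc] M(2)
      by (simp cong: measurable_cong_sets)
    have intf: "integrable M f" using fm B by (intro integrable_const_bound[where B=B]) auto
    have inth: "integrable M (\<lambda>x. h (p x))" using hm hB by (intro integrable_const_bound[where B=B]) auto
    have KS: "K \<in> sets M" using K(2) M(2) by simp
    have "\<bar>(\<integral>x. f x \<partial>M) - (\<integral>x. h (p x) \<partial>M)\<bar> = \<bar>\<integral>x. f x - h (p x) \<partial>M\<bar>"
      using intf inth by simp
    also have "\<dots> \<le> (\<integral>x. \<bar>f x - h (p x)\<bar> \<partial>M)" by (rule integral_abs_bound)
    also have "\<dots> \<le> (\<integral>x. r/8 + 2 * B * indicator (space M - K) x \<partial>M)"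
    proof (rule integral_mono)
      show "integrable M (\<lambda>x. r / 8 + 2 * B * indicator (space M - K) x)" using KS by (auto simp: less_top[symmetric])
      fix x assume "x \<in> space M"
      then show "\<bar>f x - h (p x)\<bar> \<le> r / 8 + 2 * B * indicator (space M - K) x"
        using hK[of x] B[of x] hB[of "p x"] r by (cases "x \<in> K") auto
    qed (use intf inth in auto)
    also have "\<dots> = r/8 + 2 * B * measure M (space M - K)"
      using KS by (subst Bochner_Integration.integral_add) (auto simp: prob_space less_top[symmetric])
    also have "measure M (space M - K) \<le> \<epsilon>" using prob_compl[OF KS] KM by simp
    then have "r/8 + 2 * B * measure M (space M - K) \<le> r/8 + 2 * B * \<epsilon>"
      using B1 by (intro add_left_mono mult_left_mono) auto
    also have "\<dots> = r/4" unfolding \<epsilon>_def using B1 by (simp add: field_simps)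
    finally show ?thesis .
  qed
  obtain n1 where n1: "\<And>n. n \<ge> n1 \<Longrightarrow> \<bar>(\<integral>x. h (p x) \<partial>\<mu> n) - (\<integral>x. h (p x) \<partial>\<nu>)\<bar> < r/4"
    using LIMSEQ_D[OF lim, of "r/4"] r by auto
  obtain n2 where n2: "\<And>n. n \<ge> n2 \<Longrightarrow> measure (\<mu> n) K \<ge> 1 - \<epsilon>"
    using K(5) unfolding eventually_sequentially by blast
  show "\<exists>no. \<forall>n\<ge>no. norm ((\<integral>x. f x \<partial>\<mu> n) - (\<integral>x. f x \<partial>\<nu>)) < r"
  proof (intro exI allI impI)
    fix n assume "n \<ge> max n1 n2"
    then have n: "n \<ge> n1" "n \<ge> n2" by auto
    show "norm ((\<integral>x. f x \<partial>\<mu> n) - (\<integral>x. f x \<partial>\<nu>)) < r"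
      using n1[OF n(1)] close[OF pr n2[OF n(2)]] close[OF pr' K(4)] r
      by (simp add: abs_if split: if_splits)
  qed
qed

text \<open>The free phase \<open>b\<close> makes cosines sufficient: a shift by pi/2 gives sines,
  and the product-to-sum formula keeps products inside the set, so that it is a real
  algebra.\<close>

inductive_set trig_poly :: "'i set \<Rightarrow> ('i \<Rightarrow> 'b \<Rightarrow> real) \<Rightarrow> ('b \<Rightarrow> real) set"
  for I :: "'i set" and c :: "'i \<Rightarrow> 'b \<Rightarrow> real" where
  base: "(\<lambda>x. cos ((\<Sum>i\<in>I. a i * c i x) + b)) \<in> trig_poly I c"
| add: "f \<in> trig_poly I c \<Longrightarrow> g \<in> trig_poly I c \<Longrightarrow> (\<lambda>x. f x + g x) \<in> trig_poly I c"
| scale: "f \<in> trig_poly I c \<Longrightarrow> (\<lambda>x. w * f x) \<in> trig_poly I c"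

lemma trig_poly_mult_base:
  assumes "g \<in> trig_poly I c"
  shows "(\<lambda>x. cos ((\<Sum>i\<in>I. a i * c i x) + b) * g x) \<in> trig_poly I c"
  using assms
proof induction
  case (base a' b')
  have "(\<lambda>x. cos ((\<Sum>i\<in>I. a i * c i x) + b) * cos ((\<Sum>i\<in>I. a' i * c i x) + b')) =
    (\<lambda>x. (1/2) * (cos ((\<Sum>i\<in>I. (a i - a' i) * c i x) + (b - b')) + cos ((\<Sum>i\<in>I. (a i + a' i) * c i x) + (b + b'))))"
    by (simp add: cos_times_cos sum.distrib sum_subtractf algebra_simps add_divide_distrib)
  then show ?case by (simp only:) (intro trig_poly.intros)
next
  case (add f g)
  from trig_poly.add[OF add.IH] show ?case by (simp add: algebra_simps)
next
  case (scale f w)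
  from trig_poly.scale[OF scale.IH, of w] show ?case by (simp add: algebra_simps)
qed

lemma trig_poly_mult:
  assumes "f \<in> trig_poly I c" "g \<in> trig_poly I c"
  shows "(\<lambda>x. f x * g x) \<in> trig_poly I c"
  using assms(1)
proof induction
  case (base a b) then show ?case by (rule trig_poly_mult_base[OF assms(2)])
next
  case (add f h)
  from trig_poly.add[OF add.IH] show ?case by (simp add: algebra_simps)
next
  case (scale f w)
  from trig_poly.scale[OF scale.IH, of w] show ?case by (simp add: algebra_simps)
qed

lemma trig_poly_const: "(\<lambda>_. w) \<in> trig_poly I c"
  using trig_poly.scale[OF trig_poly.base[where a="\<lambda>_. 0" and b=0], of w] by simp

lemma trig_poly_bounded: "f \<in> trig_poly I c \<Longrightarrow> bounded (range f)"
proof (induction rule: trig_poly.induct)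
  case (base a b)
  show ?case unfolding bounded_iff by (intro exI[of _ 1]) auto
next
  case (add f g)
  then show ?case using bounded_plus_comp[of f UNIV g] by simp
next
  case (scale f w)
  then show ?case using bounded_scaleR_comp[of f UNIV w] by simp
qed

lemma trig_poly_continuous:
  fixes c :: "'i \<Rightarrow> 'b::t2_space \<Rightarrow> real"
  assumes "\<And>i. i \<in> I \<Longrightarrow> continuous_on UNIV (c i)" "f \<in> trig_poly I c"
  shows "continuous_on UNIV f"
  using assms(2)
proof induction
  case (base a b)
  show ?case by (intro continuous_intros assms(1)) auto
qed (auto intro!: continuous_intros)

text \<open>A sine of one coordinate, scaled so that both values fall into (-pi/2, pi/2), where the
  sine is injective.\<close>

lemma trig_poly_separates:
  assumes fin: "finite I" and i: "i \<in> I" "c i x \<noteq> c i y"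
  shows "\<exists>f\<in>trig_poly I c. f x \<noteq> f y"
proof (rule ccontr)
  assume "\<not> ?thesis"
  then have *: "f x = f y" if "f \<in> trig_poly I c" for f using that by blast
  define w where "w = pi / (2 * (\<bar>c i x\<bar> + \<bar>c i y\<bar> + 1))"
  have w0: "w > 0" unfolding w_def by (intro divide_pos_pos) (auto intro: add_nonneg_pos)
  have wb: "\<bar>w * c i z\<bar> < pi/2" if "z = x \<or> z = y" for z
  proof -
    have "\<bar>c i z\<bar> < \<bar>c i x\<bar> + \<bar>c i y\<bar> + 1" using that by auto
    then have "w * \<bar>c i z\<bar> < w * (\<bar>c i x\<bar> + \<bar>c i y\<bar> + 1)" using w0 by simp
    also have "\<dots> = pi/2" unfolding w_def by (simp add: field_simps add_nonneg_eq_0_iff)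
    finally show ?thesis using w0 by (simp add: abs_mult)
  qed
  have s: "(\<Sum>j\<in>I. (if j = i then w else 0) * c j z) = w * c i z" for z
    using fin i by (simp add: if_distrib[of "\<lambda>v. v * _"] cong: if_cong)
  have "cos (w * c i x - pi/2) = cos (w * c i y - pi/2)"
    using *[OF trig_poly.base[where a="\<lambda>j. if j = i then w else 0" and b="-(pi/2)"]] by (simp add: s)
  then have "sin (w * c i x) = sin (w * c i y)" by (simp add: cos_diff)
  then have "w * c i x = w * c i y"
    using sin_inj_pi[of "w * c i x" "w * c i y"] wb[of x] wb[of y] by (auto simp: abs_less_iff)
  then show False using w0 i by simp
qed

text \<open>A shifted cosine is the real part of a unimodular constant times a character, so
  convergence of characteristic functions spreads to the algebra by linearity.\<close>

lemma trig_poly_integral_tendsto: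
  fixes \<mu> :: "nat \<Rightarrow> 'b measure"
  assumes pr: "\<And>n. prob_space (\<mu> n)" "\<And>n. \<And>i. i \<in> I \<Longrightarrow> c i \<in> borel_measurable (\<mu> n)"
    and pr': "prob_space \<nu>" "\<And>i. i \<in> I \<Longrightarrow> c i \<in> borel_measurable \<nu>"
    and char: "\<And>a. (\<lambda>n. \<integral>x. exp (\<i> * of_real (\<Sum>i\<in>I. a i * c i x)) \<partial>\<mu> n) \<longlonglongrightarrow>
       (\<integral>x. exp (\<i> * of_real (\<Sum>i\<in>I. a i * c i x)) \<partial>\<nu>)"
    and f: "f \<in> trig_poly I c"
  shows "(\<lambda>n. \<integral>x. f x \<partial>\<mu> n) \<longlonglongrightarrow> (\<integral>x. f x \<partial>\<nu>)"
proof -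
  have meas: "g \<in> borel_measurable M" if "\<And>i. i \<in> I \<Longrightarrow> c i \<in> borel_measurable M" "g \<in> trig_poly I c" for M g
    using that(2)
  proof induction
    case (base a b)
    show ?case using that(1) by measurable
  qed simp_all
  have int: "integrable M g" if "prob_space M" "\<And>i. i \<in> I \<Longrightarrow> c i \<in> borel_measurable M" "g \<in> trig_poly I c" for M g
  proof -
    interpret prob_space M by fact
    obtain B where "\<And>x. \<bar>g x\<bar> \<le> B" using trig_poly_bounded[OF \<open>g \<in> _\<close>] unfolding bounded_iff by auto
    then show ?thesis using meas[OF that(2)] \<open>g \<in> _\<close> by (intro integrable_const_bound[where B=B]) auto
  qed
  show ?thesis using f
  proof induction
    case (base a b)
    have eq: "(\<integral>x. cos ((\<Sum>i\<in>I. a i * c i x) + b) \<partial>M) =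
       Re (exp (\<i> * of_real b) * (\<integral>x. exp (\<i> * of_real (\<Sum>i\<in>I. a i * c i x)) \<partial>M))"
      if M: "prob_space M" "\<And>i. i \<in> I \<Longrightarrow> c i \<in> borel_measurable M" for M
    proof -
      interpret prob_space M by fact
      have *: "integrable M (\<lambda>x. exp (\<i> * of_real (\<Sum>i\<in>I. a i * c i x)))"
        using M(2) by (intro integrable_const_bound[where B=1]) (auto simp: norm_exp_eq_Re)
      have "Re (exp (\<i> * of_real b) * (\<integral>x. exp (\<i> * of_real (\<Sum>i\<in>I. a i * c i x)) \<partial>M)) =
        (\<integral>x. Re (exp (\<i> * of_real b) * exp (\<i> * of_real (\<Sum>i\<in>I. a i * c i x))) \<partial>M)"
        using * by simp
      also have "\<dots> = (\<integral>x. cos ((\<Sum>i\<in>I. a i * c i x) + b) \<partial>M)"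
        by (intro Bochner_Integration.integral_cong refl)
          (simp add: exp_add[symmetric] Re_exp algebra_simps)
      finally show ?thesis by simp
    qed
    have "(\<lambda>n. \<integral>x. cos ((\<Sum>i\<in>I. a i * c i x) + b) \<partial>\<mu> n) =
       (\<lambda>n. Re (exp (\<i> * of_real b) * (\<integral>x. exp (\<i> * of_real (\<Sum>i\<in>I. a i * c i x)) \<partial>\<mu> n)))"
      by (intro ext eq) (use pr in auto)
    moreover have "(\<integral>x. cos ((\<Sum>i\<in>I. a i * c i x) + b) \<partial>\<nu>) =
       Re (exp (\<i> * of_real b) * (\<integral>x. exp (\<i> * of_real (\<Sum>i\<in>I. a i * c i x)) \<partial>\<nu>))"
      by (intro eq) (use pr' in auto)
    ultimately show ?case by (simp only:) (intro tendsto_intros char)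
  next
    case (add f g)
    have "(\<integral>x. f x + g x \<partial>M) = (\<integral>x. f x \<partial>M) + (\<integral>x. g x \<partial>M)"
      if "prob_space M" "\<And>i. i \<in> I \<Longrightarrow> c i \<in> borel_measurable M" for M
      using int[OF that] add.hyps by simp
    from this[OF pr(1)] this[OF pr'(1)] pr(2) pr'(2) show ?case using tendsto_add[OF add.IH] by simp
  next
    case (scale f w)
    then show ?case by (auto intro!: tendsto_intros)
  qed
qed

text \<open>Tent functions built from the distance to a closed set decrease to its indicator, and
  the closed sets form an intersection-stable generator of the Borel sets.\<close>

lemma measure_eqI_bounded_continuous:
  fixes M N :: "'b::metric_space measure"
  assumes M: "prob_space M" "sets M = sets borel" and N: "prob_space N" "sets N = sets borel"
    and eq: "\<And>f. continuous_on UNIV f \<Longrightarrow> bounded (range f) \<Longrightarrow> (\<integral>x. f x \<partial>M) = (\<integral>x. (f x :: real) \<partial>N)"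
  shows "M = N"
proof -
  interpret M: prob_space M by fact
  interpret N: prob_space N by fact
  have closed_eq: "emeasure M C = emeasure N C" if C: "closed C" for C
  proof (cases "C = {}")
    case False
    define f :: "nat \<Rightarrow> 'b \<Rightarrow> real" where "f n x = max 0 (1 - real n * infdist x C)" for n x
    have fc: "continuous_on UNIV (f n)" for n unfolding f_def by (intro continuous_intros)
    have fb: "\<bar>f n x\<bar> \<le> 1" for n x unfolding f_def using infdist_nonneg[of x C] by auto
    have lim: "(\<lambda>n. f n x) \<longlonglongrightarrow> indicator C x" for x
    proof (cases "x \<in> C")
      case True then show ?thesis by (simp add: f_def)
    next
      case False
      then have d: "infdist x C > 0"
        using C \<open>C \<noteq> {}\<close> in_closed_iff_infdist_zero[of C x] infdist_nonneg[of x C] by (simp add: less_le)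
      obtain n0 :: nat where n0: "1 / infdist x C < n0" using reals_Archimedean2 by blast
      have "f n x = 0" if "n \<ge> n0" for n
      proof -
        have "1 < real n0 * infdist x C" using n0 d by (simp add: field_simps)
        also have "\<dots> \<le> real n * infdist x C" using that d by (intro mult_right_mono) auto
        finally show ?thesis by (simp add: f_def)
      qed
      then have "\<forall>\<^sub>F n in sequentially. f n x = 0" unfolding eventually_sequentially by blast
      then show ?thesis using False by (simp add: tendsto_eventually)
    qed
    have *: "(\<lambda>n. \<integral>x. f n x \<partial>Q) \<longlonglongrightarrow> measure Q C" if "prob_space Q" "sets Q = sets borel" for Q
    proof -
      interpret Q: prob_space Q by fact
      have "C \<in> sets Q" using C that by simp
      have "(\<lambda>n. \<integral>x. f n x \<partial>Q) \<longlonglongrightarrow> (\<integral>x. indicator C x \<partial>Q)"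
      proof (rule integral_dominated_convergence[where w="\<lambda>_. 1"])
        show "f n \<in> borel_measurable Q" for n
          using borel_measurable_continuous_onI[OF fc] that(2) by (simp cong: measurable_cong_sets)
      qed (use lim fb \<open>C \<in> sets Q\<close> in auto)
      then show ?thesis using \<open>C \<in> sets Q\<close> by simp
    qed
    have "(\<lambda>n. \<integral>x. f n x \<partial>M) = (\<lambda>n. \<integral>x. f n x \<partial>N)"
    proof (intro ext eq fc)
      show "bounded (range (f n))" for n using fb unfolding bounded_iff by auto
    qed
    then have "measure M C = measure N C"
      using *[OF M] *[OF N] LIMSEQ_unique by simp
    then show ?thesis by (simp add: M.emeasure_eq_measure N.emeasure_eq_measure)
  qed simp
  show ?thesis
  proof (rule measure_eqI_generator_eq[where E="Collect closed" and \<Omega>=UNIV and A="\<lambda>_. UNIV"])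
    show "Int_stable (Collect closed :: 'b set set)" by (auto simp: Int_stable_def)
    show "sets M = sigma_sets UNIV (Collect closed)" "sets N = sigma_sets UNIV (Collect closed)"
      using M(2) N(2) by (simp_all add: borel_eq_closed)
    show "emeasure M UNIV \<noteq> \<infinity>" for i using M.emeasure_finite by (simp add: infinity_ennreal_def)
  qed (use closed_eq in auto)
qed

text \<open>Coordinates outside \<open>J\<close> are frozen at 0 so that the uniqueness theorem can be run in the metric
  space of all functions on the countable index type.\<close>

lemma distr_PiM_eqI_char:
  fixes X :: "'i::countable \<Rightarrow> 'a \<Rightarrow> real" and Y :: "'i \<Rightarrow> 'b \<Rightarrow> real"
  assumes M: "prob_space M" "\<And>i. i \<in> J \<Longrightarrow> X i \<in> borel_measurable M"
    and N: "prob_space N" "\<And>i. i \<in> J \<Longrightarrow> Y i \<in> borel_measurable N"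
    and J: "finite J"
    and char: "\<And>a. (\<integral>x. exp (\<i> * of_real (\<Sum>i\<in>J. a i * X i x)) \<partial>M) =
       (\<integral>x. exp (\<i> * of_real (\<Sum>i\<in>J. a i * Y i x)) \<partial>N)"
  shows "distr M (PiM J (\<lambda>_. borel)) (\<lambda>x. \<lambda>i\<in>J. X i x) = distr N (PiM J (\<lambda>_. borel)) (\<lambda>x. \<lambda>i\<in>J. Y i x)"
proof -
  interpret M: prob_space M by fact
  interpret N: prob_space N by fact
  define ext :: "('i \<Rightarrow> real) \<Rightarrow> 'i \<Rightarrow> real" where "ext x = (\<lambda>i. if i \<in> J then x i else 0)" for x
  define T where "T = range ext"
  have meas: "(\<lambda>x. ext (\<lambda>i. Z i x)) \<in> measurable Q borel"
    if "\<And>i. i \<in> J \<Longrightarrow> Z i \<in> borel_measurable Q" for Z and Q :: "'c measure"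
  proof (rule measurable_coordinatewise_then_product)
    fix i show "(\<lambda>x. ext (\<lambda>i. Z i x) i) \<in> borel_measurable Q"
      using that[of i] by (cases "i \<in> J") (auto simp: ext_def)
  qed
  define P where "P = distr M borel (\<lambda>x. ext (\<lambda>i. X i x))"
  define P' where "P' = distr N borel (\<lambda>x. ext (\<lambda>i. Y i x))"
  have mX: "(\<lambda>x. ext (\<lambda>i. X i x)) \<in> measurable M borel" by (rule meas) (rule M(2))
  have mY: "(\<lambda>x. ext (\<lambda>i. Y i x)) \<in> measurable N borel" by (rule meas) (rule N(2))
  have P: "prob_space P" "sets P = sets borel" and P': "prob_space P'" "sets P' = sets borel"
    unfolding P_def P'_def using mX mY by (auto intro!: M.prob_space_distr N.prob_space_distr)
  let ?c = "\<lambda>i (x :: 'i \<Rightarrow> real). x i"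
  \<comment> \<open>Products of compact intervals and singletons are compact by Tychonoff, even over
    infinitely many coordinates. They increase to cover \<open>T\<close>, which yields
    tightness.\<close>
  define K where "K n = PiE UNIV (\<lambda>i. if i \<in> J then {-real n..real n} else {0})" for n :: nat
  have Kc: "compact (K n)" for n
    unfolding K_def compactin_euclidean_iff[symmetric] euclidean_product_topology[symmetric] compactin_PiE
    by (auto simp: compactin_euclidean_iff)
  have KT: "K n \<subseteq> T" for n
  proof
    fix x assume "x \<in> K n"
    then have "x i = ext x i" for i unfolding K_def ext_def by (auto simp: PiE_iff split: if_splits dest: spec[of _ i])
    then have "x = ext x" by (rule ext)
    then show "x \<in> T" unfolding T_def by blast
  qed
  have KU: "T \<subseteq> (\<Union>n. K n)"
  proof
    fix x assume "x \<in> T"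
    then obtain y where x: "x = ext y" unfolding T_def by auto
    obtain n :: nat where n: "(\<Sum>i\<in>J. \<bar>x i\<bar>) < n" using reals_Archimedean2 by blast
    have "x \<in> K n" unfolding K_def
    proof (rule PiE_I)
      fix i :: 'i
      show "x i \<in> (if i \<in> J then {-real n..real n} else {0})"
      proof (cases "i \<in> J")
        case True
        then have "\<bar>x i\<bar> \<le> (\<Sum>i\<in>J. \<bar>x i\<bar>)" using J by (intro member_le_sum) auto
        then show ?thesis using n True by auto
      qed (simp add: x ext_def)
    qed simp
    then show "x \<in> (\<Union>n. K n)" by blast
  qed
  have Kb: "K n \<in> sets borel" for n using compact_imp_closed[OF Kc] by simp
  have tail: "(\<lambda>n. measure Q (K n)) \<longlonglongrightarrow> 1"
    if Q: "prob_space Q" "sets Q = sets borel" "\<And>x. x \<in> space Q' \<Longrightarrow> Z x \<in> T" "Q = distr Q' borel Z" "Z \<in> measurable Q' borel"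
    for Q and Q' :: "'c measure" and Z
  proof -
    interpret Q: prob_space Q by fact
    have inc: "incseq K" unfolding K_def incseq_def by (intro allI impI PiE_mono) auto
    have "(\<lambda>n. measure Q (K n)) \<longlonglongrightarrow> measure Q (\<Union>n. K n)"
      using Kb Q(2) inc by (intro Q.finite_Lim_measure_incseq) auto
    also have "measure Q (\<Union>n. K n) = measure Q (space Q)"
    proof -
      have "(\<Union>n. K n) \<in> sets borel" using Kb by blast
      moreover have "Z -` (\<Union>n. K n) \<inter> space Q' = space Q'" using Q(3) KU by blast
      ultimately show ?thesis unfolding Q(4) using Q(5) by (simp add: measure_distr)
    qed
    finally show ?thesis by (simp add: Q.prob_space)
  qed
  have tailP: "(\<lambda>n. measure P (K n)) \<longlonglongrightarrow> 1"
    by (rule tail[OF P _ P_def mX]) (auto simp: T_def)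
  have tailP': "(\<lambda>n. measure P' (K n)) \<longlonglongrightarrow> 1"
    by (rule tail[OF P' _ P'_def mY]) (auto simp: T_def)
  \<comment> \<open>Uniqueness is obtained as a convergence statement: the constant sequence
    \<open>P'\<close> converges weakly to \<open>P\<close>, hence the two laws have the same
    integrals of bounded continuous functions.\<close>
  have "weakly_converges (\<lambda>_. P') P"
  proof (rule weakly_converges_algebra[where R="trig_poly J ?c" and T=T])
    fix \<epsilon> :: real assume "\<epsilon> > 0"
    then have "\<forall>\<^sub>F n in sequentially. measure P (K n) > 1 - \<epsilon>" "\<forall>\<^sub>F n in sequentially. measure P' (K n) > 1 - \<epsilon>"
      using order_tendstoD(1)[OF tailP, of "1-\<epsilon>"] order_tendstoD(1)[OF tailP', of "1-\<epsilon>"] by auto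
    then have "\<forall>\<^sub>F n in sequentially. measure P (K n) > 1 - \<epsilon> \<and> measure P' (K n) > 1 - \<epsilon>"
      by eventually_elim auto
    then obtain n where "measure P (K n) > 1 - \<epsilon>" "measure P' (K n) > 1 - \<epsilon>"
      unfolding eventually_sequentially by blast
    then show "\<exists>K. compact K \<and> K \<in> sets borel \<and> K \<subseteq> T \<and> measure P K \<ge> 1 - \<epsilon> \<and>
        (\<forall>\<^sub>F n in sequentially. measure P' K \<ge> 1 - \<epsilon>)"
      using Kc Kb KT by (intro exI[of _ "K n"]) auto
  next
    fix x y assume xy: "x \<in> T" "y \<in> T" "x \<noteq> y"
    then obtain i where "i \<in> J" "x i \<noteq> y i" unfolding T_def ext_def by (auto simp: fun_eq_iff split: if_splits)
    then show "\<exists>f\<in>trig_poly J ?c. f x \<noteq> f y" using trig_poly_separates[OF J, of i ?c x y] by blast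
  next
    fix p assume p: "p \<in> trig_poly J ?c"
    have cm: "?c i \<in> borel_measurable Q" if "sets Q = sets borel" for Q i
      using borel_measurable_continuous_onI[OF continuous_on_product_coordinates[of i]] that
      by (simp cong: measurable_cong_sets)
    have "(\<integral>x. exp (\<i> * of_real (\<Sum>i\<in>J. a i * x i)) \<partial>P') = (\<integral>x. exp (\<i> * of_real (\<Sum>i\<in>J. a i * x i)) \<partial>P)" for a
    proof -
      have m: "(\<lambda>x. exp (\<i> * of_real (\<Sum>i\<in>J. a i * x i))) \<in> borel_measurable (borel :: ('i \<Rightarrow> real) measure)"
        using cm[of borel] by measurable
      have *: "(\<Sum>i\<in>J. a i * ext x i) = (\<Sum>i\<in>J. a i * x i)" for x
        by (intro sum.cong) (auto simp: ext_def)
      show ?thesis unfolding P_def P'_def integral_distr[OF mX m] integral_distr[OF mY m] *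
        using char[of a] by simp
    qed
    then show "(\<lambda>n. \<integral>x. p x \<partial>P') \<longlonglongrightarrow> (\<integral>x. p x \<partial>P)"
      by (intro trig_poly_integral_tendsto[OF P'(1) _ P(1) _ _ p] cm P P') auto
  next
    fix f assume "f \<in> trig_poly J ?c"
    then show "continuous_on UNIV f" "bounded (range f)"
      by (simp_all add: trig_poly_bounded trig_poly_continuous[where I=J and c="?c"])
  qed (fact P P' trig_poly.add trig_poly_mult trig_poly_const)+
  then have "P = P'"
    by (intro measure_eqI_bounded_continuous[OF P P']) (auto simp: weakly_converges_def LIMSEQ_const_iff)
  have r: "(\<lambda>x. \<lambda>i\<in>J. x i) \<in> measurable borel (PiM J (\<lambda>_. borel))"
    using borel_measurable_continuous_onI[OF continuous_on_product_coordinates] by (intro measurable_restrict)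
  have "distr P (PiM J (\<lambda>_. borel)) (\<lambda>x. \<lambda>i\<in>J. x i) = distr M (PiM J (\<lambda>_. borel)) (\<lambda>x. \<lambda>i\<in>J. X i x)"
    unfolding P_def by (subst distr_distr[OF r mX]) (auto intro!: distr_cong simp: ext_def)
  moreover have "distr P' (PiM J (\<lambda>_. borel)) (\<lambda>x. \<lambda>i\<in>J. x i) = distr N (PiM J (\<lambda>_. borel)) (\<lambda>x. \<lambda>i\<in>J. Y i x)"
    unfolding P'_def by (subst distr_distr[OF r mY]) (auto intro!: distr_cong simp: ext_def)
  ultimately show ?thesis using \<open>P = P'\<close> by simp
qed

section \<open>Gaussian vectors and integration by parts\<close>

abbreviation centered_normal :: "real \<Rightarrow> real measure" where
  "centered_normal u \<equiv> density lborel (\<lambda>x. ennreal (normal_density 0 u x))"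

lemma integral_exp_centered_normal:
  assumes u: "u > 0"
  shows "(\<integral>y. exp (\<i> * of_real (a * y)) \<partial>centered_normal u) = exp (- of_real (a\<^sup>2 * u\<^sup>2 / 2))"
proof -
  interpret N: prob_space "centered_normal u" by (rule prob_space_normal_density[OF u])
  have "distributed (centered_normal u) lborel (\<lambda>x. x) (\<lambda>x. ennreal (normal_density 0 u x))"
    unfolding distributed_def by (auto simp: distr_id2)
  then have "distributed (centered_normal u) lborel (\<lambda>x. (x - 0) / u) std_normal_density"
    by (rule N.normal_standard_normal_convert[OF u, THEN iffD1])
  then have d: "distr (centered_normal u) lborel (\<lambda>x. x / u) = density lborel std_normal_density"
    by (simp add: distributed_def)
  have "(\<integral>y. exp (\<i> * of_real (a * u * y)) \<partial>density lborel std_normal_density) =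
      (\<integral>y. exp (\<i> * of_real (a * u * (y / u))) \<partial>centered_normal u)"
    unfolding d[symmetric] by (subst integral_distr) auto
  also have "\<dots> = (\<integral>y. exp (\<i> * of_real (a * y)) \<partial>centered_normal u)"
    using u by simp
  finally have "(\<integral>y. exp (\<i> * of_real (a * y)) \<partial>centered_normal u) = char std_normal_distribution (a * u)"
    by (simp add: char_def mult.assoc)
  then show ?thesis by (simp add: char_std_normal_distribution exp_of_real[symmetric] power_mult_distrib)
qed

text \<open>The degenerate case fits the same formula: a constant of mean 0 vanishes almost surely,
  so that \<open>v = 0\<close> and both sides are 1.\<close>

lemma gaussian_rv_char:
  assumes "prob_space M" and g: "gaussian_rv M Y" and m: "(\<integral>x. Y x \<partial>M) = 0" and v: "(\<integral>x. (Y x)\<^sup>2 \<partial>M) = v"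
  shows "(\<integral>x. exp (\<i> * of_real (Y x)) \<partial>M) = exp (- of_real (v / 2))"
proof -
  interpret prob_space M by fact
  have Y: "Y \<in> borel_measurable M" using g unfolding gaussian_rv_def by simp
  from g consider a where "AE x in M. Y x = a"
    | a \<sigma> where "\<sigma> > 0" "distributed M lborel Y (\<lambda>x. ennreal (normal_density a \<sigma> x))"
    unfolding gaussian_rv_def by blast
  then show ?thesis
  proof cases
    case 1
    have "(\<integral>x. Y x \<partial>M) = (\<integral>x. a \<partial>M)" using 1 Y by (intro integral_cong_AE) auto
    then have a: "a = 0" using m by (simp add: prob_space)
    have "(\<integral>x. (Y x)\<^sup>2 \<partial>M) = (\<integral>x. 0 \<partial>M)" using 1 Y a by (intro integral_cong_AE) auto
    then have "v = 0" using v by simp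
    moreover have "(\<integral>x. exp (\<i> * of_real (Y x)) \<partial>M) = (\<integral>x. 1 \<partial>M)" using 1 Y a by (intro integral_cong_AE) auto
    ultimately show ?thesis by (simp add: prob_space)
  next
    case 2
    have a: "a = 0" using normal_distributed_expectation[OF 2] m by simp
    have "v = \<sigma>\<^sup>2" using normal_distributed_variance[OF 2] m v by simp
    moreover have "distr M lborel Y = centered_normal \<sigma>" using 2(2) a by (simp add: distributed_def)
    then have "(\<integral>x. exp (\<i> * of_real (Y x)) \<partial>M) = (\<integral>y. exp (\<i> * of_real (1 * y)) \<partial>centered_normal \<sigma>)"
      by (subst \<open>distr M lborel Y = _\<close>[symmetric], subst integral_distr) (use Y in auto)
    ultimately show ?thesis unfolding integral_exp_centered_normal[OF 2(1)] by simp
  qed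
qed

lemma normal_density_tendsto_0:
  assumes u: "u > 0" and F: "F = at_top \<or> F = at_bot"
  shows "(normal_density 0 u \<longlongrightarrow> 0) F"
proof -
  have "filterlim (\<lambda>x::real. x\<^sup>2) at_top F"
    using F filterlim_pow_at_top[of 2 "\<lambda>x::real. x" at_top] filterlim_pow_at_bot_even[of 2 "\<lambda>x::real. x" at_bot]
    by (auto simp: filterlim_ident)
  then have "filterlim (\<lambda>x::real. x\<^sup>2 * (1 / (2 * u\<^sup>2))) at_top F"
    using u by (intro filterlim_at_top_mult_tendsto_pos[OF tendsto_const]) auto
  then have "filterlim (\<lambda>x::real. - (x\<^sup>2 * (1 / (2 * u\<^sup>2)))) at_bot F"
    by (simp add: filterlim_uminus_at_top)
  then have "((\<lambda>x. exp (- (x\<^sup>2 * (1 / (2 * u\<^sup>2))))) \<longlongrightarrow> 0) F"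
    by (rule filterlim_compose[OF exp_at_bot])
  then have "((\<lambda>x. 1 / sqrt (2 * pi * u\<^sup>2) * exp (- (x\<^sup>2 * (1 / (2 * u\<^sup>2))))) \<longlongrightarrow> 1 / sqrt (2 * pi * u\<^sup>2) * 0) F"
    by (intro tendsto_intros)
  then show ?thesis by (simp add: normal_density_def[abs_def])
qed

text \<open>Stein's identity. The function \<open>g\<close> in the proof is the derivative of the
  density times \<open>f\<close>; this product vanishes at both ends because \<open>f\<close> is
  bounded, so \<open>g\<close> integrates to 0.\<close>

lemma centered_normal_integration_by_parts:
  fixes f f' :: "real \<Rightarrow> complex"
  assumes u: "u > 0"
    and d: "\<And>y. (f has_vector_derivative f' y) (at y)" and c: "\<And>y. isCont f' y"
    and B: "\<And>y. norm (f y) \<le> B" "\<And>y. norm (f' y) \<le> B"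
  shows "(\<integral>y. of_real y * f y \<partial>centered_normal u) = of_real (u\<^sup>2) * (\<integral>y. f' y \<partial>centered_normal u)"
proof -
  let ?n = "normal_density 0 u"
  have fc: "isCont f y" for y using d has_vector_derivative_continuous by blast
  have fm: "f \<in> borel_measurable borel" "f' \<in> borel_measurable borel"
    using fc c by (auto intro!: borel_measurable_continuous_onI simp: continuous_on_eq_continuous_at)
  have n: "(?n has_real_derivative (- (y / u\<^sup>2) * ?n y)) (at y)" for y
  proof -
    define c where "c = 1 / sqrt (2 * pi * u\<^sup>2)"
    define k where "k = 1 / (2 * u\<^sup>2)"
    have "((\<lambda>y. c * exp (- (y\<^sup>2 * k))) has_real_derivative c * (exp (- (y\<^sup>2 * k)) * - (2 * y * k))) (at y)"
      by (auto intro!: derivative_eq_intros)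
    moreover have "c * (exp (- (y\<^sup>2 * k)) * - (2 * y * k)) = - (y / u\<^sup>2) * (c * exp (- (y\<^sup>2 * k)))"
      by (simp add: k_def)
    ultimately show ?thesis by (simp add: normal_density_def[abs_def] c_def k_def)
  qed
  define g where "g y = ?n y *\<^sub>R f' y - (y / u\<^sup>2 * ?n y) *\<^sub>R f y" for y
  have i1: "integrable lborel (\<lambda>y. ?n y *\<^sub>R f' y)"
  proof (rule Bochner_Integration.integrable_bound[where f="\<lambda>y. B * ?n y"])
    show "AE x in lborel. norm (normal_density 0 u x *\<^sub>R f' x) \<le> norm (B * normal_density 0 u x)"
      using B(2) norm_ge_zero order_trans[OF norm_ge_zero B(2)] by (auto simp: mult.commute[of B] intro!: AE_I2 mult_left_mono)
  qed (use fm u in \<open>auto intro: integrable_normal_density\<close>)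
  have i2: "integrable lborel (\<lambda>y. (y * ?n y) *\<^sub>R f y)"
  proof (rule Bochner_Integration.integrable_bound[where f="\<lambda>y. B * (?n y * \<bar>y - 0\<bar>^1)"])
    show "integrable lborel (\<lambda>y. B * (?n y * \<bar>y - 0\<bar>^1))"
      using integrable_normal_moment_abs[OF u, of 0 1] by (intro integrable_mult_right)
    show "AE x in lborel. norm ((x * normal_density 0 u x) *\<^sub>R f x) \<le> norm (B * (?n x * \<bar>x - 0\<bar>^1))"
    proof (rule AE_I2)
      fix x
      have "(\<bar>x\<bar> * ?n x) * norm (f x) \<le> (\<bar>x\<bar> * ?n x) * B"
        by (intro mult_left_mono B) auto
      moreover have "0 \<le> B" using order_trans[OF norm_ge_zero B(1)] .
      ultimately show "norm ((x * ?n x) *\<^sub>R f x) \<le> norm (B * (?n x * \<bar>x - 0\<bar>^1))"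
        by (simp add: abs_mult mult_ac)
    qed
  qed (use fm u in auto)
  have ig: "integrable lborel g"
    unfolding g_def using i1 integrable_scaleR_right[OF i2, of "1/u\<^sup>2"] by (intro Bochner_Integration.integrable_diff) auto
  have lim: "((\<lambda>y. ?n y *\<^sub>R f y) \<longlongrightarrow> 0) F" if "F = at_top \<or> F = at_bot" for F
  proof (rule Lim_null_comparison)
    show "\<forall>\<^sub>F x in F. norm (?n x *\<^sub>R f x) \<le> ?n x * B"
      using B(1) by (intro always_eventually allI) (auto intro!: mult_left_mono)
    show "((\<lambda>x. ?n x * B) \<longlongrightarrow> 0) F" using tendsto_mult_right[OF normal_density_tendsto_0[OF u that], of B] by simp
  qed
  have "(LBINT y=-\<infinity>..\<infinity>. g y) = 0 - 0"
  proof (rule interval_integral_FTC_integrable)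
    show "((\<lambda>y. ?n y *\<^sub>R f y) has_vector_derivative g x) (at x)" for x
      unfolding g_def using has_vector_derivative_scaleR[OF n d] by (simp add: algebra_simps)
    show "isCont g x" for x
      unfolding g_def using fc c DERIV_isCont[OF n] u by (intro continuous_intros) auto
    show "set_integrable lborel (einterval (-\<infinity>) \<infinity>) g"
      using ig by (simp add: set_integrable_def einterval_def)
    show "(((\<lambda>y. ?n y *\<^sub>R f y) \<circ> real_of_ereal) \<longlongrightarrow> 0) (at_right (-\<infinity>))"
      "(((\<lambda>y. ?n y *\<^sub>R f y) \<circ> real_of_ereal) \<longlongrightarrow> 0) (at_left \<infinity>)"
      using lim by (auto simp: ereal_tendsto_simps)
  qed auto
  then have "integral\<^sup>L lborel g = 0"
    by (simp add: interval_lebesgue_integral_def set_lebesgue_integral_def einterval_def)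
  moreover have "integral\<^sup>L lborel g = (\<integral>y. ?n y *\<^sub>R f' y \<partial>lborel) - (1/u\<^sup>2) *\<^sub>R (\<integral>y. (y * ?n y) *\<^sub>R f y \<partial>lborel)"
    unfolding g_def using i1 i2 integrable_scaleR_right[OF i2, of "1/u\<^sup>2"]
    by (simp flip: integral_scaleR_right)
  ultimately have "(\<integral>y. (y * ?n y) *\<^sub>R f y \<partial>lborel) = u\<^sup>2 *\<^sub>R (\<integral>y. ?n y *\<^sub>R f' y \<partial>lborel)"
    using u by (simp add: scaleR_conv_of_real field_simps)
  then show ?thesis
    using fm by (simp add: integral_density scaleR_conv_of_real mult_ac)
qed

text \<open>Cholesky factorization, one index at a time: a positive pivot is eliminated by passing
  to the Schur complement, and a zero pivot forces its whole column to vanish.\<close>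

lemma psd_gram_factorization:
  fixes K :: "'k \<Rightarrow> 'k \<Rightarrow> real"
  assumes "finite S" and "\<And>i j. K i j = K j i"
    and "\<And>a. (\<Sum>i\<in>S. \<Sum>j\<in>S. a i * a j * K i j) \<ge> 0"
  shows "\<exists>v :: 'k \<Rightarrow> 'k \<Rightarrow> real. \<forall>i\<in>S. \<forall>j\<in>S. K i j = (\<Sum>k\<in>S. v i k * v j k)"
  using assms
proof (induction S arbitrary: K rule: finite_induct)
  case (insert e S)
  note sym = insert.prems(1) and psd = insert.prems(2)
  have quad: "a e * a e * K e e + 2 * a e * (\<Sum>i\<in>S. a i * K i e) + (\<Sum>i\<in>S. \<Sum>j\<in>S. a i * a j * K i j) \<ge> 0" for a
  proof -
    have "(\<Sum>i\<in>insert e S. \<Sum>j\<in>insert e S. a i * a j * K i j) =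
      a e * a e * K e e + (\<Sum>j\<in>S. a e * a j * K e j) + ((\<Sum>i\<in>S. a i * a e * K i e) + (\<Sum>i\<in>S. \<Sum>j\<in>S. a i * a j * K i j))"
      using insert.hyps by (simp add: sum.distrib)
    also have "(\<Sum>j\<in>S. a e * a j * K e j) = a e * (\<Sum>i\<in>S. a i * K i e)"
      by (simp add: sum_distrib_left sym[of e] mult_ac)
    also have "(\<Sum>i\<in>S. a i * a e * K i e) = a e * (\<Sum>i\<in>S. a i * K i e)"
      by (simp add: sum_distrib_left mult_ac)
    finally show ?thesis using psd[of a] by simp
  qed
  have d0: "K e e \<ge> 0"
  proof -
    define a where "a i = (if i = e then 1 else 0 :: real)" for i
    have "a i = 0" if "i \<in> S" for i using that insert.hyps unfolding a_def by auto
    then show ?thesis using quad[of a] by (simp add: a_def[of e])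
  qed
  show ?case
  proof (cases "K e e = 0")
    case True
    have "(\<Sum>i\<in>S. \<Sum>j\<in>S. a i * a j * K i j) \<ge> 0" for a
    proof -
      have "(\<Sum>i\<in>S. \<Sum>j\<in>S. (a(e:=0)) i * (a(e:=0)) j * K i j) = (\<Sum>i\<in>S. \<Sum>j\<in>S. a i * a j * K i j)"
        using insert.hyps by (intro sum.cong refl) auto
      then show ?thesis using quad[of "a(e:=0)"] by simp
    qed
    from insert.IH[OF sym this] obtain v :: "'k \<Rightarrow> 'k \<Rightarrow> real"
      where v: "\<And>i j. i \<in> S \<Longrightarrow> j \<in> S \<Longrightarrow> K i j = (\<Sum>k\<in>S. v i k * v j k)" by blast
    have z: "K j e = 0" if j: "j \<in> S" for j
    proof (rule ccontr)
      assume nz: "K j e \<noteq> 0"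
      \<comment> \<open>With weight 1 at \<open>j\<close> and \<open>t\<close> at \<open>e\<close>
        the quadratic form becomes 2 t K j e + K j j = -1, a contradiction.\<close>
      define t where "t = - (K j j + 1) / (2 * K j e)"
      define a where "a = (\<lambda>i. if i = e then t else if i = j then 1 else 0 :: real)"
      have je: "j \<noteq> e" using j insert.hyps by auto
      have as: "a i = (if i = j then 1 else 0)" if "i \<in> S" for i using that insert.hyps je unfolding a_def by auto
      have 1: "(\<Sum>i\<in>S. a i * K i e) = (\<Sum>i\<in>S. if i = j then K i e else 0)" by (intro sum.cong refl) (simp add: as)
      have 2: "(\<Sum>i\<in>S. \<Sum>j'\<in>S. a i * a j' * K i j') = (\<Sum>i\<in>S. if i = j then (\<Sum>j'\<in>S. if j' = j then K i j' else 0) else 0)"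
        by (intro sum.cong refl) (auto simp: as intro!: sum.cong)
      have "2 * t * K j e + K j j \<ge> 0"
        using quad[of a] True j insert.hyps unfolding 1 2 by (simp add: a_def)
      moreover have "2 * t * K j e = - (K j j + 1)" using nz unfolding t_def by (simp add: field_simps)
      ultimately show False by simp
    qed
    define w where "w i k = (if i = e \<or> k = e then 0 else v i k)" for i k
    have "K i j = (\<Sum>k\<in>insert e S. w i k * w j k)" if "i \<in> insert e S" "j \<in> insert e S" for i j
    proof -
      have "(\<Sum>k\<in>insert e S. w i k * w j k) = (\<Sum>k\<in>S. w i k * w j k)" using insert.hyps by (simp add: w_def)
      also have "\<dots> = (\<Sum>k\<in>S. if i = e \<or> j = e then 0 else v i k * v j k)"
        using insert.hyps by (intro sum.cong) (auto simp: w_def)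
      also have "\<dots> = (if i = e \<or> j = e then 0 else (\<Sum>k\<in>S. v i k * v j k))" by simp
      also have "\<dots> = K i j"
        using that v[of i j] z True sym[of e j] by (auto split: if_splits)
      finally show ?thesis by simp
    qed
    then show ?thesis by blast
  next
    case False
    define d where "d = K e e"
    have d: "d > 0" using False d0 unfolding d_def by simp
    define K' where "K' i j = K i j - K i e * K j e / d" for i j
    have sym': "K' i j = K' j i" for i j unfolding K'_def using sym[of i j] by simp
    have "(\<Sum>i\<in>S. \<Sum>j\<in>S. a i * a j * K' i j) \<ge> 0" for a
    proof -
      define s where "s = (\<Sum>i\<in>S. a i * K i e)"
      \<comment> \<open>This weight of \<open>e\<close> minimises the quadratic form for given
        weights on \<open>S\<close>; the minimum is the form of the Schur complement
        \<open>K'\<close>.\<close>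
      define b where "b = a(e := - s / d)"
      have b: "b i = a i" if "i \<in> S" for i using that insert.hyps unfolding b_def by auto
      have be: "b e = - s / d" unfolding b_def by simp
      have "(\<Sum>i\<in>S. \<Sum>j\<in>S. a i * a j * K' i j) =
        (\<Sum>i\<in>S. \<Sum>j\<in>S. a i * a j * K i j) - (\<Sum>i\<in>S. \<Sum>j\<in>S. (a i * K i e) * (a j * K j e)) / d"
        unfolding K'_def by (simp add: sum_subtractf[symmetric] sum_divide_distrib right_diff_distrib mult_ac)
      also have "(\<Sum>i\<in>S. \<Sum>j\<in>S. (a i * K i e) * (a j * K j e)) = s * s"
        unfolding s_def by (simp add: sum_product)
      finally have 1: "(\<Sum>i\<in>S. \<Sum>j\<in>S. a i * a j * K' i j) = (\<Sum>i\<in>S. \<Sum>j\<in>S. a i * a j * K i j) - s * s / d" .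
      have "b e * b e * K e e + 2 * b e * (\<Sum>i\<in>S. b i * K i e) + (\<Sum>i\<in>S. \<Sum>j\<in>S. b i * b j * K i j)
        = (\<Sum>i\<in>S. \<Sum>j\<in>S. a i * a j * K i j) - s * s / d"
        using d unfolding be by (simp add: b s_def[symmetric] d_def[symmetric] field_simps)
      then show ?thesis using quad[of b] 1 by simp
    qed
    from insert.IH[OF sym' this] obtain v :: "'k \<Rightarrow> 'k \<Rightarrow> real"
      where v: "\<And>i j. i \<in> S \<Longrightarrow> j \<in> S \<Longrightarrow> K' i j = (\<Sum>k\<in>S. v i k * v j k)" by blast
    define w where "w i k = (if k = e then K i e / sqrt d else if i = e then 0 else v i k)" for i k
    have "K i j = (\<Sum>k\<in>insert e S. w i k * w j k)" if "i \<in> insert e S" "j \<in> insert e S" for i j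
    proof -
      have "(\<Sum>k\<in>insert e S. w i k * w j k) = K i e * K j e / d + (\<Sum>k\<in>S. w i k * w j k)"
        using insert.hyps d by (simp add: w_def)
      also have "(\<Sum>k\<in>S. w i k * w j k) = (\<Sum>k\<in>S. if i = e \<or> j = e then 0 else v i k * v j k)"
        using insert.hyps by (intro sum.cong) (auto simp: w_def)
      also have "\<dots> = (if i = e \<or> j = e then 0 else (\<Sum>k\<in>S. v i k * v j k))" by simp
      also have "\<dots> = K i j - K i e * K j e / d"
      proof (cases "i = e \<or> j = e")
        case True
        then have "K i e * K j e / d = K i j" using d sym[of e j] unfolding d_def by auto
        then show ?thesis using True by simp
      next
        case False
        then show ?thesis using that v[of i j] by (simp add: K'_def)
      qed
      finally show ?thesis by simp
    qed
    then show ?thesis by blast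
  qed
qed simp

lemma jointly_gaussian_measurable:
  assumes "jointly_gaussian M I X" "i \<in> I"
  shows "X i \<in> borel_measurable M"
  using assms(1)[unfolded jointly_gaussian_def, rule_format, of "{i}" "\<lambda>_. 1"] assms(2)
  by (simp add: gaussian_rv_def)

lemma distr_PiM_centered_normal_restrict:
  assumes "finite J"
  shows "distr (PiM J (\<lambda>_. centered_normal u)) (PiM J (\<lambda>_. borel)) (\<lambda>x. \<lambda>i\<in>J. x i) =
    PiM J (\<lambda>_. centered_normal u)"
proof -
  have s: "sets (PiM J (\<lambda>_. borel :: real measure)) = sets (PiM J (\<lambda>_. centered_normal u))"
    by (intro sets_PiM_cong) auto
  have "distr (PiM J (\<lambda>_. centered_normal u)) (PiM J (\<lambda>_. borel)) (\<lambda>x. \<lambda>i\<in>J. x i) =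
    distr (PiM J (\<lambda>_. centered_normal u)) (PiM J (\<lambda>_. centered_normal u)) (\<lambda>x. x)"
    by (intro distr_cong s) (auto simp: space_PiM PiE_restrict)
  then show ?thesis by (simp add: distr_id2)
qed

text \<open>A non-integrable function has integral 0, so a nonzero second moment certifies
  integrability.\<close>

lemma square_integrable_of_moment:
  fixes X :: "'a \<Rightarrow> real"
  assumes "(\<integral>x. X x * X x \<partial>M) \<noteq> 0"
  shows "integrable M (\<lambda>x. (X x)\<^sup>2)"
  using assms not_integrable_integral_eq[of M "\<lambda>x. X x * X x"] by (auto simp: power2_eq_square)

lemma integrable_mult_of_squares:
  fixes X Y :: "'a \<Rightarrow> real"
  assumes "X \<in> borel_measurable M" "Y \<in> borel_measurable M"
    "integrable M (\<lambda>x. (X x)\<^sup>2)" "integrable M (\<lambda>x. (Y x)\<^sup>2)"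
  shows "integrable M (\<lambda>x. X x * Y x)"
proof (rule Bochner_Integration.integrable_bound[where f="\<lambda>x. (X x)\<^sup>2 + (Y x)\<^sup>2"])
  show "AE x in M. norm (X x * Y x) \<le> norm ((X x)\<^sup>2 + (Y x)\<^sup>2)"
  proof (rule AE_I2)
    fix x
    have "2 * (\<bar>X x\<bar> * \<bar>Y x\<bar>) \<le> (X x)\<^sup>2 + (Y x)\<^sup>2"
      using sum_squares_bound[of "\<bar>X x\<bar>" "\<bar>Y x\<bar>"] by simp
    moreover have "norm (X x * Y x) = \<bar>X x\<bar> * \<bar>Y x\<bar>" by (simp add: abs_mult)
    moreover have "norm ((X x)\<^sup>2 + (Y x)\<^sup>2) = (X x)\<^sup>2 + (Y x)\<^sup>2" by simp
    moreover have "0 \<le> norm (X x * Y x)" by (rule norm_ge_zero)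
    ultimately show "norm (X x * Y x) \<le> norm ((X x)\<^sup>2 + (Y x)\<^sup>2)" by linarith
  qed
qed (use assms in auto)

lemma (in prob_space) integrable_of_square:
  fixes X :: "'a \<Rightarrow> real"
  assumes "X \<in> borel_measurable M" "integrable M (\<lambda>x. (X x)\<^sup>2)"
  shows "integrable M X"
  using integrable_mult_of_squares[OF assms(1) _ assms(2), of "\<lambda>_. 1"] by simp

text \<open>Uncorrelated jointly Gaussian variables are independent, because the characteristic
  function of every linear combination factorises. The hypotheses speak of values of integrals only;
  integrability is first extracted from the nonzero variances.\<close>

lemma jointly_gaussian_distr:
  fixes X :: "'i::countable \<Rightarrow> 'a \<Rightarrow> real"
  assumes "prob_space M" and g: "jointly_gaussian M I X" and J: "finite J" "J \<subseteq> I" and u: "u > 0"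
    and mean: "\<And>i. i \<in> J \<Longrightarrow> (\<integral>x. X i x \<partial>M) = 0"
    and cov: "\<And>i j. i \<in> J \<Longrightarrow> j \<in> J \<Longrightarrow> (\<integral>x. X i x * X j x \<partial>M) = (if i = j then u\<^sup>2 else 0)"
  shows "distr M (PiM J (\<lambda>_. borel)) (\<lambda>x. \<lambda>i\<in>J. X i x) = PiM J (\<lambda>_. centered_normal u)"
proof -
  interpret prob_space M by fact
  interpret N: product_prob_space "\<lambda>_. centered_normal u" J
    by (intro product_prob_spaceI prob_space_normal_density u)
  have m: "X i \<in> borel_measurable M" if "i \<in> J" for i
    using jointly_gaussian_measurable[OF g] J that by blast
  have sq: "integrable M (\<lambda>x. (X i x)\<^sup>2)" if "i \<in> J" for i
    by (rule square_integrable_of_moment) (use cov[OF that that] u in auto)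
  have int1: "integrable M (X i)" if "i \<in> J" for i
    by (rule integrable_of_square[OF m sq]) (use that in auto)
  have int2: "integrable M (\<lambda>x. X i x * X j x)" if "i \<in> J" "j \<in> J" for i j
    by (rule integrable_mult_of_squares[OF m m sq sq]) (use that in auto)
  have "distr M (PiM J (\<lambda>_. borel)) (\<lambda>x. \<lambda>i\<in>J. X i x) =
     distr (PiM J (\<lambda>_. centered_normal u)) (PiM J (\<lambda>_. borel)) (\<lambda>x. \<lambda>i\<in>J. x i)"
  proof (rule distr_PiM_eqI_char[OF \<open>prob_space M\<close> m _ _ J(1)])
    show "prob_space (PiM J (\<lambda>_. centered_normal u))" by (rule N.prob_space_axioms)
    show "(\<lambda>x. x i) \<in> borel_measurable (PiM J (\<lambda>_. centered_normal u))" if "i \<in> J" for i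
      using measurable_component_singleton[OF that, of "\<lambda>_. centered_normal u"] by simp
    fix a :: "'i \<Rightarrow> real"
    have "(\<integral>x. exp (\<i> * of_real (\<Sum>i\<in>J. a i * X i x)) \<partial>M) = exp (- of_real ((\<Sum>i\<in>J. (a i)\<^sup>2 * u\<^sup>2) / 2))"
    proof (rule gaussian_rv_char[OF \<open>prob_space M\<close>])
      show "gaussian_rv M (\<lambda>x. \<Sum>i\<in>J. a i * X i x)" using g J unfolding jointly_gaussian_def by blast
      show "(\<integral>x. (\<Sum>i\<in>J. a i * X i x) \<partial>M) = 0" using int1 mean by (simp add: Bochner_Integration.integral_sum)
      have "(\<integral>x. (\<Sum>i\<in>J. a i * X i x)\<^sup>2 \<partial>M) = (\<integral>x. (\<Sum>i\<in>J. \<Sum>j\<in>J. (a i * a j) * (X i x * X j x)) \<partial>M)"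
        by (intro Bochner_Integration.integral_cong refl) (simp add: power2_eq_square sum_product mult_ac)
      also have "\<dots> = (\<Sum>i\<in>J. \<Sum>j\<in>J. (a i * a j) * (\<integral>x. X i x * X j x \<partial>M))"
        using int2 by (simp add: Bochner_Integration.integral_sum)
      also have "\<dots> = (\<Sum>i\<in>J. \<Sum>j\<in>J. if i = j then (a i * a j) * u\<^sup>2 else 0)"
        by (intro sum.cong refl) (simp add: cov)
      also have "\<dots> = (\<Sum>i\<in>J. (a i)\<^sup>2 * u\<^sup>2)" using J by (simp add: power2_eq_square)
      finally show "(\<integral>x. (\<Sum>i\<in>J. a i * X i x)\<^sup>2 \<partial>M) = (\<Sum>i\<in>J. (a i)\<^sup>2 * u\<^sup>2)" .
    qed
    moreover have "(\<integral>x. exp (\<i> * of_real (\<Sum>i\<in>J. a i * x i)) \<partial>PiM J (\<lambda>_. centered_normal u)) =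
       exp (- of_real ((\<Sum>i\<in>J. (a i)\<^sup>2 * u\<^sup>2) / 2))"
    proof -
      have "(\<integral>x. exp (\<i> * of_real (\<Sum>i\<in>J. a i * x i)) \<partial>PiM J (\<lambda>_. centered_normal u)) =
        (\<integral>x. (\<Prod>i\<in>J. exp (\<i> * of_real (a i * x i))) \<partial>PiM J (\<lambda>_. centered_normal u))"
        by (simp add: exp_sum[OF J(1), symmetric] sum_distrib_left)
      also have "\<dots> = (\<Prod>i\<in>J. \<integral>y. exp (\<i> * of_real (a i * y)) \<partial>centered_normal u)"
      proof (rule N.product_integral_prod[OF J(1)])
        fix i
        show "integrable (centered_normal u) (\<lambda>y. exp (\<i> * of_real (a i * y)))"
          by (intro finite_measure.integrable_const_bound[where B=1] prob_space.finite_measure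
              prob_space_normal_density u) (auto simp: norm_exp_eq_Re)
      qed
      also have "\<dots> = exp (\<Sum>i\<in>J. - of_real ((a i)\<^sup>2 * u\<^sup>2 / 2))"
        unfolding integral_exp_centered_normal[OF u] by (simp add: exp_sum[OF J(1)])
      finally show ?thesis by (simp add: sum_negf sum_divide_distrib)
    qed
    ultimately show "(\<integral>x. exp (\<i> * of_real (\<Sum>i\<in>J. a i * X i x)) \<partial>M) =
      (\<integral>x. exp (\<i> * of_real (\<Sum>i\<in>J. a i * x i)) \<partial>PiM J (\<lambda>_. centered_normal u))" by simp
  qed
  then show ?thesis unfolding distr_PiM_centered_normal_restrict[OF J(1)] .
qed

text \<open>The law of the block is a product measure, so Fubini isolates the coordinate
  \<open>e\<close> and leaves the one-dimensional identity. The assumption \<open>dep\<close> says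
  that \<open>F\<close> and \<open>F'\<close> see only the coordinates in \<open>J\<close>, although
  they are written as functions of the full configuration.\<close>

proposition gaussian_integration_by_parts:
  fixes Z :: "'i::countable \<Rightarrow> 'a \<Rightarrow> real" and F F' :: "('i \<Rightarrow> real) \<Rightarrow> complex"
  assumes M: "prob_space M" and u: "u > 0" and J: "finite J" "e \<in> J"
    and Z: "\<And>i. i \<in> J \<Longrightarrow> Z i \<in> borel_measurable M"
    and law: "distr M (PiM J (\<lambda>_. borel)) (\<lambda>x. \<lambda>i\<in>J. Z i x) = PiM J (\<lambda>_. centered_normal u)"
    and cont: "continuous_on UNIV F" "continuous_on UNIV F'"
    and dep: "\<And>x. F (restrict x J) = F x" "\<And>x. F' (restrict x J) = F' x"
    and B: "\<And>x. norm (F x) \<le> B" "\<And>x. norm (F' x) \<le> B"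
    and deriv: "\<And>x y. ((\<lambda>y. F (x(e := y))) has_vector_derivative F' (x(e := y))) (at y)"
  shows "integrable M (\<lambda>\<omega>. of_real (Z e \<omega>) * F (\<lambda>i. Z i \<omega>))"
    and "(\<integral>\<omega>. of_real (Z e \<omega>) * F (\<lambda>i. Z i \<omega>) \<partial>M) = of_real (u\<^sup>2) * (\<integral>\<omega>. F' (\<lambda>i. Z i \<omega>) \<partial>M)"
proof -
  interpret prob_space M by fact
  let ?Q = "PiM J (\<lambda>_. centered_normal u)"
  interpret N: product_prob_space "\<lambda>_. centered_normal u" J
    by (intro product_prob_spaceI prob_space_normal_density u)
  define I where "I = J - {e}"
  have JI: "J = insert e I" "finite I" "e \<notin> I" using J unfolding I_def by auto
  have coord: "(\<lambda>x. x) \<in> measurable (PiM J (\<lambda>_. borel)) (borel :: ('i \<Rightarrow> real) measure)"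
  proof (rule measurable_coordinatewise_then_product)
    fix i :: 'i
    show "(\<lambda>x. x i) \<in> borel_measurable (PiM J (\<lambda>_. borel :: real measure))"
    proof (cases "i \<in> J")
      case False
      have "x i = undefined" if "x \<in> space (PiM J (\<lambda>_. borel :: real measure))" for x
        using that False by (auto simp: space_PiM PiE_def extensional_def)
      then show ?thesis by (subst measurable_cong[where g="\<lambda>_. undefined"]) auto
    qed simp
  qed
  have mF: "h \<in> borel_measurable (PiM J (\<lambda>_. borel))" if "continuous_on UNIV h" for h :: "('i \<Rightarrow> real) \<Rightarrow> complex"
    using measurable_compose[OF coord borel_measurable_continuous_onI[OF that]] .
  have sQ: "sets ?Q = sets (PiM J (\<lambda>_. borel))" by (intro sets_PiM_cong) auto
  have mQ: "h \<in> borel_measurable ?Q" if "continuous_on UNIV h" for h :: "('i \<Rightarrow> real) \<Rightarrow> complex"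
    using mF[OF that] sQ by (simp cong: measurable_cong_sets)
  have rm: "(\<lambda>x. \<lambda>i\<in>J. Z i x) \<in> measurable M (PiM J (\<lambda>_. borel))" using Z by (intro measurable_restrict)
  have me: "(\<lambda>x. x e) \<in> borel_measurable (PiM J (\<lambda>_. borel :: real measure))"
    using J(2) by simp
  have comp: "distr ?Q (centered_normal u) (\<lambda>x. x e) = centered_normal u" by (rule N.PiM_component[OF J(2)])
  have B0: "0 \<le> B" using order_trans[OF norm_ge_zero B(1)] .
  have "integrable (centered_normal u) (\<lambda>y. y)"
    using integrable_normal_moment_nz_1[OF u, of 0] by (subst integrable_density) (auto simp: mult.commute)
  then have ie: "integrable ?Q (\<lambda>x. x e)"
    using integrable_distr_eq[OF measurable_component_singleton[OF J(2), of "\<lambda>_. centered_normal u"], of "\<lambda>y. y"]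
    unfolding comp by simp
  have iF: "integrable ?Q (\<lambda>x. of_real (x e) * F x)"
  proof (rule Bochner_Integration.integrable_bound)
    show "integrable ?Q (\<lambda>x. B * \<bar>x e\<bar>)" using ie by (intro integrable_mult_right integrable_abs)
    show "(\<lambda>x. complex_of_real (x e) * F x) \<in> borel_measurable ?Q"
      using mQ[OF cont(1)] ie by measurable
    show "AE x in ?Q. norm (complex_of_real (x e) * F x) \<le> norm (B * \<bar>x e\<bar>)"
      using B(1) B0 by (intro AE_I2) (auto simp: norm_mult abs_mult mult.commute[of B] intro!: mult_left_mono)
  qed
  have iF': "integrable ?Q F'"
    using mQ[OF cont(2)] B(2) by (intro N.integrable_const_bound[where B=B]) auto
  have "integrable M (\<lambda>\<omega>. of_real ((\<lambda>i\<in>J. Z i \<omega>) e) * F (\<lambda>i\<in>J. Z i \<omega>))"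
    using iF unfolding law[symmetric] by (subst (asm) integrable_distr_eq[OF rm]) (use me mF[OF cont(1)] J(2) in auto)
  then show "integrable M (\<lambda>\<omega>. of_real (Z e \<omega>) * F (\<lambda>i. Z i \<omega>))" using J(2) dep(1) by simp
  have "(\<integral>\<omega>. of_real (Z e \<omega>) * F (\<lambda>i. Z i \<omega>) \<partial>M) =
      (\<integral>\<omega>. of_real ((\<lambda>i\<in>J. Z i \<omega>) e) * F (\<lambda>i\<in>J. Z i \<omega>) \<partial>M)"
    using J(2) dep(1) by simp
  also have "\<dots> = (\<integral>x. of_real (x e) * F x \<partial>?Q)"
    unfolding law[symmetric]
    by (subst integral_distr[OF rm]) (use me mF[OF cont(1)] J(2) in auto)
  also have "\<dots> = (\<integral>x. (\<integral>y. of_real y * F (x(e := y)) \<partial>centered_normal u) \<partial>PiM I (\<lambda>_. centered_normal u))"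
    using N.product_integral_insert[OF JI(2,3) iF[unfolded JI(1)]] JI(1) by simp
  also have "\<dots> = (\<integral>x. of_real (u\<^sup>2) * (\<integral>y. F' (x(e := y)) \<partial>centered_normal u) \<partial>PiM I (\<lambda>_. centered_normal u))"
  proof (intro Bochner_Integration.integral_cong refl centered_normal_integration_by_parts[OF u deriv _ B])
    fix x :: "'i \<Rightarrow> real" and y :: real
    have "continuous_on UNIV (\<lambda>y. x(e := y))"
    proof (rule continuous_on_coordinatewise_then_product)
      fix i show "continuous_on UNIV (\<lambda>y. (x(e := y)) i)" by (cases "i = e") auto
    qed
    then have "continuous_on UNIV (\<lambda>y. F' (x(e := y)))"
      using continuous_on_compose2[OF cont(2)] by blast
    then show "isCont (\<lambda>y. F' (x(e := y))) y" by (simp add: continuous_on_eq_continuous_at)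
  qed
  also have "\<dots> = of_real (u\<^sup>2) * (\<integral>x. F' x \<partial>?Q)"
    using N.product_integral_insert[OF JI(2,3) iF'[unfolded JI(1)]] JI(1) by simp
  also have "(\<integral>x. F' x \<partial>?Q) = (\<integral>\<omega>. F' (\<lambda>i\<in>J. Z i \<omega>) \<partial>M)"
    unfolding law[symmetric] using mF[OF cont(2)] by (subst integral_distr[OF rm]) auto
  finally show "(\<integral>\<omega>. of_real (Z e \<omega>) * F (\<lambda>i. Z i \<omega>) \<partial>M) = of_real (u\<^sup>2) * (\<integral>\<omega>. F' (\<lambda>i. Z i \<omega>) \<partial>M)"
    by (simp add: dep(2))
qed

text \<open>The law is that of independent standard normals transformed by the Gram factor
  \<open>v\<close>. Its characteristic function is recorded too, since the limit will be identified
  through it.\<close>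

lemma centered_gaussian_distribution_exists:
  fixes K :: "'k::finite \<Rightarrow> 'k \<Rightarrow> real"
  assumes sym: "\<And>i j. K i j = K j i" and psd: "\<And>a. (\<Sum>i\<in>UNIV. \<Sum>j\<in>UNIV. a i * a j * K i j) \<ge> 0"
  shows "\<exists>\<nu>. centered_gaussian_distribution \<nu> K \<and>
    (\<forall>a. (\<integral>x. exp (\<i> * of_real (\<Sum>i\<in>UNIV. a i * x $ i)) \<partial>\<nu>) =
       exp (- of_real ((\<Sum>i\<in>UNIV. \<Sum>j\<in>UNIV. a i * a j * K i j) / 2)))"
proof -
  from psd_gram_factorization[OF finite sym psd]
  obtain v :: "'k \<Rightarrow> 'k \<Rightarrow> real" where v: "\<And>i j. K i j = (\<Sum>k\<in>UNIV. v i k * v j k)" by auto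
  let ?N = "centered_normal 1"
  define P where "P = PiM (UNIV :: 'k set) (\<lambda>_. ?N)"
  interpret P: product_prob_space "\<lambda>_. ?N" "UNIV :: 'k set"
    by (intro product_prob_spaceI prob_space_normal_density) simp
  have probP: "prob_space P" unfolding P_def by (rule P.prob_space_axioms)
  interpret Q: prob_space P by (rule probP)
  have c_meas: "(\<lambda>x. x k) \<in> measurable P ?N" for k :: 'k unfolding P_def by (rule measurable_component_singleton) simp
  then have [measurable]: "(\<lambda>x. x k) \<in> borel_measurable P" for k :: 'k by simp
  have comp: "distr P ?N (\<lambda>x. x k) = ?N" for k :: 'k unfolding P_def by (rule P.PiM_component) simp
  have comp_lborel: "distr P lborel (\<lambda>x. x k) = ?N" for k :: 'k
    using comp[of k] by (simp cong: distr_cong)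
  have dist: "distributed P lborel (\<lambda>x. x k) (\<lambda>x. ennreal (normal_density 0 1 x))" for k :: 'k
    unfolding distributed_def using comp_lborel[of k] by simp
  have m1: "(\<integral>y. y \<partial>?N) = 0" "integrable ?N (\<lambda>y. y)"
    using integral_normal_moment_nz_1[of 1 0] integrable_normal_moment_nz_1[of 1 0]
    by (simp_all add: integral_density integrable_density mult.commute)
  have m2: "(\<integral>y. y * y \<partial>?N) = 1" "integrable ?N (\<lambda>y. y * y)"
    using integral_normal_moment_even[of 1 0 1] integrable_normal_moment[of 1 0 2]
    by (simp_all add: integral_density integrable_density power2_eq_square)
  have N1: "measure ?N UNIV = 1" using prob_space.prob_space[OF prob_space_normal_density[of 1 0]] by simp
  have prod: "(\<integral>x. x k * x l \<partial>P) = (if k = l then 1 else 0) \<and> integrable P (\<lambda>x. x k * x l)" for k l :: 'k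
  proof -
    \<comment> \<open>Written as a product over all coordinates, so that one formula covers k = l,
      where a single factor is a square, and k \<noteq> l, where two factors are linear.\<close>
    define f where "f i y = (if i = k then y else 1) * (if i = l then y else 1 :: real)" for i y
    have intf: "integrable ?N (f i)" for i
      unfolding f_def using m1 m2 by (cases "i = k"; cases "i = l") (simp_all add: P.M.integrable_const)
    have fprod: "(\<Prod>i\<in>UNIV. f i (x i)) = x k * x l" for x unfolding f_def by (simp add: prod.distrib)
    have "(\<integral>x. (\<Prod>i\<in>UNIV. f i (x i)) \<partial>P) = (\<Prod>i\<in>UNIV. integral\<^sup>L ?N (f i))"
      unfolding P_def by (rule P.product_integral_prod) (auto intro: intf)
    moreover have "integrable P (\<lambda>x. \<Prod>i\<in>UNIV. f i (x i))"
      unfolding P_def by (rule P.product_integrable_prod) (auto intro: intf)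
    moreover have "(\<Prod>i\<in>UNIV. integral\<^sup>L ?N (f i)) = (if k = l then 1 else 0)"
    proof (cases "k = l")
      case True
      then have "integral\<^sup>L ?N (f i) = 1" for i
        unfolding f_def using m2 by (cases "i = l") (simp_all add: N1)
      then show ?thesis using True by simp
    next
      case False
      then have "integral\<^sup>L ?N (f k) = 0" unfolding f_def using m1 by simp
      then have "(\<Prod>i\<in>UNIV. integral\<^sup>L ?N (f i)) = 0" by (intro prod_zero) auto
      then show ?thesis using False by simp
    qed
    ultimately show ?thesis unfolding fprod by simp
  qed
  have mean: "(\<integral>x. x k \<partial>P) = 0 \<and> integrable P (\<lambda>x. x k)" for k :: 'k
  proof -
    have "(\<integral>y. y \<partial>distr P ?N (\<lambda>x. x k)) = (\<integral>x. x k \<partial>P)" by (rule integral_distr[OF c_meas]) simp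
    moreover have "integrable (distr P ?N (\<lambda>x. x k)) (\<lambda>y. y) \<longleftrightarrow> integrable P (\<lambda>x. x k)"
      by (rule integrable_distr_eq[OF c_meas]) simp
    ultimately show ?thesis unfolding comp using m1 by simp
  qed
  define g where "g z = (\<chi> i. \<Sum>k\<in>UNIV. v i k * z k)" for z :: "'k \<Rightarrow> real"
  have gm [measurable]: "g \<in> measurable P borel"
  proof (rule borel_measurable_euclidean_space[THEN iffD2], intro ballI)
    fix b :: "real ^ 'k" assume "b \<in> Basis"
    then obtain i where "b = axis i 1" unfolding Basis_vec_def by auto
    then show "(\<lambda>z. g z \<bullet> b) \<in> borel_measurable P" unfolding g_def by (simp add: inner_axis)
  qed
  define \<nu> where "\<nu> = distr P borel g"
  have probv: "prob_space \<nu>" unfolding \<nu>_def by (rule Q.prob_space_distr[OF gm])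
  \<comment> \<open>Independence holds because \<open>P\<close> is the product of its own
    marginals.\<close>
  have indep: "Q.indep_vars (\<lambda>_. borel) (\<lambda>k x. x k) (UNIV :: 'k set)"
  proof (subst Q.indep_vars_iff_distr_eq_PiM')
    have "distr P (PiM UNIV (\<lambda>i. borel)) (\<lambda>x. restrict x UNIV) = distr P P (\<lambda>x. x)"
      by (intro distr_cong) (auto simp: P_def intro!: sets_PiM_cong)
    then have "distr P (PiM UNIV (\<lambda>i. borel)) (\<lambda>x. restrict x UNIV) = P" by (simp add: distr_id2)
    moreover have "distr P borel (\<lambda>x. x i) = distr P lborel (\<lambda>x. x i)" for i
      by (intro distr_cong) auto
    then have "(PiM UNIV (\<lambda>i. distr P borel (\<lambda>x. x i))) = P"
      unfolding comp_lborel by (simp only:) (simp add: P_def)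
    ultimately show "distr P (PiM UNIV (\<lambda>i. borel)) (\<lambda>x. \<lambda>i\<in>UNIV. x i) = PiM UNIV (\<lambda>i. distr P borel (\<lambda>x. x i))" by simp
  qed auto
  have gauss: "gaussian_rv P (\<lambda>z. \<Sum>k\<in>UNIV. b k * z k)" for b :: "'k \<Rightarrow> real"
  proof -
    \<comment> \<open>The sum rule for independent normals asks for positive variances, so vanishing
      coefficients are removed; if none is left, the sum is the constant 0 and counts as
      degenerate.\<close>
    define S where "S = {k. b k \<noteq> 0}"
    have eq: "(\<Sum>k\<in>UNIV. b k * z k) = (\<Sum>k\<in>S. b k * z k)" for z :: "'k \<Rightarrow> real"
      unfolding S_def by (intro sum.mono_neutral_right) auto
    show ?thesis
    proof (cases "S = {}")
      case True
      then show ?thesis unfolding gaussian_rv_def eq by auto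
    next
      case False
      have "distributed P lborel (\<lambda>z. \<Sum>k\<in>S. b k * z k) (normal_density (\<Sum>k\<in>S. 0) (sqrt (\<Sum>k\<in>S. \<bar>b k\<bar>\<^sup>2)))"
      proof (rule Q.sum_indep_normal)
        show "Q.indep_vars (\<lambda>i. borel) (\<lambda>k z. b k * z k) S"
          using Q.indep_vars_compose2[OF Q.indep_vars_subset[OF indep subset_UNIV], of S "\<lambda>k y. b k * y" "\<lambda>_. borel"] by simp
        fix k assume "k \<in> S"
        then show "distributed P lborel (\<lambda>z. b k * z k) (\<lambda>x. ennreal (normal_density 0 \<bar>b k\<bar> x))"
          using Q.normal_density_affine[OF dist[of k], of "b k" 0] unfolding S_def by simp
      qed (use False in \<open>auto simp: S_def\<close>)
      moreover have "sqrt (\<Sum>k\<in>S. \<bar>b k\<bar>\<^sup>2) > 0"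
        using False by (auto simp: S_def intro!: sum_pos)
      ultimately show ?thesis unfolding gaussian_rv_def eq by auto
    qed
  qed
  have lin: "(\<Sum>i\<in>J. a i * g z $ i) = (\<Sum>k\<in>UNIV. (\<Sum>i\<in>J. a i * v i k) * z k)" for J a z
    unfolding g_def by (simp add: sum_distrib_left sum_distrib_right mult_ac, subst sum.swap) (simp add: mult_ac)
  have gv: "gaussian_rv \<nu> (\<lambda>x. \<Sum>i\<in>J. a i * x $ i)" for J and a :: "'k \<Rightarrow> real"
  proof -
    have m': "(\<lambda>x. \<Sum>i\<in>J. a i * x $ i) \<in> borel_measurable borel"
      by (intro borel_measurable_continuous_onI continuous_intros)
    then have m: "(\<lambda>x. \<Sum>i\<in>J. a i * x $ i) \<in> borel_measurable \<nu>" unfolding \<nu>_def by simp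
    from gauss[of "\<lambda>k. \<Sum>i\<in>J. a i * v i k", folded lin] consider
      c where "AE z in P. (\<Sum>i\<in>J. a i * g z $ i) = c"
      | c \<sigma> where "\<sigma> > 0" "distributed P lborel (\<lambda>z. \<Sum>i\<in>J. a i * g z $ i) (\<lambda>x. ennreal (normal_density c \<sigma> x))"
      unfolding gaussian_rv_def by blast
    then show ?thesis
    proof cases
      case 1
      then have "AE x in \<nu>. (\<Sum>i\<in>J. a i * x $ i) = c"
        unfolding \<nu>_def using m' by (subst AE_distr_iff[OF gm]) auto
      then show ?thesis unfolding gaussian_rv_def using m by blast
    next
      case 2
      have "distr \<nu> lborel (\<lambda>x. \<Sum>i\<in>J. a i * x $ i) = distr P lborel (\<lambda>z. \<Sum>i\<in>J. a i * g z $ i)"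
        unfolding \<nu>_def using m' by (subst distr_distr[OF _ gm]) (auto simp: comp_def)
      then have "distributed \<nu> lborel (\<lambda>x. \<Sum>i\<in>J. a i * x $ i) (\<lambda>x. ennreal (normal_density c \<sigma> x))"
        using 2(2) m unfolding distributed_def by simp
      then show ?thesis unfolding gaussian_rv_def using m 2(1) by blast
    qed
  qed
  have int1: "integrable P (\<lambda>z. g z $ i)" for i
    unfolding g_def using mean by simp
  have mean0: "(\<integral>x. x $ i \<partial>\<nu>) = 0" for i
    unfolding \<nu>_def by (subst integral_distr[OF gm]) (use mean in \<open>auto simp: g_def Bochner_Integration.integral_sum\<close>)
  have g2: "g z $ i * g z $ j = (\<Sum>k\<in>UNIV. \<Sum>l\<in>UNIV. (v i k * v j l) * (z k * z l))" for z i j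
    unfolding g_def by (simp add: sum_product mult_ac)
  have int2: "integrable P (\<lambda>z. g z $ i * g z $ j)" for i j
    unfolding g2 using prod by simp
  have covP: "(\<integral>z. g z $ i * g z $ j \<partial>P) = K i j" for i j
  proof -
    have "(\<integral>z. g z $ i * g z $ j \<partial>P) = (\<Sum>k\<in>UNIV. \<Sum>l\<in>UNIV. (v i k * v j l) * (if k = l then 1 else 0))"
      unfolding g2 using prod by (simp add: Bochner_Integration.integral_sum)
    also have "\<dots> = (\<Sum>k\<in>UNIV. v i k * v j k)" by (simp add: if_distrib[of "\<lambda>y. _ * y"] cong: if_cong)
    finally show ?thesis using v by simp
  qed
  have cov: "(\<integral>x. x $ i * x $ j \<partial>\<nu>) = K i j" for i j
    unfolding \<nu>_def by (subst integral_distr[OF gm]) (auto simp: covP)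
  have "centered_gaussian_distribution \<nu> K"
    unfolding centered_gaussian_distribution_def jointly_gaussian_def
    using probv gv mean0 cov by (auto simp: \<nu>_def)
  moreover have "(\<integral>x. exp (\<i> * of_real (\<Sum>i\<in>UNIV. a i * x $ i)) \<partial>\<nu>) =
       exp (- of_real ((\<Sum>i\<in>UNIV. \<Sum>j\<in>UNIV. a i * a j * K i j) / 2))" for a
  proof (rule gaussian_rv_char[OF probv gv])
    show "(\<integral>x. (\<Sum>i\<in>UNIV. a i * x $ i) \<partial>\<nu>) = 0"
      unfolding \<nu>_def using int1 mean0[unfolded \<nu>_def]
      by (subst Bochner_Integration.integral_sum) (auto simp: integrable_distr_eq[OF gm])
    have "(\<integral>x. (\<Sum>i\<in>UNIV. a i * x $ i)\<^sup>2 \<partial>\<nu>) = (\<integral>x. (\<Sum>i\<in>UNIV. \<Sum>j\<in>UNIV. (a i * a j) * (x $ i * x $ j)) \<partial>\<nu>)"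
      by (intro Bochner_Integration.integral_cong refl) (simp add: power2_eq_square sum_product mult_ac)
    also have "\<dots> = (\<Sum>i\<in>UNIV. \<Sum>j\<in>UNIV. a i * a j * K i j)"
    proof -
      have "integrable \<nu> (\<lambda>x. x $ i * x $ j)" for i j
        unfolding \<nu>_def using int2 by (subst integrable_distr_eq[OF gm]) auto
      then show ?thesis by (simp add: Bochner_Integration.integral_sum cov)
    qed
    finally show "(\<integral>x. (\<Sum>i\<in>UNIV. a i * x $ i)\<^sup>2 \<partial>\<nu>) = (\<Sum>i\<in>UNIV. \<Sum>j\<in>UNIV. a i * a j * K i j)" .
  qed
  ultimately show ?thesis by blast
qed

section \<open>Resolvents of sample covariance matrices\<close>

lemma mult_mat_entry:
  assumes "A \<in> carrier_mat n n" "B \<in> carrier_mat n n" "i < n" "j < n"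
  shows "(A * B) $$ (i, j) = (\<Sum>k<n. A $$ (i, k) * B $$ (k, j))"
  using assms by (auto simp: scalar_prod_def atLeast0LessThan)

text \<open>The quotient is formed in the complex field, which is the shape in which the resolvent
  identity delivers it.\<close>

lemma has_vector_derivative_complex_quotient:
  fixes f :: "real \<Rightarrow> complex"
  shows "(f has_vector_derivative D) (at x) \<longleftrightarrow> ((\<lambda>h. (f (x + h) - f x) / of_real h) \<longlongrightarrow> D) (at 0)"
proof -
  have "(f has_vector_derivative D) (at x) \<longleftrightarrow> ((\<lambda>h. norm (f (x + h) - f x - h *\<^sub>R D) / norm h) \<longlongrightarrow> 0) (at 0)"
    unfolding has_vector_derivative_def has_derivative_at by (simp add: bounded_linear_scaleR_left)
  also have "\<dots> \<longleftrightarrow> ((\<lambda>h. norm ((f (x + h) - f x) / of_real h - D)) \<longlongrightarrow> 0) (at 0)"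
  proof (rule tendsto_cong)
    have "norm (f (x + h) - f x - h *\<^sub>R D) / norm h = norm ((f (x + h) - f x) / of_real h - D)" if "h \<noteq> 0" for h
    proof -
      have "(f (x + h) - f x) / of_real h - D = (f (x + h) - f x - h *\<^sub>R D) / of_real h"
        using that by (simp add: field_simps scaleR_conv_of_real)
      then show ?thesis by (simp add: norm_divide)
    qed
    then show "\<forall>\<^sub>F h in at 0. norm (f (x + h) - f x - h *\<^sub>R D) / norm h = norm ((f (x + h) - f x) / of_real h - D)"
      by (auto simp: eventually_at_filter)
  qed
  also have "\<dots> \<longleftrightarrow> ((\<lambda>h. (f (x + h) - f x) / of_real h) \<longlongrightarrow> D) (at 0)"
    by (simp add: tendsto_norm_zero_iff LIM_zero_iff)
  finally show ?thesis .
qed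

lemma sum_rotate:
  fixes f :: "'i \<Rightarrow> 'j \<Rightarrow> 'k \<Rightarrow> 'a::comm_monoid_add"
  shows "(\<Sum>i\<in>A. \<Sum>j\<in>B. \<Sum>k\<in>C. f i j k) = (\<Sum>j\<in>B. \<Sum>k\<in>C. \<Sum>i\<in>A. f i j k)"
proof -
  have "(\<Sum>i\<in>A. \<Sum>j\<in>B. \<Sum>k\<in>C. f i j k) = (\<Sum>j\<in>B. \<Sum>i\<in>A. \<Sum>k\<in>C. f i j k)" by (rule sum.swap)
  also have "\<dots> = (\<Sum>j\<in>B. \<Sum>k\<in>C. \<Sum>i\<in>A. f i j k)" by (intro sum.cong refl) (rule sum.swap)
  finally show ?thesis .
qed

text \<open>Sample configurations are functions on pairs \<open>(\<mu>, a)\<close>, both indices counted from 0.\<close>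

locale wishart =
  fixes m N :: nat
  assumes N_pos: "0 < N"
begin

definition H :: "(nat \<times> nat \<Rightarrow> real) \<Rightarrow> nat \<Rightarrow> nat \<Rightarrow> real" where
  "H X a b = (1 / real N) * (\<Sum>\<mu><m. X (\<mu>, a) * X (\<mu>, b))"

definition Hm :: "(nat \<times> nat \<Rightarrow> real) \<Rightarrow> complex mat" where
  "Hm X = mat N N (\<lambda>(a, b). complex_of_real (H X a b))"

definition green :: "(nat \<times> nat \<Rightarrow> real) \<Rightarrow> complex \<Rightarrow> nat \<Rightarrow> nat \<Rightarrow> complex" where
  "green X z a b = resolvent (Hm X) z $$ (a, b)"

lemma Hm_carrier [simp]: "Hm X \<in> carrier_mat N N" by (simp add: Hm_def)

lemma Hm_entry [simp]: "a < N \<Longrightarrow> b < N \<Longrightarrow> Hm X $$ (a, b) = complex_of_real (H X a b)"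
  by (simp add: Hm_def)

lemma H_sym: "H X a b = H X b a" by (simp add: H_def mult.commute)

text \<open>\<open>H\<close> is a Gram matrix, so its quadratic form is a sum of squares;
  nonnegativity of the spectrum comes from here.\<close>

lemma quadratic_form:
  "(\<Sum>a<N. \<Sum>b<N. cnj (v a) * of_real (H X a b) * v b) =
    of_real ((1 / real N) * (\<Sum>\<mu><m. (cmod (\<Sum>a<N. of_real (X (\<mu>, a)) * v a))\<^sup>2))"
proof -
  have "of_real ((cmod (\<Sum>a<N. of_real (X (\<mu>, a)) * v a))\<^sup>2) =
    (\<Sum>a<N. \<Sum>b<N. cnj (v a) * of_real (X (\<mu>, a) * X (\<mu>, b)) * v b)" for \<mu>
  proof -
    have "of_real ((cmod (\<Sum>a<N. of_real (X (\<mu>, a)) * v a))\<^sup>2) =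
      cnj (\<Sum>a<N. of_real (X (\<mu>, a)) * v a) * (\<Sum>a<N. of_real (X (\<mu>, a)) * v a)"
      by (subst complex_norm_square) (rule mult.commute)
    also have "\<dots> = (\<Sum>a<N. \<Sum>b<N. cnj (of_real (X (\<mu>, a)) * v a) * (of_real (X (\<mu>, b)) * v b))"
      by (simp only: cnj_sum sum_product)
    finally show ?thesis by (simp add: mult_ac)
  qed
  then have "of_real ((1 / real N) * (\<Sum>\<mu><m. (cmod (\<Sum>a<N. of_real (X (\<mu>, a)) * v a))\<^sup>2)) =
    (1 / of_nat N) * (\<Sum>\<mu><m. \<Sum>a<N. \<Sum>b<N. cnj (v a) * of_real (X (\<mu>, a) * X (\<mu>, b)) * v b)"
    by simp
  also have "(\<Sum>\<mu><m. \<Sum>a<N. \<Sum>b<N. cnj (v a) * of_real (X (\<mu>, a) * X (\<mu>, b)) * v b) =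
     (\<Sum>a<N. \<Sum>b<N. \<Sum>\<mu><m. cnj (v a) * of_real (X (\<mu>, a) * X (\<mu>, b)) * v b)"
    by (rule sum_rotate)
  finally show ?thesis
    by (simp add: H_def sum_distrib_left sum_distrib_right mult_ac)
qed

text \<open>A null vector of H - z would make \<open>z\<close> the quotient of two nonnegative
  numbers. Only the nonnegative half-line is excluded, not the whole real line: applied with
  \<open>z\<close> an eigenvalue, this later shows that the eigenvalues are nonnegative
  reals.\<close>

lemma resolvent_inverse:
  assumes z: "z \<notin> \<real>\<^sub>\<ge>\<^sub>0"
  shows "resolvent (Hm X) z \<in> carrier_mat N N"
    "(Hm X - z \<cdot>\<^sub>m 1\<^sub>m N) * resolvent (Hm X) z = 1\<^sub>m N"
    "resolvent (Hm X) z * (Hm X - z \<cdot>\<^sub>m 1\<^sub>m N) = 1\<^sub>m N"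
proof -
  let ?A = "Hm X - z \<cdot>\<^sub>m 1\<^sub>m N"
  have A: "?A \<in> carrier_mat N N" by (rule minus_carrier_mat) simp
  have "det ?A \<noteq> 0"
  proof
    assume "det ?A = 0"
    then obtain v where v: "v \<in> carrier_vec N" "v \<noteq> 0\<^sub>v N" "?A *\<^sub>v v = 0\<^sub>v N"
      using det_0_iff_vec_prod_zero_field[OF A] by blast
    define w where "w = vec_index v"
    have eq: "(\<Sum>b<N. of_real (H X a b) * w b) = z * w a" if a: "a < N" for a
    proof -
      have "vec_index (?A *\<^sub>v v) a = (\<Sum>b<N. (of_real (H X a b) - z * (if a = b then 1 else 0)) * w b)"
        using v(1) a by (auto simp: scalar_prod_def atLeast0LessThan w_def Hm_def intro!: sum.cong)
      also have "\<dots> = (\<Sum>b<N. of_real (H X a b) * w b) - (\<Sum>b<N. if a = b then z * w b else 0)"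
        unfolding sum_subtractf[symmetric] by (intro sum.cong refl) (auto simp: algebra_simps)
      also have "\<dots> = (\<Sum>b<N. of_real (H X a b) * w b) - z * w a" using a by simp
      finally show ?thesis using v(3) a by simp
    qed
    define S where "S = (\<Sum>a<N. (cmod (w a))\<^sup>2)"
    define q where "q = (1 / real N) * (\<Sum>\<mu><m. (cmod (\<Sum>a<N. of_real (X (\<mu>, a)) * w a))\<^sup>2)"
    have "of_real q = (\<Sum>a<N. cnj (w a) * (\<Sum>b<N. of_real (H X a b) * w b))"
      unfolding q_def quadratic_form[symmetric] by (simp add: sum_distrib_left mult_ac)
    also have "\<dots> = (\<Sum>a<N. z * of_real ((cmod (w a))\<^sup>2))"
    proof (intro sum.cong refl)
      fix a assume "a \<in> {..<N}"
      then show "cnj (w a) * (\<Sum>b<N. of_real (H X a b) * w b) = z * of_real ((cmod (w a))\<^sup>2)"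
        using eq[of a] complex_norm_square[of "w a"] by (simp add: mult_ac)
    qed
    also have "\<dots> = z * of_real S" unfolding S_def by (simp add: sum_distrib_left)
    finally have qS: "of_real q = z * of_real S" .
    obtain a where a: "a < N" "w a \<noteq> 0"
      using v(1,2) unfolding w_def by (metis carrier_vecD eq_vecI index_zero_vec)
    have "S > 0"
    proof -
      have "(cmod (w a))\<^sup>2 \<le> S" unfolding S_def using a(1) by (intro member_le_sum) auto
      moreover have "0 < (cmod (w a))\<^sup>2" using a(2) by simp
      ultimately show ?thesis by linarith
    qed
    then have "z = of_real (q / S)" using qS by (simp add: field_simps)
    moreover have "q / S \<ge> 0" unfolding q_def using \<open>S > 0\<close> by (intro divide_nonneg_pos mult_nonneg_nonneg sum_nonneg) (use N_pos in auto)
    ultimately show False using z by (simp add: nonneg_Reals_of_real_iff del: of_real_divide)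
  qed
  from det_non_zero_imp_unit[OF A this, of "()"] have "mat_inverse ?A \<noteq> None"
    using mat_inverse(1)[OF A, where b="()"] by blast
  then obtain B where "mat_inverse ?A = Some B" by blast
  moreover from mat_inverse(2)[OF A this] have "?A * B = 1\<^sub>m N" "B * ?A = 1\<^sub>m N" "B \<in> carrier_mat N N" by auto
  moreover have "dim_row (Hm X) = N" by (simp add: Hm_def)
  ultimately show "resolvent (Hm X) z \<in> carrier_mat N N"
    "(Hm X - z \<cdot>\<^sub>m 1\<^sub>m N) * resolvent (Hm X) z = 1\<^sub>m N"
    "resolvent (Hm X) z * (Hm X - z \<cdot>\<^sub>m 1\<^sub>m N) = 1\<^sub>m N"
    unfolding resolvent_def by auto
qed

lemma non_real_not_nonneg: "Im z \<noteq> 0 \<Longrightarrow> z \<notin> \<real>\<^sub>\<ge>\<^sub>0"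
  by (auto elim: nonneg_Reals_cases)

lemma H_green:
  assumes z: "Im z \<noteq> 0" and ab: "a < N" "b < N"
  shows "(\<Sum>c<N. of_real (H X a c) * green X z c b) = (if a = b then 1 else 0) + z * green X z a b"
    "(\<Sum>c<N. green X z a c * of_real (H X c b)) = (if a = b then 1 else 0) + z * green X z a b"
proof -
  let ?R = "resolvent (Hm X) z" and ?A = "Hm X - z \<cdot>\<^sub>m 1\<^sub>m N"
  note R = resolvent_inverse[OF non_real_not_nonneg[OF z], of X]
  have A: "?A \<in> carrier_mat N N" by (rule minus_carrier_mat) simp
  have Aab: "?A $$ (a, b) = of_real (H X a b) - (if a = b then z else 0)" if "a < N" "b < N" for a b
    using that by (simp add: Hm_def)
  have "(\<Sum>c<N. ?A $$ (a, c) * ?R $$ (c, b)) = (if a = b then 1 else 0)"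
    using mult_mat_entry[OF A R(1) ab] R(2) ab by simp
  moreover have "(\<Sum>c<N. ?A $$ (a, c) * ?R $$ (c, b)) =
      (\<Sum>c<N. of_real (H X a c) * green X z c b) - (\<Sum>c<N. if a = c then z * green X z c b else 0)"
    unfolding sum_subtractf[symmetric] using ab
    by (intro sum.cong refl) (auto simp: Aab green_def algebra_simps)
  ultimately show "(\<Sum>c<N. of_real (H X a c) * green X z c b) = (if a = b then 1 else 0) + z * green X z a b"
    using ab by (simp add: algebra_simps)
  have "(\<Sum>c<N. ?R $$ (a, c) * ?A $$ (c, b)) = (if a = b then 1 else 0)"
    using mult_mat_entry[OF R(1) A ab] R(3) ab by simp
  moreover have "(\<Sum>c<N. ?R $$ (a, c) * ?A $$ (c, b)) =
      (\<Sum>c<N. green X z a c * of_real (H X c b)) - (\<Sum>c<N. if b = c then z * green X z a c else 0)"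
    unfolding sum_subtractf[symmetric] using ab
    by (intro sum.cong refl) (auto simp: Aab green_def algebra_simps)
  ultimately show "(\<Sum>c<N. green X z a c * of_real (H X c b)) = (if a = b then 1 else 0) + z * green X z a b"
    using ab by (simp add: algebra_simps)
qed

text \<open>The second resolvent identity, with \<open>R\<close> any solution of (H - w) R = 1 in
  column \<open>b\<close> for the matrix of \<open>Y\<close>. Taking for \<open>R\<close> a
  resolvent, its transpose or its conjugate gives in turn the difference formula, the symmetry and
  the behaviour under conjugation.\<close>

lemma resolvent_identity_of_right_inverse:
  assumes z: "Im z \<noteq> 0" and ab: "a < N" "b < N"
    and R: "\<And>c. c < N \<Longrightarrow> (\<Sum>d<N. of_real (H Y c d) * R d b) = (if c = b then 1 else 0) + w * R c b"
  shows "green X z a b - R a b =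
    (\<Sum>c<N. \<Sum>d<N. green X z a c * of_real (H Y c d - H X c d) * R d b) + (z - w) * (\<Sum>c<N. green X z a c * R c b)"
proof -
  have 1: "(\<Sum>c<N. \<Sum>d<N. green X z a c * of_real (H Y c d) * R d b) =
    green X z a b + w * (\<Sum>c<N. green X z a c * R c b)"
  proof -
    have "(\<Sum>c<N. \<Sum>d<N. green X z a c * of_real (H Y c d) * R d b) =
      (\<Sum>c<N. green X z a c * (\<Sum>d<N. of_real (H Y c d) * R d b))"
      by (simp add: sum_distrib_left mult_ac)
    also have "\<dots> = (\<Sum>c<N. (if c = b then green X z a c else 0) + w * (green X z a c * R c b))"
    proof (intro sum.cong refl)
      fix c assume "c \<in> {..<N}"
      then have "c < N" by simp
      show "green X z a c * (\<Sum>d<N. of_real (H Y c d) * R d b) = (if c = b then green X z a c else 0) + w * (green X z a c * R c b)"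
        unfolding R[OF \<open>c < N\<close>] by (simp add: algebra_simps)
    qed
    finally show ?thesis using ab by (simp add: sum.distrib sum_distrib_left)
  qed
  have 2: "(\<Sum>c<N. \<Sum>d<N. green X z a c * of_real (H X c d) * R d b) =
    R a b + z * (\<Sum>c<N. green X z a c * R c b)"
  proof -
    have "(\<Sum>c<N. \<Sum>d<N. green X z a c * of_real (H X c d) * R d b) =
      (\<Sum>d<N. (\<Sum>c<N. green X z a c * of_real (H X c d)) * R d b)"
      by (subst sum.swap) (simp add: sum_distrib_right)
    also have "\<dots> = (\<Sum>d<N. (if a = d then R d b else 0) + z * (green X z a d * R d b))"
    proof (rule sum.cong[OF refl])
      fix d assume "d \<in> {..<N}"
      then have "d < N" by simp
      show "(\<Sum>c<N. green X z a c * of_real (H X c d)) * R d b = (if a = d then R d b else 0) + z * (green X z a d * R d b)"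
        unfolding H_green(2)[OF z ab(1) \<open>d < N\<close>] by (simp add: algebra_simps)
    qed
    finally show ?thesis using ab by (simp add: sum.distrib sum_distrib_left)
  qed
  have "(\<Sum>c<N. \<Sum>d<N. green X z a c * of_real (H Y c d - H X c d) * R d b) =
    (\<Sum>c<N. \<Sum>d<N. green X z a c * of_real (H Y c d) * R d b) - (\<Sum>c<N. \<Sum>d<N. green X z a c * of_real (H X c d) * R d b)"
    by (simp add: sum_subtractf[symmetric] algebra_simps)
  then show ?thesis unfolding 1 2 by (simp add: algebra_simps)
qed

lemma green_diff:
  assumes "Im z \<noteq> 0" "Im w \<noteq> 0" "a < N" "b < N"
  shows "green X z a b - green Y w a b =
    (\<Sum>c<N. \<Sum>d<N. green X z a c * of_real (H Y c d - H X c d) * green Y w d b) + (z - w) * (\<Sum>c<N. green X z a c * green Y w c b)"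
  using assms by (intro resolvent_identity_of_right_inverse H_green) auto

lemma green_sym:
  assumes z: "Im z \<noteq> 0" and ab: "a < N" "b < N"
  shows "green X z a b = green X z b a"
proof -
  have "green X z a b - green X z b a =
    (\<Sum>c<N. \<Sum>d<N. green X z a c * of_real (H X c d - H X c d) * green X z b d) + (z - z) * (\<Sum>c<N. green X z a c * green X z b c)"
  proof (rule resolvent_identity_of_right_inverse[OF z ab])
    fix c assume "c < N"
    have "(\<Sum>d<N. of_real (H X c d) * green X z b d) = (\<Sum>d<N. green X z b d * of_real (H X d c))"
      by (simp add: H_sym[of X c] mult.commute)
    then show "(\<Sum>d<N. of_real (H X c d) * green X z b d) = (if c = b then 1 else 0) + z * green X z b c"
      using H_green(2)[OF z ab(2) \<open>c < N\<close>] by auto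
  qed
  then show ?thesis by simp
qed

lemma green_cnj:
  assumes z: "Im z \<noteq> 0" and ab: "a < N" "b < N"
  shows "green X (cnj z) a b = cnj (green X z a b)"
proof -
  have z': "Im (cnj z) \<noteq> 0" using z by simp
  have "green X (cnj z) a b - cnj (green X z a b) =
    (\<Sum>c<N. \<Sum>d<N. green X (cnj z) a c * of_real (H X c d - H X c d) * cnj (green X z d b)) +
    (cnj z - cnj z) * (\<Sum>c<N. green X (cnj z) a c * cnj (green X z c b))"
  proof (rule resolvent_identity_of_right_inverse[OF z' ab])
    fix c assume "c < N"
    from arg_cong[OF H_green(1)[OF z this ab(2), of X], of cnj]
    show "(\<Sum>d<N. of_real (H X c d) * cnj (green X z d b)) = (if c = b then 1 else 0) + cnj z * cnj (green X z c b)"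
      by (simp add: if_distrib cong: if_cong)
  qed
  then show ?thesis by simp
qed

text \<open>The resolvent identity for one matrix at \<open>z\<close> and \<open>cnj z\<close>: the
  matrix difference disappears and only z - cnj z remains. It exchanges a sum of products of entries
  for a single entry, at the price of one factor 1/Im z.\<close>

lemma ward_identity:
  assumes z: "Im z \<noteq> 0" and ab: "a < N" "b < N"
  shows "green X z a b - cnj (green X z a b) = 2 * \<i> * of_real (Im z) * (\<Sum>c<N. green X z a c * cnj (green X z c b))"
proof -
  have "green X z a b - green X (cnj z) a b = (z - cnj z) * (\<Sum>c<N. green X z a c * green X (cnj z) c b)"
    using green_diff[of z "cnj z" a b X X] z ab by simp
  moreover have "(\<Sum>c<N. green X z a c * green X (cnj z) c b) = (\<Sum>c<N. green X z a c * cnj (green X z c b))"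
    using ab z by (intro sum.cong refl) (auto simp: green_cnj)
  moreover have "z - cnj z = 2 * \<i> * of_real (Im z)" by (simp add: complex_eq_iff)
  ultimately show ?thesis using green_cnj[OF z ab, of X] by simp
qed

lemma green_sum_norm_sq:
  assumes z: "Im z \<noteq> 0" and a: "a < N"
  shows "Im (green X z a a) = Im z * (\<Sum>c<N. (cmod (green X z a c))\<^sup>2)"
proof -
  have "(\<Sum>c<N. green X z a c * cnj (green X z c a)) = of_real (\<Sum>c<N. (cmod (green X z a c))\<^sup>2)"
    unfolding of_real_sum
  proof (intro sum.cong refl)
    fix c assume "c \<in> {..<N}"
    then have "green X z c a = green X z a c" using green_sym[OF z a, of c X] by simp
    then show "green X z a c * cnj (green X z c a) = of_real ((cmod (green X z a c))\<^sup>2)"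
      by (simp only: complex_norm_square)
  qed
  with ward_identity[OF z a a, of X] show ?thesis by (auto simp: complex_eq_iff)
qed

text \<open>The Ward identity gives |Im z| |G(a,b)|^2 <= |G(a,a)|. With b = a this bounds the
  diagonal, and then every other entry.\<close>

lemma green_bound:
  assumes z: "Im z \<noteq> 0" and ab: "a < N" "b < N"
  shows "cmod (green X z a b) \<le> 1 / \<bar>Im z\<bar>"
proof -
  have *: "\<bar>Im z\<bar> * (cmod (green X z a c))\<^sup>2 \<le> cmod (green X z a a)" if "c < N" for c
  proof -
    have "\<bar>Im z\<bar> * (cmod (green X z a c))\<^sup>2 \<le> \<bar>Im z\<bar> * (\<Sum>c<N. (cmod (green X z a c))\<^sup>2)"
      using that by (intro mult_left_mono member_le_sum) auto
    also have "\<dots> = \<bar>Im (green X z a a)\<bar>"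
      unfolding green_sum_norm_sq[OF z ab(1)] by (simp add: abs_mult sum_nonneg)
    finally show ?thesis using abs_Im_le_cmod order_trans by blast
  qed
  have aa: "cmod (green X z a a) \<le> 1 / \<bar>Im z\<bar>"
    using *[OF ab(1)] z by (cases "green X z a a = 0") (auto simp: power2_eq_square field_simps)
  have "\<bar>Im z\<bar> * (cmod (green X z a b))\<^sup>2 \<le> 1 / \<bar>Im z\<bar>" using *[OF ab(2)] aa by linarith
  then have "(cmod (green X z a b))\<^sup>2 \<le> (1 / \<bar>Im z\<bar>) / \<bar>Im z\<bar>"
    using z by (subst pos_le_divide_eq) (auto simp: mult.commute)
  then have "(cmod (green X z a b))\<^sup>2 \<le> (1 / \<bar>Im z\<bar>)\<^sup>2" by (simp add: power2_eq_square)
  then show ?thesis by (rule power2_le_imp_le) simp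
qed

text \<open>With the bound on its entries, the resolvent identity becomes a Lipschitz estimate in
  the entries of \<open>H\<close>, with a constant that does not depend on the
  configuration.\<close>

lemma green_tendsto:
  assumes z: "Im z \<noteq> 0" and ab: "a < N" "b < N"
    and lim: "\<And>c d. c < N \<Longrightarrow> d < N \<Longrightarrow> ((\<lambda>i. H (Y i) c d) \<longlongrightarrow> H X c d) F"
  shows "((\<lambda>i. green (Y i) z a b) \<longlongrightarrow> green X z a b) F"
proof (rule LIM_zero_cancel, rule Lim_null_comparison)
  let ?k = "1 / \<bar>Im z\<bar>"
  show "\<forall>\<^sub>F i in F. norm (green (Y i) z a b - green X z a b) \<le> (\<Sum>c<N. \<Sum>d<N. ?k * \<bar>H X c d - H (Y i) c d\<bar> * ?k)"
  proof (intro always_eventually allI)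
    fix i
    have "norm (green (Y i) z a b - green X z a b) \<le>
      (\<Sum>c<N. \<Sum>d<N. norm (green (Y i) z a c * of_real (H X c d - H (Y i) c d) * green X z d b))"
      unfolding green_diff[OF z z ab] by (auto intro!: order_trans[OF norm_sum] sum_mono)
    also have "\<dots> \<le> (\<Sum>c<N. \<Sum>d<N. ?k * \<bar>H X c d - H (Y i) c d\<bar> * ?k)"
      unfolding norm_mult norm_of_real using green_bound[OF z] ab
      by (intro sum_mono mult_mono mult_nonneg_nonneg) auto
    finally show "norm (green (Y i) z a b - green X z a b) \<le> (\<Sum>c<N. \<Sum>d<N. ?k * \<bar>H X c d - H (Y i) c d\<bar> * ?k)" .
  qed
  have "((\<lambda>i. \<Sum>c<N. \<Sum>d<N. ?k * \<bar>H X c d - H (Y i) c d\<bar> * ?k) \<longlongrightarrow> (\<Sum>c<N. \<Sum>d<N. ?k * \<bar>H X c d - H X c d\<bar> * ?k)) F"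
    by (intro tendsto_intros lim) auto
  then show "((\<lambda>i. \<Sum>c<N. \<Sum>d<N. ?k * \<bar>H X c d - H (Y i) c d\<bar> * ?k) \<longlongrightarrow> 0) F" by simp
qed

lemma continuous_on_green:
  assumes z: "Im z \<noteq> 0" and ab: "a < N" "b < N"
  shows "continuous_on UNIV (\<lambda>X. green X z a b)"
  unfolding continuous_on_def
proof (intro ballI green_tendsto[OF z ab])
  fix X :: "nat \<times> nat \<Rightarrow> real" and c d
  have "continuous_on UNIV (\<lambda>X. H X c d)" unfolding H_def
    by (intro continuous_intros continuous_on_product_coordinates)
  then show "((\<lambda>X. H X c d) \<longlongrightarrow> H X c d) (at X within UNIV)" by (simp add: continuous_on_def)
qed

text \<open>The resolvent identity is already a difference quotient; by continuity of
  \<open>green\<close> it passes to the limit G' = - G H' G.\<close>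

lemma green_has_vector_derivative:
  assumes z: "Im z \<noteq> 0" and ab: "a < N" "b < N"
    and d: "\<And>c d. c < N \<Longrightarrow> d < N \<Longrightarrow> ((\<lambda>t. H (Y t) c d) has_real_derivative H' c d) (at t)"
  shows "((\<lambda>t. green (Y t) z a b) has_vector_derivative
    - (\<Sum>c<N. \<Sum>d<N. green (Y t) z a c * of_real (H' c d) * green (Y t) z d b)) (at t)"
  unfolding has_vector_derivative_complex_quotient
proof -
  have lim: "((\<lambda>h. green (Y (t + h)) z a c) \<longlongrightarrow> green (Y t) z a c) (at 0)" if "c < N" for c
  proof (rule green_tendsto[OF z ab(1) that])
    fix c d assume "c < N" "d < N"
    from DERIV_isCont[OF assms(4)[OF this]] show "((\<lambda>h. H (Y (t + h)) c d) \<longlongrightarrow> H (Y t) c d) (at 0)"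
      by (simp add: isCont_iff)
  qed
  have eq: "(green (Y (t + h)) z a b - green (Y t) z a b) / of_real h =
    - (\<Sum>c<N. \<Sum>d<N. green (Y (t + h)) z a c * of_real ((H (Y (t + h)) c d - H (Y t) c d) / h) * green (Y t) z d b)" for h
    unfolding green_diff[OF z z ab]
    by (simp add: sum_divide_distrib sum_negf[symmetric] algebra_simps diff_divide_distrib)
  show "((\<lambda>h. (green (Y (t + h)) z a b - green (Y t) z a b) / of_real h) \<longlongrightarrow>
    - (\<Sum>c<N. \<Sum>d<N. green (Y t) z a c * of_real (H' c d) * green (Y t) z d b)) (at 0)"
    unfolding eq using d[unfolded DERIV_def] lim
    by (intro tendsto_intros) auto
qed

end

section \<open>Triangular matrices and traces as sums over eigenvalues\<close>

lemma upper_triangular_mult: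
  fixes A B :: "'a::comm_ring_1 mat"
  assumes A: "A \<in> carrier_mat n n" "upper_triangular A" and B: "B \<in> carrier_mat n n" "upper_triangular B"
  shows "upper_triangular (A * B)" "\<And>j. j < n \<Longrightarrow> (A * B) $$ (j, j) = A $$ (j, j) * B $$ (j, j)"
proof -
  have z: "A $$ (i, k) * B $$ (k, j) = 0" if "i < n" "k < n" "j < n" "j < i \<or> (i = j \<and> k \<noteq> j)" for i j k
  proof (cases "k < i")
    case True then show ?thesis using upper_triangularD[OF A(2) True] A(1) that by simp
  next
    case False
    then have "j < k" using that by auto
    then show ?thesis using upper_triangularD[OF B(2) \<open>j < k\<close>] B(1) that by simp
  qed
  show "upper_triangular (A * B)"
  proof (rule upper_triangularI)
    fix i j assume "j < i" "i < dim_row (A * B)"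
    then have ij: "i < n" "j < n" "j < i" using A by auto
    show "(A * B) $$ (i, j) = 0"
      unfolding mult_mat_entry[OF A(1) B(1) ij(1,2)] by (rule sum.neutral) (use z ij in auto)
  qed
  fix j assume j: "j < n"
  have "(\<Sum>k<n. A $$ (j, k) * B $$ (k, j)) = (\<Sum>k<n. if k = j then A $$ (j, j) * B $$ (j, j) else 0)"
    by (intro sum.cong refl) (use z j in auto)
  then show "(A * B) $$ (j, j) = A $$ (j, j) * B $$ (j, j)"
    using mult_mat_entry[OF A(1) B(1) j j] j by simp
qed

text \<open>Induction over the columns: once the columns before \<open>j\<close> vanish below the
  diagonal, the (i, j) entry of C A with j \<le> i reduces to C(i,j) A(j,j).\<close>

lemma upper_triangular_left_inverse:
  fixes A C :: "'a::field mat"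
  assumes A: "A \<in> carrier_mat n n" "upper_triangular A" and C: "C \<in> carrier_mat n n" and CA: "C * A = 1\<^sub>m n"
  shows "upper_triangular C" "\<And>j. j < n \<Longrightarrow> C $$ (j, j) * A $$ (j, j) = 1"
proof -
  have entry: "(\<Sum>k<n. C $$ (i, k) * A $$ (k, j)) = (if i = j then 1 else 0)" if "i < n" "j < n" for i j
    using mult_mat_entry[OF C A(1) that] CA that by simp
  have *: "j \<le> i \<longrightarrow> C $$ (i, j) * A $$ (j, j) = (if i = j then 1 else 0) \<and> (j < i \<longrightarrow> C $$ (i, j) = 0)"
    if "i < n" "j < n" for i j
    using that(2)
  proof (induction j rule: less_induct)
    case (less j)
    show ?case
    proof
      assume ji: "j \<le> i"
      have "(\<Sum>k<n. C $$ (i, k) * A $$ (k, j)) = (\<Sum>k<n. if k = j then C $$ (i, j) * A $$ (j, j) else 0)"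
      proof (intro sum.cong refl)
        fix k assume "k \<in> {..<n}"
        then have k: "k < n" by simp
        show "C $$ (i, k) * A $$ (k, j) = (if k = j then C $$ (i, j) * A $$ (j, j) else 0)"
        proof (cases k j rule: linorder_cases)
          case less
          then show ?thesis using less.IH[OF less k] ji by simp
        next
          case greater
          then show ?thesis using upper_triangularD[OF A(2) greater] A(1) k by simp
        qed simp
      qed
      then have 1: "C $$ (i, j) * A $$ (j, j) = (if i = j then 1 else 0)"
        using entry[OF \<open>i < n\<close> less.prems] less.prems by simp
      moreover have "A $$ (j, j) \<noteq> 0"
      proof -
        have "det A \<noteq> 0"
        proof
          assume "det A = 0"
          then have "det (C * A) = 0" using det_mult[OF C A(1)] by simp
          then show False using CA by simp
        qed
        moreover have "det A = prod_list (diag_mat A)" by (rule det_upper_triangular[OF A(2,1)])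
        ultimately have "0 \<notin> set (diag_mat A)" by (metis prod_list_zero_iff)
        moreover have "A $$ (j, j) \<in> set (diag_mat A)" using A(1) less.prems by (auto simp: diag_mat_def)
        ultimately show ?thesis by metis
      qed
      ultimately show "C $$ (i, j) * A $$ (j, j) = (if i = j then 1 else 0) \<and> (j < i \<longrightarrow> C $$ (i, j) = 0)" by auto
    qed
  qed
  show "upper_triangular C" using * C by (intro upper_triangularI) auto
  show "C $$ (j, j) * A $$ (j, j) = 1" if "j < n" for j using *[OF that that] by simp
qed

lemma mat_trace_mult_comm:
  fixes A B :: "'a::comm_ring_1 mat"
  assumes "A \<in> carrier_mat n n" "B \<in> carrier_mat n n"
  shows "mat_trace (A * B) = mat_trace (B * A)"
proof -
  have "mat_trace (A * B) = (\<Sum>i<n. \<Sum>k<n. A $$ (i, k) * B $$ (k, i))"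
    unfolding mat_trace_def using assms by (intro sum.cong) (auto simp: mult_mat_entry[of A n B] simp del: index_mult_mat(1))
  also have "\<dots> = (\<Sum>i<n. \<Sum>k<n. B $$ (i, k) * A $$ (k, i))"
    by (subst sum.swap) (simp add: mult.commute)
  also have "\<dots> = mat_trace (B * A)"
    unfolding mat_trace_def using assms by (intro sum.cong) (auto simp: mult_mat_entry[of B n A] simp del: index_mult_mat(1))
  finally show ?thesis .
qed

context wishart
begin

text \<open>With x the data matrix whose rows are indexed by \<mu>, so that H = x^T x / N, this is G
  x^T, the vector field of the integration by parts.\<close>

definition V :: "(nat \<times> nat \<Rightarrow> real) \<Rightarrow> complex \<Rightarrow> nat \<Rightarrow> nat \<Rightarrow> complex" where
  "V X z a \<mu> = (\<Sum>b<N. green X z a b * of_real (X (\<mu>, b)))"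

text \<open>This is G^2 x^T. Times -2/N it is the gradient of \<open>trG\<close>, see
  \<open>trG_derivative\<close>, so gradients of functions of resolvent traces are combinations of
  such terms.\<close>

definition W :: "(nat \<times> nat \<Rightarrow> real) \<Rightarrow> complex \<Rightarrow> nat \<Rightarrow> nat \<Rightarrow> complex" where
  "W X z a \<mu> = (\<Sum>b<N. green X z a b * V X z b \<mu>)"

definition trG :: "(nat \<times> nat \<Rightarrow> real) \<Rightarrow> complex \<Rightarrow> complex" where
  "trG X z = (\<Sum>a<N. green X z a a)"

definition trGHG :: "(nat \<times> nat \<Rightarrow> real) \<Rightarrow> complex \<Rightarrow> complex" where
  "trGHG X z = (1 / of_nat N) * (\<Sum>a<N. \<Sum>\<mu><m. V X z a \<mu> * V X z a \<mu>)"

text \<open>The trace of G(z) H G(w)^2. Up to the factor -2 it is the derivative of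
  \<open>trG\<close> at \<open>w\<close> along the field \<open>V\<close> at \<open>z\<close>, and
  it is the kernel from which the covariance arises.\<close>

definition trGHGG :: "(nat \<times> nat \<Rightarrow> real) \<Rightarrow> complex \<Rightarrow> complex \<Rightarrow> complex" where
  "trGHGG X z w = (1 / of_nat N) * (\<Sum>a<N. \<Sum>\<mu><m. V X z a \<mu> * W X w a \<mu>)"

lemma sum_V_V:
  assumes z: "Im z \<noteq> 0" and w: "Im w \<noteq> 0" and b: "b < N"
  shows "(\<Sum>\<mu><m. V X z a \<mu> * V X w b \<mu>) =
    of_nat N * (\<Sum>c<N. \<Sum>d<N. green X z a c * of_real (H X c d) * green X w d b)"
proof -
  have "(\<Sum>\<mu><m. V X z a \<mu> * V X w b \<mu>) =
    (\<Sum>\<mu><m. \<Sum>c<N. \<Sum>d<N. green X z a c * green X w b d * of_real (X (\<mu>, c) * X (\<mu>, d)))"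
    unfolding V_def sum_product by (intro sum.cong refl) simp
  also have "\<dots> = (\<Sum>c<N. \<Sum>d<N. \<Sum>\<mu><m. green X z a c * green X w b d * of_real (X (\<mu>, c) * X (\<mu>, d)))"
    by (rule sum_rotate)
  also have "\<dots> = (\<Sum>c<N. \<Sum>d<N. of_nat N * (green X z a c * of_real (H X c d) * green X w d b))"
  proof (intro sum.cong refl)
    fix c d assume "c \<in> {..<N}" "d \<in> {..<N}"
    then have "green X w b d = green X w d b" using green_sym[OF w b] by simp
    then show "(\<Sum>\<mu><m. green X z a c * green X w b d * of_real (X (\<mu>, c) * X (\<mu>, d))) =
      of_nat N * (green X z a c * of_real (H X c d) * green X w d b)"
      using N_pos by (simp add: H_def sum_distrib_left mult_ac)
  qed
  finally show ?thesis by (simp add: sum_distrib_left)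
qed

lemma mult_carrier_square [simp]:
  "A \<in> carrier_mat N N \<Longrightarrow> B \<in> carrier_mat N N \<Longrightarrow> A * B \<in> carrier_mat N N"
  by (rule mult_carrier_mat)

text \<open>Traces see only diagonals, and the diagonals of triangular matrices multiply and invert
  entrywise, so a Schur triangularisation does the work of a diagonalisation. One family
  \<open>l\<close> serves all arguments because the basis depends on \<open>X\<close> alone.\<close>

lemma spectral_representation:
  "\<exists>l :: nat \<Rightarrow> real. (\<forall>k<N. 0 \<le> l k) \<and>
    (\<forall>z. Im z \<noteq> 0 \<longrightarrow> trG X z = (\<Sum>k<N. 1 / (of_real (l k) - z)) \<and>
       trGHG X z = (\<Sum>k<N. of_real (l k) / (of_real (l k) - z)\<^sup>2)) \<and>
    (\<forall>z w. Im z \<noteq> 0 \<longrightarrow> Im w \<noteq> 0 \<longrightarrow>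
       trGHGG X z w = (\<Sum>k<N. of_real (l k) / ((of_real (l k) - z) * (of_real (l k) - w)\<^sup>2)))"
proof -
  obtain as where as: "char_poly (Hm X) = (\<Prod>a\<leftarrow>as. [:- a, 1:])" "length as = N"
    using char_poly_factorized[OF Hm_carrier] by blast
  obtain B P Q where "schur_decomposition (Hm X) as = (B, P, Q)" by (cases "schur_decomposition (Hm X) as") auto
  from schur_decomposition[OF Hm_carrier as(1) this]
  have sim: "similar_mat_wit (Hm X) B P Q" and ut: "upper_triangular B" by auto
  from similar_mat_witD2[OF Hm_carrier sim]
  have PQ: "P * Q = 1\<^sub>m N" "Q * P = 1\<^sub>m N" "Hm X = P * B * Q"
    and c: "B \<in> carrier_mat N N" "P \<in> carrier_mat N N" "Q \<in> carrier_mat N N" by auto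
  define ev where "ev k = B $$ (k, k)" for k
  let ?R = "resolvent (Hm X)"
  \<comment> \<open>The resolvent in the Schur basis; as the inverse of the triangular matrix B - z
    it is triangular with known diagonal.\<close>
  define C where "C z = Q * ?R z * P" for z
  have R: "?R z \<in> carrier_mat N N" if "z \<notin> \<real>\<^sub>\<ge>\<^sub>0" for z using resolvent_inverse(1)[OF that] .
  have Cc: "C z \<in> carrier_mat N N" if "z \<notin> \<real>\<^sub>\<ge>\<^sub>0" for z using R[OF that] c unfolding C_def by auto
  have Bz: "B - z \<cdot>\<^sub>m 1\<^sub>m N \<in> carrier_mat N N" "upper_triangular (B - z \<cdot>\<^sub>m 1\<^sub>m N)" for z
    using c(1) upper_triangularD[OF ut] by (auto intro!: upper_triangularI)
  have CB: "C z * (B - z \<cdot>\<^sub>m 1\<^sub>m N) = 1\<^sub>m N" if z: "z \<notin> \<real>\<^sub>\<ge>\<^sub>0" for z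
  proof -
    have Rz: "?R z \<in> carrier_mat N N" by (rule R[OF z])
    have "Q * (Hm X - z \<cdot>\<^sub>m 1\<^sub>m N) * P = B - z \<cdot>\<^sub>m 1\<^sub>m N"
    proof -
      have "Q * Hm X * P = (Q * P) * B * (Q * P)" unfolding PQ(3) using c by (simp add: assoc_mult_mat[of _ N N _ N _ N])
      also have "\<dots> = B" unfolding PQ(2) using c by simp
      finally have 1: "Q * Hm X * P = B" .
      have 2: "Q * (z \<cdot>\<^sub>m 1\<^sub>m N) * P = z \<cdot>\<^sub>m 1\<^sub>m N"
        using c PQ(2) by (simp add: mult_smult_distrib[of Q N N _ N] mult_smult_assoc_mat[of _ N N _ N])
      have "Q * (Hm X - z \<cdot>\<^sub>m 1\<^sub>m N) = Q * Hm X - Q * (z \<cdot>\<^sub>m 1\<^sub>m N)"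
        by (rule mult_minus_distrib_mat[of _ N N _ N]) (use c in auto)
      then have "Q * (Hm X - z \<cdot>\<^sub>m 1\<^sub>m N) * P = Q * Hm X * P - Q * (z \<cdot>\<^sub>m 1\<^sub>m N) * P"
        using c by (simp add: minus_mult_distrib_mat[of _ N N _ _ N])
      then show ?thesis unfolding 1 2 .
    qed
    then have "C z * (B - z \<cdot>\<^sub>m 1\<^sub>m N) = Q * ?R z * P * (Q * (Hm X - z \<cdot>\<^sub>m 1\<^sub>m N) * P)"
      by (simp add: C_def)
    also have "\<dots> = Q * ?R z * (P * Q) * ((Hm X - z \<cdot>\<^sub>m 1\<^sub>m N) * P)"
      using c Rz minus_carrier_mat[of "z \<cdot>\<^sub>m 1\<^sub>m N" N N "Hm X"] by (simp add: assoc_mult_mat[of _ N N _ N _ N])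
    also have "\<dots> = Q * (?R z * (Hm X - z \<cdot>\<^sub>m 1\<^sub>m N)) * P"
      unfolding PQ(1) using c Rz minus_carrier_mat[of "z \<cdot>\<^sub>m 1\<^sub>m N" N N "Hm X"] by (simp add: assoc_mult_mat[of _ N N _ N _ N])
    also have "\<dots> = 1\<^sub>m N" unfolding resolvent_inverse(3)[OF z] using c PQ(2) by simp
    finally show ?thesis .
  qed
  note tri = upper_triangular_left_inverse[OF Bz Cc CB]
  have diag: "C z $$ (k, k) * (ev k - z) = 1" if "z \<notin> \<real>\<^sub>\<ge>\<^sub>0" "k < N" for z k
    using tri(2)[OF that(1) that(1) that(2)] that c by (simp add: ev_def)
  \<comment> \<open>Otherwise the resolvent exists at the point \<open>ev k\<close> itself, and
    there \<open>diag\<close> reads 0 = 1.\<close>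
  have ev_nonneg: "ev k \<in> \<real>\<^sub>\<ge>\<^sub>0" if "k < N" for k
  proof (rule ccontr)
    assume "ev k \<notin> \<real>\<^sub>\<ge>\<^sub>0"
    from diag[OF this that] show False by simp
  qed
  define l where "l k = Re (ev k)" for k
  have l: "ev k = of_real (l k)" "0 \<le> l k" if "k < N" for k
    using ev_nonneg[OF that] by (auto simp: l_def elim!: nonneg_Reals_cases)
  have Cd: "C z $$ (k, k) = 1 / (of_real (l k) - z)" if "Im z \<noteq> 0" "k < N" for z k
    using diag[OF non_real_not_nonneg[OF that(1)] that(2)] l[OF that(2)]
    by (metis eq_divide_eq mult_zero_right zero_neq_one)
  have trsim: "mat_trace A = mat_trace (Q * A * P)" if "A \<in> carrier_mat N N" for A
  proof -
    have "mat_trace (Q * A * P) = mat_trace (P * (Q * A))" using that c by (intro mat_trace_mult_comm[of _ N]) auto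
    also have "P * (Q * A) = A" using that c PQ(1) by (simp flip: assoc_mult_mat[of P N N Q N A N])
    finally show ?thesis by simp
  qed
  have ins: "Q * (A * A') * P = (Q * A * P) * (Q * A' * P)" if "A \<in> carrier_mat N N" "A' \<in> carrier_mat N N" for A A'
  proof -
    have "(Q * A * P) * (Q * A' * P) = Q * A * (P * Q) * (A' * P)"
      using that c by (simp add: assoc_mult_mat[of _ N N _ N _ N])
    then show ?thesis using that c PQ(1) by (simp add: assoc_mult_mat[of _ N N _ N _ N])
  qed
  have HB: "Q * Hm X * P = B"
  proof -
    have "Q * Hm X * P = (Q * P) * B * (Q * P)" unfolding PQ(3) using c by (simp add: assoc_mult_mat[of _ N N _ N _ N])
    then show ?thesis unfolding PQ(2) using c by simp
  qed
  have utC: "upper_triangular (C z)" "C z \<in> carrier_mat N N" if "Im z \<noteq> 0" for z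
    using tri(1)[OF non_real_not_nonneg[OF that] non_real_not_nonneg[OF that]] Cc[OF non_real_not_nonneg[OF that]] by auto
  have dl: "B $$ (k, k) = of_real (l k)" if "k < N" for k using l(1)[OF that] by (simp add: ev_def)
  have 1: "trG X z = (\<Sum>k<N. 1 / (of_real (l k) - z))" if z: "Im z \<noteq> 0" for z
  proof -
    have "trG X z = mat_trace (?R z)"
      using R[OF non_real_not_nonneg[OF z]] by (simp add: trG_def mat_trace_def green_def)
    also have "\<dots> = mat_trace (C z)" using trsim[OF R[OF non_real_not_nonneg[OF z]]] by (simp add: C_def)
    also have "\<dots> = (\<Sum>k<N. 1 / (of_real (l k) - z))"
      using utC[OF z] Cd[OF z] by (simp add: mat_trace_def)
    finally show ?thesis .
  qed
  have HR: "trGHG X z = mat_trace (?R z * (Hm X * ?R z))" if z: "Im z \<noteq> 0" for z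
  proof -
    note Rz = R[OF non_real_not_nonneg[OF z]]
    have "Hm X * ?R z \<in> carrier_mat N N" using Rz by auto
    then have "mat_trace (?R z * (Hm X * ?R z)) = (\<Sum>a<N. \<Sum>c<N. green X z a c * (\<Sum>d<N. of_real (H X c d) * green X z d a))"
      using Rz by (simp add: mat_trace_def mult_mat_entry[of _ N] green_def del: index_mult_mat(1))
    also have "\<dots> = (\<Sum>a<N. \<Sum>c<N. \<Sum>d<N. green X z a c * of_real (H X c d) * green X z d a)"
      by (simp add: sum_distrib_left mult_ac)
    also have "\<dots> = (\<Sum>a<N. (1 / of_nat N) * (\<Sum>\<mu><m. V X z a \<mu> * V X z a \<mu>))"
      using N_pos by (intro sum.cong refl) (simp add: sum_V_V[OF z z])
    finally show ?thesis by (simp add: trGHG_def sum_distrib_left)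
  qed
  have 2: "trGHG X z = (\<Sum>k<N. of_real (l k) / (of_real (l k) - z)\<^sup>2)" if z: "Im z \<noteq> 0" for z
  proof -
    note Rz = R[OF non_real_not_nonneg[OF z]]
    note BC = upper_triangular_mult[OF c(1) ut utC(2,1)[OF z]]
    have BCc: "B * C z \<in> carrier_mat N N" using c utC[OF z] by auto
    note CBC = upper_triangular_mult[OF utC(2,1)[OF z] BCc BC(1)]
    have "trGHG X z = mat_trace (Q * (?R z * (Hm X * ?R z)) * P)"
      unfolding HR[OF z] by (rule trsim) (use Rz in auto)
    also have "Q * (?R z * (Hm X * ?R z)) * P = C z * (B * C z)"
      using Rz by (simp add: ins[of "?R z"] ins[of "Hm X"] HB C_def)
    also have "mat_trace (C z * (B * C z)) = (\<Sum>k<N. of_real (l k) / (of_real (l k) - z)\<^sup>2)"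
      unfolding mat_trace_def using utC(2)[OF z]
      by (intro sum.cong) (auto simp: CBC(2) BC(2) Cd[OF z] dl power2_eq_square simp del: index_mult_mat(1))
    finally show ?thesis .
  qed
  have 3: "trGHGG X z w = (\<Sum>k<N. of_real (l k) / ((of_real (l k) - z) * (of_real (l k) - w)\<^sup>2))"
    if z: "Im z \<noteq> 0" and w: "Im w \<noteq> 0" for z w
  proof -
    note Rz = R[OF non_real_not_nonneg[OF z]] and Rw = R[OF non_real_not_nonneg[OF w]]
    note CC = upper_triangular_mult[OF utC(2,1)[OF w] utC(2,1)[OF w]]
    have CCc: "C w * C w \<in> carrier_mat N N" using utC[OF w] by auto
    note BCC = upper_triangular_mult[OF c(1) ut CCc CC(1)]
    have BCCc: "B * (C w * C w) \<in> carrier_mat N N" using c utC[OF w] by auto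
    note CBCC = upper_triangular_mult[OF utC(2,1)[OF z] BCCc BCC(1)]
    have W: "W X w a \<mu> = (\<Sum>b<N. green X w a b * V X w b \<mu>)" for a \<mu> by (rule W_def)
    have "mat_trace (?R z * (Hm X * (?R w * ?R w))) =
      (\<Sum>a<N. \<Sum>c<N. green X z a c * (\<Sum>d<N. of_real (H X c d) * (\<Sum>e<N. green X w d e * green X w e a)))"
    proof -
      have "?R w * ?R w \<in> carrier_mat N N" "Hm X * (?R w * ?R w) \<in> carrier_mat N N" using Rw by auto
      then show ?thesis using Rz Rw by (simp add: mat_trace_def mult_mat_entry[of _ N] green_def del: index_mult_mat(1))
    qed
    also have "\<dots> = (\<Sum>a<N. \<Sum>e<N. green X w e a * (\<Sum>c<N. \<Sum>d<N. green X z a c * of_real (H X c d) * green X w d e))"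
    proof (rule sum.cong[OF refl])
      fix a
      have "(\<Sum>c<N. green X z a c * (\<Sum>d<N. of_real (H X c d) * (\<Sum>e<N. green X w d e * green X w e a))) =
        (\<Sum>c<N. \<Sum>d<N. \<Sum>e<N. green X w e a * (green X z a c * of_real (H X c d) * green X w d e))"
        by (simp add: sum_distrib_left mult_ac)
      also have "\<dots> = (\<Sum>e<N. \<Sum>c<N. \<Sum>d<N. green X w e a * (green X z a c * of_real (H X c d) * green X w d e))"
        by (rule sum_rotate[symmetric])
      finally show "(\<Sum>c<N. green X z a c * (\<Sum>d<N. of_real (H X c d) * (\<Sum>e<N. green X w d e * green X w e a))) =
        (\<Sum>e<N. green X w e a * (\<Sum>c<N. \<Sum>d<N. green X z a c * of_real (H X c d) * green X w d e))"
        by (simp add: sum_distrib_left)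
    qed
    also have "\<dots> = (\<Sum>a<N. \<Sum>e<N. green X w a e * ((1 / of_nat N) * (\<Sum>\<mu><m. V X z a \<mu> * V X w e \<mu>)))"
      using N_pos by (intro sum.cong refl) (simp add: sum_V_V[OF z w] green_sym[OF w])
    also have "\<dots> = (\<Sum>a<N. (1 / of_nat N) * (\<Sum>\<mu><m. V X z a \<mu> * W X w a \<mu>))"
    proof (intro sum.cong refl)
      fix a
      have "(\<Sum>\<mu><m. V X z a \<mu> * W X w a \<mu>) = (\<Sum>e<N. green X w a e * (\<Sum>\<mu><m. V X z a \<mu> * V X w e \<mu>))"
        unfolding W sum_distrib_left by (subst sum.swap) (simp add: mult_ac)
      then show "(\<Sum>e<N. green X w a e * ((1 / of_nat N) * (\<Sum>\<mu><m. V X z a \<mu> * V X w e \<mu>))) =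
        (1 / of_nat N) * (\<Sum>\<mu><m. V X z a \<mu> * W X w a \<mu>)"
        by (simp add: sum_distrib_left)
    qed
    finally have "trGHGG X z w = mat_trace (?R z * (Hm X * (?R w * ?R w)))"
      by (simp add: trGHGG_def sum_distrib_left)
    also have "\<dots> = mat_trace (Q * (?R z * (Hm X * (?R w * ?R w))) * P)"
      by (rule trsim) (use Rz Rw in auto)
    also have "Q * (?R z * (Hm X * (?R w * ?R w))) * P = C z * (B * (C w * C w))"
      using Rz Rw by (simp add: ins[of "?R z"] ins[of "Hm X"] ins[of "?R w"] HB C_def)
    also have "mat_trace (C z * (B * (C w * C w))) = (\<Sum>k<N. of_real (l k) / ((of_real (l k) - z) * (of_real (l k) - w)\<^sup>2))"
      unfolding mat_trace_def using utC(2)[OF z]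
      by (intro sum.cong) (auto simp: CBCC(2) BCC(2) CC(2) Cd[OF z] Cd[OF w] dl power2_eq_square simp del: index_mult_mat(1))
    finally show ?thesis .
  qed
  show ?thesis
    by (rule exI[of _ l]) (use l(2) 1 2 3 in blast)
qed

section \<open>Bounded observables and their derivatives\<close>

abbreviation J :: "(nat \<times> nat) set" where "J \<equiv> {..<m} \<times> {..<N}"

text \<open>The diagonal entry at \<mu> of x G x^T.\<close>

definition Q :: "(nat \<times> nat \<Rightarrow> real) \<Rightarrow> complex \<Rightarrow> nat \<Rightarrow> complex" where
  "Q X z \<mu> = (\<Sum>b<N. V X z b \<mu> * of_real (X (\<mu>, b)))"

text \<open>The functionals to which integration by parts applies and whose integrals exist. The
  bound may depend on \<open>m\<close>, \<open>N\<close> and \<open>z\<close> in any way, as it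
  serves integrability only; invariance under \<open>restrict\<close> means dependence on finitely
  many coordinates.\<close>

definition nice :: "((nat \<times> nat \<Rightarrow> real) \<Rightarrow> complex) \<Rightarrow> bool" where
  "nice h \<longleftrightarrow> continuous_on UNIV h \<and> (\<exists>B. \<forall>X. cmod (h X) \<le> B) \<and> (\<forall>X. h (restrict X J) = h X)"

lemma nice_const: "nice (\<lambda>_. c)" by (auto simp: nice_def)

lemma nice_add:
  assumes "nice f" "nice g"
  shows "nice (\<lambda>X. f X + g X)"
proof -
  obtain A B where "\<And>X. cmod (f X) \<le> A" "\<And>X. cmod (g X) \<le> B" using assms unfolding nice_def by blast
  then have "cmod (f X + g X) \<le> A + B" for X by (meson add_mono norm_triangle_le order_trans)
  then show ?thesis using assms unfolding nice_def by (auto intro!: continuous_intros)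
qed

lemma nice_mult:
  assumes "nice f" "nice g"
  shows "nice (\<lambda>X. f X * g X)"
proof -
  obtain A B where AB: "\<And>X. cmod (f X) \<le> A" "\<And>X. cmod (g X) \<le> B" using assms unfolding nice_def by blast
  then have "0 \<le> A" using norm_ge_zero order_trans by blast
  then have "cmod (f X * g X) \<le> A * B" for X using AB by (auto simp: norm_mult intro!: mult_mono)
  then show ?thesis using assms unfolding nice_def by (auto intro!: continuous_intros)
qed

lemma nice_minus: "nice f \<Longrightarrow> nice (\<lambda>X. - f X)"
  using nice_mult[OF nice_const[of "-1"]] by simp

lemma nice_diff: "nice f \<Longrightarrow> nice g \<Longrightarrow> nice (\<lambda>X. f X - g X)"
  using nice_add[OF _ nice_minus] by force

lemma nice_sum:
  assumes "\<And>i. i \<in> A \<Longrightarrow> nice (f i)"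
  shows "nice (\<lambda>X. \<Sum>i\<in>A. f i X)"
  using assms
proof (induction A rule: infinite_finite_induct)
  case (insert i A)
  have "(\<lambda>X. \<Sum>i\<in>insert i A. f i X) = (\<lambda>X. f i X + (\<Sum>i\<in>A. f i X))" using insert.hyps by auto
  then show ?case using insert nice_add by simp
qed (auto simp: nice_const)

lemma nice_power: "nice f \<Longrightarrow> nice (\<lambda>X. f X ^ k)"
  by (induction k) (auto intro: nice_const nice_mult)

lemmas nice_intros = nice_const nice_add nice_mult nice_minus nice_diff nice_sum nice_power

lemma Hm_restrict: "Hm (restrict X J) = Hm X"
  unfolding Hm_def H_def by (intro cong_mat refl) (auto intro!: sum.cong)

lemma green_restrict: "green (restrict X J) z a b = green X z a b"
  by (simp add: green_def Hm_restrict)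

lemma nice_green: "Im z \<noteq> 0 \<Longrightarrow> a < N \<Longrightarrow> b < N \<Longrightarrow> nice (\<lambda>X. green X z a b)"
  unfolding nice_def using continuous_on_green green_bound green_restrict by blast

lemma continuous_on_coordinate: "continuous_on UNIV (\<lambda>X :: nat \<times> nat \<Rightarrow> real. complex_of_real (X e))"
  by (intro continuous_intros continuous_on_product_coordinates)

text \<open>The left-hand side is N times an entry of G(z) H G(cnj z), and G H = 1 + z G removes
  \<open>H\<close>. Thus \<open>V\<close> is controlled by the resolvent alone, although its
  definition contains the unbounded variables \<open>X\<close>.\<close>

lemma green_gram:
  assumes z: "Im z \<noteq> 0" and ab: "a < N" "b < N"
  shows "(\<Sum>\<mu><m. V X z a \<mu> * cnj (V X z b \<mu>)) =
    of_nat N * (cnj (green X z a b) + z * (\<Sum>c<N. green X z a c * cnj (green X z c b)))"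
proof -
  have Vc: "cnj (V X z b \<mu>) = V X (cnj z) b \<mu>" for \<mu>
    unfolding V_def using z ab by (simp add: green_cnj)
  have "(\<Sum>\<mu><m. V X z a \<mu> * cnj (V X z b \<mu>)) =
    of_nat N * (\<Sum>c<N. \<Sum>d<N. green X z a c * of_real (H X c d) * green X (cnj z) d b)"
    unfolding Vc using z ab by (intro sum_V_V) auto
  also have "(\<Sum>c<N. \<Sum>d<N. green X z a c * of_real (H X c d) * green X (cnj z) d b) =
    (\<Sum>d<N. (\<Sum>c<N. green X z a c * of_real (H X c d)) * green X (cnj z) d b)"
    by (subst sum.swap) (simp add: sum_distrib_right)
  also have "\<dots> = (\<Sum>d<N. (if a = d then cnj (green X z d b) else 0) + z * (green X z a d * cnj (green X z d b)))"
  proof (rule sum.cong[OF refl])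
    fix d assume "d \<in> {..<N}"
    then have d: "d < N" by simp
    show "(\<Sum>c<N. green X z a c * of_real (H X c d)) * green X (cnj z) d b =
      (if a = d then cnj (green X z d b) else 0) + z * (green X z a d * cnj (green X z d b))"
      unfolding H_green(2)[OF z ab(1) d] green_cnj[OF z d ab(2)] by (simp add: algebra_simps)
  qed
  also have "\<dots> = cnj (green X z a b) + z * (\<Sum>c<N. green X z a c * cnj (green X z c b))"
    using ab by (simp add: sum.distrib sum_distrib_left)
  finally show ?thesis .
qed

lemma V_bound:
  assumes z: "Im z \<noteq> 0" and a: "a < N" and \<mu>: "\<mu> < m"
  shows "(cmod (V X z a \<mu>))\<^sup>2 \<le> real N * (1 / \<bar>Im z\<bar> + cmod z * (\<Sum>c<N. (1 / \<bar>Im z\<bar>) * (1 / \<bar>Im z\<bar>)))"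
proof -
  have "(cmod (V X z a \<mu>))\<^sup>2 \<le> (\<Sum>\<mu><m. (cmod (V X z a \<mu>))\<^sup>2)" using \<mu> by (intro member_le_sum) auto
  also have "\<dots> = cmod (\<Sum>\<mu><m. V X z a \<mu> * cnj (V X z a \<mu>))"
  proof -
    have "(\<Sum>\<mu><m. V X z a \<mu> * cnj (V X z a \<mu>)) = of_real (\<Sum>\<mu><m. (cmod (V X z a \<mu>))\<^sup>2)"
      by (simp only: of_real_sum complex_norm_square)
    then show ?thesis by (simp only: norm_of_real abs_of_nonneg sum_nonneg zero_le_power2)
  qed
  also have "\<dots> \<le> real N * (1 / \<bar>Im z\<bar> + cmod z * (\<Sum>c<N. (1 / \<bar>Im z\<bar>) * (1 / \<bar>Im z\<bar>)))"
    unfolding green_gram[OF z a a] norm_mult norm_of_nat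
  proof (intro mult_left_mono order_trans[OF norm_triangle_ineq] add_mono)
    show "cmod (cnj (green X z a a)) \<le> 1 / \<bar>Im z\<bar>" using green_bound[OF z a a] by simp
    show "cmod (z * (\<Sum>c<N. green X z a c * cnj (green X z c a))) \<le> cmod z * (\<Sum>c<N. (1 / \<bar>Im z\<bar>) * (1 / \<bar>Im z\<bar>))"
      unfolding norm_mult
    proof (intro mult_left_mono order_trans[OF norm_sum] sum_mono norm_ge_zero)
      fix c assume "c \<in> {..<N}"
      then have c: "c < N" by simp
      show "norm (green X z a c * cnj (green X z c a)) \<le> (1 / \<bar>Im z\<bar>) * (1 / \<bar>Im z\<bar>)"
        unfolding norm_mult complex_mod_cnj by (intro mult_mono green_bound z a c) auto
    qed
  qed auto
  finally show ?thesis .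
qed

lemma nice_V:
  assumes z: "Im z \<noteq> 0" and a: "a < N" and \<mu>: "\<mu> < m"
  shows "nice (\<lambda>X. V X z a \<mu>)"
proof -
  have "continuous_on UNIV (\<lambda>X. V X z a \<mu>)"
    unfolding V_def using z a by (intro continuous_intros continuous_on_green continuous_on_coordinate) auto
  moreover have "cmod (V X z a \<mu>) \<le> sqrt (real N * (1 / \<bar>Im z\<bar> + cmod z * (\<Sum>c<N. (1 / \<bar>Im z\<bar>) * (1 / \<bar>Im z\<bar>))))" for X
    using V_bound[OF assms] by (intro real_le_rsqrt) auto
  moreover have "V (restrict X J) z a \<mu> = V X z a \<mu>" for X
    unfolding V_def green_restrict using \<mu> by (intro sum.cong) auto
  ultimately show ?thesis unfolding nice_def by blast
qed

lemma nice_W: "Im z \<noteq> 0 \<Longrightarrow> a < N \<Longrightarrow> \<mu> < m \<Longrightarrow> nice (\<lambda>X. W X z a \<mu>)"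
  unfolding W_def by (intro nice_intros nice_green nice_V) auto

lemma nice_trG: "Im z \<noteq> 0 \<Longrightarrow> nice (\<lambda>X. trG X z)"
  unfolding trG_def by (intro nice_intros nice_green) auto

lemma nice_trGHG: "Im z \<noteq> 0 \<Longrightarrow> nice (\<lambda>X. trGHG X z)"
  unfolding trGHG_def by (intro nice_intros nice_V) auto

lemma nice_trGHGG: "Im z \<noteq> 0 \<Longrightarrow> Im w \<noteq> 0 \<Longrightarrow> nice (\<lambda>X. trGHGG X z w)"
  unfolding trGHGG_def by (intro nice_intros nice_V nice_W) auto

lemma Q_eq: "Q X z \<mu> = (\<Sum>a<N. \<Sum>b<N. of_real (X (\<mu>, a)) * green X z a b * of_real (X (\<mu>, b)))"
  unfolding Q_def V_def by (simp add: sum_distrib_left sum_distrib_right mult_ac)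

text \<open>Column \<mu> of x G x^T contains \<open>Q\<close>, so |Q|^2 is at most the squared norm
  of this column. By \<open>green_gram\<close> and the Ward identity that squared norm is linear in
  \<open>Q\<close> and its conjugate, hence |Q|^2 <= C |Q|.\<close>

lemma Q_bound:
  assumes z: "Im z \<noteq> 0" and \<mu>: "\<mu> < m"
  shows "cmod (Q X z \<mu>) \<le> real N * (1 + cmod z / \<bar>Im z\<bar>)"
proof -
  define q where "q \<nu> = (\<Sum>a<N. of_real (X (\<mu>, a)) * V X z a \<nu>)" for \<nu>
  have qQ: "q \<mu> = Q X z \<mu>" unfolding q_def Q_def by (simp add: mult.commute)
  have cQ: "cnj (Q X z \<mu>) = (\<Sum>a<N. \<Sum>b<N. of_real (X (\<mu>, a)) * cnj (green X z a b) * of_real (X (\<mu>, b)))"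
    unfolding Q_eq by simp
  have "(\<Sum>\<nu><m. q \<nu> * cnj (q \<nu>)) =
    (\<Sum>\<nu><m. \<Sum>a<N. \<Sum>b<N. of_real (X (\<mu>, a)) * of_real (X (\<mu>, b)) * (V X z a \<nu> * cnj (V X z b \<nu>)))"
    unfolding q_def cnj_sum sum_product by (simp add: mult_ac)
  also have "\<dots> = (\<Sum>a<N. \<Sum>b<N. \<Sum>\<nu><m. of_real (X (\<mu>, a)) * of_real (X (\<mu>, b)) * (V X z a \<nu> * cnj (V X z b \<nu>)))"
    by (rule sum_rotate)
  also have "\<dots> = (\<Sum>a<N. \<Sum>b<N. of_nat N * (of_real (X (\<mu>, a)) * cnj (green X z a b) * of_real (X (\<mu>, b)) +
      z / (2 * \<i> * of_real (Im z)) * (of_real (X (\<mu>, a)) * green X z a b * of_real (X (\<mu>, b)) -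
        of_real (X (\<mu>, a)) * cnj (green X z a b) * of_real (X (\<mu>, b)))))"
  proof (intro sum.cong refl)
    fix a b assume "a \<in> {..<N}" "b \<in> {..<N}"
    then have ab: "a < N" "b < N" by auto
    define k where "k = z / (2 * \<i> * of_real (Im z))"
    have "(\<Sum>c<N. green X z a c * cnj (green X z c b)) = (green X z a b - cnj (green X z a b)) / (2 * \<i> * of_real (Im z))"
      using ward_identity[OF z ab, of X] z by (simp add: field_simps)
    then have w: "z * (\<Sum>c<N. green X z a c * cnj (green X z c b)) = k * (green X z a b - cnj (green X z a b))"
      by (simp add: k_def)
    show "(\<Sum>\<nu><m. of_real (X (\<mu>, a)) * of_real (X (\<mu>, b)) * (V X z a \<nu> * cnj (V X z b \<nu>))) =
      of_nat N * (of_real (X (\<mu>, a)) * cnj (green X z a b) * of_real (X (\<mu>, b)) +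
      z / (2 * \<i> * of_real (Im z)) * (of_real (X (\<mu>, a)) * green X z a b * of_real (X (\<mu>, b)) -
        of_real (X (\<mu>, a)) * cnj (green X z a b) * of_real (X (\<mu>, b))))"
      unfolding sum_distrib_left[symmetric] green_gram[OF z ab] w k_def[symmetric] by (simp add: algebra_simps)
  qed
  also have "\<dots> = of_nat N * (cnj (Q X z \<mu>) + z / (2 * \<i> * of_real (Im z)) * (Q X z \<mu> - cnj (Q X z \<mu>)))"
    unfolding cQ unfolding Q_eq by (simp only: sum.distrib sum_subtractf sum_distrib_left[symmetric])
  finally have e: "(\<Sum>\<nu><m. q \<nu> * cnj (q \<nu>)) = of_nat N * (cnj (Q X z \<mu>) + z / (2 * \<i> * of_real (Im z)) * (Q X z \<mu> - cnj (Q X z \<mu>)))" .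
  have "(cmod (Q X z \<mu>))\<^sup>2 \<le> (\<Sum>\<nu><m. (cmod (q \<nu>))\<^sup>2)"
    unfolding qQ[symmetric] using \<mu> by (intro member_le_sum) auto
  also have "\<dots> = cmod (\<Sum>\<nu><m. q \<nu> * cnj (q \<nu>))"
  proof -
    have "(\<Sum>\<nu><m. q \<nu> * cnj (q \<nu>)) = of_real (\<Sum>\<nu><m. (cmod (q \<nu>))\<^sup>2)"
      by (simp only: of_real_sum complex_norm_square)
    then show ?thesis by (simp only: norm_of_real abs_of_nonneg sum_nonneg zero_le_power2)
  qed
  also have "\<dots> \<le> real N * (cmod (Q X z \<mu>) + cmod z / (2 * \<bar>Im z\<bar>) * (cmod (Q X z \<mu>) + cmod (Q X z \<mu>)))"
    unfolding e norm_mult norm_of_nat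
  proof (intro mult_left_mono order_trans[OF norm_triangle_ineq] add_mono)
    show "cmod (z / (2 * \<i> * of_real (Im z)) * (Q X z \<mu> - cnj (Q X z \<mu>))) \<le> cmod z / (2 * \<bar>Im z\<bar>) * (cmod (Q X z \<mu>) + cmod (Q X z \<mu>))"
      unfolding norm_mult using norm_triangle_ineq4[of "Q X z \<mu>" "cnj (Q X z \<mu>)"]
      by (intro mult_mono) (auto simp: norm_divide norm_mult)
  qed auto
  also have "\<dots> = (real N * (1 + cmod z / \<bar>Im z\<bar>)) * cmod (Q X z \<mu>)" using z by (simp add: field_simps)
  finally have "cmod (Q X z \<mu>) * cmod (Q X z \<mu>) \<le> (real N * (1 + cmod z / \<bar>Im z\<bar>)) * cmod (Q X z \<mu>)"
    by (simp add: power2_eq_square)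
  then show ?thesis
    by (cases "Q X z \<mu> = 0") (auto intro!: mult_nonneg_nonneg add_nonneg_nonneg)
qed

lemma nice_Q:
  assumes z: "Im z \<noteq> 0" and \<mu>: "\<mu> < m"
  shows "nice (\<lambda>X. Q X z \<mu>)"
proof -
  have "continuous_on UNIV (\<lambda>X. Q X z \<mu>)"
    unfolding Q_eq using z by (intro continuous_intros continuous_on_green continuous_on_coordinate) auto
  moreover have "Q (restrict X J) z \<mu> = Q X z \<mu>" for X
    unfolding Q_eq green_restrict using \<mu> by (intro sum.cong) auto
  ultimately show ?thesis using Q_bound[OF assms] unfolding nice_def by blast
qed

lemma H_derivative:
  fixes X :: "nat \<times> nat \<Rightarrow> real"
  assumes e: "\<nu> < m" "x < N"
  defines "Z \<equiv> \<lambda>t. X((\<nu>, x) := t)"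
  shows "((\<lambda>t. H (Z t) c d) has_real_derivative
    (1 / real N) * ((if c = x then Z t (\<nu>, d) else 0) + (if d = x then Z t (\<nu>, c) else 0))) (at t)"
proof -
  have c: "((\<lambda>t. Z t (\<mu>, a)) has_real_derivative (if \<mu> = \<nu> \<and> a = x then 1 else 0)) (at t)" for \<mu> a
    unfolding Z_def by (cases "\<mu> = \<nu> \<and> a = x") auto
  have "((\<lambda>t. H (Z t) c d) has_real_derivative
    (1 / real N) * (\<Sum>\<mu><m. (if \<mu> = \<nu> \<and> c = x then 1 else 0) * Z t (\<mu>, d) + (if \<mu> = \<nu> \<and> d = x then 1 else 0) * Z t (\<mu>, c))) (at t)"
    unfolding H_def by (intro DERIV_cmult DERIV_sum DERIV_mult c)
  moreover have "(\<Sum>\<mu><m. (if \<mu> = \<nu> \<and> c = x then 1 else 0) * Z t (\<mu>, d) + (if \<mu> = \<nu> \<and> d = x then 1 else 0) * Z t (\<mu>, c)) =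
    (\<Sum>\<mu><m. if \<mu> = \<nu> then (if c = x then Z t (\<nu>, d) else 0) + (if d = x then Z t (\<nu>, c) else 0) else 0)"
    by (intro sum.cong refl) auto
  ultimately show ?thesis using e by simp
qed

lemma green_derivative:
  fixes X :: "nat \<times> nat \<Rightarrow> real"
  assumes z: "Im z \<noteq> 0" and e: "\<nu> < m" "x < N" and ab: "a < N" "b < N"
  defines "Z \<equiv> \<lambda>t. X((\<nu>, x) := t)"
  shows "((\<lambda>t. green (Z t) z a b) has_vector_derivative
    - (1 / of_nat N) * (green (Z t) z a x * V (Z t) z b \<nu> + V (Z t) z a \<nu> * green (Z t) z x b)) (at t)"
proof -
  let ?g = "green (Z t) z" and ?Z = "\<lambda>d. complex_of_real (Z t (\<nu>, d))"
  have "(\<Sum>c<N. \<Sum>d<N. ?g a c * of_real ((1 / real N) * ((if c = x then Z t (\<nu>, d) else 0) + (if d = x then Z t (\<nu>, c) else 0))) * ?g d b)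
    = (\<Sum>c<N. \<Sum>d<N. (1 / of_nat N) * ((if c = x then ?g a x * (?g b d * ?Z d) else 0) + (if d = x then ?g a c * ?Z c * ?g x b else 0)))"
    using ab by (intro sum.cong refl) (auto simp: algebra_simps green_sym[OF z, of b])
  also have "\<dots> = (1 / of_nat N) * ((\<Sum>c<N. \<Sum>d<N. if c = x then ?g a x * (?g b d * ?Z d) else 0) +
     (\<Sum>c<N. \<Sum>d<N. if d = x then ?g a c * ?Z c * ?g x b else 0))"
    by (simp only: sum_distrib_left sum.distrib distrib_left)
  also have "(\<Sum>c<N. \<Sum>d<N. if c = x then ?g a x * (?g b d * ?Z d) else 0) = (\<Sum>c<N. if c = x then ?g a x * V (Z t) z b \<nu> else 0)"
    by (intro sum.cong refl) (simp add: V_def sum_distrib_left)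
  also have "\<dots> = ?g a x * V (Z t) z b \<nu>" using e by simp
  also have "(\<Sum>c<N. \<Sum>d<N. if d = x then ?g a c * ?Z c * ?g x b else 0) = V (Z t) z a \<nu> * ?g x b"
    using e by (simp add: V_def sum_distrib_right)
  finally have eq: "(\<Sum>c<N. \<Sum>d<N. ?g a c * of_real ((1 / real N) * ((if c = x then Z t (\<nu>, d) else 0) + (if d = x then Z t (\<nu>, c) else 0))) * ?g d b)
    = (1 / of_nat N) * (?g a x * V (Z t) z b \<nu> + V (Z t) z a \<nu> * ?g x b)" .
  have "((\<lambda>t. green (Z t) z a b) has_vector_derivative
    - (\<Sum>c<N. \<Sum>d<N. ?g a c * of_real ((1 / real N) * ((if c = x then Z t (\<nu>, d) else 0) + (if d = x then Z t (\<nu>, c) else 0))) * ?g d b)) (at t)"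
    unfolding Z_def by (rule green_has_vector_derivative[OF z ab H_derivative[OF e]])
  then show ?thesis unfolding eq by simp
qed

text \<open>Only the derivative of the entry (x, \<nu>) in the variable (\<nu>, x) itself is
  computed: these diagonal terms make up the divergence of the field.\<close>

lemma V_derivative:
  fixes X :: "nat \<times> nat \<Rightarrow> real"
  assumes z: "Im z \<noteq> 0" and e: "\<nu> < m" "x < N"
  defines "Z \<equiv> \<lambda>t. X((\<nu>, x) := t)"
  shows "((\<lambda>t. V (Z t) z x \<nu>) has_vector_derivative
    green (Z t) z x x - (1 / of_nat N) * (green (Z t) z x x * Q (Z t) z \<nu> + V (Z t) z x \<nu> * V (Z t) z x \<nu>)) (at t)"
proof -
  have c: "((\<lambda>t. complex_of_real (Z t (\<nu>, b))) has_vector_derivative (if b = x then 1 else 0)) (at t)" for b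
    unfolding Z_def by (cases "b = x") (auto intro!: derivative_eq_intros)
  have "((\<lambda>t. V (Z t) z x \<nu>) has_vector_derivative
    (\<Sum>b<N. green (Z t) z x b * (if b = x then 1 else 0) +
      (- (1 / of_nat N) * (green (Z t) z x x * V (Z t) z b \<nu> + V (Z t) z x \<nu> * green (Z t) z x b)) * of_real (Z t (\<nu>, b)))) (at t)"
  proof -
    have g: "((\<lambda>t. green (Z t) z x b) has_vector_derivative
      - (1 / of_nat N) * (green (Z t) z x x * V (Z t) z b \<nu> + V (Z t) z x \<nu> * green (Z t) z x b)) (at t)" if "b < N" for b
      unfolding Z_def by (rule green_derivative[OF z e e(2) that])
    have "(\<lambda>t. V (Z t) z x \<nu>) = (\<lambda>t. \<Sum>b<N. green (Z t) z x b * complex_of_real (Z t (\<nu>, b)))"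
      by (simp add: V_def)
    then show ?thesis by (simp only:) (intro has_vector_derivative_sum has_vector_derivative_mult c g, simp)
  qed
  moreover have "(\<Sum>b<N. green (Z t) z x b * (if b = x then 1 else 0) +
      (- (1 / of_nat N) * (green (Z t) z x x * V (Z t) z b \<nu> + V (Z t) z x \<nu> * green (Z t) z x b)) * of_real (Z t (\<nu>, b))) =
    green (Z t) z x x - (1 / of_nat N) * (green (Z t) z x x * Q (Z t) z \<nu> + V (Z t) z x \<nu> * V (Z t) z x \<nu>)"
  proof -
    have "(\<Sum>b<N. green (Z t) z x b * (if b = x then 1 else 0) +
      (- (1 / of_nat N) * (green (Z t) z x x * V (Z t) z b \<nu> + V (Z t) z x \<nu> * green (Z t) z x b)) * of_real (Z t (\<nu>, b))) =
      (\<Sum>b<N. (if b = x then green (Z t) z x b else 0) - (1 / of_nat N) * (green (Z t) z x x * (V (Z t) z b \<nu> * of_real (Z t (\<nu>, b))) +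
         V (Z t) z x \<nu> * (green (Z t) z x b * of_real (Z t (\<nu>, b)))))"
      by (intro sum.cong refl) (auto simp: algebra_simps)
    also have "\<dots> = (\<Sum>b<N. if b = x then green (Z t) z x b else 0) - (1 / of_nat N) * (green (Z t) z x x * Q (Z t) z \<nu> + V (Z t) z x \<nu> * (\<Sum>b<N. green (Z t) z x b * of_real (Z t (\<nu>, b))))"
      unfolding Q_def by (simp only: sum.distrib sum_subtractf sum_distrib_left[symmetric])
    finally show ?thesis using e by (simp add: V_def)
  qed
  ultimately show ?thesis by simp
qed

lemma trG_derivative:
  fixes X :: "nat \<times> nat \<Rightarrow> real"
  assumes z: "Im z \<noteq> 0" and e: "\<nu> < m" "x < N"
  defines "Z \<equiv> \<lambda>t. X((\<nu>, x) := t)"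
  shows "((\<lambda>t. trG (Z t) z) has_vector_derivative - (2 / of_nat N) * W (Z t) z x \<nu>) (at t)"
proof -
  have "((\<lambda>t. trG (Z t) z) has_vector_derivative
    (\<Sum>a<N. - (1 / of_nat N) * (green (Z t) z a x * V (Z t) z a \<nu> + V (Z t) z a \<nu> * green (Z t) z x a))) (at t)"
    unfolding trG_def Z_def by (intro has_vector_derivative_sum green_derivative[OF z e]) auto
  also have "(\<Sum>a<N. - (1 / of_nat N) * (green (Z t) z a x * V (Z t) z a \<nu> + V (Z t) z a \<nu> * green (Z t) z x a)) =
    (\<Sum>a<N. - (2 / of_nat N) * (green (Z t) z x a * V (Z t) z a \<nu>))"
    using e by (intro sum.cong refl) (auto simp: green_sym[OF z, of _ x] algebra_simps)
  finally show ?thesis unfolding W_def by (simp only: sum_distrib_left)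
qed

text \<open>The sum is the trace of x G x^T, that is N Tr (G H), and G H = 1 + z G.\<close>

lemma sum_Q:
  assumes z: "Im z \<noteq> 0"
  shows "(\<Sum>\<mu><m. Q X z \<mu>) = of_nat N * (of_nat N + z * trG X z)"
proof -
  have "(\<Sum>\<mu><m. Q X z \<mu>) = (\<Sum>a<N. \<Sum>b<N. \<Sum>\<mu><m. of_real (X (\<mu>, a)) * green X z a b * of_real (X (\<mu>, b)))"
    unfolding Q_eq by (rule sum_rotate)
  also have "\<dots> = (\<Sum>a<N. \<Sum>b<N. of_nat N * (green X z a b * of_real (H X b a)))"
    using N_pos by (intro sum.cong refl) (simp add: H_def sum_distrib_left mult_ac)
  also have "\<dots> = (\<Sum>a<N. of_nat N * (\<Sum>b<N. green X z a b * of_real (H X b a)))"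
    by (simp add: sum_distrib_left)
  also have "\<dots> = (\<Sum>a<N. of_nat N * (1 + z * green X z a a))"
    by (intro sum.cong refl) (simp add: H_green(2)[OF z])
  finally show ?thesis by (simp add: trG_def sum_distrib_left sum.distrib algebra_simps)
qed

end

section \<open>The loop equation\<close>

text \<open>A law is prescribed only for the block of \<open>Z\<close> over \<open>J\<close>, so
  that one infinite array carries the ensembles of all sizes.\<close>

locale wishart_ensemble = wishart m N + prob_space M for m N :: nat and M :: "'a measure" +
  fixes Z :: "nat \<times> nat \<Rightarrow> 'a \<Rightarrow> real" and u :: real
  assumes u_pos: "u > 0"
    and Z_meas: "\<And>i. Z i \<in> borel_measurable M"
    and law: "distr M (PiM J (\<lambda>_. borel)) (\<lambda>\<omega>. \<lambda>i\<in>J. Z i \<omega>) = PiM J (\<lambda>_. centered_normal u)"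
begin

abbreviation cf :: "'a \<Rightarrow> nat \<times> nat \<Rightarrow> real" where "cf \<omega> \<equiv> (\<lambda>i. Z i \<omega>)"

lemma nice_measurable: "nice h \<Longrightarrow> (\<lambda>\<omega>. h (cf \<omega>)) \<in> borel_measurable M"
  unfolding nice_def
  using measurable_compose[OF measurable_coordinatewise_then_product[of cf M] borel_measurable_continuous_onI] Z_meas
  by blast

lemma nice_integrable:
  assumes "nice h"
  shows "integrable M (\<lambda>\<omega>. h (cf \<omega>))"
proof -
  obtain B where "\<And>X. cmod (h X) \<le> B" using assms unfolding nice_def by blast
  then show ?thesis using nice_measurable[OF assms] by (intro integrable_const_bound[where B=B]) auto
qed

lemma nice_integration_by_parts:
  assumes e: "e \<in> J" and F: "nice F" "nice F'"
    and d: "\<And>X t. ((\<lambda>t. F (X(e := t))) has_vector_derivative F' (X(e := t))) (at t)"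
  shows "integrable M (\<lambda>\<omega>. of_real (Z e \<omega>) * F (cf \<omega>))"
    "(\<integral>\<omega>. of_real (Z e \<omega>) * F (cf \<omega>) \<partial>M) = of_real (u\<^sup>2) * (\<integral>\<omega>. F' (cf \<omega>) \<partial>M)"
proof -
  obtain B B' where B: "\<And>X. cmod (F X) \<le> B" "\<And>X. cmod (F' X) \<le> B'" using F unfolding nice_def by blast
  have B2: "cmod (F X) \<le> max B B'" "cmod (F' X) \<le> max B B'" for X using B[of X] by (auto simp: le_max_iff_disj)
  have r: "F (restrict X J) = F X" "F' (restrict X J) = F' X" "continuous_on UNIV F" "continuous_on UNIV F'" for X
    using F unfolding nice_def by auto
  note * = gaussian_integration_by_parts[OF prob_space_axioms u_pos _ e Z_meas law r(3,4) r(1,2) B2 d]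
  show "integrable M (\<lambda>\<omega>. of_real (Z e \<omega>) * F (cf \<omega>))"
    "(\<integral>\<omega>. of_real (Z e \<omega>) * F (cf \<omega>) \<partial>M) = of_real (u\<^sup>2) * (\<integral>\<omega>. F' (cf \<omega>) \<partial>M)"
    using * by auto
qed

text \<open>The vector field \<open>V \<Phi>\<close> turns Gaussian integration by parts into the loop equation for \<open>trG\<close>.\<close>

proposition loop_equation:
  assumes z: "Im z \<noteq> 0" and A: "finite A" and w: "\<And>j. j \<in> A \<Longrightarrow> Im (w j) \<noteq> 0"
    and \<Phi>: "nice \<Phi>" and \<phi>: "\<And>j. j \<in> A \<Longrightarrow> nice (\<phi> j)"
    and d: "\<And>\<nu> x X t. \<nu> < m \<Longrightarrow> x < N \<Longrightarrow> ((\<lambda>t. \<Phi> (X((\<nu>, x) := t))) has_vector_derivative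
      (\<Sum>j\<in>A. \<phi> j (X((\<nu>, x) := t)) * (- (2 / of_nat N) * W (X((\<nu>, x) := t)) (w j) x \<nu>))) (at t)"
  shows "(\<integral>\<omega>. of_nat N * (of_nat N + z * trG (cf \<omega>) z) * \<Phi> (cf \<omega>) \<partial>M) =
    of_real (u\<^sup>2) * (\<integral>\<omega>. (of_nat m * trG (cf \<omega>) z - trG (cf \<omega>) z * (of_nat N + z * trG (cf \<omega>) z) - trGHG (cf \<omega>) z) * \<Phi> (cf \<omega>) -
       2 * (\<Sum>j\<in>A. \<phi> j (cf \<omega>) * trGHGG (cf \<omega>) z (w j)) \<partial>M)"
proof -
  define F where "F \<nu> x X = V X z x \<nu> * \<Phi> X" for \<nu> x X
  define F' where "F' \<nu> x X = V X z x \<nu> * (\<Sum>j\<in>A. \<phi> j X * (- (2 / of_nat N) * W X (w j) x \<nu>)) +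
    (green X z x x - (1 / of_nat N) * (green X z x x * Q X z \<nu> + V X z x \<nu> * V X z x \<nu>)) * \<Phi> X" for \<nu> x X
  have nF: "nice (F \<nu> x)" "nice (F' \<nu> x)" if "\<nu> < m" "x < N" for \<nu> x
    unfolding F_def F'_def using that z w by (intro nice_intros nice_V nice_green nice_Q nice_W \<Phi> \<phi>; simp)+
  have dF: "((\<lambda>t. F \<nu> x (X((\<nu>, x) := t))) has_vector_derivative F' \<nu> x (X((\<nu>, x) := t))) (at t)"
    if "\<nu> < m" "x < N" for \<nu> x X t
    unfolding F_def F'_def by (intro has_vector_derivative_mult V_derivative[OF z that] d[OF that])
  have ibp: "integrable M (\<lambda>\<omega>. of_real (Z (\<nu>, x) \<omega>) * F \<nu> x (cf \<omega>))"
    "(\<integral>\<omega>. of_real (Z (\<nu>, x) \<omega>) * F \<nu> x (cf \<omega>) \<partial>M) = of_real (u\<^sup>2) * (\<integral>\<omega>. F' \<nu> x (cf \<omega>) \<partial>M)"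
    if "\<nu> < m" "x < N" for \<nu> x
    using nice_integration_by_parts[OF _ nF[OF that] dF[OF that]] that by auto
  \<comment> \<open>The pairing of the configuration with the field: summed over all entries it is
    the trace in \<open>sum_Q\<close> times the test function.\<close>
  have L: "(\<Sum>\<nu><m. \<Sum>x<N. of_real (X (\<nu>, x)) * F \<nu> x X) = of_nat N * (of_nat N + z * trG X z) * \<Phi> X" for X
  proof -
    have "(\<Sum>\<nu><m. \<Sum>x<N. of_real (X (\<nu>, x)) * F \<nu> x X) = (\<Sum>\<nu><m. Q X z \<nu>) * \<Phi> X"
      unfolding F_def Q_def by (simp add: sum_distrib_left sum_distrib_right mult_ac)
    then show ?thesis by (simp add: sum_Q[OF z])
  qed
  \<comment> \<open>The divergence of the field: differentiating \<Phi> produces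
    \<open>trGHGG\<close>, differentiating \<open>V\<close> the expression quadratic in
    \<open>trG\<close> and the correction \<open>trGHG\<close>.\<close>
  have R: "(\<Sum>\<nu><m. \<Sum>x<N. F' \<nu> x X) = (of_nat m * trG X z - trG X z * (of_nat N + z * trG X z) - trGHG X z) * \<Phi> X -
       2 * (\<Sum>j\<in>A. \<phi> j X * trGHGG X z (w j))" for X
  proof -
    have 1: "(\<Sum>\<nu><m. \<Sum>x<N. V X z x \<nu> * (\<Sum>j\<in>A. \<phi> j X * (- (2 / of_nat N) * W X (w j) x \<nu>))) =
      - 2 * (\<Sum>j\<in>A. \<phi> j X * trGHGG X z (w j))"
    proof -
      have "(\<Sum>\<nu><m. \<Sum>x<N. V X z x \<nu> * (\<Sum>j\<in>A. \<phi> j X * (- (2 / of_nat N) * W X (w j) x \<nu>))) =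
        (\<Sum>\<nu><m. \<Sum>x<N. \<Sum>j\<in>A. - 2 * (\<phi> j X * ((1 / of_nat N) * (V X z x \<nu> * W X (w j) x \<nu>))))"
        by (simp add: sum_distrib_left mult_ac)
      also have "\<dots> = (\<Sum>\<nu><m. \<Sum>j\<in>A. \<Sum>x<N. - 2 * (\<phi> j X * ((1 / of_nat N) * (V X z x \<nu> * W X (w j) x \<nu>))))"
        by (intro sum.cong[OF refl] sum.swap)
      also have "\<dots> = (\<Sum>j\<in>A. \<Sum>x<N. \<Sum>\<nu><m. - 2 * (\<phi> j X * ((1 / of_nat N) * (V X z x \<nu> * W X (w j) x \<nu>))))"
        by (rule sum_rotate)
      also have "\<dots> = - 2 * (\<Sum>j\<in>A. \<phi> j X * trGHGG X z (w j))"
        unfolding trGHGG_def by (simp only: sum_distrib_left)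
      finally show ?thesis .
    qed
    have 2: "(\<Sum>\<nu><m. \<Sum>x<N. (green X z x x - (1 / of_nat N) * (green X z x x * Q X z \<nu> + V X z x \<nu> * V X z x \<nu>)) * \<Phi> X) =
      (of_nat m * trG X z - (1 / of_nat N) * (trG X z * (\<Sum>\<nu><m. Q X z \<nu>)) - trGHG X z) * \<Phi> X"
    proof -
      have "(\<Sum>\<nu><m. \<Sum>x<N. green X z x x - (1 / of_nat N) * (green X z x x * Q X z \<nu> + V X z x \<nu> * V X z x \<nu>)) =
        (\<Sum>\<nu><m. trG X z - (1 / of_nat N) * (trG X z * Q X z \<nu>) - (1 / of_nat N) * (\<Sum>x<N. V X z x \<nu> * V X z x \<nu>))"
      proof (rule sum.cong[OF refl])
        fix \<nu>
        show "(\<Sum>x<N. green X z x x - (1 / of_nat N) * (green X z x x * Q X z \<nu> + V X z x \<nu> * V X z x \<nu>)) =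
          trG X z - (1 / of_nat N) * (trG X z * Q X z \<nu>) - (1 / of_nat N) * (\<Sum>x<N. V X z x \<nu> * V X z x \<nu>)"
          unfolding trG_def by (simp only: sum_subtractf sum.distrib sum_distrib_left sum_distrib_right distrib_left diff_diff_eq)
      qed
      also have "\<dots> = of_nat m * trG X z - (1 / of_nat N) * (trG X z * (\<Sum>\<nu><m. Q X z \<nu>)) - (1 / of_nat N) * (\<Sum>\<nu><m. \<Sum>x<N. V X z x \<nu> * V X z x \<nu>)"
        by (simp add: sum_subtractf sum_distrib_left)
      also have "(1 / of_nat N) * (\<Sum>\<nu><m. \<Sum>x<N. V X z x \<nu> * V X z x \<nu>) = trGHG X z"
        unfolding trGHG_def by (subst sum.swap) simp
      finally show ?thesis by (simp add: sum_distrib_right[symmetric])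
    qed
    have "(\<Sum>\<nu><m. \<Sum>x<N. F' \<nu> x X) = - 2 * (\<Sum>j\<in>A. \<phi> j X * trGHGG X z (w j)) +
       (of_nat m * trG X z - (1 / of_nat N) * (trG X z * (\<Sum>\<nu><m. Q X z \<nu>)) - trGHG X z) * \<Phi> X"
      unfolding F'_def sum.distrib 1 2 ..
    moreover have "(1 / of_nat N) * (trG X z * (\<Sum>\<nu><m. Q X z \<nu>)) = trG X z * (of_nat N + z * trG X z)"
      unfolding sum_Q[OF z] using N_pos by simp
    ultimately show ?thesis by simp
  qed
  have "(\<integral>\<omega>. of_nat N * (of_nat N + z * trG (cf \<omega>) z) * \<Phi> (cf \<omega>) \<partial>M) =
    (\<Sum>\<nu><m. \<Sum>x<N. (\<integral>\<omega>. of_real (Z (\<nu>, x) \<omega>) * F \<nu> x (cf \<omega>) \<partial>M))"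
  proof -
    have "(\<integral>\<omega>. of_nat N * (of_nat N + z * trG (cf \<omega>) z) * \<Phi> (cf \<omega>) \<partial>M) =
      (\<integral>\<omega>. (\<Sum>\<nu><m. \<Sum>x<N. of_real (Z (\<nu>, x) \<omega>) * F \<nu> x (cf \<omega>)) \<partial>M)"
      by (simp only: L[symmetric])
    also have "\<dots> = (\<Sum>\<nu><m. \<integral>\<omega>. (\<Sum>x<N. of_real (Z (\<nu>, x) \<omega>) * F \<nu> x (cf \<omega>)) \<partial>M)"
      by (rule Bochner_Integration.integral_sum) (auto intro!: Bochner_Integration.integrable_sum ibp(1))
    also have "\<dots> = (\<Sum>\<nu><m. \<Sum>x<N. (\<integral>\<omega>. of_real (Z (\<nu>, x) \<omega>) * F \<nu> x (cf \<omega>) \<partial>M))"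
      by (intro sum.cong[OF refl] Bochner_Integration.integral_sum) (auto intro!: ibp(1))
    finally show ?thesis .
  qed
  also have "\<dots> = (\<Sum>\<nu><m. \<Sum>x<N. of_real (u\<^sup>2) * (\<integral>\<omega>. F' \<nu> x (cf \<omega>) \<partial>M))"
    by (intro sum.cong refl) (use ibp(2) in auto)
  also have "\<dots> = of_real (u\<^sup>2) * (\<Sum>\<nu><m. \<Sum>x<N. \<integral>\<omega>. F' \<nu> x (cf \<omega>) \<partial>M)" by (simp only: sum_distrib_left)
  also have "(\<Sum>\<nu><m. \<Sum>x<N. \<integral>\<omega>. F' \<nu> x (cf \<omega>) \<partial>M) = (\<integral>\<omega>. (\<Sum>\<nu><m. \<Sum>x<N. F' \<nu> x (cf \<omega>)) \<partial>M)"
  proof -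
    have "(\<integral>\<omega>. (\<Sum>\<nu><m. \<Sum>x<N. F' \<nu> x (cf \<omega>)) \<partial>M) = (\<Sum>\<nu><m. \<integral>\<omega>. (\<Sum>x<N. F' \<nu> x (cf \<omega>)) \<partial>M)"
      by (rule Bochner_Integration.integral_sum, rule Bochner_Integration.integrable_sum, rule nice_integrable, rule nF) auto
    also have "\<dots> = (\<Sum>\<nu><m. \<Sum>x<N. \<integral>\<omega>. F' \<nu> x (cf \<omega>) \<partial>M)"
      by (intro sum.cong[OF refl] Bochner_Integration.integral_sum) (auto intro!: nice_integrable nF)
    finally show ?thesis ..
  qed
  finally show ?thesis unfolding R .
qed

end

section \<open>Bounds for the traces in terms of the eigenvalues\<close>

lemma norm_inverse_real_diff:
  assumes "Im z \<noteq> 0"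
  shows "cmod (1 / (of_real x - z)) \<le> 1 / \<bar>Im z\<bar>" "of_real x - z \<noteq> 0"
proof -
  have 1: "\<bar>Im z\<bar> \<le> cmod (of_real x - z)" using abs_Im_le_cmod[of "of_real x - z"] by simp
  then show "cmod (1 / (of_real x - z)) \<le> 1 / \<bar>Im z\<bar>"
    using assms by (simp add: norm_divide frac_le)
  show "of_real x - z \<noteq> 0" using 1 assms by auto
qed

lemma Im_inverse_real_diff: "Im (1 / (of_real x - z)) = Im z * (cmod (1 / (of_real x - z)))\<^sup>2"
  by (simp add: Im_divide norm_divide cmod_power2 power_divide)

lemma Im_mult_inverse_real_diff:
  "Im (z * (1 / (of_real x - z))) = Im z * (x * (cmod (1 / (of_real x - z)))\<^sup>2)"
proof -
  have "Im (z * (1 / (of_real x - z))) = Im z * x / ((x - Re z)\<^sup>2 + (Im z)\<^sup>2)"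
    by (simp add: Im_divide algebra_simps)
  then show ?thesis by (simp add: norm_divide cmod_power2 power_divide)
qed

text \<open>For p = 1/(x - z'), q = 1/(x - w) and d = z' - w this is the partial fraction expansion
  with a double pole at w.\<close>

lemma partial_fraction_square:
  fixes p q d :: complex
  assumes pq: "p * q * d = p - q" and d: "d \<noteq> 0"
  shows "p * q\<^sup>2 = (p - q) / d\<^sup>2 - q\<^sup>2 / d"
proof -
  have e: "p * q = (p - q) / d" using assms by (simp add: eq_divide_eq)
  have "p * q\<^sup>2 = (p - q) / d * q" unfolding e[symmetric] by (simp add: power2_eq_square)
  also have "\<dots> = (p * q - q\<^sup>2) / d" by (simp add: left_diff_distrib power2_eq_square)
  also have "\<dots> = ((p - q) / d - q\<^sup>2) / d" unfolding e ..
  finally show ?thesis by (simp add: diff_divide_distrib power2_eq_square)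
qed

text \<open>\<open>L\<close> is an eigenvalue, \<open>A\<close>, \<open>B\<close>, \<open>C\<close>
  are its resolvents at w, z' and z, and d = z' - w. The partial fractions are taken at z' instead
  of z so that z = w is allowed; this shift leaves the last term.\<close>

lemma three_resolvents:
  fixes L A B C z z' d :: complex
  assumes 1: "L * C = 1 + z * C" and 2: "C = B + (z - z') * (B * C)" and 3: "B * A\<^sup>2 = (B - A) / d\<^sup>2 - A\<^sup>2 / d"
  shows "L * C * A\<^sup>2 = A\<^sup>2 * (1 - z / d) + z / d\<^sup>2 * (B - A) + z * ((z - z') * (B * C * A\<^sup>2))"
proof -
  have "C * A\<^sup>2 = (B + (z - z') * (B * C)) * A\<^sup>2" using 2 by simp
  also have "\<dots> = B * A\<^sup>2 + (z - z') * (B * C * A\<^sup>2)" by (simp add: distrib_right mult.assoc)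
  finally have 4: "C * A\<^sup>2 = (B - A) / d\<^sup>2 - A\<^sup>2 / d + (z - z') * (B * C * A\<^sup>2)" unfolding 3 .
  have "L * C * A\<^sup>2 = A\<^sup>2 + z * (C * A\<^sup>2)" unfolding 1 by (simp add: distrib_right mult.assoc)
  then show ?thesis unfolding 4 by (simp add: algebra_simps diff_divide_distrib)
qed

context wishart
begin

definition g :: "(nat \<times> nat \<Rightarrow> real) \<Rightarrow> complex \<Rightarrow> complex" where
  "g X z = trG X z / of_nat N"

text \<open>The derivative of \<open>g\<close> in \<open>z\<close>, obtained from G H G = G + z
  G^2.\<close>

definition dg :: "(nat \<times> nat \<Rightarrow> real) \<Rightarrow> complex \<Rightarrow> complex" where
  "dg X z = (trGHG X z / of_nat N - g X z) / z"

lemma nice_g: "Im z \<noteq> 0 \<Longrightarrow> nice (\<lambda>X. g X z)"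
  unfolding g_def divide_inverse by (intro nice_intros nice_trG)

lemma nice_dg: "Im z \<noteq> 0 \<Longrightarrow> nice (\<lambda>X. dg X z)"
  unfolding dg_def divide_inverse by (intro nice_intros nice_trGHG nice_g)

lemma g_cnj: "Im z \<noteq> 0 \<Longrightarrow> g X (cnj z) = cnj (g X z)"
  by (simp add: g_def trG_def green_cnj)

text \<open>A choice made once per configuration, so that bounds at different spectral parameters
  refer to the same eigenvalues.\<close>

definition eig :: "(nat \<times> nat \<Rightarrow> real) \<Rightarrow> nat \<Rightarrow> real" where
  "eig X = (SOME l. (\<forall>k<N. 0 \<le> l k) \<and>
    (\<forall>z. Im z \<noteq> 0 \<longrightarrow> trG X z = (\<Sum>k<N. 1 / (of_real (l k) - z)) \<and>
       trGHG X z = (\<Sum>k<N. of_real (l k) / (of_real (l k) - z)\<^sup>2)) \<and>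
    (\<forall>z w. Im z \<noteq> 0 \<longrightarrow> Im w \<noteq> 0 \<longrightarrow>
       trGHGG X z w = (\<Sum>k<N. of_real (l k) / ((of_real (l k) - z) * (of_real (l k) - w)\<^sup>2))))"

lemma eig:
  shows "k < N \<Longrightarrow> 0 \<le> eig X k"
    and "Im z \<noteq> 0 \<Longrightarrow> of_nat N * g X z = (\<Sum>k<N. 1 / (of_real (eig X k) - z))"
    and "Im z \<noteq> 0 \<Longrightarrow> trGHG X z = (\<Sum>k<N. of_real (eig X k) * (1 / (of_real (eig X k) - z))\<^sup>2)"
    and "Im z \<noteq> 0 \<Longrightarrow> Im w \<noteq> 0 \<Longrightarrow>
       trGHGG X z w = (\<Sum>k<N. of_real (eig X k) * (1 / (of_real (eig X k) - z)) * (1 / (of_real (eig X k) - w))\<^sup>2)"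
proof -
  note * = someI_ex[OF spectral_representation[of X], folded eig_def]
  show "k < N \<Longrightarrow> 0 \<le> eig X k" using * by blast
  show "Im z \<noteq> 0 \<Longrightarrow> of_nat N * g X z = (\<Sum>k<N. 1 / (of_real (eig X k) - z))"
    using * N_pos by (simp add: g_def)
  show "Im z \<noteq> 0 \<Longrightarrow> trGHG X z = (\<Sum>k<N. of_real (eig X k) * (1 / (of_real (eig X k) - z))\<^sup>2)"
    using * by (simp add: power_divide)
  show "Im z \<noteq> 0 \<Longrightarrow> Im w \<noteq> 0 \<Longrightarrow>
       trGHGG X z w = (\<Sum>k<N. of_real (eig X k) * (1 / (of_real (eig X k) - z)) * (1 / (of_real (eig X k) - w))\<^sup>2)"
    using * by (simp add: power_divide)
qed

lemma eig_dg:
  assumes w: "Im w \<noteq> 0"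
  shows "of_nat N * dg X w = (\<Sum>k<N. (1 / (of_real (eig X k) - w))\<^sup>2)"
proof -
  let ?a = "\<lambda>k. 1 / (of_real (eig X k) - w)"
  have w0: "w \<noteq> 0" using w by auto
  have "of_real (eig X k) * (?a k)\<^sup>2 = ?a k + w * (?a k)\<^sup>2" for k
  proof -
    have "of_real (eig X k) * ?a k = 1 + w * ?a k"
      using norm_inverse_real_diff(2)[OF w, of "eig X k"] by (simp add: field_simps)
    then have "(of_real (eig X k) * ?a k) * ?a k = (1 + w * ?a k) * ?a k" by simp
    then show ?thesis by (simp only: power2_eq_square distrib_right mult_1_left mult.assoc)
  qed
  then have "trGHG X w = of_nat N * g X w + w * (\<Sum>k<N. (?a k)\<^sup>2)"
    unfolding eig(3)[OF w] eig(2)[OF w] by (simp only: sum.distrib sum_distrib_left)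
  then show ?thesis unfolding dg_def using w0 N_pos by (simp add: field_simps)
qed

text \<open>These are the imaginary parts of N g and of N z g. A sum of squared resolvents thus
  costs one factor 1/|Im z| instead of two, and the weighted sum is controlled however large the
  eigenvalues are.\<close>

lemma sum_norm_sq_eq:
  assumes z: "Im z \<noteq> 0" and l: "of_nat N * g X z = (\<Sum>k<N. 1 / (of_real (l k) - z))"
  shows "real N * Im (g X z) = Im z * (\<Sum>k<N. (cmod (1 / (of_real (l k) - z)))\<^sup>2)"
    "(\<Sum>k<N. (cmod (1 / (of_real (l k) - z)))\<^sup>2) \<le> real N * cmod (g X z) / \<bar>Im z\<bar>"
    "(\<Sum>k<N. l k * (cmod (1 / (of_real (l k) - z)))\<^sup>2) \<le> real N * (cmod z * cmod (g X z)) / \<bar>Im z\<bar>"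
proof -
  have "Im (of_nat N * g X z) = Im z * (\<Sum>k<N. (cmod (1 / (of_real (l k) - z)))\<^sup>2)"
    unfolding l Im_sum Im_inverse_real_diff sum_distrib_left ..
  then show 1: "real N * Im (g X z) = Im z * (\<Sum>k<N. (cmod (1 / (of_real (l k) - z)))\<^sup>2)" by simp
  have "\<bar>Im z\<bar> * (\<Sum>k<N. (cmod (1 / (of_real (l k) - z)))\<^sup>2) = \<bar>Im z * (\<Sum>k<N. (cmod (1 / (of_real (l k) - z)))\<^sup>2)\<bar>"
    by (simp add: abs_mult sum_nonneg)
  also have "\<dots> \<le> real N * cmod (g X z)" unfolding 1[symmetric] by (simp add: abs_mult abs_Im_le_cmod mult_left_mono)
  finally show "(\<Sum>k<N. (cmod (1 / (of_real (l k) - z)))\<^sup>2) \<le> real N * cmod (g X z) / \<bar>Im z\<bar>"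
    using z by (simp add: pos_le_divide_eq mult.commute)
  have "Im (z * (of_nat N * g X z)) = Im z * (\<Sum>k<N. l k * (cmod (1 / (of_real (l k) - z)))\<^sup>2)"
    unfolding l by (simp only: sum_distrib_left Im_sum Im_mult_inverse_real_diff)
  then have 2: "Im z * (\<Sum>k<N. l k * (cmod (1 / (of_real (l k) - z)))\<^sup>2) = Im (z * (of_nat N * g X z))" ..
  have "\<bar>Im z\<bar> * (\<Sum>k<N. l k * (cmod (1 / (of_real (l k) - z)))\<^sup>2) \<le> \<bar>Im z * (\<Sum>k<N. l k * (cmod (1 / (of_real (l k) - z)))\<^sup>2)\<bar>"
    unfolding abs_mult by (intro mult_left_mono) auto
  also have "\<dots> \<le> cmod (z * (of_nat N * g X z))" unfolding 2 by (rule abs_Im_le_cmod)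
  also have "\<dots> = real N * (cmod z * cmod (g X z))" by (simp add: norm_mult)
  finally show "(\<Sum>k<N. l k * (cmod (1 / (of_real (l k) - z)))\<^sup>2) \<le> real N * (cmod z * cmod (g X z)) / \<bar>Im z\<bar>"
    using z by (simp add: pos_le_divide_eq mult.commute)
qed

lemma Im_g_nonneg:
  assumes "Im z > 0"
  shows "Im (g X z) \<ge> 0"
proof -
  define l where "l = eig X"
  note l = eig[where X=X, folded l_def]
  from sum_norm_sq_eq(1)[of z X l] l(2)[of z] assms
  have "real N * Im (g X z) = Im z * (\<Sum>k<N. (cmod (1 / (of_real (l k) - z)))\<^sup>2)" by simp
  also have "\<dots> \<ge> 0" using assms by (intro mult_nonneg_nonneg sum_nonneg) auto
  finally show ?thesis using N_pos by (simp add: zero_le_mult_iff)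
qed

lemma trGHG_bound:
  assumes z: "Im z \<noteq> 0"
  shows "cmod (trGHG X z) \<le> real N * (cmod z * cmod (g X z)) / \<bar>Im z\<bar>"
proof -
  define l where "l = eig X"
  note l = eig[where X=X, folded l_def]
  have "cmod (trGHG X z) \<le> (\<Sum>k<N. l k * (cmod (1 / (of_real (l k) - z)))\<^sup>2)"
    unfolding l(3)[OF z] by (rule order_trans[OF norm_sum]) (auto simp: norm_mult norm_power l(1) intro!: sum_mono)
  then show ?thesis using sum_norm_sq_eq(3)[OF z l(2)[OF z]] by linarith
qed

text \<open>The resolvent at \<open>z\<close> is estimated by its supremum, the square at
  \<open>w\<close> together with the eigenvalue by the weighted sum of squares.\<close>

lemma trGHGG_bound:
  assumes z: "Im z \<noteq> 0" and w: "Im w \<noteq> 0"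
  shows "cmod (trGHGG X z w) \<le> real N * (cmod w * cmod (g X w)) / \<bar>Im w\<bar> / \<bar>Im z\<bar>"
proof -
  define l where "l = eig X"
  note l = eig[where X=X, folded l_def]
  have "cmod (trGHGG X z w) \<le> (\<Sum>k<N. (1 / \<bar>Im z\<bar>) * (l k * (cmod (1 / (of_real (l k) - w)))\<^sup>2))"
    unfolding l(4)[OF z w]
  proof (rule order_trans[OF norm_sum], rule sum_mono)
    fix k assume "k \<in> {..<N}"
    then have "0 \<le> l k" using l(1) by simp
    have "cmod (of_real (l k) * (1 / (of_real (l k) - z)) * (1 / (of_real (l k) - w))\<^sup>2) =
      cmod (1 / (of_real (l k) - z)) * (l k * (cmod (1 / (of_real (l k) - w)))\<^sup>2)"
      unfolding norm_mult norm_power norm_of_real abs_of_nonneg[OF \<open>0 \<le> l k\<close>] by (simp only: mult_ac)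
    also have "\<dots> \<le> (1 / \<bar>Im z\<bar>) * (l k * (cmod (1 / (of_real (l k) - w)))\<^sup>2)"
      using norm_inverse_real_diff(1)[OF z] \<open>0 \<le> l k\<close> by (intro mult_right_mono mult_nonneg_nonneg) auto
    finally show "cmod (of_real (l k) * (1 / (of_real (l k) - z)) * (1 / (of_real (l k) - w))\<^sup>2) \<le>
      (1 / \<bar>Im z\<bar>) * (l k * (cmod (1 / (of_real (l k) - w)))\<^sup>2)" .
  qed
  also have "\<dots> = (\<Sum>k<N. l k * (cmod (1 / (of_real (l k) - w)))\<^sup>2) / \<bar>Im z\<bar>"
    unfolding sum_distrib_left[symmetric] by simp
  also have "\<dots> \<le> real N * (cmod w * cmod (g X w)) / \<bar>Im w\<bar> / \<bar>Im z\<bar>"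
    by (rule divide_right_mono[OF sum_norm_sq_eq(3)[OF w l(2)[OF w]]]) simp
  finally show ?thesis .
qed

text \<open>The difference quotient of \<open>g\<close> differs from the derivative by a sum of
  triple resolvents, which a supremum and a sum of squares control. If w' lies at distance
  \<epsilon> |Im w|, with comparable imaginary part, the second term is of order \<epsilon> |g| /
  |Im w|. This improves on the trivial bound |g| / |Im w| once \<open>g\<close> is known to nearly
  agree at both points.\<close>

lemma dg_bound:
  assumes w: "Im w \<noteq> 0" and w': "Im w' \<noteq> 0" and ne: "w \<noteq> w'"
  shows "cmod (dg X w) \<le> cmod (g X w' - g X w) / cmod (w' - w) + cmod (w' - w) * cmod (g X w) / (\<bar>Im w\<bar> * \<bar>Im w'\<bar>)"
proof -
  define l where "l = eig X"
  note l = eig[where X=X, folded l_def]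
  let ?a = "\<lambda>k. 1 / (of_real (l k) - w)" and ?b = "\<lambda>k. 1 / (of_real (l k) - w')"
  have dgw: "of_nat N * dg X w = (\<Sum>k<N. (?a k)\<^sup>2)" unfolding l_def by (rule eig_dg[OF w])
  have "of_nat N * (dg X w - (g X w' - g X w) / (w' - w)) = (\<Sum>k<N. - (w' - w) * ((?a k)\<^sup>2 * ?b k))"
  proof -
    have "(w' - w) * ((?a k)\<^sup>2 - - (w' - w) * ((?a k)\<^sup>2 * ?b k)) = ?b k - ?a k" for k
      using norm_inverse_real_diff(2)[OF w, of "l k"] norm_inverse_real_diff(2)[OF w', of "l k"]
      by (simp add: power2_eq_square divide_simps)
    then have "(w' - w) * (\<Sum>k<N. (?a k)\<^sup>2 - - (w' - w) * ((?a k)\<^sup>2 * ?b k)) = (\<Sum>k<N. ?b k - ?a k)"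
      by (simp only: sum_distrib_left)
    also have "\<dots> = of_nat N * (g X w' - g X w)"
      by (simp only: right_diff_distrib l(2)[OF w] l(2)[OF w'] sum_subtractf)
    finally have "(w' - w) * (\<Sum>k<N. (?a k)\<^sup>2 - - (w' - w) * ((?a k)\<^sup>2 * ?b k)) = of_nat N * (g X w' - g X w)" .
    then have "of_nat N * ((g X w' - g X w) / (w' - w)) = (\<Sum>k<N. (?a k)\<^sup>2 - - (w' - w) * ((?a k)\<^sup>2 * ?b k))"
      using ne by (simp add: field_simps)
    then show ?thesis unfolding right_diff_distrib[of "of_nat N"] dgw by (simp add: sum_subtractf)
  qed
  then have "real N * cmod (dg X w - (g X w' - g X w) / (w' - w)) = cmod (\<Sum>k<N. - (w' - w) * ((?a k)\<^sup>2 * ?b k))"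
    by (metis norm_mult norm_of_nat)
  also have "\<dots> \<le> (\<Sum>k<N. cmod (w' - w) * (1 / \<bar>Im w'\<bar>) * (cmod (?a k))\<^sup>2)"
  proof (rule order_trans[OF norm_sum], rule sum_mono)
    fix k
    have "cmod (- (w' - w) * ((?a k)\<^sup>2 * ?b k)) = cmod (w' - w) * cmod (?b k) * (cmod (?a k))\<^sup>2"
      unfolding norm_mult norm_power norm_minus_cancel by (simp only: mult_ac)
    also have "\<dots> \<le> cmod (w' - w) * (1 / \<bar>Im w'\<bar>) * (cmod (?a k))\<^sup>2"
      using norm_inverse_real_diff(1)[OF w'] by (intro mult_right_mono mult_left_mono) auto
    finally show "cmod (- (w' - w) * ((?a k)\<^sup>2 * ?b k)) \<le> cmod (w' - w) * (1 / \<bar>Im w'\<bar>) * (cmod (?a k))\<^sup>2" .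
  qed
  also have "\<dots> \<le> cmod (w' - w) * (1 / \<bar>Im w'\<bar>) * (real N * cmod (g X w) / \<bar>Im w\<bar>)"
    unfolding sum_distrib_left[symmetric] by (rule mult_left_mono[OF sum_norm_sq_eq(2)[OF w l(2)[OF w]]]) simp
  also have "\<dots> = real N * (cmod (w' - w) * cmod (g X w) / (\<bar>Im w\<bar> * \<bar>Im w'\<bar>))" by (simp add: mult_ac)
  finally have "cmod (dg X w - (g X w' - g X w) / (w' - w)) \<le> cmod (w' - w) * cmod (g X w) / (\<bar>Im w\<bar> * \<bar>Im w'\<bar>)"
    using N_pos by (simp only: mult_le_cancel_left_pos of_nat_0_less_iff)
  then show ?thesis
    using norm_triangle_ineq2[of "dg X w" "(g X w' - g X w) / (w' - w)"] by (simp add: norm_divide)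
qed

text \<open>The sum of \<open>three_resolvents\<close> over the spectrum. The point z' stands in for
  z in the main term and has to differ from w; for z' = z the last error is 0, for z = w it is the
  price of moving away.\<close>

lemma trGHGG_approx:
  assumes z: "Im z \<noteq> 0" and z': "Im z' \<noteq> 0" and w: "Im w \<noteq> 0" and ne: "z' \<noteq> w"
  shows "cmod (trGHGG X z w / of_nat N - z * (g X z' - g X w) / (z' - w)\<^sup>2) \<le>
    cmod (dg X w) * (1 + cmod z / cmod (z' - w)) + cmod z * (cmod (z - z') * cmod (g X w) / (\<bar>Im w\<bar> * \<bar>Im z\<bar> * \<bar>Im z'\<bar>))"
proof -
  define l where "l = eig X"
  note l = eig[where X=X, folded l_def]
  let ?a = "\<lambda>k. 1 / (of_real (l k) - w)" and ?b = "\<lambda>k. 1 / (of_real (l k) - z')" and ?c = "\<lambda>k. 1 / (of_real (l k) - z)"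
  have nz: "of_real (l k) - w \<noteq> 0" "of_real (l k) - z' \<noteq> 0" "of_real (l k) - z \<noteq> 0" for k
    using norm_inverse_real_diff(2)[OF w, of "l k"] norm_inverse_real_diff(2)[OF z', of "l k"] norm_inverse_real_diff(2)[OF z, of "l k"] by auto
  have dgw: "of_nat N * dg X w = (\<Sum>k<N. (?a k)\<^sup>2)" unfolding l_def by (rule eig_dg[OF w])
  define E where "E = (\<Sum>k<N. (z - z') * (?b k * ?c k * (?a k)\<^sup>2))"
  have "trGHGG X z w = of_nat N * (dg X w * (1 - z / (z' - w)) + z * (g X z' - g X w) / (z' - w)\<^sup>2) + z * E"
  proof -
    have *: "of_real (l k) * ?c k * (?a k)\<^sup>2 = (?a k)\<^sup>2 * (1 - z / (z' - w)) + z / (z' - w)\<^sup>2 * (?b k - ?a k) + z * ((z - z') * (?b k * ?c k * (?a k)\<^sup>2))" for k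
    proof -
      have 1: "of_real (l k) * ?c k = 1 + z * ?c k" using nz(3)[of k] by (simp add: field_simps)
      have 2: "?c k = ?b k + (z - z') * (?b k * ?c k)" using nz[of k] by (simp add: divide_simps)
      have 3: "?b k * (?a k)\<^sup>2 = (?b k - ?a k) / (z' - w)\<^sup>2 - (?a k)\<^sup>2 / (z' - w)"
      proof -
        have "?b k * ?a k * (z' - w) = ?b k - ?a k" using nz[of k] by (simp add: divide_simps)
        then show ?thesis by (rule partial_fraction_square) (use ne in simp)
      qed
      show ?thesis by (rule three_resolvents[OF 1 2 3])
    qed
    have "trGHGG X z w = (\<Sum>k<N. (?a k)\<^sup>2) * (1 - z / (z' - w)) + z / (z' - w)\<^sup>2 * ((\<Sum>k<N. ?b k) - (\<Sum>k<N. ?a k)) + z * E"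
      unfolding l(4)[OF z w] E_def *
      by (simp only: sum.distrib sum_subtractf sum_distrib_left[symmetric] sum_distrib_right[symmetric])
    then show ?thesis unfolding dgw[symmetric] l(2)[OF w, symmetric] l(2)[OF z', symmetric]
      by (simp add: algebra_simps diff_divide_distrib)
  qed
  then have eq: "trGHGG X z w / of_nat N - z * (g X z' - g X w) / (z' - w)\<^sup>2 = dg X w * (1 - z / (z' - w)) + z * (E / of_nat N)"
    using N_pos by (simp add: field_simps)
  have "cmod E \<le> (\<Sum>k<N. cmod (z - z') * (1 / \<bar>Im z\<bar>) * (1 / \<bar>Im z'\<bar>) * (cmod (?a k))\<^sup>2)"
    unfolding E_def
  proof (rule order_trans[OF norm_sum], rule sum_mono)
    fix k
    have "cmod ((z - z') * (?b k * ?c k * (?a k)\<^sup>2)) = cmod (z - z') * cmod (?c k) * cmod (?b k) * (cmod (?a k))\<^sup>2"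
      unfolding norm_mult norm_power by (simp only: mult_ac)
    also have "\<dots> \<le> cmod (z - z') * (1 / \<bar>Im z\<bar>) * (1 / \<bar>Im z'\<bar>) * (cmod (?a k))\<^sup>2"
      using norm_inverse_real_diff(1)[OF z'] norm_inverse_real_diff(1)[OF z] by (intro mult_right_mono mult_mono) auto
    finally show "cmod ((z - z') * (?b k * ?c k * (?a k)\<^sup>2)) \<le> cmod (z - z') * (1 / \<bar>Im z\<bar>) * (1 / \<bar>Im z'\<bar>) * (cmod (?a k))\<^sup>2" .
  qed
  also have "\<dots> \<le> cmod (z - z') * (1 / \<bar>Im z\<bar>) * (1 / \<bar>Im z'\<bar>) * (real N * cmod (g X w) / \<bar>Im w\<bar>)"
    unfolding sum_distrib_left[symmetric] by (rule mult_left_mono[OF sum_norm_sq_eq(2)[OF w l(2)[OF w]]]) simp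
  also have "\<dots> = real N * (cmod (z - z') * cmod (g X w) / (\<bar>Im w\<bar> * \<bar>Im z\<bar> * \<bar>Im z'\<bar>))" by (simp add: mult_ac)
  finally have E: "cmod E / real N \<le> cmod (z - z') * cmod (g X w) / (\<bar>Im w\<bar> * \<bar>Im z\<bar> * \<bar>Im z'\<bar>)"
    using N_pos by (simp add: pos_divide_le_eq mult.commute)
  have "cmod (trGHGG X z w / of_nat N - z * (g X z' - g X w) / (z' - w)\<^sup>2) \<le>
    cmod (dg X w) * cmod (1 - z / (z' - w)) + cmod z * (cmod E / real N)"
    unfolding eq using norm_triangle_ineq[of "dg X w * (1 - z / (z' - w))" "z * (E / of_nat N)"]
    by (simp add: norm_mult norm_divide)
  also have "\<dots> \<le> cmod (dg X w) * (1 + cmod z / cmod (z' - w)) + cmod z * (cmod (z - z') * cmod (g X w) / (\<bar>Im w\<bar> * \<bar>Im z\<bar> * \<bar>Im z'\<bar>))"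
    using norm_triangle_ineq4[of 1 "z / (z' - w)"] E
    by (intro add_mono mult_left_mono) (auto simp: norm_divide)
  finally show ?thesis .
qed

end

section \<open>The local law\<close>

text \<open>Here \<gamma> = |g|, p = |mp z g| and \<epsilon> = 1 / (N Im z). The assumed inequality
  makes \<gamma>^2 of order 1 + p, so Young's inequality turns the mixed terms into half of p^2,
  which can be moved to the other side of the moment estimate, plus a multiple of
  \<epsilon>^2.\<close>

lemma quadratic_absorption:
  fixes U r R q :: real
  assumes U: "U > 0" and r: "r > 0" and R: "R \<ge> 0" and q: "q \<ge> 0"
  shows "\<exists>C\<ge>0. \<forall>\<gamma> p \<epsilon>. 0 \<le> \<gamma> \<longrightarrow> 0 \<le> p \<longrightarrow> 0 \<le> \<epsilon> \<longrightarrow> \<epsilon> \<le> 1 \<longrightarrow> U * r * \<gamma>\<^sup>2 \<le> p + q * \<gamma> + 1 \<longrightarrow>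
    U * R * \<epsilon> * \<gamma> * p + 2 * U * R * \<epsilon>\<^sup>2 * (q * \<gamma> + 2 * U * R * \<gamma>\<^sup>2) \<le> p\<^sup>2 / 2 + C * \<epsilon>\<^sup>2"
proof -
  define a where "a = U * r"
  have a: "a > 0" using U r by (simp add: a_def)
  \<comment> \<open>In a \<gamma>^2 <= p + q \<gamma> + 1 the linear term is absorbed by completing
    the square, which gives \<gamma>^2 <= K (1 + p).\<close>
  define D where "D = 1 + q\<^sup>2 / (2 * a)"
  define K where "K = 2 / a * D"
  define b where "b = U * R"
  have b: "b \<ge> 0" using U R by (simp add: b_def)
  define C1 where "C1 = b\<^sup>2 + 2 * b * q + 4 * b\<^sup>2"
  define C2 where "C2 = C1 * (1 + K)"
  have D: "D \<ge> 1" unfolding D_def using a by simp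
  have K: "K \<ge> 0" unfolding K_def using a D by simp
  have C1: "C1 \<ge> 0" unfolding C1_def using b q by simp
  have C2: "C2 \<ge> 0" unfolding C2_def using C1 K by simp
  show ?thesis
  proof (intro exI[of _ "C2 + C2\<^sup>2"] conjI allI impI)
    fix \<gamma> p \<epsilon> :: real
    assume g: "0 \<le> \<gamma>" and p: "0 \<le> p" and e: "0 \<le> \<epsilon>" "\<epsilon> \<le> 1" and h: "U * r * \<gamma>\<^sup>2 \<le> p + q * \<gamma> + 1"
    have "0 \<le> (a * \<gamma> - q)\<^sup>2 / (2 * a)" using a by simp
    also have "(a * \<gamma> - q)\<^sup>2 / (2 * a) = a * \<gamma>\<^sup>2 / 2 + q\<^sup>2 / (2 * a) - q * \<gamma>"
      using a by (simp add: power2_eq_square field_simps)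
    finally have "a / 2 * \<gamma>\<^sup>2 \<le> p + D" using h unfolding a_def[symmetric] D_def by simp
    also have "\<dots> \<le> D * (1 + p)" using D p mult_right_mono[of 1 D p] by (simp add: algebra_simps)
    finally have "\<gamma>\<^sup>2 \<le> K * (1 + p)" unfolding K_def using a by (simp add: field_simps)
    then have g2: "1 + \<gamma>\<^sup>2 \<le> (1 + K) * (1 + p)" using p by (simp add: algebra_simps)
    have "0 \<le> (p / 2 - b * \<epsilon> * \<gamma>)\<^sup>2" by simp
    then have 1: "b * \<epsilon> * \<gamma> * p \<le> p\<^sup>2 / 4 + \<epsilon>\<^sup>2 * (b\<^sup>2 * \<gamma>\<^sup>2)" by (simp add: power2_eq_square field_simps)
    have "0 \<le> (\<gamma> - 1)\<^sup>2" by simp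
    then have "2 * \<gamma> \<le> 1 + \<gamma>\<^sup>2" by (simp add: power2_eq_square algebra_simps)
    then have "\<gamma> \<le> 1 + \<gamma>\<^sup>2" using g by linarith
    then have "q * \<gamma> \<le> q * (1 + \<gamma>\<^sup>2)" using q by (rule mult_left_mono)
    then have *: "2 * b * (q * \<gamma> + 2 * b * \<gamma>\<^sup>2) \<le> 2 * b * (q * (1 + \<gamma>\<^sup>2) + 2 * b * \<gamma>\<^sup>2)" using b by (intro mult_left_mono) auto
    have "C1 * (1 + \<gamma>\<^sup>2) = b\<^sup>2 * \<gamma>\<^sup>2 + 2 * b * (q * (1 + \<gamma>\<^sup>2) + 2 * b * \<gamma>\<^sup>2) + 5 * b\<^sup>2"
      unfolding C1_def by (simp add: power2_eq_square algebra_simps)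
    then have "b\<^sup>2 * \<gamma>\<^sup>2 + 2 * b * (q * \<gamma> + 2 * b * \<gamma>\<^sup>2) \<le> C1 * (1 + \<gamma>\<^sup>2)"
      using * zero_le_power2[of b] by linarith
    also have "\<dots> \<le> C2 * (1 + p)" unfolding C2_def using mult_left_mono[OF g2 C1] by (simp add: mult.assoc)
    finally have 2: "\<epsilon>\<^sup>2 * (b\<^sup>2 * \<gamma>\<^sup>2 + 2 * b * (q * \<gamma> + 2 * b * \<gamma>\<^sup>2)) \<le> \<epsilon>\<^sup>2 * (C2 * (1 + p))"
      by (rule mult_left_mono) simp
    have "0 \<le> (p / 2 - C2 * \<epsilon>\<^sup>2)\<^sup>2" by simp
    then have 3: "\<epsilon>\<^sup>2 * (C2 * p) \<le> p\<^sup>2 / 4 + C2\<^sup>2 * (\<epsilon>\<^sup>2 * \<epsilon>\<^sup>2)" by (simp add: power2_eq_square field_simps)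
    have "\<epsilon>\<^sup>2 * \<epsilon>\<^sup>2 \<le> \<epsilon>\<^sup>2 * 1" using e by (intro mult_left_mono) (auto simp: power_le_one)
    then have 4: "C2\<^sup>2 * (\<epsilon>\<^sup>2 * \<epsilon>\<^sup>2) \<le> C2\<^sup>2 * \<epsilon>\<^sup>2" by (intro mult_left_mono) auto
    have "b * \<epsilon> * \<gamma> * p + 2 * b * \<epsilon>\<^sup>2 * (q * \<gamma> + 2 * b * \<gamma>\<^sup>2) \<le>
      p\<^sup>2 / 4 + \<epsilon>\<^sup>2 * (b\<^sup>2 * \<gamma>\<^sup>2 + 2 * b * (q * \<gamma> + 2 * b * \<gamma>\<^sup>2))" using 1 by (simp add: algebra_simps)
    also have "\<dots> \<le> p\<^sup>2 / 4 + \<epsilon>\<^sup>2 * (C2 * (1 + p))" using 2 by simp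
    also have "\<dots> \<le> p\<^sup>2 / 2 + (C2 + C2\<^sup>2) * \<epsilon>\<^sup>2" using 3 4 by (simp add: algebra_simps)
    finally show "U * R * \<epsilon> * \<gamma> * p + 2 * U * R * \<epsilon>\<^sup>2 * (q * \<gamma> + 2 * U * R * \<gamma>\<^sup>2) \<le> p\<^sup>2 / 2 + (C2 + C2\<^sup>2) * \<epsilon>\<^sup>2"
      unfolding b_def by (simp add: mult_ac)
  qed (use C2 in simp)
qed

text \<open>Naming the constant makes visible that it depends on these four parameters only, hence
  is uniform in N once they are fixed.\<close>

definition moment_const :: "real \<Rightarrow> real \<Rightarrow> real \<Rightarrow> real \<Rightarrow> real" where
  "moment_const U r R q = (SOME C. C \<ge> 0 \<and> (\<forall>\<gamma> p \<epsilon>. 0 \<le> \<gamma> \<longrightarrow> 0 \<le> p \<longrightarrow> 0 \<le> \<epsilon> \<longrightarrow> \<epsilon> \<le> 1 \<longrightarrow> U * r * \<gamma>\<^sup>2 \<le> p + q * \<gamma> + 1 \<longrightarrow>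
    U * R * \<epsilon> * \<gamma> * p + 2 * U * R * \<epsilon>\<^sup>2 * (q * \<gamma> + 2 * U * R * \<gamma>\<^sup>2) \<le> p\<^sup>2 / 2 + C * \<epsilon>\<^sup>2))"

lemma moment_const:
  fixes U r R q :: real
  assumes "U > 0" "r > 0" "R \<ge> 0" "q \<ge> 0"
  shows "moment_const U r R q \<ge> 0"
    "0 \<le> \<gamma> \<Longrightarrow> 0 \<le> p \<Longrightarrow> 0 \<le> \<epsilon> \<Longrightarrow> \<epsilon> \<le> 1 \<Longrightarrow> U * r * \<gamma>\<^sup>2 \<le> p + q * \<gamma> + 1 \<Longrightarrow>
      U * R * \<epsilon> * \<gamma> * p + 2 * U * R * \<epsilon>\<^sup>2 * (q * \<gamma> + 2 * U * R * \<gamma>\<^sup>2) \<le> p\<^sup>2 / 2 + moment_const U r R q * \<epsilon>\<^sup>2"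
  using someI_ex[OF quadratic_absorption[OF assms, unfolded Bex_def], folded moment_const_def] by auto

context wishart_ensemble
begin

text \<open>\<open>mp z\<close> is the Marchenko-Pastur quadratic; for \<open>z\<close> in the upper half plane
  its root there approximates \<open>g X z\<close>.\<close>

definition lin :: "complex \<Rightarrow> complex" where
  "lin z = z + of_real (u\<^sup>2) * (1 - of_nat m / of_nat N)"

definition mp :: "complex \<Rightarrow> complex \<Rightarrow> complex" where
  "mp z x = 1 + lin z * x + of_real (u\<^sup>2) * z * x\<^sup>2"

lemma nice_mp: "Im z \<noteq> 0 \<Longrightarrow> nice (\<lambda>X. mp z (g X z))"
  unfolding mp_def by (intro nice_intros nice_g)

lemma lin_cnj: "lin (cnj z) = cnj (lin z)" by (simp add: lin_def)

lemma mp_cnj: "mp (cnj z) (cnj x) = cnj (mp z x)" by (simp add: mp_def lin_cnj)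

text \<open>Division by N^2 collects the terms quadratic in \<open>trG\<close> into
  \<open>mp\<close>; the lower-order trace and the derivative of \<Phi> stay on the right. The
  functions \<open>\<phi> j\<close> are the partial derivatives of \<Phi> with respect to the traces
  \<open>trG\<close> at \<open>w j\<close>.\<close>

proposition scaled_loop_equation:
  assumes z: "Im z \<noteq> 0" and A: "finite A" and w: "\<And>j. j \<in> A \<Longrightarrow> Im (w j) \<noteq> 0"
    and \<Phi>: "nice \<Phi>" and \<phi>: "\<And>j. j \<in> A \<Longrightarrow> nice (\<phi> j)"
    and d: "\<And>\<nu> x X t. \<nu> < m \<Longrightarrow> x < N \<Longrightarrow> ((\<lambda>t. \<Phi> (X((\<nu>, x) := t))) has_vector_derivative
      (\<Sum>j\<in>A. \<phi> j (X((\<nu>, x) := t)) * (- (2 / of_nat N) * W (X((\<nu>, x) := t)) (w j) x \<nu>))) (at t)"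
  shows "(\<integral>\<omega>. mp z (g (cf \<omega>) z) * \<Phi> (cf \<omega>) \<partial>M) =
    - (of_real (u\<^sup>2) / (of_nat N)\<^sup>2) * ((\<integral>\<omega>. trGHG (cf \<omega>) z * \<Phi> (cf \<omega>) \<partial>M) +
      2 * (\<Sum>j\<in>A. \<integral>\<omega>. \<phi> j (cf \<omega>) * trGHGG (cf \<omega>) z (w j) \<partial>M))"
proof -
  have N0: "of_nat N \<noteq> (0 :: complex)" using N_pos by simp
  define a where "a X = of_nat N * (of_nat N + z * trG X z) * \<Phi> X" for X
  define b where "b X = (of_nat m * trG X z - trG X z * (of_nat N + z * trG X z) - trGHG X z) * \<Phi> X -
       2 * (\<Sum>j\<in>A. \<phi> j X * trGHGG X z (w j))" for X
  define c where "c X = trGHG X z * \<Phi> X" for X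
  define e where "e j X = \<phi> j X * trGHGG X z (w j)" for j X
  have na: "nice a" unfolding a_def by (intro nice_intros nice_trG z \<Phi>)
  have nb: "nice b" unfolding b_def by (intro nice_intros nice_trG nice_trGHG nice_trGHGG z w \<Phi> \<phi>)
  have nc: "nice c" unfolding c_def by (intro nice_intros nice_trGHG z \<Phi>)
  have ne: "nice (e j)" if "j \<in> A" for j unfolding e_def by (intro nice_intros nice_trGHGG z w \<phi> that)
  have pt: "(of_nat N)\<^sup>2 * (mp z (g X z) * \<Phi> X) = a X - of_real (u\<^sup>2) * (b X + c X + 2 * (\<Sum>j\<in>A. e j X))" for X
  proof -
    define T where "T = g X z"
    have T: "trG X z = of_nat N * T" unfolding T_def g_def using N0 by simp
    show ?thesis
      unfolding a_def b_def c_def e_def mp_def lin_def T T_def[symmetric] using N0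
      by (simp add: power2_eq_square field_simps)
  qed
  note ints = nice_integrable[OF na] nice_integrable[OF nb] nice_integrable[OF nc] nice_integrable[OF ne]
  have le: "(\<integral>\<omega>. a (cf \<omega>) \<partial>M) = of_real (u\<^sup>2) * (\<integral>\<omega>. b (cf \<omega>) \<partial>M)"
    unfolding a_def b_def by (rule loop_equation[OF z A w \<Phi> \<phi> d])
  have "(of_nat N)\<^sup>2 * (\<integral>\<omega>. mp z (g (cf \<omega>) z) * \<Phi> (cf \<omega>) \<partial>M) =
    (\<integral>\<omega>. a (cf \<omega>) - of_real (u\<^sup>2) * (b (cf \<omega>) + c (cf \<omega>) + 2 * (\<Sum>j\<in>A. e j (cf \<omega>))) \<partial>M)"
    by (simp only: pt[symmetric] integral_mult_right_zero)
  also have "\<dots> = (\<integral>\<omega>. a (cf \<omega>) \<partial>M) - of_real (u\<^sup>2) * ((\<integral>\<omega>. b (cf \<omega>) \<partial>M) + (\<integral>\<omega>. c (cf \<omega>) \<partial>M) + 2 * (\<Sum>j\<in>A. \<integral>\<omega>. e j (cf \<omega>) \<partial>M))"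
    using ints by simp
  also have "\<dots> = - of_real (u\<^sup>2) * ((\<integral>\<omega>. c (cf \<omega>) \<partial>M) + 2 * (\<Sum>j\<in>A. \<integral>\<omega>. e j (cf \<omega>) \<partial>M))"
    unfolding le by (simp add: algebra_simps)
  finally show ?thesis unfolding c_def e_def using N0 by (simp add: field_simps)
qed

lemma g_derivative:
  fixes X :: "nat \<times> nat \<Rightarrow> real"
  assumes "Im z \<noteq> 0" "\<nu> < m" "x < N"
  shows "((\<lambda>t. g (X((\<nu>, x) := t)) z) has_vector_derivative (1 / of_nat N) * (- (2 / of_nat N) * W (X((\<nu>, x) := t)) z x \<nu>)) (at t)"
  using has_vector_derivative_mult_right[OF trG_derivative[OF assms, of X t], of "1 / of_nat N"]
  unfolding g_def by simp

text \<open>The test function is \<open>cnj (mp z g)\<close>. No bootstrap in \<open>Im z\<close> is needed: \<open>|g|\<^sup>2\<close> on the right-hand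
  side is bounded by \<open>|mp z g|\<close> and lower order terms, which is what \<open>quadratic_absorption\<close> exploits.\<close>

lemma mp_second_moment:
  assumes z: "Im z > 0" and r: "r > 0" "r \<le> cmod z" and R: "cmod z \<le> R" and q: "cmod (lin z) \<le> q"
    and NI: "1 \<le> real N * Im z"
  shows "(\<integral>\<omega>. (cmod (mp z (g (cf \<omega>) z)))\<^sup>2 \<partial>M) \<le> 2 * moment_const (u\<^sup>2) r R q * (1 / (real N * Im z))\<^sup>2"
proof -
  \<comment> \<open>The conjugate of mp z g is the same expression at the conjugate point, so the
    test function is again a polynomial in a resolvent trace and its gradient is available.\<close>
  define z' where "z' = cnj z"
  have z0: "Im z \<noteq> 0" and z'0: "Im z' \<noteq> 0" using z by (auto simp: z'_def)
  define U where "U = u\<^sup>2"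
  have U: "U > 0" using u_pos by (simp add: U_def)
  define \<epsilon> where "\<epsilon> = 1 / (real N * Im z)"
  have \<epsilon>: "0 \<le> \<epsilon>" "\<epsilon> \<le> 1" using NI z by (auto simp: \<epsilon>_def divide_le_eq_1)
  have R0: "R \<ge> 0" "q \<ge> 0" using R q norm_ge_zero order_trans by blast+
  note mc = moment_const[OF U r(1) R0]
  define \<Phi> where "\<Phi> X = mp z' (g X z')" for X
  define \<phi> where "\<phi> X = (lin z' + 2 * of_real U * z' * g X z') * (1 / of_nat N)" for X
  have n\<Phi>: "nice \<Phi>" unfolding \<Phi>_def by (rule nice_mp[OF z'0])
  have n\<phi>: "nice \<phi>" unfolding \<phi>_def by (intro nice_intros nice_g z'0)
  have \<Phi>cnj: "\<Phi> X = cnj (mp z (g X z))" for X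
    unfolding \<Phi>_def z'_def g_cnj[OF z0] mp_cnj ..
  have d: "((\<lambda>t. \<Phi> (X((\<nu>, x) := t))) has_vector_derivative
      (\<Sum>j\<in>{0::nat}. \<phi> (X((\<nu>, x) := t)) * (- (2 / of_nat N) * W (X((\<nu>, x) := t)) z' x \<nu>))) (at t)"
    if "\<nu> < m" "x < N" for \<nu> x X t
  proof -
    define g' where "g' = (1 / of_nat N) * (- (2 / of_nat N) * W (X((\<nu>, x) := t)) z' x \<nu>)"
    note gd = g_derivative[OF z'0 that, of X t, folded g'_def]
    let ?g = "g (X((\<nu>, x) := t)) z'"
    have "((\<lambda>t. \<Phi> (X((\<nu>, x) := t))) has_vector_derivative
      0 + lin z' * g' + of_real (u\<^sup>2) * z' * (?g * g' + g' * ?g)) (at t)"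
      unfolding \<Phi>_def mp_def power2_eq_square[of "g _ _"]
      by (intro has_vector_derivative_add has_vector_derivative_const has_vector_derivative_mult_right has_vector_derivative_mult gd)
    moreover have "0 + lin z' * g' + of_real (u\<^sup>2) * z' * (?g * g' + g' * ?g) =
      (\<Sum>j\<in>{0::nat}. \<phi> (X((\<nu>, x) := t)) * (- (2 / of_nat N) * W (X((\<nu>, x) := t)) z' x \<nu>))"
      by (simp add: \<phi>_def U_def g'_def algebra_simps)
    ultimately show ?thesis by simp
  qed
  have eq: "(\<integral>\<omega>. mp z (g (cf \<omega>) z) * \<Phi> (cf \<omega>) \<partial>M) =
    - (of_real U / (of_nat N)\<^sup>2) * ((\<integral>\<omega>. trGHG (cf \<omega>) z * \<Phi> (cf \<omega>) \<partial>M) +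
      2 * (\<integral>\<omega>. \<phi> (cf \<omega>) * trGHGG (cf \<omega>) z z' \<partial>M))"
    using scaled_loop_equation[of z "{0::nat}" "\<lambda>_. z'" \<Phi> "\<lambda>_. \<phi>", OF z0 _ _ n\<Phi> n\<phi> d] z'0 by (simp add: U_def)
  define p where "p X = cmod (mp z (g X z))" for X
  define \<gamma> where "\<gamma> X = cmod (g X z)" for X
  have np: "integrable M (\<lambda>\<omega>. (p (cf \<omega>))\<^sup>2)"
  proof -
    have "integrable M (\<lambda>\<omega>. cmod (mp z (g (cf \<omega>) z) * \<Phi> (cf \<omega>)))"
      by (intro integrable_norm nice_integrable nice_mult nice_mp z0 n\<Phi>)
    then show ?thesis by (simp add: p_def \<Phi>cnj norm_mult power2_eq_square)
  qed
  have i1: "integrable M (\<lambda>\<omega>. cmod (trGHG (cf \<omega>) z * \<Phi> (cf \<omega>)))" "integrable M (\<lambda>\<omega>. cmod (\<phi> (cf \<omega>) * trGHGG (cf \<omega>) z z'))"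
    by (intro integrable_norm nice_integrable nice_mult nice_trGHG nice_trGHGG z0 z'0 n\<Phi> n\<phi>)+
  have "(\<integral>\<omega>. mp z (g (cf \<omega>) z) * \<Phi> (cf \<omega>) \<partial>M) = of_real (\<integral>\<omega>. (p (cf \<omega>))\<^sup>2 \<partial>M)"
    unfolding \<Phi>cnj p_def by (simp only: complex_norm_square[symmetric] integral_complex_of_real)
  then have "(\<integral>\<omega>. (p (cf \<omega>))\<^sup>2 \<partial>M) = cmod (\<integral>\<omega>. mp z (g (cf \<omega>) z) * \<Phi> (cf \<omega>) \<partial>M)"
    by (simp add: integral_nonneg_AE)
  also have "\<dots> = U / (real N)\<^sup>2 * cmod ((\<integral>\<omega>. trGHG (cf \<omega>) z * \<Phi> (cf \<omega>) \<partial>M) + 2 * (\<integral>\<omega>. \<phi> (cf \<omega>) * trGHGG (cf \<omega>) z z' \<partial>M))"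
    unfolding eq norm_mult using U by (simp add: norm_divide norm_power)
  also have "\<dots> \<le> U / (real N)\<^sup>2 * ((\<integral>\<omega>. cmod (trGHG (cf \<omega>) z * \<Phi> (cf \<omega>)) \<partial>M) + 2 * (\<integral>\<omega>. cmod (\<phi> (cf \<omega>) * trGHGG (cf \<omega>) z z') \<partial>M))"
  proof (rule mult_left_mono, rule order_trans[OF norm_triangle_ineq], rule add_mono)
    show "cmod (\<integral>\<omega>. trGHG (cf \<omega>) z * \<Phi> (cf \<omega>) \<partial>M) \<le> (\<integral>\<omega>. cmod (trGHG (cf \<omega>) z * \<Phi> (cf \<omega>)) \<partial>M)"
      by (rule integral_norm_bound)
    show "cmod (2 * (\<integral>\<omega>. \<phi> (cf \<omega>) * trGHGG (cf \<omega>) z z' \<partial>M)) \<le> 2 * (\<integral>\<omega>. cmod (\<phi> (cf \<omega>) * trGHGG (cf \<omega>) z z') \<partial>M)"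
      using integral_norm_bound[of M "\<lambda>\<omega>. \<phi> (cf \<omega>) * trGHGG (cf \<omega>) z z'"] by (simp add: norm_mult)
  qed (use U in simp)
  also have "\<dots> = (\<integral>\<omega>. U / (real N)\<^sup>2 * (cmod (trGHG (cf \<omega>) z * \<Phi> (cf \<omega>)) + 2 * cmod (\<phi> (cf \<omega>) * trGHGG (cf \<omega>) z z')) \<partial>M)"
    using i1 by simp
  also have "\<dots> \<le> (\<integral>\<omega>. (p (cf \<omega>))\<^sup>2 / 2 + moment_const U r R q * \<epsilon>\<^sup>2 \<partial>M)"
  proof (rule integral_mono)
    show "integrable M (\<lambda>\<omega>. U / (real N)\<^sup>2 * (cmod (trGHG (cf \<omega>) z * \<Phi> (cf \<omega>)) + 2 * cmod (\<phi> (cf \<omega>) * trGHGG (cf \<omega>) z z')))"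
      using i1 by (intro integrable_mult_right Bochner_Integration.integrable_add)
    show "integrable M (\<lambda>\<omega>. (p (cf \<omega>))\<^sup>2 / 2 + moment_const U r R q * \<epsilon>\<^sup>2)" using np by auto
    fix \<omega>
    let ?X = "cf \<omega>" and ?\<gamma> = "\<gamma> (cf \<omega>)" and ?p = "p (cf \<omega>)"
    have g0: "0 \<le> ?\<gamma>" "0 \<le> ?p" by (auto simp: \<gamma>_def p_def)
    have \<gamma>': "cmod (g ?X z') = ?\<gamma>" unfolding z'_def g_cnj[OF z0] \<gamma>_def by simp
    have cz': "cmod z' = cmod z" "\<bar>Im z'\<bar> = Im z" "\<bar>Im z\<bar> = Im z" using z by (auto simp: z'_def)
    have b1: "cmod (trGHG ?X z * \<Phi> ?X) \<le> (real N * (R * ?\<gamma>) / Im z) * ?p"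
    proof -
      have "cmod (trGHG ?X z) \<le> real N * (R * ?\<gamma>) / Im z"
        using trGHG_bound[OF z0, of ?X] z R g0
        by (rule_tac order_trans) (auto simp: \<gamma>_def intro!: divide_right_mono mult_left_mono mult_right_mono)
      then show ?thesis unfolding norm_mult \<Phi>cnj p_def by (intro mult_mono) (use R0 g0 z in auto)
    qed
    have b2: "cmod (\<phi> ?X * trGHGG ?X z z') \<le> ((q + 2 * U * R * ?\<gamma>) * (1 / real N)) * (real N * (R * ?\<gamma>) / Im z / Im z)"
      unfolding norm_mult
    proof (intro mult_mono)
      show "cmod (\<phi> ?X) \<le> (q + 2 * U * R * ?\<gamma>) * (1 / real N)"
      proof -
        have "cmod (lin z' + 2 * of_real U * z' * g ?X z') \<le> cmod (lin z') + cmod (2 * of_real U * z' * g ?X z')"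
          by (rule norm_triangle_ineq)
        also have "cmod (lin z') \<le> q" using q unfolding z'_def lin_cnj by simp
        also have "cmod (2 * of_real U * z' * g ?X z') = 2 * U * cmod z * ?\<gamma>" using U by (simp add: norm_mult \<gamma>' cz')
        also have "\<dots> \<le> 2 * U * R * ?\<gamma>" using U R g0 by (intro mult_right_mono mult_left_mono) auto
        finally show ?thesis unfolding \<phi>_def norm_mult
          by (simp only: norm_divide norm_one norm_of_nat) (intro mult_right_mono, auto)
      qed
      show "cmod (trGHGG ?X z z') \<le> real N * (R * ?\<gamma>) / Im z / Im z"
        using trGHGG_bound[OF z0 z'0, of ?X] unfolding \<gamma>' cz'
        by (rule order_trans) (use z R g0 in \<open>auto intro!: divide_right_mono mult_left_mono mult_right_mono\<close>)
    qed (use U R0 g0 in auto)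
    \<comment> \<open>Solved for its quadratic term, the definition of \<open>mp\<close> bounds
      |g|^2 in the form that \<open>moment_const\<close> asks for.\<close>
    have gr: "U * r * ?\<gamma>\<^sup>2 \<le> ?p + q * ?\<gamma> + 1"
    proof -
      have "cmod (of_real (u\<^sup>2) * z * (g ?X z)\<^sup>2) = cmod (mp z (g ?X z) - lin z * g ?X z - 1)" by (simp add: mp_def)
      also have "\<dots> \<le> cmod (mp z (g ?X z)) + cmod (lin z * g ?X z) + cmod 1"
        by (meson add_mono norm_triangle_ineq4 order_refl order_trans)
      also have "\<dots> \<le> ?p + q * ?\<gamma> + 1"
        unfolding p_def \<gamma>_def norm_mult using q by (intro add_mono mult_right_mono) auto
      finally have "U * cmod z * ?\<gamma>\<^sup>2 \<le> ?p + q * ?\<gamma> + 1" by (simp add: norm_mult norm_power U_def \<gamma>_def)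
      moreover have "U * r * ?\<gamma>\<^sup>2 \<le> U * cmod z * ?\<gamma>\<^sup>2" using U r by (intro mult_right_mono mult_left_mono) auto
      ultimately show ?thesis by linarith
    qed
    have "U / (real N)\<^sup>2 * (cmod (trGHG ?X z * \<Phi> ?X) + 2 * cmod (\<phi> ?X * trGHGG ?X z z')) \<le>
      U / (real N)\<^sup>2 * ((real N * (R * ?\<gamma>) / Im z) * ?p + 2 * (((q + 2 * U * R * ?\<gamma>) * (1 / real N)) * (real N * (R * ?\<gamma>) / Im z / Im z)))"
      using b1 b2 U by (intro mult_left_mono add_mono) auto
    also have "\<dots> = U * R * \<epsilon> * ?\<gamma> * ?p + 2 * U * R * \<epsilon>\<^sup>2 * (q * ?\<gamma> + 2 * U * R * ?\<gamma>\<^sup>2)"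
      unfolding \<epsilon>_def using N_pos z by (simp add: power2_eq_square field_simps)
    also have "\<dots> \<le> ?p\<^sup>2 / 2 + moment_const U r R q * \<epsilon>\<^sup>2" by (rule mc(2)[OF g0 \<epsilon> gr])
    finally show "U / (real N)\<^sup>2 * (cmod (trGHG ?X z * \<Phi> ?X) + 2 * cmod (\<phi> ?X * trGHGG ?X z z')) \<le> ?p\<^sup>2 / 2 + moment_const U r R q * \<epsilon>\<^sup>2" .
  qed
  also have "\<dots> = (\<integral>\<omega>. (p (cf \<omega>))\<^sup>2 \<partial>M) / 2 + moment_const U r R q * \<epsilon>\<^sup>2"
    using np by (simp add: prob_space)
  finally show ?thesis unfolding p_def U_def \<epsilon>_def by simp
qed

lemma local_law:
  assumes z: "Im z > 0" and r: "r > 0" "r \<le> cmod z" and R: "cmod z \<le> R" and q: "cmod (lin z) \<le> q"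
    and NI: "1 \<le> real N * Im z" and roots: "\<And>x. mp z x = of_real (u\<^sup>2) * z * (x - s) * (x - s')"
    and s': "Im s' \<le> - \<delta>" and \<delta>: "\<delta> > 0"
  shows "(\<integral>\<omega>. (cmod (g (cf \<omega>) z - s))\<^sup>2 \<partial>M) \<le>
    2 * moment_const (u\<^sup>2) r R q / (u\<^sup>2 * r * \<delta>)\<^sup>2 * (1 / (real N * Im z))\<^sup>2"
proof -
  have z0: "Im z \<noteq> 0" using z by simp
  \<comment> \<open>A lower bound for |u^2 z (g - s')|, the cofactor of g - s in
    \<open>mp\<close>.\<close>
  define k where "k = u\<^sup>2 * r * \<delta>"
  have k: "k > 0" using u_pos r \<delta> by (simp add: k_def)
  have i: "integrable M (\<lambda>\<omega>. (cmod (f (cf \<omega>)))\<^sup>2)" if "nice f" for f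
  proof -
    have "integrable M (\<lambda>\<omega>. cmod (f (cf \<omega>) * f (cf \<omega>)))"
      by (intro integrable_norm nice_integrable nice_mult that)
    then show ?thesis by (simp add: norm_mult power2_eq_square)
  qed
  have "(\<integral>\<omega>. (cmod (g (cf \<omega>) z - s))\<^sup>2 \<partial>M) \<le> (\<integral>\<omega>. (1 / k)\<^sup>2 * (cmod (mp z (g (cf \<omega>) z)))\<^sup>2 \<partial>M)"
  proof (rule integral_mono)
    show "integrable M (\<lambda>\<omega>. (cmod (g (cf \<omega>) z - s))\<^sup>2)" by (intro i nice_intros nice_g z0)
    show "integrable M (\<lambda>\<omega>. (1 / k)\<^sup>2 * (cmod (mp z (g (cf \<omega>) z)))\<^sup>2)" by (intro integrable_mult_right i nice_mp z0)
    fix \<omega>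
    let ?x = "g (cf \<omega>) z"
    have "\<delta> \<le> Im (?x - s')" using Im_g_nonneg[OF z, of "cf \<omega>"] s' by simp
    also have "\<dots> \<le> cmod (?x - s')" using abs_Im_le_cmod[of "?x - s'"] by linarith
    finally have "u\<^sup>2 * r * cmod (?x - s) * \<delta> \<le> u\<^sup>2 * cmod z * cmod (?x - s) * cmod (?x - s')"
      using r \<delta> by (intro mult_mono mult_right_mono mult_left_mono) auto
    also have "\<dots> = cmod (mp z ?x)" unfolding roots norm_mult by (simp add: norm_power)
    finally have "k * cmod (?x - s) \<le> cmod (mp z ?x)" by (simp add: k_def mult_ac)
    then have "cmod (?x - s) \<le> 1 / k * cmod (mp z ?x)" using k by (simp add: field_simps)
    then have "(cmod (?x - s))\<^sup>2 \<le> (1 / k * cmod (mp z ?x))\<^sup>2" by (intro power_mono) auto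
    then show "(cmod (?x - s))\<^sup>2 \<le> (1 / k)\<^sup>2 * (cmod (mp z ?x))\<^sup>2" by (simp add: power_mult_distrib power_divide)
  qed
  also have "\<dots> = (1 / k)\<^sup>2 * (\<integral>\<omega>. (cmod (mp z (g (cf \<omega>) z)))\<^sup>2 \<partial>M)" by simp
  also have "\<dots> \<le> (1 / k)\<^sup>2 * (2 * moment_const (u\<^sup>2) r R q * (1 / (real N * Im z))\<^sup>2)"
    by (intro mult_left_mono mp_second_moment z r R q NI) auto
  finally show ?thesis by (simp add: k_def power_divide)
qed

end

section \<open>Convergence to zero in mean, and the quadratic in the bulk\<close>

context prob_space
begin

text \<open>For nonnegative \<open>F\<close> this is convergence to 0 in mean. Integrability is
  included because a non-integrable function has integral 0 by convention.\<close>

definition small :: "(nat \<Rightarrow> 'a \<Rightarrow> real) \<Rightarrow> bool" where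
  "small F \<longleftrightarrow> (\<forall>\<^sub>F N in sequentially. integrable M (F N)) \<and> (\<lambda>N. \<integral>\<omega>. F N \<omega> \<partial>M) \<longlonglongrightarrow> 0"

lemma small_const: "c \<longlonglongrightarrow> 0 \<Longrightarrow> small (\<lambda>N _. c N)"
  by (simp add: small_def prob_space)

lemma small_add:
  assumes "small F" "small G"
  shows "small (\<lambda>N \<omega>. F N \<omega> + G N \<omega>)"
proof -
  have e: "\<forall>\<^sub>F N in sequentially. integrable M (F N) \<and> integrable M (G N)"
    using assms unfolding small_def by (auto elim: eventually_elim2)
  have "(\<lambda>N. (\<integral>\<omega>. F N \<omega> \<partial>M) + (\<integral>\<omega>. G N \<omega> \<partial>M)) \<longlonglongrightarrow> 0 + 0"
    using assms unfolding small_def by (intro tendsto_add) auto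
  then have "(\<lambda>N. \<integral>\<omega>. F N \<omega> + G N \<omega> \<partial>M) \<longlonglongrightarrow> 0"
    by (rule_tac Lim_transform_eventually) (use e in \<open>auto elim!: eventually_mono\<close>)
  then show ?thesis unfolding small_def using e by (auto elim!: eventually_mono)
qed

lemma small_mult:
  assumes F: "small F" and c: "c \<longlonglongrightarrow> (c0 :: real)"
  shows "small (\<lambda>N \<omega>. c N * F N \<omega>)"
proof -
  have "(\<lambda>N. c N * (\<integral>\<omega>. F N \<omega> \<partial>M)) \<longlonglongrightarrow> c0 * 0"
    using F c unfolding small_def by (intro tendsto_mult) auto
  then show ?thesis using F unfolding small_def by (auto elim!: eventually_mono)
qed

text \<open>The error \<epsilon> is fixed before N grows. This admits comparison functions built
  with a shift that tends to 0 only afterwards.\<close>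

lemma small_approx:
  assumes F: "\<forall>\<^sub>F N in sequentially. F N \<in> borel_measurable M"
    and *: "\<And>\<epsilon>. \<epsilon> > 0 \<Longrightarrow> \<exists>S. small S \<and> (\<forall>\<^sub>F N in sequentially. \<forall>\<omega>. 0 \<le> F N \<omega> \<and> F N \<omega> \<le> S N \<omega> + \<epsilon>)"
  shows "small F"
proof -
  have int: "\<forall>\<^sub>F N in sequentially. integrable M (F N)"
  proof -
    obtain S where S: "small S" "\<forall>\<^sub>F N in sequentially. \<forall>\<omega>. 0 \<le> F N \<omega> \<and> F N \<omega> \<le> S N \<omega> + 1" using *[of 1] by auto
    from S(1) have "\<forall>\<^sub>F N in sequentially. integrable M (S N)" by (simp add: small_def)
    with S(2) F show ?thesis
    proof eventually_elim
      case (elim N)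
      show ?case
      proof (rule Bochner_Integration.integrable_bound[where f="\<lambda>\<omega>. S N \<omega> + 1"])
        show "AE \<omega> in M. norm (F N \<omega>) \<le> norm (S N \<omega> + 1)"
        proof (rule AE_I2)
          fix \<omega> show "norm (F N \<omega>) \<le> norm (S N \<omega> + 1)" using elim(1)[rule_format, of \<omega>] by simp
        qed
      qed (use elim in auto)
    qed
  qed
  moreover have "(\<lambda>N. \<integral>\<omega>. F N \<omega> \<partial>M) \<longlonglongrightarrow> 0"
  proof (rule LIMSEQ_I)
    fix r :: real assume r: "0 < r"
    obtain S where S: "small S" "\<forall>\<^sub>F N in sequentially. \<forall>\<omega>. 0 \<le> F N \<omega> \<and> F N \<omega> \<le> S N \<omega> + r/2" using *[of "r/2"] r by auto
    have "\<forall>\<^sub>F N in sequentially. (\<integral>\<omega>. S N \<omega> \<partial>M) < r/2" using S(1) r unfolding small_def by (intro order_tendstoD) auto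
    moreover from S(1) have "\<forall>\<^sub>F N in sequentially. integrable M (S N)" by (simp add: small_def)
    ultimately have "\<forall>\<^sub>F N in sequentially. norm ((\<integral>\<omega>. F N \<omega> \<partial>M) - 0) < r"
      using S(2) int
    proof eventually_elim
      case (elim N)
      have "(\<integral>\<omega>. F N \<omega> \<partial>M) \<le> (\<integral>\<omega>. S N \<omega> + r/2 \<partial>M)" using elim by (intro integral_mono) auto
      also have "\<dots> = (\<integral>\<omega>. S N \<omega> \<partial>M) + r/2" using elim by (simp add: prob_space)
      finally show ?case using elim integral_nonneg_AE[of "F N" M] by auto
    qed
    then show "\<exists>no. \<forall>n\<ge>no. norm ((\<integral>\<omega>. F n \<omega> \<partial>M) - 0) < r" unfolding eventually_sequentially by blast
  qed
  ultimately show ?thesis unfolding small_def by blast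
qed

lemma small_mono:
  assumes "\<forall>\<^sub>F N in sequentially. F N \<in> borel_measurable M" "small S"
    "\<forall>\<^sub>F N in sequentially. \<forall>\<omega>. 0 \<le> F N \<omega> \<and> F N \<omega> \<le> S N \<omega>"
  shows "small F"
  using assms(1)
proof (rule small_approx)
  fix \<epsilon> :: real assume "\<epsilon> > 0"
  from assms(3) have "\<forall>\<^sub>F N in sequentially. \<forall>\<omega>. 0 \<le> F N \<omega> \<and> F N \<omega> \<le> S N \<omega> + \<epsilon>"
  proof eventually_elim
    case (elim N) then show ?case using \<open>\<epsilon> > 0\<close> by (metis add_increasing2 less_imp_le)
  qed
  then show "\<exists>S. small S \<and> (\<forall>\<^sub>F N in sequentially. \<forall>\<omega>. 0 \<le> F N \<omega> \<and> F N \<omega> \<le> S N \<omega> + \<epsilon>)" using assms(2) by blast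
qed

end

text \<open>The square root is taken of minus the discriminant, which in the bulk is close to a
  positive number. So \<open>csqrt\<close> is used away from its branch cut, and both roots converge
  along with the coefficients.\<close>

lemma quadratic_roots:
  fixes a z b x :: complex
  assumes "a \<noteq> 0" "z \<noteq> 0"
  defines "r \<equiv> csqrt (- (b\<^sup>2 - 4 * a * z))"
  shows "1 + b * x + a * z * x\<^sup>2 = a * z * (x - (- b + \<i> * r) / (2 * a * z)) * (x - (- b - \<i> * r) / (2 * a * z))"
proof -
  have r: "r * r = 4 * a * z - b\<^sup>2" using power2_csqrt[of "- (b\<^sup>2 - 4 * a * z)"] by (simp add: r_def power2_eq_square)
  define d where "d = 2 * a * z"
  have d: "d \<noteq> 0" "a * z = d / 2" using assms by (auto simp: d_def)
  define w where "w = (x - (- b + \<i> * r) / d) * (x - (- b - \<i> * r) / d)"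
  have "w * (d * d) = (d * x + b - \<i> * r) * (d * x + b + \<i> * r)"
    using d(1) unfolding w_def by (simp add: field_simps)
  also have "\<dots> = (d * x + b) * (d * x + b) + r * r" by (simp add: algebra_simps)
  also have "\<dots> = (1 + b * x + a * z * x\<^sup>2) * (2 * d)"
    unfolding r by (simp add: d_def power2_eq_square algebra_simps)
  finally have "1 + b * x + a * z * x\<^sup>2 = w * (d * d) / (2 * d)"
    using d(1) by (simp add: eq_divide_eq)
  also have "\<dots> = a * z * w" unfolding d(2) using d(1) by simp
  finally show ?thesis unfolding w_def d_def by (simp add: mult_ac)
qed

text \<open>The gap 4 u^2 l - (l + u^2 (1 - c))^2 equals the product of the distances of
  \<open>l\<close> to the two spectral edges.\<close>

lemma bulk_discriminant_neg:
  fixes u c l :: real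
  assumes u: "u > 0" and c: "c > 0" and l: "u\<^sup>2 * (1 - sqrt c)\<^sup>2 < l" "l < u\<^sup>2 * (1 + sqrt c)\<^sup>2"
  shows "0 < l" "(l + u\<^sup>2 * (1 - c))\<^sup>2 < 4 * u\<^sup>2 * l"
proof -
  have "0 \<le> u\<^sup>2 * (1 - sqrt c)\<^sup>2" by simp
  then show l0: "0 < l" using l by linarith
  have sc: "sqrt c * sqrt c = c" using c by simp
  have "(l - u\<^sup>2 * (1 - sqrt c)\<^sup>2) * (u\<^sup>2 * (1 + sqrt c)\<^sup>2 - l) > 0" using l by simp
  also have "(l - u\<^sup>2 * (1 - sqrt c)\<^sup>2) * (u\<^sup>2 * (1 + sqrt c)\<^sup>2 - l) =
    2 * l * u\<^sup>2 * (1 + sqrt c * sqrt c) - l\<^sup>2 - (u\<^sup>2)\<^sup>2 * ((1 - sqrt c * sqrt c))\<^sup>2"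
    by (simp add: power2_eq_square algebra_simps)
  also have "\<dots> = 4 * u\<^sup>2 * l - (l + u\<^sup>2 * (1 - c))\<^sup>2"
    unfolding sc by (simp add: power2_eq_square algebra_simps)
  finally show "(l + u\<^sup>2 * (1 - c))\<^sup>2 < 4 * u\<^sup>2 * l" by simp
qed

section \<open>Mesoscopic limits\<close>

locale mesoscopic = prob_space M for M :: "'a measure" +
  fixes Z :: "nat \<times> nat \<Rightarrow> 'a \<Rightarrow> real" and m :: "nat \<Rightarrow> nat" and u c \<alpha> l :: real
  assumes u_pos: "u > 0" and c_pos: "c > 0" and \<alpha>: "0 < \<alpha>" "\<alpha> < 1"
    and bulk: "u\<^sup>2 * (1 - sqrt c)\<^sup>2 < l" "l < u\<^sup>2 * (1 + sqrt c)\<^sup>2"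
    and ratio: "(\<lambda>N. real (m N) / real N) \<longlonglongrightarrow> c"
    and ens: "\<And>N. 0 < N \<Longrightarrow> wishart_ensemble (m N) N M Z u"
begin

definition \<eta> :: "nat \<Rightarrow> real" where "\<eta> N = real N powr (- \<alpha>)"

text \<open>Local coordinates at \<open>l\<close>: p = \<tau> + i stands for the point l + \<tau>
  \<eta> + i \<eta>.\<close>

definition zz :: "nat \<Rightarrow> complex \<Rightarrow> complex" where "zz N p = of_real l + of_real (\<eta> N) * p"

abbreviation cfg :: "'a \<Rightarrow> nat \<times> nat \<Rightarrow> real" where "cfg \<omega> \<equiv> (\<lambda>i. Z i \<omega>)"

definition GG :: "nat \<Rightarrow> complex \<Rightarrow> 'a \<Rightarrow> complex" where "GG N p \<omega> = wishart.g (m N) N (cfg \<omega>) (zz N p)"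
definition DG :: "nat \<Rightarrow> complex \<Rightarrow> 'a \<Rightarrow> complex" where "DG N p \<omega> = wishart.dg (m N) N (cfg \<omega>) (zz N p)"
text \<open>The covariance kernel per dimension; times \<eta>^2 it has a deterministic limit, see
  \<open>AA_small\<close>.\<close>

definition AA :: "nat \<Rightarrow> complex \<Rightarrow> complex \<Rightarrow> 'a \<Rightarrow> complex" where
  "AA N p q \<omega> = wishart.trGHGG (m N) N (cfg \<omega>) (zz N p) (zz N q) / of_nat N"

lemma \<eta>_pos: "0 < N \<Longrightarrow> 0 < \<eta> N" by (simp add: \<eta>_def)

lemma \<eta>_lim: "\<eta> \<longlonglongrightarrow> 0"
  unfolding \<eta>_def using \<alpha> by (intro tendsto_neg_powr filterlim_real_sequentially) auto

text \<open>Here \<alpha> < 1 enters: the scale \<eta> stays well above the typical eigenvalue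
  spacing 1/N.\<close>

lemma N\<eta>_lim: "filterlim (\<lambda>N. real N * \<eta> N) at_top sequentially"
proof -
  have "filterlim (\<lambda>N. exp ((1 - \<alpha>) * ln (real N))) at_top sequentially"
    using \<alpha> by (intro filterlim_compose[OF exp_at_top] filterlim_tendsto_pos_mult_at_top[OF tendsto_const]
      filterlim_compose[OF ln_at_top filterlim_real_sequentially]) auto
  moreover have "\<forall>\<^sub>F N in sequentially. exp ((1 - \<alpha>) * ln (real N)) = real N * \<eta> N"
    using eventually_gt_at_top[of 0]
  proof eventually_elim
    case (elim N)
    have "(1 - \<alpha>) * ln (real N) = ln (real N) + (- \<alpha> * ln (real N))" by (simp add: algebra_simps)
    then have "exp ((1 - \<alpha>) * ln (real N)) = exp (ln (real N)) * exp (- \<alpha> * ln (real N))" by (simp only: exp_add)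
    then show ?case using elim by (simp add: \<eta>_def powr_def)
  qed
  ultimately show ?thesis by (subst (asm) filterlim_cong[OF refl refl])
qed

lemma inverse_N\<eta>_lim: "(\<lambda>N. 1 / (real N * \<eta> N)) \<longlonglongrightarrow> 0"
  using tendsto_divide_0[OF tendsto_const, of "\<lambda>N. real N * \<eta> N" sequentially 1]
    filterlim_at_top_imp_at_infinity[OF N\<eta>_lim] by simp

lemma l_pos: "0 < l" using bulk_discriminant_neg(1)[OF u_pos c_pos bulk] .

lemma Im_zz: "Im (zz N p) = \<eta> N * Im p" by (simp add: zz_def)

lemma Im_zz_nonzero: "0 < N \<Longrightarrow> Im p \<noteq> 0 \<Longrightarrow> Im (zz N p) \<noteq> 0" using \<eta>_pos[of N] by (simp add: Im_zz)

lemma zz_diff: "zz N p - zz N q = of_real (\<eta> N) * (p - q)" by (simp add: zz_def algebra_simps)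

lemma zz_cnj: "zz N (cnj p) = cnj (zz N p)" by (simp add: zz_def)

lemma zz_lim: "(\<lambda>N. zz N p) \<longlonglongrightarrow> of_real l"
proof -
  have "(\<lambda>N. of_real l + of_real (\<eta> N) * p) \<longlonglongrightarrow> of_real l + of_real 0 * p"
    by (intro tendsto_intros \<eta>_lim)
  then show ?thesis by (simp add: zz_def)
qed

lemma GG_cnj: "0 < N \<Longrightarrow> Im p \<noteq> 0 \<Longrightarrow> GG N (cnj p) \<omega> = cnj (GG N p \<omega>)"
  unfolding GG_def zz_cnj using wishart.g_cnj[OF wishart_ensemble.axioms(1)[OF ens] Im_zz_nonzero] by blast

lemma GG_integrable: "0 < N \<Longrightarrow> Im p \<noteq> 0 \<Longrightarrow> integrable M (GG N p)"
  unfolding GG_def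
  by (rule wishart_ensemble.nice_integrable[OF ens wishart.nice_g[OF wishart_ensemble.axioms(1)[OF ens]]]) (auto simp: Im_zz_nonzero)

lemma DG_integrable: "0 < N \<Longrightarrow> Im p \<noteq> 0 \<Longrightarrow> integrable M (DG N p)"
  unfolding DG_def
  by (rule wishart_ensemble.nice_integrable[OF ens wishart.nice_dg[OF wishart_ensemble.axioms(1)[OF ens]]]) (auto simp: Im_zz_nonzero)

lemma AA_integrable:
  assumes "0 < N" "Im p \<noteq> 0" "Im q \<noteq> 0"
  shows "integrable M (AA N p q)"
proof -
  have "integrable M (\<lambda>\<omega>. wishart.trGHGG (m N) N (cfg \<omega>) (zz N p) (zz N q))"
    by (rule wishart_ensemble.nice_integrable[OF ens wishart.nice_trGHGG[OF wishart_ensemble.axioms(1)[OF ens]]]) (use assms in \<open>auto simp: Im_zz_nonzero\<close>)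
  then show ?thesis unfolding AA_def by simp
qed

section \<open>The local law at rescaled points\<close>

definition lin_lim :: real where "lin_lim = l + u\<^sup>2 * (1 - c)"

definition \<rho> :: real where "\<rho> = sqrt (4 * u\<^sup>2 * l - lin_lim\<^sup>2)"

text \<open>The boundary value at \<open>l\<close>, from the upper half-plane, of the Stieltjes
  transform of the Marchenko-Pastur law.\<close>

definition s0 :: complex where "s0 = (- of_real lin_lim + \<i> * of_real \<rho>) / (2 * of_real (u\<^sup>2) * of_real l)"

text \<open>The limit of \<open>GG\<close>. It depends on the sign of Im p only: on the scale \<eta>
  the limiting transform is constant on either side of the real axis and jumps across it.\<close>

definition sg :: "complex \<Rightarrow> complex" where "sg p = (if Im p > 0 then s0 else cnj s0)"

lemma \<rho>_pos: "\<rho> > 0"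
  using bulk_discriminant_neg(2)[OF u_pos c_pos bulk] by (simp add: \<rho>_def lin_lim_def)

lemma Im_s0: "Im s0 > 0"
proof -
  have "s0 = Complex (- lin_lim / (2 * u\<^sup>2 * l)) (\<rho> / (2 * u\<^sup>2 * l))"
    unfolding s0_def using u_pos l_pos by (simp add: complex_eq_iff Re_divide Im_divide power2_eq_square field_simps)
  then show ?thesis using \<rho>_pos u_pos l_pos by simp
qed


lemma lin_tendsto: "(\<lambda>N. wishart_ensemble.lin (m N) N u (zz N p)) \<longlonglongrightarrow> of_real lin_lim"
proof -
  have "(\<lambda>N. zz N p + of_real (u\<^sup>2) * (1 - of_real (real (m N) / real N))) \<longlonglongrightarrow> of_real l + of_real (u\<^sup>2) * (1 - of_real c)"
    by (intro tendsto_intros zz_lim ratio)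
  moreover have "\<forall>\<^sub>F N in sequentially. zz N p + of_real (u\<^sup>2) * (1 - of_real (real (m N) / real N)) = wishart_ensemble.lin (m N) N u (zz N p)"
    using eventually_gt_at_top[of 0]
  proof eventually_elim
    case (elim N)
    show ?case unfolding wishart_ensemble.lin_def[OF ens[OF elim]] by simp
  qed
  ultimately have "(\<lambda>N. wishart_ensemble.lin (m N) N u (zz N p)) \<longlonglongrightarrow> of_real l + of_real (u\<^sup>2) * (1 - of_real c)"
    by (rule Lim_transform_eventually)
  then show ?thesis by (simp add: lin_lim_def)
qed

text \<open>The exact roots for finite N are kept because m/N tends to c without any rate: the bound
  of order 1/(N \<eta>)^2 holds around \<open>s N\<close> and might fail around
  \<open>s0\<close>.\<close>

lemma local_law_upper:
  assumes p: "Im p > 0"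
  shows "\<exists>s s' C. s \<longlonglongrightarrow> s0 \<and> s' \<longlonglongrightarrow> cnj s0 \<and>
    (\<forall>\<^sub>F N in sequentially. \<forall>x. wishart_ensemble.mp (m N) N u (zz N p) x = of_real (u\<^sup>2) * zz N p * (x - s N) * (x - s' N)) \<and>
    (\<forall>\<^sub>F N in sequentially. (\<integral>\<omega>. (cmod (GG N p \<omega> - s N))\<^sup>2 \<partial>M) \<le> C * (1 / (real N * \<eta> N))\<^sup>2)"
proof -
  define b where "b N = wishart_ensemble.lin (m N) N u (zz N p)" for N
  define a :: complex where "a = of_real (u\<^sup>2)"
  define r where "r N = csqrt (- ((b N)\<^sup>2 - 4 * a * zz N p))" for N
  define s where "s N = (- b N + \<i> * r N) / (2 * a * zz N p)" for N
  define s' where "s' N = (- b N - \<i> * r N) / (2 * a * zz N p)" for N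
  have a0: "a \<noteq> 0" using u_pos by (simp add: a_def)
  have bl: "b \<longlonglongrightarrow> of_real lin_lim" unfolding b_def by (rule lin_tendsto)
  have D: "4 * u\<^sup>2 * l - lin_lim\<^sup>2 > 0" using bulk_discriminant_neg(2)[OF u_pos c_pos bulk] by (simp add: lin_lim_def)
  have arg: "(\<lambda>N. - ((b N)\<^sup>2 - 4 * a * zz N p)) \<longlonglongrightarrow> of_real (4 * u\<^sup>2 * l - lin_lim\<^sup>2)"
  proof -
    have "(\<lambda>N. - ((b N)\<^sup>2 - 4 * a * zz N p)) \<longlonglongrightarrow> - ((of_real lin_lim)\<^sup>2 - 4 * a * of_real l)"
      by (intro tendsto_intros bl zz_lim)
    then show ?thesis by (simp add: a_def)
  qed
  have rl: "r \<longlonglongrightarrow> of_real \<rho>"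
  proof -
    have "of_real (4 * u\<^sup>2 * l - lin_lim\<^sup>2) \<notin> (\<real>\<^sub>\<le>\<^sub>0 :: complex set)" using D by (simp add: nonpos_Reals_of_real_iff del: of_real_diff of_real_mult)
    then have "isCont csqrt (of_real (4 * u\<^sup>2 * l - lin_lim\<^sup>2))" by (rule continuous_at_csqrt)
    from isCont_tendsto_compose[OF this arg] show ?thesis
      using D unfolding r_def \<rho>_def by (simp add: csqrt_of_real_nonneg del: of_real_diff of_real_mult)
  qed
  have den: "2 * a * of_real l \<noteq> 0" using a0 l_pos by simp
  have sl: "s \<longlonglongrightarrow> s0"
    unfolding s_def s0_def a_def[symmetric] by (intro tendsto_intros bl rl zz_lim den)
  have "s' \<longlonglongrightarrow> (- of_real lin_lim - \<i> * of_real \<rho>) / (2 * a * of_real l)"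
    unfolding s'_def by (intro tendsto_intros bl rl zz_lim den)
  also have "(- of_real lin_lim - \<i> * of_real \<rho>) / (2 * a * of_real l) = cnj s0"
    by (simp add: s0_def a_def)
  finally have s'l: "s' \<longlonglongrightarrow> cnj s0" .
  \<comment> \<open>Half of the limiting gap, so that Im s' < - \<delta> holds eventually.\<close>
  define \<delta> where "\<delta> = Im s0 / 2"
  have \<delta>: "\<delta> > 0" using Im_s0 by (simp add: \<delta>_def)
  have roots: "wishart_ensemble.mp (m N) N u (zz N p) x = of_real (u\<^sup>2) * zz N p * (x - s N) * (x - s' N)" if "0 < N" for N x
  proof -
    have "zz N p \<noteq> 0" using Im_zz_nonzero[OF that, of p] p by auto
    from quadratic_roots[OF a0 this, of "b N" x] show ?thesis
      unfolding wishart_ensemble.mp_def[OF ens[OF that]] b_def[symmetric] r_def[symmetric] s_def[symmetric] s'_def[symmetric] a_def[symmetric] .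
  qed
  \<comment> \<open>The arguments l/2, l + 1 and |lin_lim| + 1 are bounds for |z| and |lin z| valid
    for large N, as these quantities tend to l and |lin_lim|.\<close>
  define C where "C = 2 * moment_const (u\<^sup>2) (l/2) (l+1) (\<bar>lin_lim\<bar> + 1) / (u\<^sup>2 * (l/2) * \<delta>)\<^sup>2"
  have e1: "\<forall>\<^sub>F N in sequentially. l / 2 < cmod (zz N p)" "\<forall>\<^sub>F N in sequentially. cmod (zz N p) < l + 1"
    using order_tendstoD(1)[OF tendsto_norm[OF zz_lim, of p], of "l/2"]
      order_tendstoD(2)[OF tendsto_norm[OF zz_lim, of p], of "l+1"] l_pos by auto
  have e2: "\<forall>\<^sub>F N in sequentially. cmod (b N) < \<bar>lin_lim\<bar> + 1"
    using order_tendstoD(2)[OF tendsto_norm[OF bl], of "\<bar>lin_lim\<bar> + 1"] by simp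
  have e3: "\<forall>\<^sub>F N in sequentially. Im (s' N) < - \<delta>"
    using order_tendstoD(2)[OF tendsto_Im[OF s'l], of "- \<delta>"] \<delta> by (simp add: \<delta>_def)
  have e4: "\<forall>\<^sub>F N in sequentially. 1 / Im p \<le> real N * \<eta> N"
    using N\<eta>_lim unfolding filterlim_at_top by blast
  have "\<forall>\<^sub>F N in sequentially. (\<integral>\<omega>. (cmod (GG N p \<omega> - s N))\<^sup>2 \<partial>M) \<le> C / (Im p)\<^sup>2 * (1 / (real N * \<eta> N))\<^sup>2"
    using eventually_gt_at_top[of 0] e1 e2 e3 e4
  proof eventually_elim
    case (elim N)
    have "(\<integral>\<omega>. (cmod (GG N p \<omega> - s N))\<^sup>2 \<partial>M) \<le> C * (1 / (real N * Im (zz N p)))\<^sup>2"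
      unfolding GG_def C_def
    proof (rule wishart_ensemble.local_law[OF ens[OF elim(1)]])
      show "0 < Im (zz N p)" using p \<eta>_pos[OF elim(1)] by (simp add: Im_zz)
      show "1 \<le> real N * Im (zz N p)" using elim(6) p by (simp add: Im_zz field_simps)
      show "wishart_ensemble.mp (m N) N u (zz N p) x = of_real (u\<^sup>2) * zz N p * (x - s N) * (x - s' N)" for x
        by (rule roots[OF elim(1)])
    qed (use elim l_pos \<delta> in \<open>auto simp: b_def\<close>)
    also have "\<dots> = C / (Im p)\<^sup>2 * (1 / (real N * \<eta> N))\<^sup>2" by (simp add: Im_zz power_divide power_mult_distrib)
    finally show ?case .
  qed
  moreover have "\<forall>\<^sub>F N in sequentially. \<forall>x. wishart_ensemble.mp (m N) N u (zz N p) x = of_real (u\<^sup>2) * zz N p * (x - s N) * (x - s' N)"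
    using eventually_gt_at_top[of 0] by eventually_elim (use roots in blast)
  ultimately show ?thesis using sl s'l by blast
qed

text \<open>The lower half-plane follows by conjugation. Both sides are used because an imaginary
  part combines \<open>GG\<close> at a point and at its conjugate.\<close>

lemma local_law_both:
  assumes p: "Im p \<noteq> 0"
  shows "\<exists>s s' C. s \<longlonglongrightarrow> sg p \<and> s' \<longlonglongrightarrow> cnj (sg p) \<and>
    (\<forall>\<^sub>F N in sequentially. \<forall>x. wishart_ensemble.mp (m N) N u (zz N p) x = of_real (u\<^sup>2) * zz N p * (x - s N) * (x - s' N)) \<and>
    (\<forall>\<^sub>F N in sequentially. (\<integral>\<omega>. (cmod (GG N p \<omega> - s N))\<^sup>2 \<partial>M) \<le> C * (1 / (real N * \<eta> N))\<^sup>2)"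
proof (cases "Im p > 0")
  case True
  then show ?thesis using local_law_upper[OF True] by (simp add: sg_def)
next
  case False
  then have "Im (cnj p) > 0" using p by simp
  from local_law_upper[OF this] obtain s s' C where s: "s \<longlonglongrightarrow> s0" "s' \<longlonglongrightarrow> cnj s0"
    "\<forall>\<^sub>F N in sequentially. \<forall>x. wishart_ensemble.mp (m N) N u (zz N (cnj p)) x = of_real (u\<^sup>2) * zz N (cnj p) * (x - s N) * (x - s' N)"
    "\<forall>\<^sub>F N in sequentially. (\<integral>\<omega>. (cmod (GG N (cnj p) \<omega> - s N))\<^sup>2 \<partial>M) \<le> C * (1 / (real N * \<eta> N))\<^sup>2" by blast
  show ?thesis
  proof (rule exI[of _ "\<lambda>N. cnj (s N)"], rule exI[of _ "\<lambda>N. cnj (s' N)"], rule exI[of _ C], intro conjI)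
    show "(\<lambda>N. cnj (s N)) \<longlonglongrightarrow> sg p" using tendsto_cnj[OF s(1)] False by (simp add: sg_def)
    show "(\<lambda>N. cnj (s' N)) \<longlonglongrightarrow> cnj (sg p)" using tendsto_cnj[OF s(2)] False by (simp add: sg_def)
    show "\<forall>\<^sub>F N in sequentially. \<forall>x. wishart_ensemble.mp (m N) N u (zz N p) x = of_real (u\<^sup>2) * zz N p * (x - cnj (s N)) * (x - cnj (s' N))"
      using s(3) eventually_gt_at_top[of 0]
    proof eventually_elim
      case (elim N)
      show ?case
      proof
        fix x
        have "wishart_ensemble.mp (m N) N u (zz N p) x = cnj (wishart_ensemble.mp (m N) N u (zz N (cnj p)) (cnj x))"
          unfolding zz_cnj wishart_ensemble.mp_cnj[OF ens[OF elim(2)]] by simp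
        then show "wishart_ensemble.mp (m N) N u (zz N p) x = of_real (u\<^sup>2) * zz N p * (x - cnj (s N)) * (x - cnj (s' N))"
          unfolding elim(1)[rule_format] by (simp add: zz_cnj)
      qed
    qed
    show "\<forall>\<^sub>F N in sequentially. (\<integral>\<omega>. (cmod (GG N p \<omega> - cnj (s N)))\<^sup>2 \<partial>M) \<le> C * (1 / (real N * \<eta> N))\<^sup>2"
      using s(4) eventually_gt_at_top[of 0]
    proof eventually_elim
      case (elim N)
      have "cmod (GG N (cnj p) \<omega> - s N) = cmod (GG N p \<omega> - cnj (s N))" for \<omega>
        unfolding GG_cnj[OF elim(2) p] by (metis complex_cnj_cnj complex_cnj_diff complex_mod_cnj)
      then show ?case using elim(1) by simp
    qed
  qed
qed

lemma GG_small:
  assumes p: "Im p \<noteq> 0"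
  shows "small (\<lambda>N \<omega>. cmod (GG N p \<omega> - sg p))"
proof -
  from local_law_both[OF p] obtain s C where s: "s \<longlonglongrightarrow> sg p"
    "\<forall>\<^sub>F N in sequentially. (\<integral>\<omega>. (cmod (GG N p \<omega> - s N))\<^sup>2 \<partial>M) \<le> C * (1 / (real N * \<eta> N))\<^sup>2" by blast
  have Cl: "(\<lambda>N. C * (1 / (real N * \<eta> N))\<^sup>2) \<longlonglongrightarrow> C * 0\<^sup>2"
    by (intro tendsto_intros inverse_N\<eta>_lim)
  have sq: "integrable M (\<lambda>\<omega>. (cmod (GG N p \<omega> - s N))\<^sup>2)" if "0 < N" for N
  proof -
    interpret W: wishart_ensemble "m N" N M Z u by (rule ens[OF that])
    have "integrable M (\<lambda>\<omega>. cmod ((W.g (cfg \<omega>) (zz N p) - s N) * (W.g (cfg \<omega>) (zz N p) - s N)))"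
      by (intro integrable_norm W.nice_integrable W.nice_intros W.nice_g Im_zz_nonzero that p)
    then show ?thesis by (simp add: GG_def norm_mult power2_eq_square)
  qed
  have sm: "small (\<lambda>N \<omega>. (cmod (GG N p \<omega> - s N))\<^sup>2)"
    unfolding small_def
  proof
    show "\<forall>\<^sub>F N in sequentially. integrable M (\<lambda>\<omega>. (cmod (GG N p \<omega> - s N))\<^sup>2)"
      using eventually_gt_at_top[of 0] by eventually_elim (rule sq)
    show "(\<lambda>N. \<integral>\<omega>. (cmod (GG N p \<omega> - s N))\<^sup>2 \<partial>M) \<longlonglongrightarrow> 0"
      by (rule tendsto_sandwich[OF _ s(2) tendsto_const]) (use Cl in auto)
  qed
  have ms: "\<forall>\<^sub>F N in sequentially. (\<lambda>\<omega>. cmod (GG N p \<omega> - sg p)) \<in> borel_measurable M"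
    using eventually_gt_at_top[of 0]
  proof eventually_elim
    case (elim N)
    then have "GG N p \<in> borel_measurable M" using GG_integrable p by auto
    then show ?case by measurable
  qed
  show ?thesis
  proof (rule small_approx[OF ms])
    fix \<epsilon> :: real assume \<epsilon>: "\<epsilon> > 0"
    have "(\<lambda>N. cmod (s N - sg p)) \<longlonglongrightarrow> 0" using s(1) by (simp add: LIM_zero tendsto_norm_zero)
    then have S: "small (\<lambda>N \<omega>. (1 / (4 * \<epsilon>)) * (cmod (GG N p \<omega> - s N))\<^sup>2 + cmod (s N - sg p))"
      by (intro small_add small_mult[OF sm tendsto_const] small_const)
    have "0 \<le> cmod (GG N p \<omega> - sg p) \<and>
      cmod (GG N p \<omega> - sg p) \<le> (1 / (4 * \<epsilon>)) * (cmod (GG N p \<omega> - s N))\<^sup>2 + cmod (s N - sg p) + \<epsilon>" for N \<omega>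
    proof -
      define x where "x = cmod (GG N p \<omega> - s N)"
      \<comment> \<open>Completing the square gives x <= x^2 / (4 \<epsilon>) + \<epsilon>, which
        passes from the second moment to the first.\<close>
      have "0 \<le> (x - 2 * \<epsilon>)\<^sup>2 / (4 * \<epsilon>)" using \<epsilon> by simp
      also have "(x - 2 * \<epsilon>)\<^sup>2 / (4 * \<epsilon>) = (1 / (4 * \<epsilon>)) * x\<^sup>2 - x + \<epsilon>" using \<epsilon> by (simp add: power2_eq_square field_simps)
      finally have "x \<le> (1 / (4 * \<epsilon>)) * x\<^sup>2 + \<epsilon>" by simp
      moreover have "cmod (GG N p \<omega> - sg p) \<le> x + cmod (s N - sg p)"
        using norm_triangle_ineq[of "GG N p \<omega> - s N" "s N - sg p"] by (simp add: x_def)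
      ultimately show ?thesis unfolding x_def by simp
    qed
    then show "\<exists>S. small S \<and> (\<forall>\<^sub>F N in sequentially. \<forall>\<omega>. 0 \<le> cmod (GG N p \<omega> - sg p) \<and> cmod (GG N p \<omega> - sg p) \<le> S N \<omega> + \<epsilon>)"
      using S by (intro exI conjI always_eventually) auto
  qed
qed

text \<open>Moving the point away from the real axis replaces derivatives of \<open>GG\<close> by difference quotients
  with an error proportional to the shift, uniformly in \<open>N\<close>.\<close>

definition push :: "real \<Rightarrow> complex \<Rightarrow> complex" where
  "push \<epsilon> p = p + of_real (\<epsilon> * sgn (Im p)) * \<i>"

lemma push:
  assumes "Im p \<noteq> 0" "\<epsilon> > 0"
  shows "Im (push \<epsilon> p) \<noteq> 0" "\<bar>Im p\<bar> \<le> \<bar>Im (push \<epsilon> p)\<bar>" "cmod (push \<epsilon> p - p) = \<epsilon>" "sg (push \<epsilon> p) = sg p" "push \<epsilon> p \<noteq> p"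
  using assms by (auto simp: push_def sg_def norm_mult sgn_if complex_eq_iff split: if_splits)

lemma GG_diff_small:
  assumes "Im p \<noteq> 0" "Im q \<noteq> 0" "sg p = sg q"
  shows "small (\<lambda>N \<omega>. cmod (GG N p \<omega> - sg p) + cmod (GG N q \<omega> - sg p))"
  using small_add[OF GG_small[OF assms(1)] GG_small[OF assms(2)]] assms(3) by simp

text \<open>Points of the same half-plane share the limit \<open>sg\<close>, so \<eta> times the
  difference quotient of \<open>GG\<close> over a distance \<epsilon> \<eta> tends to 0 for fixed
  \<epsilon>; the error in \<open>dg_bound\<close>, times \<eta>, is of order \<epsilon>.\<close>

lemma DG_small:
  assumes p: "Im p \<noteq> 0"
  shows "small (\<lambda>N \<omega>. \<eta> N * cmod (DG N p \<omega>))"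
proof (rule small_approx)
  show "\<forall>\<^sub>F N in sequentially. (\<lambda>\<omega>. \<eta> N * cmod (DG N p \<omega>)) \<in> borel_measurable M"
    using eventually_gt_at_top[of 0]
  proof eventually_elim
    case (elim N)
    then have "DG N p \<in> borel_measurable M" using DG_integrable p by auto
    then show ?case by measurable
  qed
next
  fix e :: real assume e: "e > 0"
  \<comment> \<open>Chosen so that the shift costs \<epsilon> B = e; the added 1 keeps
    \<open>B\<close> positive.\<close>
  define B where "B = (cmod (sg p) + 1) / (Im p)\<^sup>2"
  have B: "B > 0" using p by (simp add: B_def add_nonneg_pos)
  define \<epsilon> where "\<epsilon> = e / B"
  have \<epsilon>: "\<epsilon> > 0" using e B by (simp add: \<epsilon>_def)
  define q where "q = push \<epsilon> p"
  note q = push[OF p \<epsilon>, folded q_def]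
  let ?S = "\<lambda>N \<omega>. (1 / \<epsilon>) * (cmod (GG N q \<omega> - sg q) + cmod (GG N p \<omega> - sg q)) + \<epsilon> / (Im p)\<^sup>2 * cmod (GG N p \<omega> - sg p)"
  have S: "small ?S"
    by (intro small_add small_mult[OF GG_diff_small tendsto_const] small_mult[OF GG_small tendsto_const] p q)
  have "\<forall>\<^sub>F N in sequentially. \<forall>\<omega>. 0 \<le> \<eta> N * cmod (DG N p \<omega>) \<and> \<eta> N * cmod (DG N p \<omega>) \<le> ?S N \<omega> + e"
    using eventually_gt_at_top[of 0]
  proof (eventually_elim, intro allI)
    fix N \<omega> assume N: "0 < (N::nat)"
    interpret W: wishart_ensemble "m N" N M Z u by (rule ens[OF N])
    have h: "\<eta> N > 0" by (rule \<eta>_pos[OF N])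
    have ne: "zz N p \<noteq> zz N q" using zz_diff[of N p q] q(5) h by auto
    have c1: "cmod (zz N q - zz N p) = \<eta> N * \<epsilon>" using h q(3) by (simp add: zz_diff norm_mult)
    have "cmod (DG N p \<omega>) \<le> cmod (GG N q \<omega> - GG N p \<omega>) / (\<eta> N * \<epsilon>) + \<eta> N * \<epsilon> * cmod (GG N p \<omega>) / (\<eta> N * \<bar>Im p\<bar> * (\<eta> N * \<bar>Im q\<bar>))"
      using W.dg_bound[OF Im_zz_nonzero[OF N p] Im_zz_nonzero[OF N q(1)] ne, of "cfg \<omega>"] h
      unfolding c1 by (simp add: GG_def DG_def Im_zz abs_mult)
    then have "\<eta> N * cmod (DG N p \<omega>) \<le> \<eta> N * (cmod (GG N q \<omega> - GG N p \<omega>) / (\<eta> N * \<epsilon>) + \<eta> N * \<epsilon> * cmod (GG N p \<omega>) / (\<eta> N * \<bar>Im p\<bar> * (\<eta> N * \<bar>Im q\<bar>)))"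
      using h by (intro mult_left_mono) auto
    also have "\<dots> = (1 / \<epsilon>) * cmod (GG N q \<omega> - GG N p \<omega>) + \<epsilon> * cmod (GG N p \<omega>) / (\<bar>Im p\<bar> * \<bar>Im q\<bar>)"
      using h p q(1) \<epsilon> by (simp add: field_simps)
    also have "\<dots> \<le> (1 / \<epsilon>) * (cmod (GG N q \<omega> - sg q) + cmod (GG N p \<omega> - sg q)) + \<epsilon> * cmod (GG N p \<omega>) / (\<bar>Im p\<bar> * \<bar>Im p\<bar>)"
    proof (intro add_mono mult_left_mono)
      show "cmod (GG N q \<omega> - GG N p \<omega>) \<le> cmod (GG N q \<omega> - sg q) + cmod (GG N p \<omega> - sg q)"
        using norm_triangle_ineq4[of "GG N q \<omega> - sg q" "GG N p \<omega> - sg q"] by simp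
      show "\<epsilon> * cmod (GG N p \<omega>) / (\<bar>Im p\<bar> * \<bar>Im q\<bar>) \<le> \<epsilon> * cmod (GG N p \<omega>) / (\<bar>Im p\<bar> * \<bar>Im p\<bar>)"
        using q(2) p \<epsilon> by (intro divide_left_mono mult_left_mono mult_pos_pos) auto
    qed (use \<epsilon> in auto)
    also have "\<epsilon> * cmod (GG N p \<omega>) / (\<bar>Im p\<bar> * \<bar>Im p\<bar>) = \<epsilon> / (Im p)\<^sup>2 * cmod (GG N p \<omega>)" by (simp add: power2_eq_square)
    also have "\<dots> \<le> \<epsilon> / (Im p)\<^sup>2 * (cmod (GG N p \<omega> - sg p) + cmod (sg p))"
      using \<epsilon> norm_triangle_ineq[of "GG N p \<omega> - sg p" "sg p"] by (intro mult_left_mono) auto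
    also have "\<dots> \<le> \<epsilon> / (Im p)\<^sup>2 * cmod (GG N p \<omega> - sg p) + e"
    proof -
      have "\<epsilon> / (Im p)\<^sup>2 * cmod (sg p) \<le> \<epsilon> / (Im p)\<^sup>2 * (cmod (sg p) + 1)" using \<epsilon> by (intro mult_left_mono) auto
      also have "\<dots> = \<epsilon> * B" by (simp add: B_def)
      also have "\<dots> = e" using B by (simp add: \<epsilon>_def)
      finally show ?thesis by (simp add: distrib_left)
    qed
    finally show "0 \<le> \<eta> N * cmod (DG N p \<omega>) \<and> \<eta> N * cmod (DG N p \<omega>) \<le> ?S N \<omega> + e" using h by (simp add: algebra_simps)
  qed
  then show "\<exists>S. small S \<and> (\<forall>\<^sub>F N in sequentially. \<forall>\<omega>. 0 \<le> \<eta> N * cmod (DG N p \<omega>) \<and> \<eta> N * cmod (DG N p \<omega>) \<le> S N \<omega> + e)"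
    using S by blast
qed

text \<open>This is \<open>trGHGG_approx\<close> in local coordinates. Multiplication by \<eta>^2
  cancels every negative power of \<eta>, so that what remains is controlled by \<open>GG\<close>
  and \<eta> \<open>DG\<close>.\<close>

lemma AA_bound:
  assumes N: "0 < N" and p: "Im p \<noteq> 0" "Im p' \<noteq> 0" "Im q \<noteq> 0" and ne: "p' \<noteq> q"
  shows "cmod (of_real ((\<eta> N)\<^sup>2) * AA N p q \<omega> - zz N p * (GG N p' \<omega> - GG N q \<omega>) / (p' - q)\<^sup>2) \<le>
    \<eta> N * cmod (DG N q \<omega>) * (\<eta> N + cmod (zz N p) / cmod (p' - q)) +
    cmod (zz N p) * (cmod (p - p') * cmod (GG N q \<omega>) / (\<bar>Im q\<bar> * \<bar>Im p\<bar> * \<bar>Im p'\<bar>))"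
proof -
  interpret W: wishart_ensemble "m N" N M Z u by (rule ens[OF N])
  have h: "\<eta> N > 0" by (rule \<eta>_pos[OF N])
  have ne': "zz N p' \<noteq> zz N q" using zz_diff[of N p' q] ne h by auto
  let ?d = "AA N p q \<omega> - zz N p * (GG N p' \<omega> - GG N q \<omega>) / (of_real (\<eta> N) * (p' - q))\<^sup>2"
  have "cmod ?d \<le> cmod (DG N q \<omega>) * (1 + cmod (zz N p) / (\<eta> N * cmod (p' - q))) +
    cmod (zz N p) * (\<eta> N * cmod (p - p') * cmod (GG N q \<omega>) / (\<eta> N * \<bar>Im q\<bar> * (\<eta> N * \<bar>Im p\<bar>) * (\<eta> N * \<bar>Im p'\<bar>)))"
    using W.trGHGG_approx[OF Im_zz_nonzero[OF N p(1)] Im_zz_nonzero[OF N p(2)] Im_zz_nonzero[OF N p(3)] ne', of "cfg \<omega>"] h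
    unfolding zz_diff by (simp add: AA_def GG_def DG_def Im_zz abs_mult norm_mult)
  then have "(\<eta> N)\<^sup>2 * cmod ?d \<le> (\<eta> N)\<^sup>2 * (cmod (DG N q \<omega>) * (1 + cmod (zz N p) / (\<eta> N * cmod (p' - q))) +
    cmod (zz N p) * (\<eta> N * cmod (p - p') * cmod (GG N q \<omega>) / (\<eta> N * \<bar>Im q\<bar> * (\<eta> N * \<bar>Im p\<bar>) * (\<eta> N * \<bar>Im p'\<bar>))))"
    by (rule mult_left_mono) simp
  also have "\<dots> = \<eta> N * cmod (DG N q \<omega>) * (\<eta> N + cmod (zz N p) / cmod (p' - q)) +
    cmod (zz N p) * (cmod (p - p') * cmod (GG N q \<omega>) / (\<bar>Im q\<bar> * \<bar>Im p\<bar> * \<bar>Im p'\<bar>))"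
    using h p ne by (simp add: power2_eq_square field_simps)
  also have "(\<eta> N)\<^sup>2 * cmod ?d = cmod (of_real ((\<eta> N)\<^sup>2) * ?d)" unfolding norm_mult norm_of_real by simp
  also have "of_real ((\<eta> N)\<^sup>2) * ?d = of_real ((\<eta> N)\<^sup>2) * AA N p q \<omega> - zz N p * (GG N p' \<omega> - GG N q \<omega>) / (p' - q)\<^sup>2"
  proof -
    have "of_real ((\<eta> N)\<^sup>2) * (w / (of_real (\<eta> N) * d)\<^sup>2) = w / d\<^sup>2" for w d :: complex
      using h by (simp add: power_mult_distrib)
    then show ?thesis by (simp only: right_diff_distrib[of "of_real ((\<eta> N)\<^sup>2)"])
  qed
  finally show ?thesis .
qed

lemma norm_zz_lim: "(\<lambda>N. cmod (zz N p)) \<longlonglongrightarrow> l"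
  using tendsto_norm[OF zz_lim[of p]] l_pos by simp

lemma AA_measurable:
  assumes "Im p \<noteq> 0" "Im q \<noteq> 0"
  shows "\<forall>\<^sub>F N in sequentially. (\<lambda>\<omega>. cmod (of_real ((\<eta> N)\<^sup>2) * AA N p q \<omega> - w)) \<in> borel_measurable M"
  using eventually_gt_at_top[of 0]
proof eventually_elim
  case (elim N)
  then have "AA N p q \<in> borel_measurable M" using AA_integrable assms by auto
  then show ?case by measurable
qed

text \<open>With p' = p in \<open>AA_bound\<close> the shift error is 0. The limit vanishes when
  both points lie on the same side of the axis, where \<open>sg\<close> agrees.\<close>

lemma AA_small_distinct:
  assumes p: "Im p \<noteq> 0" and q: "Im q \<noteq> 0" and ne: "p \<noteq> q"
  shows "small (\<lambda>N \<omega>. cmod (of_real ((\<eta> N)\<^sup>2) * AA N p q \<omega> - of_real l * (sg p - sg q) / (p - q)\<^sup>2))"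
proof (rule small_mono[OF AA_measurable[OF p q]])
  let ?S = "\<lambda>N \<omega>. (\<eta> N + cmod (zz N p) / cmod (p - q)) * (\<eta> N * cmod (DG N q \<omega>)) +
    ((cmod (zz N p) / (cmod (p - q))\<^sup>2) * (cmod (GG N p \<omega> - sg p) + cmod (GG N q \<omega> - sg q)) +
    cmod (zz N p - of_real l) * cmod (sg p - sg q) / (cmod (p - q))\<^sup>2)"
  have "(\<lambda>N. cmod (zz N p - of_real l)) \<longlonglongrightarrow> 0" using zz_lim by (simp add: LIM_zero tendsto_norm_zero)
  from tendsto_mult_left_zero[OF this, of "cmod (sg p - sg q) / (cmod (p - q))\<^sup>2"]
  have z: "(\<lambda>N. cmod (zz N p - of_real l) * cmod (sg p - sg q) / (cmod (p - q))\<^sup>2) \<longlonglongrightarrow> 0" by simp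
  have c1: "(\<lambda>N. \<eta> N + cmod (zz N p) / cmod (p - q)) \<longlonglongrightarrow> 0 + l / cmod (p - q)"
    using ne by (intro tendsto_intros \<eta>_lim norm_zz_lim) auto
  have c2: "(\<lambda>N. cmod (zz N p) / (cmod (p - q))\<^sup>2) \<longlonglongrightarrow> l / (cmod (p - q))\<^sup>2"
    using ne by (intro tendsto_intros norm_zz_lim) auto
  show "small ?S"
    by (intro small_add small_mult[OF DG_small[OF q] c1] small_mult[OF small_add c2] GG_small p q small_const z)
  show "\<forall>\<^sub>F N in sequentially. \<forall>\<omega>. 0 \<le> cmod (of_real ((\<eta> N)\<^sup>2) * AA N p q \<omega> - of_real l * (sg p - sg q) / (p - q)\<^sup>2) \<and>
    cmod (of_real ((\<eta> N)\<^sup>2) * AA N p q \<omega> - of_real l * (sg p - sg q) / (p - q)\<^sup>2) \<le> ?S N \<omega>"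
    using eventually_gt_at_top[of 0]
  proof (eventually_elim, intro allI)
    fix N \<omega> assume N: "0 < (N::nat)"
    let ?A = "of_real ((\<eta> N)\<^sup>2) * AA N p q \<omega>" and ?B = "zz N p * (GG N p \<omega> - GG N q \<omega>) / (p - q)\<^sup>2"
      and ?L = "of_real l * (sg p - sg q) / (p - q)\<^sup>2"
    have 1: "cmod (?A - ?B) \<le> (\<eta> N + cmod (zz N p) / cmod (p - q)) * (\<eta> N * cmod (DG N q \<omega>))"
      using AA_bound[OF N p p q ne, of \<omega>] by (simp add: mult.commute)
    have "?B - ?L = (zz N p * ((GG N p \<omega> - sg p) - (GG N q \<omega> - sg q)) + (zz N p - of_real l) * (sg p - sg q)) / (p - q)\<^sup>2"
      by (simp add: diff_divide_distrib add_divide_distrib algebra_simps)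
    then have "cmod (?B - ?L) = cmod (zz N p * ((GG N p \<omega> - sg p) - (GG N q \<omega> - sg q)) + (zz N p - of_real l) * (sg p - sg q)) / (cmod (p - q))\<^sup>2"
      by (simp add: norm_divide norm_power)
    also have "\<dots> \<le> (cmod (zz N p) * (cmod (GG N p \<omega> - sg p) + cmod (GG N q \<omega> - sg q)) + cmod (zz N p - of_real l) * cmod (sg p - sg q)) / (cmod (p - q))\<^sup>2"
    proof (rule divide_right_mono, rule order_trans[OF norm_triangle_ineq], rule add_mono)
      show "cmod (zz N p * ((GG N p \<omega> - sg p) - (GG N q \<omega> - sg q))) \<le> cmod (zz N p) * (cmod (GG N p \<omega> - sg p) + cmod (GG N q \<omega> - sg q))"
        unfolding norm_mult by (rule mult_left_mono[OF norm_triangle_ineq4]) simp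
    qed (simp_all add: norm_mult)
    finally have 2: "cmod (?B - ?L) \<le> (cmod (zz N p) / (cmod (p - q))\<^sup>2) * (cmod (GG N p \<omega> - sg p) + cmod (GG N q \<omega> - sg q)) +
      cmod (zz N p - of_real l) * cmod (sg p - sg q) / (cmod (p - q))\<^sup>2" by (simp add: add_divide_distrib)
    have "cmod (?A - ?L) \<le> cmod (?A - ?B) + cmod (?B - ?L)" using norm_triangle_ineq[of "?A - ?B" "?B - ?L"] by simp
    then show "0 \<le> cmod (?A - ?L) \<and> cmod (?A - ?L) \<le> ?S N \<omega>" using 1 2 norm_ge_zero[of "?A - ?L"] by linarith
  qed
qed

text \<open>Partial fractions require distinct poles, so one point is pushed away by \<epsilon>. The
  main term then compares \<open>GG\<close> at two points of the same half-plane and tends to 0,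
  while the shift error is of order \<epsilon>.\<close>

lemma AA_small_equal:
  assumes p: "Im p \<noteq> 0"
  shows "small (\<lambda>N \<omega>. cmod (of_real ((\<eta> N)\<^sup>2) * AA N p p \<omega> - 0))"
proof (rule small_approx[OF AA_measurable[OF p p]])
  fix e :: real assume e: "e > 0"
  \<comment> \<open>Chosen so that the shift error is at most \<epsilon> B = e; the factor l + 1
    bounds |zz N p| eventually.\<close>
  define B where "B = (l + 1) * (cmod (sg p) + 1) / \<bar>Im p\<bar> ^ 3"
  have B: "B > 0" using p l_pos by (auto simp: B_def intro!: divide_pos_pos mult_pos_pos add_nonneg_pos)
  define \<epsilon> where "\<epsilon> = e / B"
  have \<epsilon>: "\<epsilon> > 0" using e B by (simp add: \<epsilon>_def)
  define q where "q = push \<epsilon> p"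
  note q = push[OF p \<epsilon>, folded q_def]
  let ?S = "\<lambda>N \<omega>. (\<eta> N + cmod (zz N p) / \<epsilon>) * (\<eta> N * cmod (DG N p \<omega>)) +
    ((cmod (zz N p) / \<epsilon>\<^sup>2) * (cmod (GG N q \<omega> - sg q) + cmod (GG N p \<omega> - sg q)) +
     (l + 1) * \<epsilon> / \<bar>Im p\<bar> ^ 3 * cmod (GG N p \<omega> - sg p))"
  have c1: "(\<lambda>N. \<eta> N + cmod (zz N p) / \<epsilon>) \<longlonglongrightarrow> 0 + l / \<epsilon>"
    using \<epsilon> by (intro tendsto_intros \<eta>_lim norm_zz_lim) auto
  have c2: "(\<lambda>N. cmod (zz N p) / \<epsilon>\<^sup>2) \<longlonglongrightarrow> l / \<epsilon>\<^sup>2"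
    using \<epsilon> by (intro tendsto_intros norm_zz_lim) auto
  have S: "small ?S"
    by (intro small_add small_mult[OF DG_small[OF p] c1] small_mult[OF GG_diff_small c2] small_mult[OF GG_small tendsto_const] p q)
  have zb: "\<forall>\<^sub>F N in sequentially. cmod (zz N p) < l + 1"
    using order_tendstoD(2)[OF norm_zz_lim, of "l + 1"] by simp
  have "\<forall>\<^sub>F N in sequentially. \<forall>\<omega>. 0 \<le> cmod (of_real ((\<eta> N)\<^sup>2) * AA N p p \<omega> - 0) \<and> cmod (of_real ((\<eta> N)\<^sup>2) * AA N p p \<omega> - 0) \<le> ?S N \<omega> + e"
    using eventually_gt_at_top[of 0] zb
  proof (eventually_elim, intro allI)
    fix N \<omega> assume N: "0 < (N::nat)" and zb: "cmod (zz N p) < l + 1"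
    let ?A = "of_real ((\<eta> N)\<^sup>2) * AA N p p \<omega>" and ?B = "zz N p * (GG N q \<omega> - GG N p \<omega>) / (q - p)\<^sup>2"
    have "cmod (?A - ?B) \<le> \<eta> N * cmod (DG N p \<omega>) * (\<eta> N + cmod (zz N p) / \<epsilon>) +
      cmod (zz N p) * (\<epsilon> * cmod (GG N p \<omega>) / (\<bar>Im p\<bar> * \<bar>Im p\<bar> * \<bar>Im q\<bar>))"
      using AA_bound[OF N p q(1) p q(5), of \<omega>] by (simp add: q(3) norm_minus_commute[of p q])
    also have "cmod (zz N p) * (\<epsilon> * cmod (GG N p \<omega>) / (\<bar>Im p\<bar> * \<bar>Im p\<bar> * \<bar>Im q\<bar>)) \<le>
      (l + 1) * (\<epsilon> * cmod (GG N p \<omega>) / (\<bar>Im p\<bar> * \<bar>Im p\<bar> * \<bar>Im p\<bar>))"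
      using zb q(2) p \<epsilon> l_pos by (intro mult_mono divide_left_mono mult_left_mono mult_pos_pos) auto
    also have "\<dots> = (l + 1) * \<epsilon> / \<bar>Im p\<bar> ^ 3 * cmod (GG N p \<omega>)" by (simp add: power3_eq_cube)
    also have "\<dots> \<le> (l + 1) * \<epsilon> / \<bar>Im p\<bar> ^ 3 * (cmod (GG N p \<omega> - sg p) + cmod (sg p))"
      using \<epsilon> l_pos norm_triangle_ineq[of "GG N p \<omega> - sg p" "sg p"] by (intro mult_left_mono) auto
    also have "\<dots> \<le> (l + 1) * \<epsilon> / \<bar>Im p\<bar> ^ 3 * cmod (GG N p \<omega> - sg p) + e"
    proof -
      have "(l + 1) * \<epsilon> / \<bar>Im p\<bar> ^ 3 * cmod (sg p) \<le> (l + 1) * \<epsilon> / \<bar>Im p\<bar> ^ 3 * (cmod (sg p) + 1)"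
        using \<epsilon> l_pos by (intro mult_left_mono) auto
      also have "\<dots> = \<epsilon> * B" by (simp add: B_def)
      also have "\<dots> = e" using B by (simp add: \<epsilon>_def)
      finally show ?thesis by (simp add: distrib_left)
    qed
    finally have 1: "cmod (?A - ?B) \<le> \<eta> N * cmod (DG N p \<omega>) * (\<eta> N + cmod (zz N p) / \<epsilon>) +
      ((l + 1) * \<epsilon> / \<bar>Im p\<bar> ^ 3 * cmod (GG N p \<omega> - sg p) + e)" by simp
    have "cmod ?B = cmod (zz N p) / \<epsilon>\<^sup>2 * cmod (GG N q \<omega> - GG N p \<omega>)" by (simp add: norm_mult norm_divide norm_power q(3))
    also have "\<dots> \<le> cmod (zz N p) / \<epsilon>\<^sup>2 * (cmod (GG N q \<omega> - sg q) + cmod (GG N p \<omega> - sg q))"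
      using norm_triangle_ineq4[of "GG N q \<omega> - sg q" "GG N p \<omega> - sg q"] by (intro mult_left_mono) auto
    finally have 2: "cmod ?B \<le> cmod (zz N p) / \<epsilon>\<^sup>2 * (cmod (GG N q \<omega> - sg q) + cmod (GG N p \<omega> - sg q))" .
    have "cmod (?A - 0) \<le> cmod (?A - ?B) + cmod ?B" using norm_triangle_ineq[of "?A - ?B" "?B"] by simp
    then show "0 \<le> cmod (?A - 0) \<and> cmod (?A - 0) \<le> ?S N \<omega> + e"
      using 1 2 norm_ge_zero[of "?A - 0"] by (simp add: mult_ac)
  qed
  then show "\<exists>S. small S \<and> (\<forall>\<^sub>F N in sequentially. \<forall>\<omega>. 0 \<le> cmod (of_real ((\<eta> N)\<^sup>2) * AA N p p \<omega> - 0) \<and> cmod (of_real ((\<eta> N)\<^sup>2) * AA N p p \<omega> - 0) \<le> S N \<omega> + e)"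
    using S by blast
qed

text \<open>For p = q the limit as written is 0, division by zero being 0, in agreement with
  \<open>AA_small_equal\<close>; so the covariance computation can treat all pairs alike.\<close>

lemma AA_small:
  assumes "Im p \<noteq> 0" "Im q \<noteq> 0"
  shows "small (\<lambda>N \<omega>. cmod (of_real ((\<eta> N)\<^sup>2) * AA N p q \<omega> - of_real l * (sg p - sg q) / (p - q)\<^sup>2))"
proof (cases "p = q")
  case True
  then show ?thesis using AA_small_equal[OF assms(1)] by simp
next
  case False
  then show ?thesis by (rule AA_small_distinct[OF assms])
qed

text \<open>By the definition of \<open>dg\<close> the trace over N is \<open>GG\<close> plus
  \<open>zz\<close> times \<open>DG\<close>. The factor \<eta> makes the first part small, and
  \<open>DG_small\<close> handles the second.\<close>

lemma trGHG_small:
  assumes p: "Im p \<noteq> 0"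
  shows "small (\<lambda>N \<omega>. \<eta> N * cmod (wishart.trGHG (m N) N (cfg \<omega>) (zz N p) / of_nat N))"
proof (rule small_mono)
  show "\<forall>\<^sub>F N in sequentially. (\<lambda>\<omega>. \<eta> N * cmod (wishart.trGHG (m N) N (cfg \<omega>) (zz N p) / of_nat N)) \<in> borel_measurable M"
    using eventually_gt_at_top[of 0]
  proof eventually_elim
    case (elim N)
    interpret W: wishart_ensemble "m N" N M Z u by (rule ens[OF elim])
    have "(\<lambda>\<omega>. W.trGHG (cfg \<omega>) (zz N p)) \<in> borel_measurable M"
      by (rule W.nice_measurable[OF W.nice_trGHG[OF Im_zz_nonzero[OF elim p]]])
    then show ?case by measurable
  qed
  have "(\<lambda>N. \<eta> N * cmod (sg p)) \<longlonglongrightarrow> 0" by (rule tendsto_mult_left_zero[OF \<eta>_lim])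
  then show "small (\<lambda>N \<omega>. \<eta> N * cmod (GG N p \<omega> - sg p) + (\<eta> N * cmod (sg p) + cmod (zz N p) * (\<eta> N * cmod (DG N p \<omega>))))"
    by (intro small_add small_const small_mult[OF GG_small[OF p] \<eta>_lim] small_mult[OF DG_small[OF p] norm_zz_lim])
  show "\<forall>\<^sub>F N in sequentially. \<forall>\<omega>. 0 \<le> \<eta> N * cmod (wishart.trGHG (m N) N (cfg \<omega>) (zz N p) / of_nat N) \<and>
    \<eta> N * cmod (wishart.trGHG (m N) N (cfg \<omega>) (zz N p) / of_nat N) \<le>
      \<eta> N * cmod (GG N p \<omega> - sg p) + (\<eta> N * cmod (sg p) + cmod (zz N p) * (\<eta> N * cmod (DG N p \<omega>)))"
    using eventually_gt_at_top[of 0]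
  proof (eventually_elim, intro allI)
    fix N \<omega> assume N: "0 < (N::nat)"
    interpret W: wishart_ensemble "m N" N M Z u by (rule ens[OF N])
    have h: "\<eta> N > 0" by (rule \<eta>_pos[OF N])
    have "zz N p \<noteq> 0" using Im_zz_nonzero[OF N p] by auto
    then have "W.trGHG (cfg \<omega>) (zz N p) / of_nat N = (GG N p \<omega> - sg p) + (sg p + zz N p * DG N p \<omega>)"
      by (simp add: GG_def DG_def W.dg_def)
    then have "cmod (W.trGHG (cfg \<omega>) (zz N p) / of_nat N) \<le> cmod (GG N p \<omega> - sg p) + (cmod (sg p) + cmod (zz N p) * cmod (DG N p \<omega>))"
      using norm_triangle_ineq[of "GG N p \<omega> - sg p" "sg p + zz N p * DG N p \<omega>"]
        norm_triangle_ineq[of "sg p" "zz N p * DG N p \<omega>"] by (simp add: norm_mult)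
    then have "\<eta> N * cmod (W.trGHG (cfg \<omega>) (zz N p) / of_nat N) \<le> \<eta> N * (cmod (GG N p \<omega> - sg p) + (cmod (sg p) + cmod (zz N p) * cmod (DG N p \<omega>)))"
      using h by (intro mult_left_mono) auto
    then show "0 \<le> \<eta> N * cmod (W.trGHG (cfg \<omega>) (zz N p) / of_nat N) \<and>
      \<eta> N * cmod (W.trGHG (cfg \<omega>) (zz N p) / of_nat N) \<le>
      \<eta> N * cmod (GG N p \<omega> - sg p) + (\<eta> N * cmod (sg p) + cmod (zz N p) * (\<eta> N * cmod (DG N p \<omega>)))"
      using h by (simp add: algebra_simps)
  qed
qed

end

lemma (in wishart) nice_exp:
  assumes f: "nice f" "\<And>X. Im (f X) = 0"
  shows "nice (\<lambda>X. exp (\<i> * of_real \<theta> * f X))"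
proof -
  have "cmod (exp (\<i> * of_real \<theta> * f X)) \<le> 1" for X using f(2)[of X] by (simp add: norm_exp_eq_Re)
  then have "\<exists>B. \<forall>X. cmod (exp (\<i> * of_real \<theta> * f X)) \<le> B" by blast
  moreover have "continuous_on UNIV (\<lambda>X. exp (\<i> * of_real \<theta> * f X))"
    using f(1) unfolding nice_def by (intro continuous_intros) auto
  ultimately show ?thesis using f(1) unfolding nice_def by simp
qed

section \<open>Gaussian fluctuations\<close>

locale mesoscopic_points = mesoscopic M Z m u c \<alpha> l
  for M :: "'a measure" and Z m u c \<alpha> l +
  fixes \<tau> :: "'k::finite \<Rightarrow> real"
begin

definition pk :: "'k \<Rightarrow> complex" where "pk j = Complex (\<tau> j) 1"

lemma Im_pk: "Im (pk j) = 1" "Im (pk j) \<noteq> 0" "Im (cnj (pk j)) \<noteq> 0" by (auto simp: pk_def)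

text \<open>The variable of the theorem, with N powr (1 - \<alpha>) written as N \<eta>.\<close>

definition gam :: "nat \<Rightarrow> 'k \<Rightarrow> 'a \<Rightarrow> real" where
  "gam N j \<omega> = real N * \<eta> N * (Im (GG N (pk j) \<omega>) - (\<integral>\<omega>. Im (GG N (pk j) \<omega>) \<partial>M))"

definition Ts :: "('k \<Rightarrow> real) \<Rightarrow> nat \<Rightarrow> 'a \<Rightarrow> real" where
  "Ts a N \<omega> = (\<Sum>j\<in>UNIV. a j * gam N j \<omega>)"

definition ex :: "('k \<Rightarrow> real) \<Rightarrow> nat \<Rightarrow> real \<Rightarrow> 'a \<Rightarrow> complex" where
  "ex a N \<theta> \<omega> = exp (\<i> * of_real (\<theta> * Ts a N \<omega>))"

definition \<psi> :: "('k \<Rightarrow> real) \<Rightarrow> nat \<Rightarrow> real \<Rightarrow> complex" where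
  "\<psi> a N \<theta> = (\<integral>\<omega>. ex a N \<theta> \<omega> \<partial>M)"

lemma gam_measurable: "0 < N \<Longrightarrow> gam N j \<in> borel_measurable M"
proof -
  assume "0 < N"
  then have "GG N (pk j) \<in> borel_measurable M" using GG_integrable Im_pk by auto
  then show ?thesis unfolding gam_def by measurable
qed

lemma Ts_measurable: "0 < N \<Longrightarrow> Ts a N \<in> borel_measurable M"
  unfolding Ts_def using gam_measurable by measurable

lemma norm_ex: "cmod (ex a N \<theta> \<omega>) = 1" by (simp add: ex_def norm_exp_eq_Re)

lemma ex_integrable: "0 < N \<Longrightarrow> integrable M (ex a N \<theta>)"
  using Ts_measurable[of N a] unfolding ex_def[abs_def]
  by (intro integrable_const_bound[where B=1]) (auto simp: norm_exp_eq_Re)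

lemma norm_\<psi>: "0 < N \<Longrightarrow> cmod (\<psi> a N \<theta>) \<le> 1"
proof -
  assume N: "0 < N"
  have "cmod (\<psi> a N \<theta>) \<le> (\<integral>\<omega>. cmod (ex a N \<theta> \<omega>) \<partial>M)" unfolding \<psi>_def by (rule integral_norm_bound)
  then show ?thesis by (simp add: norm_ex prob_space)
qed

lemma mult_ex_integrable: "0 < N \<Longrightarrow> integrable M f \<Longrightarrow> integrable M (\<lambda>\<omega>. f \<omega> * ex a N \<theta> \<omega>)"
  using ex_integrable[of N a \<theta>]
  by (rule_tac Bochner_Integration.integrable_bound[where f=f]) (auto simp: norm_mult norm_ex)

text \<open>Since Im g = (g(z) - g(cnj z)) / (2 i), the exponent is linear in the traces at the
  points \<open>pk j\<close> and at their conjugates, and its gradient brings in \<open>AA\<close>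
  at both with opposite signs. Subtracting \<psi> centres the test function.\<close>

lemma test_identity:
  assumes N: "0 < N" and p: "Im p \<noteq> 0"
  shows "(\<integral>\<omega>. wishart_ensemble.mp (m N) N u (zz N p) (GG N p \<omega>) * (ex a N \<theta> \<omega> - \<psi> a N \<theta>) \<partial>M) =
    - (of_real (u\<^sup>2) / (of_nat N)\<^sup>2) * ((\<integral>\<omega>. wishart.trGHG (m N) N (cfg \<omega>) (zz N p) * (ex a N \<theta> \<omega> - \<psi> a N \<theta>) \<partial>M) +
      of_real (\<theta> * \<eta> N * real N) * (\<Sum>j\<in>UNIV. of_real (a j) * ((\<integral>\<omega>. ex a N \<theta> \<omega> * AA N p (pk j) \<omega> \<partial>M) -
        (\<integral>\<omega>. ex a N \<theta> \<omega> * AA N p (cnj (pk j)) \<omega> \<partial>M))))"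
proof -
  interpret W: wishart_ensemble "m N" N M Z u by (rule ens[OF N])
  have N0: "of_nat N \<noteq> (0::complex)" using N by simp
  \<comment> \<open>The flag \<open>b\<close> selects the point \<open>pk j\<close> or its
    conjugate; the pairs of an index and a flag label the traces on which the test function
    depends.\<close>
  define zj where "zj b j = zz N (if b then pk j else cnj (pk j))" for b j
  have zj: "Im (zj b j) \<noteq> 0" for b j
    unfolding zj_def using Im_zz_nonzero[OF N] Im_pk by (auto split: if_splits)
  have zjc: "zj False j = cnj (zj True j)" for j by (simp add: zj_def zz_cnj)
  define e where "e j = complex_of_real (\<integral>\<omega>. Im (GG N (pk j) \<omega>) \<partial>M)" for j
  define f where "f X = (\<Sum>j\<in>UNIV. of_real (a j) * (of_real (real N * \<eta> N) * ((W.g X (zj True j) - W.g X (zj False j)) * (1 / (2 * \<i>)) - e j)))" for X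
  have fre: "f X = of_real (\<Sum>j\<in>UNIV. a j * (real N * \<eta> N * (Im (W.g X (zj True j)) - (\<integral>\<omega>. Im (GG N (pk j) \<omega>) \<partial>M))))" for X
  proof -
    have "(W.g X (zj True j) - W.g X (zj False j)) * (1 / (2 * \<i>)) = of_real (Im (W.g X (zj True j)))" for j
      unfolding zjc W.g_cnj[OF zj] by (simp add: complex_eq_iff Re_divide Im_divide)
    then show ?thesis by (simp add: f_def e_def)
  qed
  have nf: "W.nice f" unfolding f_def by (intro W.nice_intros W.nice_g zj)
  have nE: "W.nice (\<lambda>X. exp (\<i> * of_real \<theta> * f X))" by (rule W.nice_exp[OF nf]) (simp only: fre Im_complex_of_real)
  have fcf: "f (cfg \<omega>) = of_real (Ts a N \<omega>)" for \<omega>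
    unfolding fre by (simp add: Ts_def gam_def GG_def zj_def)
  have Ecf: "exp (\<i> * of_real \<theta> * f (cfg \<omega>)) = ex a N \<theta> \<omega>" for \<omega>
    unfolding fcf ex_def by (simp add: mult.assoc)
  define \<Phi> where "\<Phi> X = exp (\<i> * of_real \<theta> * f X) - \<psi> a N \<theta>" for X
  \<comment> \<open>The constant is i \<theta> times a N \<eta> / (2 i) times 1/N, the last factor
    from passing from \<open>trG\<close> to \<open>g\<close>; the flag gives the sign.\<close>
  define \<phi> where "\<phi> jb X = exp (\<i> * of_real \<theta> * f X) * (of_real (\<theta> * a (fst jb) * \<eta> N / 2) * (if snd jb then 1 else -1))" for jb X
  define w where "w jb = zj (snd jb) (fst jb)" for jb
  have n\<Phi>: "W.nice \<Phi>" unfolding \<Phi>_def by (intro W.nice_intros nE)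
  have n\<phi>: "W.nice (\<phi> jb)" for jb unfolding \<phi>_def by (intro W.nice_intros nE)
  have pairs: "(\<Sum>jb\<in>(UNIV :: ('k \<times> bool) set). F jb) = (\<Sum>j\<in>UNIV. F (j, True) + F (j, False))" for F :: "_ \<Rightarrow> complex"
  proof -
    have "(\<Sum>jb\<in>(UNIV :: ('k \<times> bool) set). F jb) = (\<Sum>j\<in>UNIV. \<Sum>b\<in>UNIV. F (j, b))"
      unfolding UNIV_Times_UNIV[symmetric] by (simp only: sum.cartesian_product case_prod_eta)
    then show ?thesis by (simp add: UNIV_bool add.commute)
  qed
  have d: "((\<lambda>t. \<Phi> (X((\<nu>, x) := t))) has_vector_derivative
      (\<Sum>jb\<in>UNIV. \<phi> jb (X((\<nu>, x) := t)) * (- (2 / of_nat N) * W.W (X((\<nu>, x) := t)) (w jb) x \<nu>))) (at t)"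
    if \<nu>x: "\<nu> < m N" "x < N" for \<nu> x X t
  proof -
    let ?X = "\<lambda>t. X((\<nu>, x) := t)"
    define D where "D b j = - (2 / of_nat N) * W.W (?X t) (zj b j) x \<nu>" for b j
    define f' where "f' = (\<Sum>j\<in>UNIV. of_real (a j) * (of_real (real N * \<eta> N) * (((1 / of_nat N) * D True j - (1 / of_nat N) * D False j) * (1 / (2 * \<i>)) - 0)))"
    have fd: "((\<lambda>t. f (?X t)) has_vector_derivative f') (at t)"
      unfolding f_def f'_def D_def
      by (intro has_vector_derivative_sum has_vector_derivative_mult_right has_vector_derivative_mult_left has_vector_derivative_diff
          has_vector_derivative_const W.g_derivative zj \<nu>x)
    have "((\<lambda>y. exp (\<i> * of_real \<theta> * y)) has_field_derivative exp (\<i> * of_real \<theta> * f (?X t)) * (\<i> * of_real \<theta>)) (at (f (?X t)))"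
      by (auto intro!: derivative_eq_intros)
    from field_vector_diff_chain_at[OF fd this]
    have "((\<lambda>t. exp (\<i> * of_real \<theta> * f (?X t))) has_vector_derivative f' * (exp (\<i> * of_real \<theta> * f (?X t)) * (\<i> * of_real \<theta>))) (at t)"
      by (simp only: o_def)
    then have "((\<lambda>t. \<Phi> (?X t)) has_vector_derivative f' * (exp (\<i> * of_real \<theta> * f (?X t)) * (\<i> * of_real \<theta>)) - 0) (at t)"
      unfolding \<Phi>_def by (intro has_vector_derivative_diff has_vector_derivative_const)
    moreover have "f' * (exp (\<i> * of_real \<theta> * f (?X t)) * (\<i> * of_real \<theta>)) - 0 =
      (\<Sum>jb\<in>UNIV. \<phi> jb (?X t) * (- (2 / of_nat N) * W.W (?X t) (w jb) x \<nu>))"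
    proof -
      have f'eq: "f' = (\<Sum>j\<in>UNIV. of_real (a j * \<eta> N) * (D True j - D False j) * (1 / (2 * \<i>)))"
        unfolding f'_def using N0 by (intro sum.cong refl) (simp add: field_simps)
      then have "f' * (exp (\<i> * of_real \<theta> * f (?X t)) * (\<i> * of_real \<theta>)) =
        (\<Sum>j\<in>UNIV. exp (\<i> * of_real \<theta> * f (?X t)) * of_real (\<theta> * a j * \<eta> N / 2) * (D True j - D False j))"
      proof -
        have "x * (1 / (2 * \<i>)) * (e * (\<i> * y)) = e * (y / 2) * x" for x y e :: complex
          by (simp add: field_simps)
        then have "of_real (a j * \<eta> N) * (D True j - D False j) * (1 / (2 * \<i>)) * (exp (\<i> * of_real \<theta> * f (?X t)) * (\<i> * of_real \<theta>)) =
          exp (\<i> * of_real \<theta> * f (?X t)) * (of_real \<theta> / 2) * (of_real (a j * \<eta> N) * (D True j - D False j))" for j by blast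
        then show ?thesis unfolding f'eq sum_distrib_right by (intro sum.cong refl) (simp add: mult_ac)
      qed
      also have "\<dots> = (\<Sum>jb\<in>UNIV. \<phi> jb (?X t) * (- (2 / of_nat N) * W.W (?X t) (w jb) x \<nu>))"
      proof -
        have Dw: "- (2 / of_nat N) * W.W (?X t) (w (j, b)) x \<nu> = D b j" for j b by (simp add: D_def w_def)
        show ?thesis unfolding pairs Dw by (intro sum.cong refl) (simp add: \<phi>_def right_diff_distrib)
      qed
      finally show ?thesis by simp
    qed
    ultimately show ?thesis by simp
  qed
  have wn: "Im (w jb) \<noteq> 0" for jb by (simp add: w_def zj)
  from W.scaled_loop_equation[OF Im_zz_nonzero[OF N p] finite wn n\<Phi> n\<phi> d]
  have "(\<integral>\<omega>. W.mp (zz N p) (W.g (cfg \<omega>) (zz N p)) * \<Phi> (cfg \<omega>) \<partial>M) =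
    - (of_real (u\<^sup>2) / (of_nat N)\<^sup>2) * ((\<integral>\<omega>. W.trGHG (cfg \<omega>) (zz N p) * \<Phi> (cfg \<omega>) \<partial>M) +
      2 * (\<Sum>jb\<in>UNIV. \<integral>\<omega>. \<phi> jb (cfg \<omega>) * W.trGHGG (cfg \<omega>) (zz N p) (w jb) \<partial>M))" .
  moreover have "2 * (\<Sum>jb\<in>UNIV. \<integral>\<omega>. \<phi> jb (cfg \<omega>) * W.trGHGG (cfg \<omega>) (zz N p) (w jb) \<partial>M) =
    of_real (\<theta> * \<eta> N * real N) * (\<Sum>j\<in>UNIV. of_real (a j) * ((\<integral>\<omega>. ex a N \<theta> \<omega> * AA N p (pk j) \<omega> \<partial>M) -
        (\<integral>\<omega>. ex a N \<theta> \<omega> * AA N p (cnj (pk j)) \<omega> \<partial>M)))"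
  proof -
    have *: "(\<integral>\<omega>. \<phi> (j, b) (cfg \<omega>) * W.trGHGG (cfg \<omega>) (zz N p) (w (j, b)) \<partial>M) =
      of_real (\<theta> * a j * \<eta> N / 2) * (if b then 1 else -1) * of_nat N * (\<integral>\<omega>. ex a N \<theta> \<omega> * AA N p (if b then pk j else cnj (pk j)) \<omega> \<partial>M)" for j b
    proof -
      have "(\<integral>\<omega>. \<phi> (j, b) (cfg \<omega>) * W.trGHGG (cfg \<omega>) (zz N p) (w (j, b)) \<partial>M) =
        (\<integral>\<omega>. (of_real (\<theta> * a j * \<eta> N / 2) * (if b then 1 else -1) * of_nat N) * (ex a N \<theta> \<omega> * AA N p (if b then pk j else cnj (pk j)) \<omega>) \<partial>M)"
        using N0 by (intro Bochner_Integration.integral_cong refl) (simp add: \<phi>_def Ecf AA_def w_def zj_def)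
      then show ?thesis by simp
    qed
    show ?thesis unfolding pairs * sum_distrib_left
      by (intro sum.cong refl) (simp add: algebra_simps)
  qed
  ultimately show ?thesis by (simp only: \<Phi>_def Ecf GG_def)
qed

text \<open>The limit of \<eta>^2 times the difference of \<open>AA\<close> at \<open>pk j\<close>
  and at its conjugate.\<close>

definition lim_pair :: "complex \<Rightarrow> 'k \<Rightarrow> complex" where
  "lim_pair p j = of_real l * (sg p - s0) / (p - pk j)\<^sup>2 - of_real l * (sg p - cnj s0) / (p - cnj (pk j))\<^sup>2"

text \<open>The response coefficient: N \<eta> times the covariance of \<open>GG\<close> with
  \<open>ex\<close> will be close to \<theta> times this times \<psi>.\<close>

definition resp :: "('k \<Rightarrow> real) \<Rightarrow> complex \<Rightarrow> complex" where
  "resp a p = - (\<Sum>j\<in>UNIV. of_real (a j) * lim_pair p j) / (of_real l * (sg p - cnj (sg p)))"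

lemma sg_pk: "sg (pk j) = s0" "sg (cnj (pk j)) = cnj s0" by (auto simp: sg_def Im_pk)

lemma norm_integral_le:
  fixes f :: "'a \<Rightarrow> complex"
  assumes "integrable M f" "integrable M h" "\<And>\<omega>. cmod (f \<omega>) \<le> h \<omega>"
  shows "cmod (\<integral>\<omega>. f \<omega> \<partial>M) \<le> (\<integral>\<omega>. h \<omega> \<partial>M)"
  using order_trans[OF integral_norm_bound integral_mono[OF integrable_norm[OF assms(1)] assms(2,3)]] .

text \<open>The loop equation with test function \<open>ex - \<psi>\<close>, linearised at the root near \<open>sg p\<close>: dividing by
  the derivative of the quadratic there produces the denominator of \<open>resp\<close>.\<close>

lemma fluctuation_limit:
  assumes p: "Im p \<noteq> 0"
  shows "\<exists>\<epsilon>. \<epsilon> \<longlonglongrightarrow> 0 \<and> (\<forall>\<^sub>F N in sequentially. \<forall>\<theta>. \<bar>\<theta>\<bar> \<le> 1 \<longrightarrow>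
    cmod (of_real (real N * \<eta> N) * (\<integral>\<omega>. GG N p \<omega> * (ex a N \<theta> \<omega> - \<psi> a N \<theta>) \<partial>M) - of_real \<theta> * resp a p * \<psi> a N \<theta>) \<le> \<epsilon> N)"
proof -
  from local_law_both[OF p] obtain s s' C where s: "s \<longlonglongrightarrow> sg p" "s' \<longlonglongrightarrow> cnj (sg p)"
    and roots: "\<forall>\<^sub>F N in sequentially. \<forall>x. wishart_ensemble.mp (m N) N u (zz N p) x = of_real (u\<^sup>2) * zz N p * (x - s N) * (x - s' N)"
    and C: "\<forall>\<^sub>F N in sequentially. (\<integral>\<omega>. (cmod (GG N p \<omega> - s N))\<^sup>2 \<partial>M) \<le> C * (1 / (real N * \<eta> N))\<^sup>2" by blast
  define K where "K = of_real (u\<^sup>2) * of_real l * (sg p - cnj (sg p))"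
  define KN where "KN N = of_real (u\<^sup>2) * zz N p * (s N - s' N)" for N
  have sgne: "sg p - cnj (sg p) \<noteq> 0" using Im_s0 by (auto simp: sg_def complex_eq_iff)
  have K0: "K \<noteq> 0" unfolding K_def using sgne u_pos l_pos by simp
  have KNl: "KN \<longlonglongrightarrow> K" unfolding KN_def K_def by (intro tendsto_intros s zz_lim)
  let ?e1 = "\<lambda>N. \<integral>\<omega>. \<eta> N * cmod (wishart.trGHG (m N) N (cfg \<omega>) (zz N p) / of_nat N) \<partial>M"
  let ?e2 = "\<lambda>q N. \<integral>\<omega>. cmod (of_real ((\<eta> N)\<^sup>2) * AA N p q \<omega> - of_real l * (sg p - sg q) / (p - q)\<^sup>2) \<partial>M"
  \<comment> \<open>Three errors: the lower-order trace, the replacement of \<open>AA\<close> by its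
    limit, and the quadratic remainder of \<open>mp\<close> at its root. The last is N \<eta> times
    the order 1/(N \<eta>)^2 of the local law, hence still vanishes.\<close>
  define err where "err N = 2 * u\<^sup>2 * ?e1 N + u\<^sup>2 * (\<Sum>j\<in>UNIV. \<bar>a j\<bar> * (?e2 (pk j) N + ?e2 (cnj (pk j)) N)) +
    2 * u\<^sup>2 * cmod (zz N p) * (C * (1 / (real N * \<eta> N)))" for N
  have errl: "err \<longlonglongrightarrow> 0"
  proof -
    have "err \<longlonglongrightarrow> 2 * u\<^sup>2 * 0 + u\<^sup>2 * (\<Sum>j\<in>(UNIV::'k set). \<bar>a j\<bar> * (0 + 0)) + 2 * u\<^sup>2 * l * (C * 0)"
      unfolding err_def
      by (intro tendsto_intros norm_zz_lim inverse_N\<eta>_lim)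
        (use trGHG_small[OF p] AA_small[OF p Im_pk(2)] AA_small[OF p Im_pk(3)] in \<open>auto simp: small_def\<close>)
    then show ?thesis by simp
  qed
  define \<epsilon> where "\<epsilon> N = (err N + cmod (KN N - K) * cmod (resp a p)) / cmod (KN N)" for N
  have \<epsilon>l: "\<epsilon> \<longlonglongrightarrow> 0"
  proof -
    have "(\<lambda>N. cmod (KN N - K)) \<longlonglongrightarrow> 0" using KNl by (simp add: LIM_zero tendsto_norm_zero)
    then have "\<epsilon> \<longlonglongrightarrow> (0 + 0 * cmod (resp a p)) / cmod K"
      unfolding \<epsilon>_def using K0 by (intro tendsto_intros errl KNl) auto
    then show ?thesis by simp
  qed
  have KNne: "\<forall>\<^sub>F N in sequentially. KN N \<noteq> 0" using tendsto_imp_eventually_ne[OF KNl K0] .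
  have "\<forall>\<^sub>F N in sequentially. \<forall>\<theta>. \<bar>\<theta>\<bar> \<le> 1 \<longrightarrow>
    cmod (of_real (real N * \<eta> N) * (\<integral>\<omega>. GG N p \<omega> * (ex a N \<theta> \<omega> - \<psi> a N \<theta>) \<partial>M) - of_real \<theta> * resp a p * \<psi> a N \<theta>) \<le> \<epsilon> N"
    using eventually_gt_at_top[of 0] roots C KNne
  proof (eventually_elim, intro allI impI)
    fix N \<theta> assume N: "0 < (N::nat)"
      and roots: "\<forall>x. wishart_ensemble.mp (m N) N u (zz N p) x = of_real (u\<^sup>2) * zz N p * (x - s N) * (x - s' N)"
      and C: "(\<integral>\<omega>. (cmod (GG N p \<omega> - s N))\<^sup>2 \<partial>M) \<le> C * (1 / (real N * \<eta> N))\<^sup>2"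
      and KNne: "KN N \<noteq> 0" and \<theta>: "\<bar>\<theta>\<bar> \<le> (1::real)"
    interpret W: wishart_ensemble "m N" N M Z u by (rule ens[OF N])
    have h: "\<eta> N > 0" by (rule \<eta>_pos[OF N])
    have N0: "of_nat N \<noteq> (0::complex)" using N by simp
    define E where "E \<omega> = ex a N \<theta> \<omega>" for \<omega>
    define E0 where "E0 \<omega> = ex a N \<theta> \<omega> - \<psi> a N \<theta>" for \<omega>
    have iE: "integrable M E" unfolding E_def by (rule ex_integrable[OF N])
    have E1: "cmod (E \<omega>) = 1" for \<omega> by (simp add: E_def norm_ex)
    have E02: "cmod (E0 \<omega>) \<le> 2" for \<omega>
      unfolding E0_def using norm_triangle_ineq4[of "ex a N \<theta> \<omega>" "\<psi> a N \<theta>"] norm_\<psi>[OF N, of a \<theta>] by (simp add: norm_ex)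
    have iE0: "integrable M E0" unfolding E0_def using ex_integrable[OF N] by simp
    have E0int: "(\<integral>\<omega>. E0 \<omega> \<partial>M) = 0" unfolding E0_def using ex_integrable[OF N, of a \<theta>] by (simp add: \<psi>_def prob_space)
    have iG: "integrable M (GG N p)" by (rule GG_integrable[OF N p])
    have iT: "integrable M (\<lambda>\<omega>. W.trGHG (cfg \<omega>) (zz N p))"
      by (rule W.nice_integrable[OF W.nice_trGHG[OF Im_zz_nonzero[OF N p]]])
    have iD2: "integrable M (\<lambda>\<omega>. (GG N p \<omega> - s N)\<^sup>2)"
      unfolding GG_def by (intro W.nice_integrable W.nice_intros W.nice_g Im_zz_nonzero N p)
    have times_E0: "integrable M (\<lambda>\<omega>. f \<omega> * E0 \<omega>)" if "integrable M f" for f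
      unfolding E0_def right_diff_distrib using that mult_ex_integrable[OF N that] by auto
    define L where "L = of_real (real N * \<eta> N) * (\<integral>\<omega>. GG N p \<omega> * E0 \<omega> \<partial>M)"
    define X1 where "X1 = (\<integral>\<omega>. W.trGHG (cfg \<omega>) (zz N p) * E0 \<omega> \<partial>M)"
    define X2 where "X2 q = (\<integral>\<omega>. E \<omega> * AA N p q \<omega> \<partial>M)" for q
    define X3 where "X3 = (\<integral>\<omega>. (GG N p \<omega> - s N)\<^sup>2 * E0 \<omega> \<partial>M)"
    have id: "(\<integral>\<omega>. W.mp (zz N p) (GG N p \<omega>) * E0 \<omega> \<partial>M) =
      - (of_real (u\<^sup>2) / (of_nat N)\<^sup>2) * (X1 + of_real (\<theta> * \<eta> N * real N) * (\<Sum>j\<in>UNIV. of_real (a j) * (X2 (pk j) - X2 (cnj (pk j)))))"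
      unfolding X1_def X2_def E0_def E_def by (rule test_identity[OF N p])
    \<comment> \<open>The expansion of \<open>mp\<close> at its root \<open>s N\<close> is exact,
      with derivative \<open>KN N\<close> and a quadratic remainder. The constant \<open>s N\<close>
      drops out since \<open>E0\<close> has mean 0.\<close>
    have "(\<integral>\<omega>. W.mp (zz N p) (GG N p \<omega>) * E0 \<omega> \<partial>M) =
      (\<integral>\<omega>. KN N * (GG N p \<omega> * E0 \<omega>) - KN N * s N * E0 \<omega> + of_real (u\<^sup>2) * zz N p * ((GG N p \<omega> - s N)\<^sup>2 * E0 \<omega>) \<partial>M)"
      by (intro Bochner_Integration.integral_cong refl)
        (simp add: roots KN_def power2_eq_square algebra_simps)
    also have "\<dots> = KN N * (\<integral>\<omega>. GG N p \<omega> * E0 \<omega> \<partial>M) + of_real (u\<^sup>2) * zz N p * X3"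
      using times_E0[OF iG] times_E0[OF iD2] iE0 E0int by (simp add: X3_def)
    finally have "KN N * (\<integral>\<omega>. GG N p \<omega> * E0 \<omega> \<partial>M) =
      - (of_real (u\<^sup>2) / (of_nat N)\<^sup>2) * (X1 + of_real (\<theta> * \<eta> N * real N) * (\<Sum>j\<in>UNIV. of_real (a j) * (X2 (pk j) - X2 (cnj (pk j))))) - of_real (u\<^sup>2) * zz N p * X3"
      unfolding id by (simp add: algebra_simps)
    then have "of_real (real N * \<eta> N) * (KN N * (\<integral>\<omega>. GG N p \<omega> * E0 \<omega> \<partial>M)) =
      of_real (real N * \<eta> N) * (- (of_real (u\<^sup>2) / (of_nat N)\<^sup>2) * (X1 + of_real (\<theta> * \<eta> N * real N) * (\<Sum>j\<in>UNIV. of_real (a j) * (X2 (pk j) - X2 (cnj (pk j))))) - of_real (u\<^sup>2) * zz N p * X3)"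
      by simp
    then have KL: "KN N * L = - of_real (u\<^sup>2) * (of_real (\<eta> N) * X1 / of_nat N)
      - of_real (u\<^sup>2) * of_real \<theta> * (\<Sum>j\<in>UNIV. of_real (a j) * (of_real ((\<eta> N)\<^sup>2) * X2 (pk j) - of_real ((\<eta> N)\<^sup>2) * X2 (cnj (pk j))))
      - of_real (u\<^sup>2) * zz N p * (of_real (real N * \<eta> N) * X3)"
    proof -
      define S where "S = (\<Sum>j\<in>UNIV. of_real (a j) * (X2 (pk j) - X2 (cnj (pk j))))"
      have S: "(\<Sum>j\<in>UNIV. of_real (a j) * (of_real ((\<eta> N)\<^sup>2) * X2 (pk j) - of_real ((\<eta> N)\<^sup>2) * X2 (cnj (pk j)))) = of_real ((\<eta> N)\<^sup>2) * S"
        unfolding S_def sum_distrib_left by (intro sum.cong refl) (simp add: algebra_simps)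
      have "KN N * L = of_real (real N * \<eta> N) * (KN N * (\<integral>\<omega>. GG N p \<omega> * E0 \<omega> \<partial>M))" by (simp add: L_def mult_ac)
      also have "\<dots> = of_real (real N * \<eta> N) * (- (of_real (u\<^sup>2) / (of_nat N)\<^sup>2) * (X1 + of_real (\<theta> * \<eta> N * real N) * S) - of_real (u\<^sup>2) * zz N p * X3)"
        unfolding S_def by fact
      also have "\<dots> = - of_real (u\<^sup>2) * (of_real (\<eta> N) * X1 / of_nat N) - of_real (u\<^sup>2) * of_real \<theta> * (of_real ((\<eta> N)\<^sup>2) * S) - of_real (u\<^sup>2) * zz N p * (of_real (real N * \<eta> N) * X3)"
        using N0 by (simp add: power2_eq_square field_simps)
      finally show ?thesis unfolding S .
    qed
    \<comment> \<open>Replacing \<open>AA\<close> by its deterministic limit turns the expectation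
      of its product with \<open>ex\<close> into that limit times \<psi>; \<open>Y\<close> is the
      error.\<close>
    define Y where "Y q = (\<integral>\<omega>. E \<omega> * (of_real ((\<eta> N)\<^sup>2) * AA N p q \<omega> - of_real l * (sg p - sg q) / (p - q)\<^sup>2) \<partial>M)" for q
    have iA: "integrable M (AA N p q)" if "Im q \<noteq> 0" for q by (rule AA_integrable[OF N p that])
    have Y: "of_real ((\<eta> N)\<^sup>2) * X2 q = Y q + of_real l * (sg p - sg q) / (p - q)\<^sup>2 * \<psi> a N \<theta>" if "Im q \<noteq> 0" for q
    proof -
      define k where "k = of_real l * (sg p - sg q) / (p - q)\<^sup>2"
      have "integrable M (\<lambda>\<omega>. E \<omega> * AA N p q \<omega>)" using mult_ex_integrable[OF N iA[OF that]] by (simp add: E_def mult.commute)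
      moreover have "Y q = (\<integral>\<omega>. of_real ((\<eta> N)\<^sup>2) * (E \<omega> * AA N p q \<omega>) - k * E \<omega> \<partial>M)"
        unfolding Y_def k_def[symmetric] by (intro Bochner_Integration.integral_cong refl) (simp add: algebra_simps)
      ultimately have "Y q = of_real ((\<eta> N)\<^sup>2) * X2 q - k * (\<integral>\<omega>. E \<omega> \<partial>M)"
        unfolding X2_def using iE by simp
      then have "of_real ((\<eta> N)\<^sup>2) * X2 q = Y q + k * (\<integral>\<omega>. E \<omega> \<partial>M)" by simp
      moreover have "(\<integral>\<omega>. E \<omega> \<partial>M) = \<psi> a N \<theta>" by (simp add: \<psi>_def E_def)
      ultimately show ?thesis by (simp only: k_def)
    qed
    have Kres: "K * resp a p = - of_real (u\<^sup>2) * (\<Sum>j\<in>UNIV. of_real (a j) * lim_pair p j)"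
      unfolding resp_def K_def using sgne l_pos by (simp add: field_simps)
    have diff: "KN N * L - of_real \<theta> * (K * resp a p) * \<psi> a N \<theta> = - of_real (u\<^sup>2) * (of_real (\<eta> N) * X1 / of_nat N)
      - of_real (u\<^sup>2) * of_real \<theta> * (\<Sum>j\<in>UNIV. of_real (a j) * (Y (pk j) - Y (cnj (pk j))))
      - of_real (u\<^sup>2) * zz N p * (of_real (real N * \<eta> N) * X3)"
    proof -
      have "(\<Sum>j\<in>UNIV. of_real (a j) * (of_real ((\<eta> N)\<^sup>2) * X2 (pk j) - of_real ((\<eta> N)\<^sup>2) * X2 (cnj (pk j)))) =
        (\<Sum>j\<in>UNIV. of_real (a j) * (Y (pk j) - Y (cnj (pk j)))) + (\<Sum>j\<in>UNIV. of_real (a j) * lim_pair p j) * \<psi> a N \<theta>"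
        unfolding Y[OF Im_pk(2)] Y[OF Im_pk(3)] lim_pair_def sg_pk sum_distrib_right sum.distrib[symmetric]
        by (intro sum.cong refl) (simp add: algebra_simps)
      then show ?thesis unfolding KL Kres by (simp add: algebra_simps)
    qed
    have b1: "cmod (of_real (\<eta> N) * X1 / of_nat N) \<le> 2 * ?e1 N"
    proof -
      have "of_real (\<eta> N) * X1 / of_nat N = (\<integral>\<omega>. (of_real (\<eta> N) / of_nat N) * (W.trGHG (cfg \<omega>) (zz N p) * E0 \<omega>) \<partial>M)"
        unfolding X1_def by simp
      also have "cmod \<dots> \<le> (\<integral>\<omega>. 2 * (\<eta> N * cmod (W.trGHG (cfg \<omega>) (zz N p) / of_nat N)) \<partial>M)"
      proof (rule norm_integral_le)
        show "integrable M (\<lambda>\<omega>. (of_real (\<eta> N) / of_nat N) * (W.trGHG (cfg \<omega>) (zz N p) * E0 \<omega>))"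
          by (intro integrable_mult_right times_E0 iT)
        show "integrable M (\<lambda>\<omega>. 2 * (\<eta> N * cmod (W.trGHG (cfg \<omega>) (zz N p) / of_nat N)))"
          using iT by (intro integrable_mult_right integrable_norm integrable_divide)
        fix \<omega>
        have "cmod ((of_real (\<eta> N) / of_nat N) * (W.trGHG (cfg \<omega>) (zz N p) * E0 \<omega>)) = (\<eta> N * cmod (W.trGHG (cfg \<omega>) (zz N p) / of_nat N)) * cmod (E0 \<omega>)"
          using h by (simp add: norm_mult norm_divide)
        also have "\<dots> \<le> (\<eta> N * cmod (W.trGHG (cfg \<omega>) (zz N p) / of_nat N)) * 2"
          using h E02 by (intro mult_left_mono) auto
        finally show "cmod ((of_real (\<eta> N) / of_nat N) * (W.trGHG (cfg \<omega>) (zz N p) * E0 \<omega>)) \<le> 2 * (\<eta> N * cmod (W.trGHG (cfg \<omega>) (zz N p) / of_nat N))" by simp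
      qed
      finally show ?thesis by simp
    qed
    have b2: "cmod (Y q) \<le> ?e2 q N" if q: "Im q \<noteq> 0" for q
    proof -
      have i: "integrable M (\<lambda>\<omega>. of_real ((\<eta> N)\<^sup>2) * AA N p q \<omega> - of_real l * (sg p - sg q) / (p - q)\<^sup>2)" using iA[OF q] by simp
      show ?thesis unfolding Y_def
      proof (rule norm_integral_le)
        show "integrable M (\<lambda>\<omega>. E \<omega> * (of_real ((\<eta> N)\<^sup>2) * AA N p q \<omega> - of_real l * (sg p - sg q) / (p - q)\<^sup>2))"
          using mult_ex_integrable[OF N i, of a \<theta>] by (simp add: E_def mult.commute)
      qed (use i in \<open>auto simp: norm_mult E1 intro!: integrable_norm\<close>)
    qed
    have b3: "cmod (of_real (real N * \<eta> N) * X3) \<le> 2 * (C * (1 / (real N * \<eta> N)))"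
    proof -
      have Nh: "real N * \<eta> N > 0" using N h by simp
      have "cmod X3 \<le> (\<integral>\<omega>. 2 * (cmod (GG N p \<omega> - s N))\<^sup>2 \<partial>M)"
        unfolding X3_def
      proof (rule norm_integral_le[OF times_E0[OF iD2]])
        show "integrable M (\<lambda>\<omega>. 2 * (cmod (GG N p \<omega> - s N))\<^sup>2)"
          using integrable_norm[OF iD2] by (simp add: norm_power)
        fix \<omega> show "cmod ((GG N p \<omega> - s N)\<^sup>2 * E0 \<omega>) \<le> 2 * (cmod (GG N p \<omega> - s N))\<^sup>2"
          unfolding norm_mult norm_power using mult_left_mono[OF E02[of \<omega>], of "(cmod (GG N p \<omega> - s N))\<^sup>2"] by simp
      qed
      also have "\<dots> \<le> 2 * (C * (1 / (real N * \<eta> N))\<^sup>2)" using C by simp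
      finally have "(real N * \<eta> N) * cmod X3 \<le> (real N * \<eta> N) * (2 * (C * (1 / (real N * \<eta> N))\<^sup>2))"
        using Nh by (intro mult_left_mono) auto
      also have "\<dots> = 2 * (C * (1 / (real N * \<eta> N)))" using Nh by (simp add: power2_eq_square)
      finally show ?thesis using Nh by (simp only: norm_mult norm_of_real abs_of_pos)
    qed
    have "cmod (KN N * L - of_real \<theta> * (K * resp a p) * \<psi> a N \<theta>) \<le> err N"
    proof -
      have t: "cmod (- x - y - z) \<le> cmod x + cmod y + cmod z" for x y z :: complex
        using norm_triangle_ineq4[of "- x - y" z] norm_triangle_ineq4[of "- x" y] by simp
      have "cmod (KN N * L - of_real \<theta> * (K * resp a p) * \<psi> a N \<theta>) \<le>
        cmod (of_real (u\<^sup>2) * (of_real (\<eta> N) * X1 / of_nat N)) +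
        cmod (of_real (u\<^sup>2) * of_real \<theta> * (\<Sum>j\<in>UNIV. of_real (a j) * (Y (pk j) - Y (cnj (pk j))))) +
        cmod (of_real (u\<^sup>2) * zz N p * (of_real (real N * \<eta> N) * X3))"
        unfolding diff using t[of "of_real (u\<^sup>2) * (of_real (\<eta> N) * X1 / of_nat N)"] by (simp only: mult_minus_left)
      also have "\<dots> \<le> 2 * u\<^sup>2 * ?e1 N + u\<^sup>2 * (\<Sum>j\<in>UNIV. \<bar>a j\<bar> * (?e2 (pk j) N + ?e2 (cnj (pk j)) N)) +
        2 * u\<^sup>2 * cmod (zz N p) * (C * (1 / (real N * \<eta> N)))"
      proof (intro add_mono)
        show "cmod (of_real (u\<^sup>2) * (of_real (\<eta> N) * X1 / of_nat N)) \<le> 2 * u\<^sup>2 * ?e1 N"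
          using mult_left_mono[OF b1, of "u\<^sup>2"] by (simp only: norm_mult[of "of_real (u\<^sup>2)"] norm_of_real abs_of_nonneg zero_le_power2) (simp add: mult_ac)
        have "cmod (\<Sum>j\<in>UNIV. of_real (a j) * (Y (pk j) - Y (cnj (pk j)))) \<le> (\<Sum>j\<in>UNIV. \<bar>a j\<bar> * (?e2 (pk j) N + ?e2 (cnj (pk j)) N))"
        proof (rule order_trans[OF norm_sum], rule sum_mono)
          fix j
          have "cmod (Y (pk j) - Y (cnj (pk j))) \<le> ?e2 (pk j) N + ?e2 (cnj (pk j)) N"
            using norm_triangle_ineq4[of "Y (pk j)" "Y (cnj (pk j))"] b2[OF Im_pk(2), of j] b2[OF Im_pk(3), of j] by linarith
          then show "cmod (of_real (a j) * (Y (pk j) - Y (cnj (pk j)))) \<le> \<bar>a j\<bar> * (?e2 (pk j) N + ?e2 (cnj (pk j)) N)"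
            unfolding norm_mult norm_of_real by (rule mult_left_mono) simp
        qed
        then show "cmod (of_real (u\<^sup>2) * of_real \<theta> * (\<Sum>j\<in>UNIV. of_real (a j) * (Y (pk j) - Y (cnj (pk j))))) \<le>
          u\<^sup>2 * (\<Sum>j\<in>UNIV. \<bar>a j\<bar> * (?e2 (pk j) N + ?e2 (cnj (pk j)) N))"
          unfolding norm_mult norm_of_real mult.assoc
          by (intro mult_mono order_trans[OF mult_left_le_one_le]) (use \<theta> in \<open>auto\<close>)
        show "cmod (of_real (u\<^sup>2) * zz N p * (of_real (real N * \<eta> N) * X3)) \<le> 2 * u\<^sup>2 * cmod (zz N p) * (C * (1 / (real N * \<eta> N)))"
          using mult_left_mono[OF b3, of "u\<^sup>2 * cmod (zz N p)"]
          by (simp only: norm_mult[of "of_real (u\<^sup>2) * zz N p"] norm_mult[of "of_real (u\<^sup>2)"] norm_of_real abs_of_nonneg zero_le_power2) (simp add: mult_ac)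
      qed
      finally show ?thesis by (simp add: err_def)
    qed
    moreover have "cmod (of_real \<theta> * ((K - KN N) * resp a p) * \<psi> a N \<theta>) \<le> cmod (KN N - K) * cmod (resp a p)"
    proof -
      have "cmod (of_real \<theta> * ((K - KN N) * resp a p) * \<psi> a N \<theta>) = (\<bar>\<theta>\<bar> * cmod (\<psi> a N \<theta>)) * (cmod (KN N - K) * cmod (resp a p))"
        by (simp add: norm_mult norm_minus_commute)
      also have "\<dots> \<le> 1 * (cmod (KN N - K) * cmod (resp a p))"
        using \<theta> norm_\<psi>[OF N, of a \<theta>] by (intro mult_right_mono mult_le_one) auto
      finally show ?thesis by simp
    qed
    moreover have "KN N * (L - of_real \<theta> * resp a p * \<psi> a N \<theta>) =
      (KN N * L - of_real \<theta> * (K * resp a p) * \<psi> a N \<theta>) + of_real \<theta> * ((K - KN N) * resp a p) * \<psi> a N \<theta>"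
      by (simp add: algebra_simps)
    ultimately have "cmod (KN N * (L - of_real \<theta> * resp a p * \<psi> a N \<theta>)) \<le> err N + cmod (KN N - K) * cmod (resp a p)"
      using norm_triangle_ineq[of "KN N * L - of_real \<theta> * (K * resp a p) * \<psi> a N \<theta>" "of_real \<theta> * ((K - KN N) * resp a p) * \<psi> a N \<theta>"] by simp
    then have "cmod (L - of_real \<theta> * resp a p * \<psi> a N \<theta>) \<le> \<epsilon> N"
      unfolding \<epsilon>_def norm_mult[of "KN N"] using KNne by (simp add: pos_le_divide_eq mult.commute)
    then show "cmod (of_real (real N * \<eta> N) * (\<integral>\<omega>. GG N p \<omega> * (ex a N \<theta> \<omega> - \<psi> a N \<theta>) \<partial>M) - of_real \<theta> * resp a p * \<psi> a N \<theta>) \<le> \<epsilon> N"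
      unfolding L_def E0_def .
  qed
  then show ?thesis using \<epsilon>l by blast
qed

text \<open>At \<open>pk i\<close> only the conjugate points contribute, and at its conjugate only
  the \<open>pk j\<close>; in both cases the jump \<open>s0 - cnj s0\<close> and the factor
  \<open>l\<close> cancel against the denominator. The two contributions are conjugate to each other
  and add up to 2 Re (1 / (x + 2 i)^2) with x = \<open>\<tau> i - \<tau> j\<close>.\<close>

lemma resp_identity:
  "(resp a (pk i) - resp a (cnj (pk i))) / (2 * \<i>) = \<i> * of_real (\<Sum>j\<in>UNIV. a j * C_cov (\<tau> i) (\<tau> j))"
proof -
  define d where "d = s0 - cnj s0"
  have d: "d \<noteq> 0" using Im_s0 by (auto simp: d_def complex_eq_iff)
  have l0: "of_real l \<noteq> (0::complex)" using l_pos by simp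
  have r1: "resp a (pk i) = (\<Sum>j\<in>UNIV. of_real (a j) / (pk i - cnj (pk j))\<^sup>2)"
  proof -
    have "(\<Sum>j\<in>UNIV. of_real (a j) * lim_pair (pk i) j) = (\<Sum>j\<in>UNIV. - (of_real l * d) * (of_real (a j) / (pk i - cnj (pk j))\<^sup>2))"
      unfolding lim_pair_def sg_pk d_def by (intro sum.cong refl) simp
    then have "resp a (pk i) = - (- (of_real l * d) * (\<Sum>j\<in>UNIV. of_real (a j) / (pk i - cnj (pk j))\<^sup>2)) / (of_real l * d)"
      unfolding resp_def sg_pk d_def by (simp only: sum_distrib_left)
    then show ?thesis using d l0 by simp
  qed
  have r2: "resp a (cnj (pk i)) = - (\<Sum>j\<in>UNIV. of_real (a j) / (cnj (pk i) - pk j)\<^sup>2)"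
  proof -
    have "(\<Sum>j\<in>UNIV. of_real (a j) * lim_pair (cnj (pk i)) j) = (\<Sum>j\<in>UNIV. - (of_real l * d) * (of_real (a j) / (cnj (pk i) - pk j)\<^sup>2))"
      unfolding lim_pair_def sg_pk d_def by (intro sum.cong refl) (simp add: minus_divide_left[symmetric] algebra_simps)
    moreover have "sg (cnj (pk i)) - cnj (sg (cnj (pk i))) = - d" by (simp add: sg_pk d_def)
    ultimately have "resp a (cnj (pk i)) = - (- (of_real l * d) * (\<Sum>j\<in>UNIV. of_real (a j) / (cnj (pk i) - pk j)\<^sup>2)) / (of_real l * (- d))"
      unfolding resp_def by (simp only: sum_distrib_left)
    then show ?thesis using d l0 by simp
  qed
  have t: "1 / (pk i - cnj (pk j))\<^sup>2 + 1 / (cnj (pk i) - pk j)\<^sup>2 = of_real (- 2 * C_cov (\<tau> i) (\<tau> j))" for j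
  proof -
    define x where "x = \<tau> i - \<tau> j"
    have 1: "pk i - cnj (pk j) = Complex x 2" "cnj (pk i) - pk j = Complex x (-2)" by (simp_all add: pk_def x_def complex_eq_iff)
    have n: "(4 + x\<^sup>2) \<noteq> 0" by (simp add: add_pos_nonneg less_imp_neq[symmetric])
    have 2: "Complex x 2 * Complex x (-2) = of_real (4 + x\<^sup>2)" by (simp add: complex_eq_iff power2_eq_square)
    have ne: "Complex x 2 \<noteq> 0" "Complex x (-2) \<noteq> 0" by (auto simp: complex_eq_iff)
    have "1 / (Complex x 2)\<^sup>2 + 1 / (Complex x (-2))\<^sup>2 = ((Complex x (-2))\<^sup>2 + (Complex x 2)\<^sup>2) / (Complex x 2 * Complex x (-2))\<^sup>2"
      using ne by (simp add: field_simps)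
    also have "(Complex x (-2))\<^sup>2 + (Complex x 2)\<^sup>2 = of_real (2 * (x\<^sup>2 - 4))" by (simp add: complex_eq_iff power2_eq_square)
    finally show ?thesis unfolding 1 2 C_cov_def x_def[symmetric] by (simp add: minus_divide_left)
  qed
  have "resp a (pk i) - resp a (cnj (pk i)) = (\<Sum>j\<in>UNIV. of_real (a j) * (1 / (pk i - cnj (pk j))\<^sup>2 + 1 / (cnj (pk i) - pk j)\<^sup>2))"
    unfolding r1 r2 by (simp only: diff_minus_eq_add sum.distrib distrib_left times_divide_eq_right mult_1_right)
  also have "\<dots> = of_real (- 2 * (\<Sum>j\<in>UNIV. a j * C_cov (\<tau> i) (\<tau> j)))"
    unfolding t by (simp add: sum_distrib_left mult_ac)
  finally have "resp a (pk i) - resp a (cnj (pk i)) = of_real (- 2 * (\<Sum>j\<in>UNIV. a j * C_cov (\<tau> i) (\<tau> j)))" .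
  then show ?thesis by (simp add: field_simps)
qed

text \<open>Centring may be moved from one factor to the other: E ((X - E X) Y) = E (X (Y - E Y)).
  Then X = Im GG is split into the two half-planes, which \<open>resp_identity\<close>
  recombines.\<close>

lemma gam_response:
  "\<exists>\<epsilon>. \<epsilon> \<longlonglongrightarrow> 0 \<and> (\<forall>\<^sub>F N in sequentially. \<forall>\<theta>. \<bar>\<theta>\<bar> \<le> 1 \<longrightarrow>
    cmod ((\<integral>\<omega>. of_real (gam N i \<omega>) * ex a N \<theta> \<omega> \<partial>M) - \<i> * of_real (\<theta> * (\<Sum>j\<in>UNIV. a j * C_cov (\<tau> i) (\<tau> j))) * \<psi> a N \<theta>) \<le> \<epsilon> N)"
proof -
  from fluctuation_limit[OF Im_pk(2), of i a] obtain \<epsilon>1 where \<epsilon>1: "\<epsilon>1 \<longlonglongrightarrow> 0" and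
    1: "\<forall>\<^sub>F N in sequentially. \<forall>\<theta>. \<bar>\<theta>\<bar> \<le> 1 \<longrightarrow>
    cmod (of_real (real N * \<eta> N) * (\<integral>\<omega>. GG N (pk i) \<omega> * (ex a N \<theta> \<omega> - \<psi> a N \<theta>) \<partial>M) - of_real \<theta> * resp a (pk i) * \<psi> a N \<theta>) \<le> \<epsilon>1 N" by blast
  from fluctuation_limit[OF Im_pk(3), of i a] obtain \<epsilon>2 where \<epsilon>2: "\<epsilon>2 \<longlonglongrightarrow> 0" and
    2: "\<forall>\<^sub>F N in sequentially. \<forall>\<theta>. \<bar>\<theta>\<bar> \<le> 1 \<longrightarrow>
    cmod (of_real (real N * \<eta> N) * (\<integral>\<omega>. GG N (cnj (pk i)) \<omega> * (ex a N \<theta> \<omega> - \<psi> a N \<theta>) \<partial>M) - of_real \<theta> * resp a (cnj (pk i)) * \<psi> a N \<theta>) \<le> \<epsilon>2 N" by blast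
  have "(\<lambda>N. (\<epsilon>1 N + \<epsilon>2 N) / 2) \<longlonglongrightarrow> (0 + 0) / 2" by (intro tendsto_intros \<epsilon>1 \<epsilon>2) simp
  moreover have "\<forall>\<^sub>F N in sequentially. \<forall>\<theta>. \<bar>\<theta>\<bar> \<le> 1 \<longrightarrow>
    cmod ((\<integral>\<omega>. of_real (gam N i \<omega>) * ex a N \<theta> \<omega> \<partial>M) - \<i> * of_real (\<theta> * (\<Sum>j\<in>UNIV. a j * C_cov (\<tau> i) (\<tau> j))) * \<psi> a N \<theta>) \<le> (\<epsilon>1 N + \<epsilon>2 N) / 2"
    using eventually_gt_at_top[of 0] 1 2
  proof (eventually_elim, intro allI impI)
    fix N \<theta> assume N: "0 < (N::nat)" and \<theta>: "\<bar>\<theta>\<bar> \<le> (1::real)"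
      and h1: "\<forall>\<theta>. \<bar>\<theta>\<bar> \<le> 1 \<longrightarrow> cmod (of_real (real N * \<eta> N) * (\<integral>\<omega>. GG N (pk i) \<omega> * (ex a N \<theta> \<omega> - \<psi> a N \<theta>) \<partial>M) - of_real \<theta> * resp a (pk i) * \<psi> a N \<theta>) \<le> \<epsilon>1 N"
      and h2: "\<forall>\<theta>. \<bar>\<theta>\<bar> \<le> 1 \<longrightarrow> cmod (of_real (real N * \<eta> N) * (\<integral>\<omega>. GG N (cnj (pk i)) \<omega> * (ex a N \<theta> \<omega> - \<psi> a N \<theta>) \<partial>M) - of_real \<theta> * resp a (cnj (pk i)) * \<psi> a N \<theta>) \<le> \<epsilon>2 N"
    define E where "E \<omega> = ex a N \<theta> \<omega>" for \<omega>
    define G where "G \<omega> = GG N (pk i) \<omega>" for \<omega>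
    define ph where "ph = \<psi> a N \<theta>"
    have iE: "integrable M E" and iG: "integrable M G"
      using ex_integrable[OF N] GG_integrable[OF N Im_pk(2)] by (simp_all add: E_def[abs_def] G_def[abs_def])
    have iGE: "integrable M (\<lambda>\<omega>. f \<omega> * E \<omega>)" if "integrable M f" for f
      unfolding E_def by (rule mult_ex_integrable[OF N that])
    have phE: "ph = (\<integral>\<omega>. E \<omega> \<partial>M)" by (simp add: ph_def \<psi>_def E_def)
    have G': "GG N (cnj (pk i)) \<omega> = cnj (G \<omega>)" for \<omega> unfolding G_def by (rule GG_cnj[OF N Im_pk(2)])
    define L1 where "L1 = of_real (real N * \<eta> N) * (\<integral>\<omega>. G \<omega> * (E \<omega> - ph) \<partial>M)"
    define L2 where "L2 = of_real (real N * \<eta> N) * (\<integral>\<omega>. cnj (G \<omega>) * (E \<omega> - ph) \<partial>M)"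
    have iGc: "integrable M (\<lambda>\<omega>. cnj (G \<omega>))" using iG by simp
    have im: "of_real (Im x) = (x - cnj x) * (1 / (2 * \<i>))" for x by (simp add: complex_eq_iff Re_divide Im_divide)
    have iIm: "integrable M (\<lambda>\<omega>. Im (G \<omega>))" using iG by simp
    define e where "e = (\<integral>\<omega>. Im (G \<omega>) \<partial>M)"
    have iIE: "integrable M (\<lambda>\<omega>. of_real (Im (G \<omega>)) * E \<omega>)" by (rule iGE) (use iIm in simp)
    have "(\<integral>\<omega>. of_real (gam N i \<omega>) * ex a N \<theta> \<omega> \<partial>M) = (\<integral>\<omega>. of_real (real N * \<eta> N) * (of_real (Im (G \<omega>)) * E \<omega> - of_real e * E \<omega>) \<partial>M)"
      by (intro Bochner_Integration.integral_cong refl) (simp add: gam_def G_def E_def e_def algebra_simps)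
    also have "\<dots> = of_real (real N * \<eta> N) * ((\<integral>\<omega>. of_real (Im (G \<omega>)) * E \<omega> \<partial>M) - of_real e * ph)"
      using iIE iE by (simp add: phE)
    also have "(\<integral>\<omega>. of_real (Im (G \<omega>)) * E \<omega> \<partial>M) - of_real e * ph = (\<integral>\<omega>. of_real (Im (G \<omega>)) * E \<omega> - of_real (Im (G \<omega>)) * ph \<partial>M)"
      using iIE iIm by (simp add: e_def)
    also have "\<dots> = (\<integral>\<omega>. (1 / (2 * \<i>)) * (G \<omega> * (E \<omega> - ph) - cnj (G \<omega>) * (E \<omega> - ph)) \<partial>M)"
      unfolding im by (intro Bochner_Integration.integral_cong refl) (simp add: algebra_simps diff_divide_distrib)
    also have "\<dots> = (1 / (2 * \<i>)) * ((\<integral>\<omega>. G \<omega> * (E \<omega> - ph) \<partial>M) - (\<integral>\<omega>. cnj (G \<omega>) * (E \<omega> - ph) \<partial>M))"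
    proof -
      have "integrable M (\<lambda>\<omega>. G \<omega> * (E \<omega> - ph))" "integrable M (\<lambda>\<omega>. cnj (G \<omega>) * (E \<omega> - ph))"
        unfolding right_diff_distrib using iGE[OF iG] iGE[OF iGc] iG iGc by auto
      then show ?thesis by (subst integral_mult_right_zero, subst Bochner_Integration.integral_diff) auto
    qed
    finally have "(\<integral>\<omega>. of_real (gam N i \<omega>) * ex a N \<theta> \<omega> \<partial>M) = (L1 - L2) / (2 * \<i>)"
      unfolding L1_def L2_def by (simp add: field_simps)
    moreover have "\<i> * of_real (\<theta> * (\<Sum>j\<in>UNIV. a j * C_cov (\<tau> i) (\<tau> j))) * ph = of_real \<theta> * ((resp a (pk i) - resp a (cnj (pk i))) / (2 * \<i>)) * ph"
      unfolding resp_identity by simp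
    ultimately have "(\<integral>\<omega>. of_real (gam N i \<omega>) * ex a N \<theta> \<omega> \<partial>M) - \<i> * of_real (\<theta> * (\<Sum>j\<in>UNIV. a j * C_cov (\<tau> i) (\<tau> j))) * ph =
      ((L1 - of_real \<theta> * resp a (pk i) * ph) - (L2 - of_real \<theta> * resp a (cnj (pk i)) * ph)) / (2 * \<i>)"
      by (simp add: field_simps)
    then have "cmod ((\<integral>\<omega>. of_real (gam N i \<omega>) * ex a N \<theta> \<omega> \<partial>M) - \<i> * of_real (\<theta> * (\<Sum>j\<in>UNIV. a j * C_cov (\<tau> i) (\<tau> j))) * ph) =
      cmod ((L1 - of_real \<theta> * resp a (pk i) * ph) - (L2 - of_real \<theta> * resp a (cnj (pk i)) * ph)) / 2"
      by (simp add: norm_divide norm_mult)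
    also have "\<dots> \<le> (\<epsilon>1 N + \<epsilon>2 N) / 2"
      by (rule divide_right_mono[OF order_trans[OF norm_triangle_ineq4 add_mono[OF
          h1[rule_format, OF \<theta>, folded ph_def, folded E_def G_def, folded L1_def]
          h2[rule_format, OF \<theta>, folded ph_def, folded E_def, unfolded G', folded L2_def]]]]) simp
    finally show "cmod ((\<integral>\<omega>. of_real (gam N i \<omega>) * ex a N \<theta> \<omega> \<partial>M) - \<i> * of_real (\<theta> * (\<Sum>j\<in>UNIV. a j * C_cov (\<tau> i) (\<tau> j))) * \<psi> a N \<theta>) \<le> (\<epsilon>1 N + \<epsilon>2 N) / 2"
      by (simp only: ph_def)
  qed
  ultimately show ?thesis by (intro exI[of _ "\<lambda>N. (\<epsilon>1 N + \<epsilon>2 N) / 2"]) simp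
qed

section \<open>Characteristic functions and second moments\<close>

definition vari :: "('k \<Rightarrow> real) \<Rightarrow> real" where
  "vari a = (\<Sum>i\<in>UNIV. \<Sum>j\<in>UNIV. a i * a j * C_cov (\<tau> i) (\<tau> j))"

lemma gam_bounded:
  assumes N: "0 < N"
  shows "\<exists>B. \<forall>\<omega>. \<bar>gam N j \<omega>\<bar> \<le> B"
proof -
  interpret W: wishart_ensemble "m N" N M Z u by (rule ens[OF N])
  obtain B where B: "\<And>X. cmod (W.g X (zz N (pk j))) \<le> B"
    using W.nice_g[OF Im_zz_nonzero[OF N Im_pk(2)], of j] unfolding W.nice_def by blast
  have "\<bar>Im (GG N (pk j) \<omega>)\<bar> \<le> B" for \<omega>
    unfolding GG_def using B abs_Im_le_cmod order_trans by blast
  then have "\<bar>gam N j \<omega>\<bar> \<le> \<bar>real N * \<eta> N\<bar> * (B + \<bar>\<integral>\<omega>. Im (GG N (pk j) \<omega>) \<partial>M\<bar>)" for \<omega>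
    unfolding gam_def abs_mult[of "real N * \<eta> N"] by (intro mult_left_mono order_trans[OF abs_triangle_ineq4] add_mono) auto
  then show ?thesis by blast
qed

lemma Ts_bounded:
  assumes N: "0 < N"
  shows "\<exists>B. \<forall>\<omega>. \<bar>Ts a N \<omega>\<bar> \<le> B"
proof -
  obtain B where B: "\<And>j \<omega>. \<bar>gam N j \<omega>\<bar> \<le> B j" using gam_bounded[OF N] by metis
  have "\<bar>Ts a N \<omega>\<bar> \<le> (\<Sum>j\<in>UNIV. \<bar>a j\<bar> * B j)" for \<omega>
    unfolding Ts_def by (rule order_trans[OF sum_abs]) (auto simp: abs_mult B intro!: sum_mono mult_left_mono)
  then show ?thesis by blast
qed

text \<open>For fixed N the variable \<open>Ts\<close> is bounded, so the second-order remainder of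
  the exponential is at most h^2 B^2 / 2 uniformly; the bound \<open>B\<close> may depend on
  N.\<close>

lemma \<psi>_derivative:
  assumes N: "0 < N"
  shows "(\<psi> a N has_vector_derivative \<i> * (\<integral>\<omega>. of_real (Ts a N \<omega>) * ex a N \<theta> \<omega> \<partial>M)) (at \<theta>)"
proof -
  obtain B where B: "\<And>\<omega>. \<bar>Ts a N \<omega>\<bar> \<le> B" using Ts_bounded[OF N] by blast
  have iT: "integrable M (\<lambda>\<omega>. complex_of_real (Ts a N \<omega>))"
    using Ts_measurable[OF N] B by (intro integrable_const_bound[where B=B]) auto
  have iTE: "integrable M (\<lambda>\<omega>. of_real (Ts a N \<omega>) * ex a N \<theta> \<omega>)" by (rule mult_ex_integrable[OF N iT])
  let ?D = "\<i> * (\<integral>\<omega>. of_real (Ts a N \<omega>) * ex a N \<theta> \<omega> \<partial>M)"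
  have bound: "cmod ((\<psi> a N (\<theta> + h) - \<psi> a N \<theta>) / of_real h - ?D) \<le> \<bar>h\<bar> * (B\<^sup>2 / 2)" if h: "h \<noteq> 0" for h
  proof -
    let ?f = "\<lambda>\<omega>. ex a N (\<theta> + h) \<omega> - ex a N \<theta> \<omega> - of_real h * (\<i> * (of_real (Ts a N \<omega>) * ex a N \<theta> \<omega>))"
    have i: "integrable M ?f"
      by (intro Bochner_Integration.integrable_diff ex_integrable[OF N] integrable_mult_right iTE)
    have eq: "(\<psi> a N (\<theta> + h) - \<psi> a N \<theta>) / of_real h - ?D = (\<integral>\<omega>. ?f \<omega> \<partial>M) / of_real h"
      unfolding \<psi>_def using ex_integrable[OF N] iTE h by (simp add: field_simps)
    have pt: "cmod (?f \<omega>) \<le> h\<^sup>2 * (B\<^sup>2 / 2)" for \<omega>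
    proof -
      define x where "x = h * Ts a N \<omega>"
      have "ex a N (\<theta> + h) \<omega> = ex a N \<theta> \<omega> * exp (\<i> * of_real x)"
        by (simp add: ex_def x_def exp_add[symmetric] algebra_simps)
      then have "?f \<omega> = ex a N \<theta> \<omega> * (exp (\<i> * of_real x) - (1 + \<i> * of_real x))"
        by (simp add: x_def algebra_simps)
      then have "cmod (?f \<omega>) = cmod (exp (\<i> * of_real x) - (1 + \<i> * of_real x))" by (simp add: norm_mult norm_ex)
      also have "\<dots> \<le> \<bar>x\<bar>\<^sup>2 / 2" using iexp_approx1[of x 1] by (simp add: power2_eq_square)
      also have "\<dots> = h\<^sup>2 * (\<bar>Ts a N \<omega>\<bar>\<^sup>2 / 2)" by (simp add: x_def power_mult_distrib)
      also have "\<dots> \<le> h\<^sup>2 * (B\<^sup>2 / 2)" using B[of \<omega>] by (intro mult_left_mono divide_right_mono power_mono) auto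
      finally show ?thesis .
    qed
    have "cmod (\<integral>\<omega>. ?f \<omega> \<partial>M) \<le> (\<integral>\<omega>. h\<^sup>2 * (B\<^sup>2 / 2) \<partial>M)" by (rule norm_integral_le[OF i _ pt]) simp
    then have "cmod (\<integral>\<omega>. ?f \<omega> \<partial>M) \<le> h\<^sup>2 * (B\<^sup>2 / 2)" by (simp add: prob_space)
    then have "cmod (\<integral>\<omega>. ?f \<omega> \<partial>M) / \<bar>h\<bar> \<le> h\<^sup>2 * (B\<^sup>2 / 2) / \<bar>h\<bar>" by (rule divide_right_mono) simp
    also have "\<dots> = \<bar>h\<bar> * (B\<^sup>2 / 2)"
    proof -
      have "h\<^sup>2 * c / \<bar>h\<bar> = \<bar>h\<bar> * c" for c :: real
        by (cases "h > 0") (use h in \<open>simp_all add: power2_eq_square\<close>)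
      then show ?thesis .
    qed
    finally show ?thesis unfolding eq by (simp add: norm_divide)
  qed
  show ?thesis
    unfolding has_vector_derivative_complex_quotient
  proof (rule LIM_zero_cancel, rule Lim_null_comparison)
  show "\<forall>\<^sub>F h in at 0. norm ((\<psi> a N (\<theta> + h) - \<psi> a N \<theta>) / of_real h - ?D) \<le> \<bar>h\<bar> * (B\<^sup>2 / 2)"
    using bound by (auto simp: eventually_at_filter)
  have "((\<lambda>h::real. \<bar>h\<bar> * (B\<^sup>2 / 2)) \<longlongrightarrow> \<bar>0\<bar> * (B\<^sup>2 / 2)) (at 0)" by (intro tendsto_intros)
  then show "((\<lambda>h::real. \<bar>h\<bar> * (B\<^sup>2 / 2)) \<longlongrightarrow> 0) (at 0)" by simp
  qed
qed

text \<open>\<open>\<psi>\<close> solves \<open>\<psi>' = - \<theta> vari \<psi>\<close> up to an error tending to 0 uniformly on \<open>[0, 1]\<close>.\<close>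

lemma char_limit: "(\<lambda>N. \<psi> a N 1) \<longlonglongrightarrow> exp (- of_real (vari a / 2))"
proof -
  have "\<forall>i. \<exists>\<epsilon>. \<epsilon> \<longlonglongrightarrow> 0 \<and> (\<forall>\<^sub>F N in sequentially. \<forall>\<theta>. \<bar>\<theta>\<bar> \<le> 1 \<longrightarrow>
    cmod ((\<integral>\<omega>. of_real (gam N i \<omega>) * ex a N \<theta> \<omega> \<partial>M) - \<i> * of_real (\<theta> * (\<Sum>j\<in>UNIV. a j * C_cov (\<tau> i) (\<tau> j))) * \<psi> a N \<theta>) \<le> \<epsilon> N)"
    by (intro allI gam_response)
  from choice[OF this] obtain \<epsilon> where E: "\<forall>i. \<epsilon> i \<longlonglongrightarrow> 0 \<and> (\<forall>\<^sub>F N in sequentially. \<forall>\<theta>. \<bar>\<theta>\<bar> \<le> 1 \<longrightarrow>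
    cmod ((\<integral>\<omega>. of_real (gam N i \<omega>) * ex a N \<theta> \<omega> \<partial>M) - \<i> * of_real (\<theta> * (\<Sum>j\<in>UNIV. a j * C_cov (\<tau> i) (\<tau> j))) * \<psi> a N \<theta>) \<le> \<epsilon> i N)" ..
  have \<epsilon>: "\<epsilon> i \<longlonglongrightarrow> 0" for i using spec[OF E, of i] by (rule conjunct1)
  have gr: "\<forall>\<^sub>F N in sequentially. \<forall>\<theta>. \<bar>\<theta>\<bar> \<le> 1 \<longrightarrow>
    cmod ((\<integral>\<omega>. of_real (gam N i \<omega>) * ex a N \<theta> \<omega> \<partial>M) - \<i> * of_real (\<theta> * (\<Sum>j\<in>UNIV. a j * C_cov (\<tau> i) (\<tau> j))) * \<psi> a N \<theta>) \<le> \<epsilon> i N" for i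
    using spec[OF E, of i] by (rule conjunct2)
  define \<delta> where "\<delta> N = (\<Sum>i\<in>UNIV. \<bar>a i\<bar> * \<epsilon> i N)" for N
  have \<delta>: "\<delta> \<longlonglongrightarrow> 0"
  proof -
    have "\<delta> \<longlonglongrightarrow> (\<Sum>i\<in>(UNIV::'k set). \<bar>a i\<bar> * 0)" unfolding \<delta>_def by (intro tendsto_intros \<epsilon>)
    then show ?thesis by simp
  qed
  \<comment> \<open>Bounds the integrating factor on [0, 1]. The absolute value is taken because the
    sign of \<open>vari\<close> is settled only afterwards, from the limit itself.\<close>
  define S where "S = exp (\<bar>vari a\<bar> / 2)"
  have gra: "\<forall>\<^sub>F N in sequentially. \<forall>i. \<forall>\<theta>. \<bar>\<theta>\<bar> \<le> 1 \<longrightarrow>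
    cmod ((\<integral>\<omega>. of_real (gam N i \<omega>) * ex a N \<theta> \<omega> \<partial>M) - \<i> * of_real (\<theta> * (\<Sum>j\<in>UNIV. a j * C_cov (\<tau> i) (\<tau> j))) * \<psi> a N \<theta>) \<le> \<epsilon> i N"
    using gr by (intro eventually_all_finite) auto
  have "\<forall>\<^sub>F N in sequentially. cmod (\<psi> a N 1 * exp (of_real (vari a / 2)) - 1) \<le> \<delta> N * S"
    using eventually_gt_at_top[of 0] gra
  proof eventually_elim
    case (elim N)
    note N = elim(1)
    \<comment> \<open>The integrating factor makes \<open>f\<close> constant for an exact solution
      of the limiting equation, so its derivative consists of the residuals \<open>r i\<close>
      only.\<close>
    define f where "f \<theta> = \<psi> a N \<theta> * exp (of_real (\<theta>\<^sup>2 * vari a / 2))" for \<theta>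
    define f' where "f' \<theta> = \<psi> a N \<theta> * (exp (of_real (\<theta>\<^sup>2 * vari a / 2)) * of_real (\<theta> * vari a)) +
      \<i> * (\<integral>\<omega>. of_real (Ts a N \<omega>) * ex a N \<theta> \<omega> \<partial>M) * exp (of_real (\<theta>\<^sup>2 * vari a / 2))" for \<theta>
    have fd: "(f has_vector_derivative f' \<theta>) (at \<theta>)" for \<theta>
    proof -
      have "((\<lambda>\<theta>. exp (\<theta>\<^sup>2 * vari a / 2)) has_real_derivative exp (\<theta>\<^sup>2 * vari a / 2) * (\<theta> * vari a)) (at \<theta>)"
        by (auto intro!: derivative_eq_intros)
      then have "((\<lambda>\<theta>. complex_of_real (exp (\<theta>\<^sup>2 * vari a / 2))) has_vector_derivative of_real (exp (\<theta>\<^sup>2 * vari a / 2) * (\<theta> * vari a))) (at \<theta>)"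
        by (intro has_vector_derivative_of_real) (simp add: has_real_derivative_iff_has_vector_derivative)
      from has_vector_derivative_mult[OF \<psi>_derivative[OF N] this] show ?thesis
        unfolding f_def[abs_def] f'_def by (simp add: exp_of_real[symmetric])
    qed
    have bound: "cmod (f' \<theta>) \<le> \<delta> N * S" if \<theta>: "\<theta> \<in> {0..1}" for \<theta>
    proof -
      have t1: "\<bar>\<theta>\<bar> \<le> 1" using \<theta> by simp
      define r where "r i = (\<integral>\<omega>. of_real (gam N i \<omega>) * ex a N \<theta> \<omega> \<partial>M) - \<i> * of_real (\<theta> * (\<Sum>j\<in>UNIV. a j * C_cov (\<tau> i) (\<tau> j))) * \<psi> a N \<theta>" for i
      have ri: "cmod (r i) \<le> \<epsilon> i N" for i unfolding r_def using elim(2) t1 by blast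
      have ig: "integrable M (\<lambda>\<omega>. of_real (gam N i \<omega>) * ex a N \<theta> \<omega>)" for i
      proof (rule mult_ex_integrable[OF N])
        obtain B where "\<And>\<omega>. \<bar>gam N i \<omega>\<bar> \<le> B" using gam_bounded[OF N] by blast
        then show "integrable M (\<lambda>\<omega>. complex_of_real (gam N i \<omega>))"
          using gam_measurable[OF N] by (intro integrable_const_bound[where B=B]) auto
      qed
      have "(\<integral>\<omega>. of_real (Ts a N \<omega>) * ex a N \<theta> \<omega> \<partial>M) = (\<integral>\<omega>. (\<Sum>i\<in>UNIV. of_real (a i) * (of_real (gam N i \<omega>) * ex a N \<theta> \<omega>)) \<partial>M)"
        by (simp add: Ts_def sum_distrib_right mult.assoc)
      also have "\<dots> = (\<Sum>i\<in>UNIV. of_real (a i) * (\<integral>\<omega>. of_real (gam N i \<omega>) * ex a N \<theta> \<omega> \<partial>M))"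
        using ig by (simp add: Bochner_Integration.integral_sum)
      also have "\<dots> = (\<Sum>i\<in>UNIV. of_real (a i) * r i) + (\<Sum>i\<in>UNIV. of_real (a i) * (\<i> * of_real (\<theta> * (\<Sum>j\<in>UNIV. a j * C_cov (\<tau> i) (\<tau> j))) * \<psi> a N \<theta>))"
        unfolding sum.distrib[symmetric] r_def by (intro sum.cong refl) (simp add: algebra_simps)
      also have "(\<Sum>i\<in>UNIV. of_real (a i) * (\<i> * of_real (\<theta> * (\<Sum>j\<in>UNIV. a j * C_cov (\<tau> i) (\<tau> j))) * \<psi> a N \<theta>)) = \<i> * of_real (\<theta> * vari a) * \<psi> a N \<theta>"
      proof -
        have "\<theta> * vari a = (\<Sum>i\<in>UNIV. a i * (\<theta> * (\<Sum>j\<in>UNIV. a j * C_cov (\<tau> i) (\<tau> j))))"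
          by (simp add: vari_def sum_distrib_left mult_ac)
        then have "\<i> * of_real (\<theta> * vari a) * \<psi> a N \<theta> = \<i> * (\<Sum>i\<in>UNIV. of_real (a i) * of_real (\<theta> * (\<Sum>j\<in>UNIV. a j * C_cov (\<tau> i) (\<tau> j)))) * \<psi> a N \<theta>"
          by (simp only: of_real_sum of_real_mult)
        then show ?thesis by (simp only: sum_distrib_left sum_distrib_right) (simp add: mult_ac)
      qed
      finally have "f' \<theta> = \<i> * (\<Sum>i\<in>UNIV. of_real (a i) * r i) * exp (of_real (\<theta>\<^sup>2 * vari a / 2))"
        unfolding f'_def by (simp add: algebra_simps)
      then have "cmod (f' \<theta>) = cmod (\<Sum>i\<in>UNIV. of_real (a i) * r i) * exp (\<theta>\<^sup>2 * vari a / 2)"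
        by (simp add: norm_mult)
      also have "\<dots> \<le> \<delta> N * S"
      proof (rule mult_mono)
        show d: "cmod (\<Sum>i\<in>UNIV. of_real (a i) * r i) \<le> \<delta> N"
          unfolding \<delta>_def by (rule order_trans[OF norm_sum]) (auto simp: norm_mult intro!: sum_mono mult_left_mono ri)
        show "0 \<le> \<delta> N" using d norm_ge_zero order_trans by blast
        have "\<theta>\<^sup>2 * vari a \<le> \<theta>\<^sup>2 * \<bar>vari a\<bar>" by (intro mult_left_mono) auto
        also have "\<dots> \<le> 1 * \<bar>vari a\<bar>" using \<theta> by (intro mult_right_mono) (auto simp: power_le_one)
        finally show "exp (\<theta>\<^sup>2 * vari a / 2) \<le> S" by (simp add: S_def)
      qed simp
      finally show ?thesis .
    qed
    have "cmod (f 1 - f 0) \<le> (\<delta> N * S) * norm (1 - 0 :: real)"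
    proof (rule differentiable_bound[where S="{0..1}" and f'="\<lambda>x h. h *\<^sub>R f' x"])
      show "(f has_derivative (\<lambda>h. h *\<^sub>R f' x)) (at x within {0..1})" for x
        using has_vector_derivative_at_within[OF fd] unfolding has_vector_derivative_def .
      show "onorm (\<lambda>h. h *\<^sub>R f' x) \<le> \<delta> N * S" if "x \<in> {0..1}" for x
        using bound[OF that] by (intro onorm_le) (auto simp: mult.commute intro!: mult_left_mono)
    qed auto
    moreover have "f 0 = 1" by (simp add: f_def \<psi>_def ex_def prob_space)
    ultimately show ?case by (simp add: f_def)
  qed
  moreover have "(\<lambda>N. \<delta> N * S) \<longlonglongrightarrow> 0" by (rule tendsto_mult_left_zero[OF \<delta>])
  ultimately have "(\<lambda>N. \<psi> a N 1 * exp (of_real (vari a / 2)) - 1) \<longlonglongrightarrow> 0"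
    by (rule Lim_null_comparison)
  then have "(\<lambda>N. \<psi> a N 1 * exp (of_real (vari a / 2))) \<longlonglongrightarrow> 1" by (rule LIM_zero_cancel)
  from tendsto_mult_right[OF this, of "exp (- of_real (vari a / 2))"]
  show ?thesis by (simp add: mult.assoc exp_add[symmetric])
qed

lemma vari_nonneg: "vari a \<ge> 0"
proof -
  have "(\<lambda>N. cmod (\<psi> a N 1)) \<longlonglongrightarrow> cmod (exp (- of_real (vari a / 2)))" by (intro tendsto_norm char_limit)
  moreover have "\<forall>\<^sub>F N in sequentially. cmod (\<psi> a N 1) \<le> 1"
    using eventually_gt_at_top[of 0] by eventually_elim (rule norm_\<psi>)
  ultimately have "cmod (exp (- of_real (vari a / 2))) \<le> 1" by (rule tendsto_upperbound) simp
  then show ?thesis by simp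
qed

text \<open>The second moment about the mean is at most that about Im (s N), which the local law
  bounds; the factor (N \<eta>)^2 cancels exactly.\<close>

lemma gam_second_moment: "\<exists>B. \<forall>\<^sub>F N in sequentially. (\<integral>\<omega>. (gam N j \<omega>)\<^sup>2 \<partial>M) \<le> B"
proof -
  from local_law_both[OF Im_pk(2)] obtain s C where
    C: "\<forall>\<^sub>F N in sequentially. (\<integral>\<omega>. (cmod (GG N (pk j) \<omega> - s N))\<^sup>2 \<partial>M) \<le> C * (1 / (real N * \<eta> N))\<^sup>2" by blast
  have "\<forall>\<^sub>F N in sequentially. (\<integral>\<omega>. (gam N j \<omega>)\<^sup>2 \<partial>M) \<le> C"
    using eventually_gt_at_top[of 0] C
  proof eventually_elim
    case (elim N)
    note N = elim(1)
    interpret W: wishart_ensemble "m N" N M Z u by (rule ens[OF N])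
    have Nh: "real N * \<eta> N > 0" using N \<eta>_pos[OF N] by simp
    define X where "X \<omega> = Im (GG N (pk j) \<omega>)" for \<omega>
    define b where "b = Im (s N)"
    have iG: "integrable M (GG N (pk j))" by (rule GG_integrable[OF N Im_pk(2)])
    have iX: "integrable M X" unfolding X_def using iG by simp
    have iD: "integrable M (\<lambda>\<omega>. (cmod (GG N (pk j) \<omega> - s N))\<^sup>2)"
    proof -
      have "integrable M (\<lambda>\<omega>. cmod ((GG N (pk j) \<omega> - s N) * (GG N (pk j) \<omega> - s N)))"
        unfolding GG_def by (intro integrable_norm W.nice_integrable W.nice_intros W.nice_g Im_zz_nonzero N Im_pk)
      then show ?thesis by (simp add: norm_mult power2_eq_square)
    qed
    have pt: "(X \<omega> - b)\<^sup>2 \<le> (cmod (GG N (pk j) \<omega> - s N))\<^sup>2" for \<omega>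
    proof -
      have "\<bar>X \<omega> - b\<bar> \<le> cmod (GG N (pk j) \<omega> - s N)" using abs_Im_le_cmod[of "GG N (pk j) \<omega> - s N"] by (simp add: X_def b_def)
      then show ?thesis using power_mono[of "\<bar>X \<omega> - b\<bar>" _ 2] by simp
    qed
    have iXb: "integrable M (\<lambda>\<omega>. (X \<omega> - b)\<^sup>2)"
      by (rule Bochner_Integration.integrable_bound[OF iD]) (use iX pt in auto)
    define e where "e = (\<integral>\<omega>. X \<omega> \<partial>M)"
    have "(\<integral>\<omega>. (gam N j \<omega>)\<^sup>2 \<partial>M) = (real N * \<eta> N)\<^sup>2 * (\<integral>\<omega>. (X \<omega> - e)\<^sup>2 \<partial>M)"
      unfolding gam_def X_def e_def by (simp add: power_mult_distrib)
    also have "(\<integral>\<omega>. (X \<omega> - e)\<^sup>2 \<partial>M) = (\<integral>\<omega>. (X \<omega> - b)\<^sup>2 + (2 * (b - e)) * X \<omega> + (e\<^sup>2 - b\<^sup>2) \<partial>M)"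
      by (intro Bochner_Integration.integral_cong refl) (simp add: power2_eq_square algebra_simps)
    also have "\<dots> = (\<integral>\<omega>. (X \<omega> - b)\<^sup>2 \<partial>M) + 2 * (b - e) * e + (e\<^sup>2 - b\<^sup>2)"
      using iXb iX by (simp add: prob_space e_def)
    also have "\<dots> = (\<integral>\<omega>. (X \<omega> - b)\<^sup>2 \<partial>M) - (b - e)\<^sup>2" by (simp add: power2_eq_square algebra_simps)
    also have "(real N * \<eta> N)\<^sup>2 * \<dots> \<le> (real N * \<eta> N)\<^sup>2 * (C * (1 / (real N * \<eta> N))\<^sup>2)"
    proof (rule mult_left_mono)
      have "(\<integral>\<omega>. (X \<omega> - b)\<^sup>2 \<partial>M) \<le> (\<integral>\<omega>. (cmod (GG N (pk j) \<omega> - s N))\<^sup>2 \<partial>M)"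
        by (rule integral_mono[OF iXb iD pt])
      then show "(\<integral>\<omega>. (X \<omega> - b)\<^sup>2 \<partial>M) - (b - e)\<^sup>2 \<le> C * (1 / (real N * \<eta> N))\<^sup>2"
        using elim(2) zero_le_power2[of "b - e"] by linarith
    qed simp
    also have "\<dots> = C"
    proof -
      have "x\<^sup>2 * (C * (1 / x)\<^sup>2) = C" if "x > 0" for x :: real using that by (simp add: power_divide)
      then show ?thesis using Nh by blast
    qed
    finally show ?case .
  qed
  then show ?thesis by blast
qed

end

section \<open>Passage to the statement and weak convergence\<close>

lemma resolvent_trace_eq:
  assumes "0 < N" "Im z \<noteq> 0"
  shows "mat_trace (resolvent (wishart.Hm m N X) z) = of_nat N * wishart.g m N X z"
proof -
  interpret wishart m N by unfold_locales fact
  have "resolvent (Hm X) z \<in> carrier_mat N N" by (rule resolvent_inverse(1)[OF non_real_not_nonneg[OF assms(2)]])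
  then show ?thesis using assms(1) by (simp add: mat_trace_def g_def trG_def green_def)
qed

lemma H_mat_eq_Hm:
  assumes "0 < N"
  shows "H_mat \<xi> m N \<omega> = wishart.Hm m N (\<lambda>(\<mu>, a). \<xi> (Suc \<mu>) (Suc a) \<omega>)"
proof -
  interpret wishart m N by unfold_locales fact
  have "(\<Sum>\<mu>=1..m. \<xi> \<mu> (Suc i) \<omega> * \<xi> \<mu> (Suc j) \<omega>) = (\<Sum>\<mu><m. \<xi> (Suc \<mu>) (Suc i) \<omega> * \<xi> (Suc \<mu>) (Suc j) \<omega>)" for i j
    using sum.atLeast1_atMost_eq[of "\<lambda>\<mu>. \<xi> \<mu> (Suc i) \<omega> * \<xi> \<mu> (Suc j) \<omega>" m] by simp
  then show ?thesis unfolding H_mat_def Hm_def H_def by simp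
qed

context mesoscopic_points
begin

lemma gam_vector_measurable:
  assumes "0 < N"
  shows "(\<lambda>\<omega>. \<chi> i. gam N i \<omega>) \<in> borel_measurable M"
proof (rule borel_measurable_euclidean_space[THEN iffD2], intro ballI)
  fix b :: "real ^ 'k" assume "b \<in> Basis"
  then obtain i where "b = axis i 1" unfolding Basis_vec_def by auto
  then show "(\<lambda>\<omega>. (\<chi> i. gam N i \<omega>) \<bullet> b) \<in> borel_measurable M"
    using gam_measurable[OF assms, of i] by (simp add: inner_axis)
qed

lemma gam_tight:
  assumes e: "e > 0"
  shows "\<exists>R>0. \<forall>\<^sub>F N in sequentially. prob {\<omega> \<in> space M. \<forall>i. \<bar>gam N i \<omega>\<bar> \<le> R} \<ge> 1 - e"
proof -
  have "\<forall>j. \<exists>B. \<forall>\<^sub>F N in sequentially. (\<integral>\<omega>. (gam N j \<omega>)\<^sup>2 \<partial>M) \<le> B"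
    by (intro allI gam_second_moment)
  from choice[OF this] obtain B where B: "\<forall>j. \<forall>\<^sub>F N in sequentially. (\<integral>\<omega>. (gam N j \<omega>)\<^sup>2 \<partial>M) \<le> B j" ..
  define S where "S = (\<Sum>j\<in>UNIV. \<bar>B j\<bar>)"
  have S: "S \<ge> 0" unfolding S_def by (intro sum_nonneg) auto
  \<comment> \<open>Chebyshev for each component and the union bound leave an exceptional
    probability of at most S / R^2; the added 1 keeps \<open>R\<close> positive when S = 0.\<close>
  define R where "R = sqrt (S / e) + 1"
  have R: "R > 0" unfolding R_def using S e by (intro add_nonneg_pos) auto
  have R2: "S / R\<^sup>2 \<le> e"
  proof -
    have "S / e = (sqrt (S / e))\<^sup>2" using S e by simp
    also have "\<dots> \<le> R\<^sup>2" unfolding R_def using S e by (intro power_mono) auto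
    finally show ?thesis using e R by (simp add: field_simps)
  qed
  have all: "\<forall>\<^sub>F N in sequentially. \<forall>j. (\<integral>\<omega>. (gam N j \<omega>)\<^sup>2 \<partial>M) \<le> B j"
    using B by (intro eventually_all_finite) auto
  have "\<forall>\<^sub>F N in sequentially. prob {\<omega> \<in> space M. \<forall>i. \<bar>gam N i \<omega>\<bar> \<le> R} \<ge> 1 - e"
    using eventually_gt_at_top[of 0] all
  proof eventually_elim
    case (elim N)
    note [measurable] = gam_measurable[OF elim(1)]
    define A where "A i = {\<omega> \<in> space M. R\<^sup>2 \<le> (gam N i \<omega>)\<^sup>2}" for i
    have A: "A i \<in> events" for i unfolding A_def by measurable
    have isq: "integrable M (\<lambda>\<omega>. (gam N i \<omega>)\<^sup>2)" for i
    proof -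
      obtain b where b: "\<And>\<omega>. \<bar>gam N i \<omega>\<bar> \<le> b" using gam_bounded[OF elim(1)] by blast
      have "(gam N i \<omega>)\<^sup>2 \<le> b\<^sup>2" for \<omega> using power_mono[OF b[of \<omega>], of 2] by simp
      then show ?thesis by (intro integrable_const_bound[where B="b\<^sup>2"]) auto
    qed
    have PA: "prob (A i) \<le> B i / R\<^sup>2" for i
    proof -
      have "prob (A i) \<le> (\<integral>\<omega>. (gam N i \<omega>)\<^sup>2 \<partial>M) / R\<^sup>2"
        unfolding A_def using integral_Markov_inequality_measure[OF isq, where A="{}" and c="R\<^sup>2"] R by simp
      also have "\<dots> \<le> B i / R\<^sup>2" using elim(2) by (intro divide_right_mono) auto
      finally show ?thesis .
    qed
    have "prob (\<Union>i. A i) \<le> (\<Sum>i\<in>UNIV. prob (A i))" using A by (intro finite_measure_subadditive_finite) auto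
    also have "\<dots> \<le> (\<Sum>i\<in>UNIV. \<bar>B i\<bar> / R\<^sup>2)"
      by (intro sum_mono order_trans[OF PA] divide_right_mono) auto
    also have "\<dots> = S / R\<^sup>2" by (simp add: S_def sum_divide_distrib)
    finally have U: "prob (\<Union>i. A i) \<le> e" using R2 by linarith
    have "1 - e \<le> 1 - prob (\<Union>i. A i)" using U by simp
    also have "\<dots> = prob (space M - (\<Union>i. A i))" using A by (intro prob_compl[symmetric]) auto
    also have "\<dots> \<le> prob {\<omega> \<in> space M. \<forall>i. \<bar>gam N i \<omega>\<bar> \<le> R}"
    proof (rule finite_measure_mono)
      show "space M - (\<Union>i. A i) \<subseteq> {\<omega> \<in> space M. \<forall>i. \<bar>gam N i \<omega>\<bar> \<le> R}"
      proof
        fix \<omega> assume w: "\<omega> \<in> space M - (\<Union>i. A i)"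
        have "\<bar>gam N i \<omega>\<bar> \<le> R" for i
        proof (rule ccontr)
          assume "\<not> \<bar>gam N i \<omega>\<bar> \<le> R"
          then have "R\<^sup>2 \<le> \<bar>gam N i \<omega>\<bar>\<^sup>2" using R by (intro power_mono) auto
          then show False using w by (auto simp: A_def)
        qed
        then show "\<omega> \<in> {\<omega> \<in> space M. \<forall>i. \<bar>gam N i \<omega>\<bar> \<le> R}" using w by auto
      qed
    qed measurable
    finally show ?case .
  qed
  then show ?thesis using R by blast
qed

lemma gam_vector_converges:
  "\<exists>\<nu> :: (real ^ 'k) measure. centered_gaussian_distribution \<nu> (\<lambda>i j. C_cov (\<tau> i) (\<tau> j)) \<and>
    weakly_converges (\<lambda>N. distr M borel (\<lambda>\<omega>. if N = 0 then 0 else \<chi> i. gam N i \<omega>)) \<nu>"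
proof -
  have sym: "C_cov (\<tau> i) (\<tau> j) = C_cov (\<tau> j) (\<tau> i)" for i j by (simp add: C_cov_def power2_commute)
  have psd: "(\<Sum>i\<in>UNIV. \<Sum>j\<in>UNIV. a i * a j * C_cov (\<tau> i) (\<tau> j)) \<ge> 0" for a
    using vari_nonneg[of a] by (simp add: vari_def)
  obtain \<nu> :: "(real ^ 'k) measure" where \<nu>: "centered_gaussian_distribution \<nu> (\<lambda>i j. C_cov (\<tau> i) (\<tau> j))"
    and char\<nu>: "\<And>a. (\<integral>x. exp (\<i> * of_real (\<Sum>i\<in>UNIV. a i * x $ i)) \<partial>\<nu>) = exp (- of_real (vari a / 2))"
    using centered_gaussian_distribution_exists[of "\<lambda>i j. C_cov (\<tau> i) (\<tau> j)", OF sym psd] unfolding vari_def by blast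
  have pr\<nu>: "prob_space \<nu>" "sets \<nu> = sets borel" using \<nu> by (auto simp: centered_gaussian_distribution_def)
  interpret nu: prob_space \<nu> by (rule pr\<nu>(1))
  \<comment> \<open>There is no ensemble for \<open>N = 0\<close>. The value 0 agrees with
    \<open>gamma_var\<close>, which also vanishes there.\<close>
  define g where "g N \<omega> = (if N = 0 then 0 else \<chi> i. gam N i \<omega>)" for N \<omega>
  have gm [measurable]: "g N \<in> borel_measurable M" for N
    using gam_vector_measurable[of N] by (cases "N = 0") (simp_all add: g_def[abs_def])
  let ?\<mu> = "\<lambda>N. distr M borel (g N)"
  let ?c = "\<lambda>i (x :: real ^ 'k). x $ i"
  have "weakly_converges ?\<mu> \<nu>"
  proof (rule weakly_converges_algebra[where R="trig_poly UNIV ?c" and T=UNIV])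
    show "prob_space (?\<mu> n)" for n by (rule prob_space_distr[OF gm])
    show "prob_space \<nu>" "sets \<nu> = sets borel" by (fact pr\<nu>)+
    show "continuous_on UNIV f" if "f \<in> trig_poly UNIV ?c" for f
      by (rule trig_poly_continuous[OF _ that]) (intro continuous_intros)
    show "\<exists>f\<in>trig_poly UNIV ?c. f x \<noteq> f y" if "x \<noteq> y" for x y
    proof -
      from that obtain i where "x $ i \<noteq> y $ i" by (auto simp: Finite_Cartesian_Product.vec_eq_iff)
      then show ?thesis by (intro trig_poly_separates[where i=i]) auto
    qed
  next
    fix \<epsilon> :: real assume \<epsilon>: "\<epsilon> > 0"
    obtain R where R: "R > 0" "\<forall>\<^sub>F N in sequentially. prob {\<omega> \<in> space M. \<forall>i. \<bar>gam N i \<omega>\<bar> \<le> R} \<ge> 1 - \<epsilon>"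
      using gam_tight[OF \<epsilon>] by blast
    define K where "K r = {x :: real ^ 'k. \<forall>i. \<bar>x $ i\<bar> \<le> r}" for r
    have Kbox: "K r = cbox (\<chi> i. - r) (\<chi> i. r)" for r by (auto simp: K_def mem_box_cart abs_le_iff minus_le_iff)
    have Kc: "compact (K r)" for r unfolding Kbox by (rule compact_cbox)
    have Kb: "K r \<in> sets borel" for r using compact_imp_closed[OF Kc] by simp
    have Kmono: "K r \<subseteq> K r'" if "r \<le> r'" for r r'
      by (auto simp: K_def intro: order_trans[OF _ that])
    have "(\<lambda>n. nu.prob (K (real n))) \<longlonglongrightarrow> nu.prob (\<Union>n. K (real n))"
      using Kb pr\<nu>(2) by (intro nu.finite_Lim_measure_incseq) (auto simp: incseq_def intro!: Kmono)
    moreover have "(\<Union>n. K (real n)) = space \<nu>"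
    proof -
      have "x \<in> (\<Union>n. K (real n))" for x :: "real ^ 'k"
      proof -
        obtain n :: nat where n: "norm x < n" using reals_Archimedean2 by blast
        have "\<bar>x $ i\<bar> \<le> real n" for i using component_le_norm_cart[of x i] n by linarith
        then show ?thesis by (auto simp: K_def)
      qed
      then show ?thesis using sets_eq_imp_space_eq[OF pr\<nu>(2)] by auto
    qed
    ultimately have "(\<lambda>n. nu.prob (K (real n))) \<longlonglongrightarrow> 1" by (simp add: nu.prob_space)
    then have "\<forall>\<^sub>F n in sequentially. nu.prob (K (real n)) > 1 - \<epsilon>" using \<epsilon> by (intro order_tendstoD) auto
    then obtain n where n: "nu.prob (K (real n)) > 1 - \<epsilon>" unfolding eventually_sequentially by blast
    \<comment> \<open>A single box has to serve both the limit law and all large N.\<close>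
    define r where "r = max R (real n)"
    have "nu.prob (K r) \<ge> nu.prob (K (real n))"
      using Kb pr\<nu>(2) by (intro nu.finite_measure_mono Kmono) (auto simp: r_def)
    moreover have "\<forall>\<^sub>F N in sequentially. measure (?\<mu> N) (K r) \<ge> 1 - \<epsilon>"
      using R(2) eventually_gt_at_top[of 0]
    proof eventually_elim
      case (elim N)
      note [measurable] = gam_measurable[OF elim(2)]
      have "measure (?\<mu> N) (K r) = prob (g N -` K r \<inter> space M)" using Kb by (intro measure_distr) auto
      also have "\<dots> \<ge> prob {\<omega> \<in> space M. \<forall>i. \<bar>gam N i \<omega>\<bar> \<le> R}"
      proof (rule finite_measure_mono)
        show "g N -` K r \<inter> space M \<in> events" by (rule measurable_sets[OF gm Kb])
      qed (use elim(2) in \<open>auto simp: g_def K_def r_def intro: order_trans[OF _ max.cobounded1]\<close>)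
      finally show ?case using elim(1) by linarith
    qed
    ultimately show "\<exists>K. compact K \<and> K \<in> sets borel \<and> K \<subseteq> UNIV \<and> measure \<nu> K \<ge> 1 - \<epsilon> \<and>
        (\<forall>\<^sub>F n in sequentially. measure (?\<mu> n) K \<ge> 1 - \<epsilon>)"
      using Kc Kb n by (intro exI[of _ "K r"]) auto
  next
    fix p assume p: "p \<in> trig_poly UNIV ?c"
    have cm: "?c i \<in> borel_measurable Q" if "sets Q = sets borel" for Q i
      using borel_measurable_continuous_onI[of "?c i"] that by (simp add: continuous_on_component cong: measurable_cong_sets)
    show "(\<lambda>n. \<integral>x. p x \<partial>?\<mu> n) \<longlonglongrightarrow> (\<integral>x. p x \<partial>\<nu>)"
    proof (rule trig_poly_integral_tendsto[OF prob_space_distr[OF gm] _ pr\<nu>(1) _ _ p])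
      show "?c i \<in> borel_measurable (?\<mu> n)" for n i by (rule cm) simp
      show "?c i \<in> borel_measurable \<nu>" for i by (rule cm[OF pr\<nu>(2)])
      fix a :: "'k \<Rightarrow> real"
      have m: "(\<lambda>x. exp (\<i> * of_real (\<Sum>i\<in>UNIV. a i * x $ i))) \<in> borel_measurable (borel :: (real ^ 'k) measure)"
        by (intro borel_measurable_continuous_onI continuous_intros)
      have "\<forall>\<^sub>F N in sequentially. \<psi> a N 1 = (\<integral>x. exp (\<i> * of_real (\<Sum>i\<in>UNIV. a i * x $ i)) \<partial>?\<mu> N)"
        using eventually_gt_at_top[of 0]
      proof eventually_elim
        case (elim N)
        then show ?case unfolding integral_distr[OF gm m] by (simp add: g_def \<psi>_def ex_def Ts_def)
      qed
      from Lim_transform_eventually[OF char_limit[of a] this]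
      show "(\<lambda>N. \<integral>x. exp (\<i> * of_real (\<Sum>i\<in>UNIV. a i * x $ i)) \<partial>?\<mu> N) \<longlonglongrightarrow>
        (\<integral>x. exp (\<i> * of_real (\<Sum>i\<in>UNIV. a i * x $ i)) \<partial>\<nu>)"
        unfolding char\<nu> .
    qed
  qed (auto intro: trig_poly_bounded trig_poly.add trig_poly_mult trig_poly_const)
  then show ?thesis using \<nu> unfolding g_def by blast
qed

end

theorem theorem2:
  fixes M :: "'a measure"
    and \<xi> :: "nat \<Rightarrow> nat \<Rightarrow> 'a \<Rightarrow> real"
    and m :: "nat \<Rightarrow> nat"
    and \<tau> :: "'k::finite \<Rightarrow> real"
    and u c \<alpha> l :: real
  assumes "prob_space M"
    and "u > 0" and "c > 0"
    and "jointly_gaussian M ({1..} \<times> {1..}) (\<lambda>(\<mu>, x). \<xi> \<mu> x)"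
    and "\<And>\<mu> x. \<mu> \<ge> 1 \<Longrightarrow> x \<ge> 1 \<Longrightarrow> (\<integral>\<omega>. \<xi> \<mu> x \<omega> \<partial>M) = 0"
    and "\<And>\<mu> \<nu> x y. \<mu> \<ge> 1 \<Longrightarrow> \<nu> \<ge> 1 \<Longrightarrow> x \<ge> 1 \<Longrightarrow> y \<ge> 1 \<Longrightarrow>
           (\<integral>\<omega>. \<xi> \<mu> x \<omega> * \<xi> \<nu> y \<omega> \<partial>M) = (if x = y \<and> \<mu> = \<nu> then u\<^sup>2 else 0)"
    and "0 < \<alpha>" and "\<alpha> < 1"
    and "l \<in> {u\<^sup>2 * (1 - sqrt c)\<^sup>2 <..< u\<^sup>2 * (1 + sqrt c)\<^sup>2}"
    and "(\<lambda>N. real (m N) / real N) \<longlonglongrightarrow> c"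
  shows "\<exists>\<nu> :: (real ^ 'k) measure.
    centered_gaussian_distribution \<nu> (\<lambda>i j. C_cov (\<tau> i) (\<tau> j)) \<and>
    weakly_converges
      (\<lambda>N. distr M borel
        (\<lambda>\<omega>. \<chi> i. gamma_var M \<xi> \<alpha> (m N) N (l + \<tau> i * real N powr (- \<alpha>)) \<omega>))
      \<nu>"
proof -
  interpret prob_space M by fact
  \<comment> \<open>Indices are counted from 0 here, so \<open>Z (\<mu>, a)\<close> is the variable
    with indices \<mu> + 1 and a + 1.\<close>
  define Z where "Z = (\<lambda>(\<mu>, a) \<omega>. \<xi> (Suc \<mu>) (Suc a) \<omega>)"
  have jg: "jointly_gaussian M UNIV Z"
    unfolding jointly_gaussian_def
  proof (intro allI impI, elim conjE)
    fix J :: "(nat \<times> nat) set" and a :: "nat \<times> nat \<Rightarrow> real"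
    assume J: "finite J"
    define s where "s = map_prod Suc Suc"
    have inj: "inj_on s J" unfolding s_def by (intro inj_onI) (auto simp: map_prod_def split: prod.splits)
    \<comment> \<open>The hypothesis concerns sums over the shifted pairs; taking predecessors
      inside the coefficients undoes the shift.\<close>
    have "gaussian_rv M (\<lambda>\<omega>. \<Sum>e\<in>s ` J. a (map_prod (\<lambda>n. n - 1) (\<lambda>n. n - 1) e) * (case e of (\<mu>, x) \<Rightarrow> \<xi> \<mu> x) \<omega>)"
      using assms(4) J unfolding jointly_gaussian_def by (elim allE impE) (auto simp: s_def)
    moreover have "(\<Sum>e\<in>s ` J. a (map_prod (\<lambda>n. n - 1) (\<lambda>n. n - 1) e) * (case e of (\<mu>, x) \<Rightarrow> \<xi> \<mu> x) \<omega>) = (\<Sum>e\<in>J. a e * Z e \<omega>)" for \<omega>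
      unfolding sum.reindex[OF inj] by (intro sum.cong refl) (auto simp: s_def Z_def)
    ultimately show "gaussian_rv M (\<lambda>\<omega>. \<Sum>i\<in>J. a i * Z i \<omega>)" by simp
  qed
  have E: "wishart_ensemble (m N) N M Z u" if "0 < N" for N
  proof (intro wishart_ensemble.intro wishart_ensemble_axioms.intro)
    show "wishart N" by unfold_locales fact
    show "Z i \<in> borel_measurable M" for i by (rule jointly_gaussian_measurable[OF jg]) simp
    show "distr M (PiM ({..<m N} \<times> {..<N}) (\<lambda>_. borel)) (\<lambda>\<omega>. \<lambda>i\<in>{..<m N} \<times> {..<N}. Z i \<omega>) =
      PiM ({..<m N} \<times> {..<N}) (\<lambda>_. centered_normal u)"
    proof (rule jointly_gaussian_distr[OF \<open>prob_space M\<close> jg])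
      show "(\<integral>x. Z i x \<partial>M) = 0" for i using assms(5) by (cases i) (simp add: Z_def)
      show "(\<integral>x. Z i x * Z j x \<partial>M) = (if i = j then u\<^sup>2 else 0)" for i j
        using assms(6) by (cases i; cases j) (auto simp: Z_def)
    qed (use assms(2) in simp_all)
  qed (use assms(1,2) in simp_all)
  interpret mesoscopic_points M Z m u c \<alpha> l \<tau>
    by (intro mesoscopic_points.intro mesoscopic.intro mesoscopic_axioms.intro E)
      (use assms(1,2,3,7-10) in simp_all)
  have gamma: "gamma_var M \<xi> \<alpha> (m N) N (l + \<tau> i * real N powr (- \<alpha>)) \<omega> = gam N i \<omega>" if N: "0 < N" for N i \<omega>
  proof -
    have z: "Complex (l + \<tau> i * real N powr (- \<alpha>)) (real N powr (- \<alpha>)) = zz N (pk i)"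
      by (simp add: zz_def pk_def \<eta>_def complex_eq_iff)
    have Zf: "(\<lambda>(\<mu>, a). \<xi> (Suc \<mu>) (Suc a) \<omega>) = cfg \<omega>" for \<omega> by (auto simp: Z_def fun_eq_iff)
    have R: "R_fun \<xi> \<alpha> (m N) N (l + \<tau> i * real N powr (- \<alpha>)) \<omega> = Im (GG N (pk i) \<omega>)" for \<omega>
      unfolding R_fun_def z H_mat_eq_Hm[OF N] Zf resolvent_trace_eq[OF N Im_zz_nonzero[OF N Im_pk(2)]] GG_def
      using N by simp
    have "real N powr (1 - \<alpha>) = real N * \<eta> N" using N by (simp add: \<eta>_def powr_diff powr_minus divide_inverse)
    then show ?thesis unfolding gamma_var_def R gam_def by simp
  qed
  have zero: "gamma_var M \<xi> \<alpha> (m N) N (l + \<tau> i * real N powr (- \<alpha>)) \<omega> = 0" if "N = 0" for N i \<omega>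
    using that by (simp add: gamma_var_def)
  have "(\<chi> i. gamma_var M \<xi> \<alpha> (m N) N (l + \<tau> i * real N powr (- \<alpha>)) \<omega>) = (if N = 0 then 0 else \<chi> i. gam N i \<omega>)" for N \<omega>
    using gamma[of N] zero[of N] by (auto simp: Finite_Cartesian_Product.vec_eq_iff)
  then show ?thesis using gam_vector_converges by simp
qed

end
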